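(* Let $\mathsf G$ be a discrete group, let $\mathcal L(\mathsf G)$ be an admissible algebra such that $\mathsf G$ is rigidly $\mathcal L$-symmetric, and let $(\mathcal A,\alpha,\omega)$ be a twisted $C^*$-dynamical system with group $\mathsf G$. (1) $\mathcal L_{\alpha,\omega}(\mathsf G;\mathcal A)$ is a symmetric Banach $*$-algebra. (2) $\mathcal L_{\alpha,\omega}(\mathsf G;\mathcal A)$ is an inverse closed subalgebra of its enveloping $C^*$-algebra. In particular, if $\mathsf G$ is rigidly symmetric, then $\ell^1_{\alpha,\omega}(\mathsf G;\mathcal A)$ is spectral (that is, inverse closed) in $\mathcal A\rtimes_\alpha^\omega\mathsf G$. (3) Let $\Pi:\mathcal A\rtimes_\alpha^\omega\mathsf G\to\mathbb B(\mathscr H)$ be a faithful $*$-representation on a Hilbert space $\mathscr H$. Then $\Pi[\ell^1_{\alpha,\omega}(\mathsf G;\mathcal A)]$ is inverse closed in $\mathbb B(\mathscr H)$.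
   Context: A Banach $*$-algebra $\mathcal B$ is symmetric if the spectrum of $B^*B$ is positive (contained in $[0,\infty)$) for every $B\in\mathcal B$. For a discrete group $\mathsf G$ with unit $\mathsf e$, $\ell^1(\mathsf G)$ has product $(k\star l)(x)=\sum_{y}k(y)l(y^{-1}x)$ and involution $k^\star(x)=\overline{k(x^{-1})}$. An admissible algebra is a subspace $\mathcal L(\mathsf G)\subset\ell^1(\mathsf G)$ with its own complete norm $\|\cdot\|_{\mathcal L}$, stronger than the $\ell^1$-norm, such that (i) it is solid: if $|k(x)|\le|l(x)|$ for all $x$ and $l\in\mathcal L(\mathsf G)$, then $k\in\mathcal L(\mathsf G)$ and $\|k\|_{\mathcal L}\le\|l\|_{\mathcal L}$; (ii) $(\mathcal L(\mathsf G),\star,{}^\star,\|\cdot\|_{\mathcal L})$ is a unital Banach $*$-algebra. $\ell^1(\mathsf G)$ is itself an admissible algebra. For a $C^*$-algebra $\mathcal A$, $\mathcal M(\mathcal A)$ is its multiplier algebra and $\mathcal{UM}(\mathcal A)$ the unitary group of $\mathcal M(\mathcal A)$ (automorphisms of $\mathcal A$ are extended to $\mathcal M(\mathcal A)$). A twisted $C^*$-dynamical system $(\mathcal A,\alpha,\omega)$ with group $\mathsf G$ consists of a $C^*$-algebra $\mathcal A$ and maps $\alpha:\mathsf G\to\mathrm{Aut}(\mathcal A)$ (the group of $*$-automorphisms), $\omega:\mathsf G\times\mathsf G\to\mathcal{UM}(\mathcal A)$ with, for all $x,y,z\in\mathsf G$: $\alpha_x\circ\alpha_y=\mathrm{ad}_{\omega(x,y)}\circ\alpha_{xy}$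 (where $\mathrm{ad}_u(a)=uau^*$), $\omega(x,y)\omega(xy,z)=\alpha_x[\omega(y,z)]\omega(x,yz)$, $\omega(x,\mathsf e)=1=\omega(\mathsf e,x)$. $\mathcal L_{\alpha,\omega}(\mathsf G;\mathcal A)$ is the space $\mathcal L(\mathsf G;\mathcal A)$ of functions $f\in\ell^1(\mathsf G;\mathcal A)$ with $\|f(\cdot)\|_{\mathcal A}\in\mathcal L(\mathsf G)$, with norm $\big\|\,\|f(\cdot)\|_{\mathcal A}\big\|_{\mathcal L}$, product $(f\diamond g)(x)=\sum_{y}f(y)\,\alpha_y[g(y^{-1}x)]\,\omega(y,y^{-1}x)$ and involution $f^{\diamond}(x)=\omega(x,x^{-1})^*\alpha_x[f(x^{-1})]^*$; it is a Banach $*$-algebra. For $\mathcal L=\ell^1$ it is written $\ell^1_{\alpha,\omega}(\mathsf G;\mathcal A)$, and $\mathcal A\rtimes_\alpha^\omega\mathsf G$ denotes the enveloping $C^*$-algebra of $\ell^1_{\alpha,\omega}(\mathsf G;\mathcal A)$. These Banach $*$-algebras are regarded as $*$-subalgebras of their enveloping $C^*$-algebras through the canonical map. $\mathsf G$ is rigidly $\mathcal L$-symmetric if for every $C^*$-algebra $\mathcal B$ the Banach $*$-algebra $\mathcal L(\mathsf G;\mathcal B)$, with the structure given by the trivial action and $\omega=1$, is symmetric; rigidly symmetric means rigidly $\ell^1$-symmetric. A $*$-subalgebra $\mathfrak B$ of a unital $C^*$-algebra $\mathfrak C$ is inverse closed (or spectral) if every $f\in\mathfrak B$ that is invertible in $\mathfrak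 C$ satisfies $f^{-1}\in\mathfrak B$.
   Formalization: Part (3) is proved under the assumption that G is rigidly symmetric (for ℓ¹); with only rigid 𝓛-symmetry it fails, e.g. 𝓛 = ℂδ_e and G = F₂, where ℓ¹(F₂) is not inverse closed in C*(F₂). *)

theory Defs
  imports "HOL-Analysis.Analysis" "HOL-Algebra.Module"
begin

section \<open>Complex *-algebras, possibly without unit\<close>

definition complex_ring :: "complex ring" where
  "complex_ring = \<lparr>carrier = UNIV, monoid.mult = (*), one = 1, zero = 0, add = (+)\<rparr>"

text \<open>
  The algebras need not be unital, and the field \<open>one\<close> inherited from \<open>ring\<close> is never consulted
  for an arbitrary algebra: units are existential, see \<open>is_one\<close>.
\<close>

record 'a star_alg = "(complex, 'a) module" +
  star :: "'a \<Rightarrow> 'a"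

record 'a normed_star_alg = "'a star_alg" +
  nrm :: "'a \<Rightarrow> real"

locale star_algebra = module complex_ring A for A :: "('a, 'm) star_alg_scheme" +
  assumes mult_closed: "\<lbrakk>a \<in> carrier A; b \<in> carrier A\<rbrakk> \<Longrightarrow> a \<otimes>\<^bsub>A\<^esub> b \<in> carrier A"
    and mult_assoc: "\<lbrakk>a \<in> carrier A; b \<in> carrier A; c \<in> carrier A\<rbrakk>
          \<Longrightarrow> (a \<otimes>\<^bsub>A\<^esub> b) \<otimes>\<^bsub>A\<^esub> c = a \<otimes>\<^bsub>A\<^esub> (b \<otimes>\<^bsub>A\<^esub> c)"
    and mult_add_left: "\<lbrakk>a \<in> carrier A; b \<in> carrier A; c \<in> carrier A\<rbrakk>
          \<Longrightarrow> (a \<oplus>\<^bsub>A\<^esub> b) \<otimes>\<^bsub>A\<^esub> c = (a \<otimes>\<^bsub>A\<^esub> c) \<oplus>\<^bsub>A\<^esub> (b \<otimes>\<^bsub>A\<^esub> c)"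
    and mult_add_right: "\<lbrakk>a \<in> carrier A; b \<in> carrier A; c \<in> carrier A\<rbrakk>
          \<Longrightarrow> a \<otimes>\<^bsub>A\<^esub> (b \<oplus>\<^bsub>A\<^esub> c) = (a \<otimes>\<^bsub>A\<^esub> b) \<oplus>\<^bsub>A\<^esub> (a \<otimes>\<^bsub>A\<^esub> c)"
    and smult_mult_left: "\<lbrakk>a \<in> carrier A; b \<in> carrier A\<rbrakk>
          \<Longrightarrow> (z \<odot>\<^bsub>A\<^esub> a) \<otimes>\<^bsub>A\<^esub> b = z \<odot>\<^bsub>A\<^esub> (a \<otimes>\<^bsub>A\<^esub> b)"
    and smult_mult_right: "\<lbrakk>a \<in> carrier A; b \<in> carrier A\<rbrakk>
          \<Longrightarrow> a \<otimes>\<^bsub>A\<^esub> (z \<odot>\<^bsub>A\<^esub> b) = z \<odot>\<^bsub>A\<^esub> (a \<otimes>\<^bsub>A\<^esub> b)"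
    and star_closed: "a \<in> carrier A \<Longrightarrow> star A a \<in> carrier A"
    and star_star: "a \<in> carrier A \<Longrightarrow> star A (star A a) = a"
    and star_add: "\<lbrakk>a \<in> carrier A; b \<in> carrier A\<rbrakk>
          \<Longrightarrow> star A (a \<oplus>\<^bsub>A\<^esub> b) = star A a \<oplus>\<^bsub>A\<^esub> star A b"
    and star_smult: "a \<in> carrier A \<Longrightarrow> star A (z \<odot>\<^bsub>A\<^esub> a) = cnj z \<odot>\<^bsub>A\<^esub> star A a"
    and star_mult: "\<lbrakk>a \<in> carrier A; b \<in> carrier A\<rbrakk>
          \<Longrightarrow> star A (a \<otimes>\<^bsub>A\<^esub> b) = star A b \<otimes>\<^bsub>A\<^esub> star A a"

definition is_one :: "('a, 'm) star_alg_scheme \<Rightarrow> 'a \<Rightarrow> bool" where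
  "is_one A e \<longleftrightarrow> e \<in> carrier A \<and> (\<forall>a\<in>carrier A. e \<otimes>\<^bsub>A\<^esub> a = a \<and> a \<otimes>\<^bsub>A\<^esub> e = a)"

definition unital :: "('a, 'm) star_alg_scheme \<Rightarrow> bool" where
  "unital A \<longleftrightarrow> (\<exists>e. is_one A e)"

definition unit_of :: "('a, 'm) star_alg_scheme \<Rightarrow> 'a" where
  "unit_of A = (THE e. is_one A e)"

definition inverses :: "('a, 'm) star_alg_scheme \<Rightarrow> 'a \<Rightarrow> 'a \<Rightarrow> bool" where
  "inverses A a b \<longleftrightarrow> a \<in> carrier A \<and> b \<in> carrier A
     \<and> a \<otimes>\<^bsub>A\<^esub> b = unit_of A \<and> b \<otimes>\<^bsub>A\<^esub> a = unit_of A"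

text \<open>The pair \<open>(z, a)\<close> stands for \<open>z1 + a\<close>.\<close>

definition unitization :: "('a, 'm) star_alg_scheme \<Rightarrow> (complex \<times> 'a) star_alg" where
  "unitization A =
    \<lparr>carrier = UNIV \<times> carrier A,
     monoid.mult = (\<lambda>(z, a) (w, b). (z * w, z \<odot>\<^bsub>A\<^esub> b \<oplus>\<^bsub>A\<^esub> w \<odot>\<^bsub>A\<^esub> a \<oplus>\<^bsub>A\<^esub> a \<otimes>\<^bsub>A\<^esub> b)),
     one = (1, \<zero>\<^bsub>A\<^esub>),
     zero = (0, \<zero>\<^bsub>A\<^esub>),
     add = (\<lambda>(z, a) (w, b). (z + w, a \<oplus>\<^bsub>A\<^esub> b)),
     smult = (\<lambda>w (z, a). (w * z, w \<odot>\<^bsub>A\<^esub> a)),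
     star = (\<lambda>(z, a). (cnj z, star A a))\<rparr>"

definition spectrum :: "('a, 'm) star_alg_scheme \<Rightarrow> 'a \<Rightarrow> complex set" where
  "spectrum A a =
    (if unital A then {z. \<nexists>b. inverses A (z \<odot>\<^bsub>A\<^esub> unit_of A \<ominus>\<^bsub>A\<^esub> a) b}
     else {z. \<nexists>b. inverses (unitization A) (z, \<ominus>\<^bsub>A\<^esub> a) b})"

definition symmetric_algebra :: "('a, 'm) star_alg_scheme \<Rightarrow> bool" where
  "symmetric_algebra B \<longleftrightarrow>
    (\<forall>b\<in>carrier B. spectrum B (star B b \<otimes>\<^bsub>B\<^esub> b) \<subseteq> complex_of_real ` {0..})"

definition star_hom :: "('a, 'm) star_alg_scheme \<Rightarrow> ('b, 'n) star_alg_scheme \<Rightarrow> ('a \<Rightarrow> 'b) set" where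
  "star_hom A B = {\<phi> \<in> carrier A \<rightarrow> carrier B.
     (\<forall>a\<in>carrier A. \<forall>b\<in>carrier A. \<phi> (a \<oplus>\<^bsub>A\<^esub> b) = \<phi> a \<oplus>\<^bsub>B\<^esub> \<phi> b) \<and>
     (\<forall>a\<in>carrier A. \<forall>z. \<phi> (z \<odot>\<^bsub>A\<^esub> a) = z \<odot>\<^bsub>B\<^esub> \<phi> a) \<and>
     (\<forall>a\<in>carrier A. \<forall>b\<in>carrier A. \<phi> (a \<otimes>\<^bsub>A\<^esub> b) = \<phi> a \<otimes>\<^bsub>B\<^esub> \<phi> b) \<and>
     (\<forall>a\<in>carrier A. \<phi> (star A a) = star B (\<phi> a))}"

definition star_aut :: "('a, 'm) star_alg_scheme \<Rightarrow> ('a \<Rightarrow> 'a) set" where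
  "star_aut A = {\<phi> \<in> star_hom A A. bij_betw \<phi> (carrier A) (carrier A)}"

definition star_subalgebra :: "'a set \<Rightarrow> ('a, 'm) star_alg_scheme \<Rightarrow> bool" where
  "star_subalgebra S C \<longleftrightarrow> S \<subseteq> carrier C \<and> \<zero>\<^bsub>C\<^esub> \<in> S \<and>
     (\<forall>a\<in>S. \<forall>b\<in>S. a \<oplus>\<^bsub>C\<^esub> b \<in> S \<and> a \<otimes>\<^bsub>C\<^esub> b \<in> S) \<and>
     (\<forall>a\<in>S. (\<forall>z. z \<odot>\<^bsub>C\<^esub> a \<in> S) \<and> star C a \<in> S)"

definition inverse_closed :: "'a set \<Rightarrow> ('a, 'm) star_alg_scheme \<Rightarrow> bool" where
  "inverse_closed S C \<longleftrightarrow> unital C \<and> star_subalgebra S C \<and>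
     (\<forall>a\<in>S. \<forall>b. inverses C a b \<longrightarrow> b \<in> S)"

text \<open>
  Inverse closedness in a possibly non-unital algebra: if \<open>C\<close> has no unit, a unit is adjoined to
  both algebras, \<open>UNIV \<times> S\<close> being the unitization of \<open>S\<close> inside that of \<open>C\<close>.
  (Only the *-algebra structure of the unitization matters here, so it carries no norm.)
\<close>

definition spectral_subalgebra :: "'a set \<Rightarrow> ('a, 'm) star_alg_scheme \<Rightarrow> bool" where
  "spectral_subalgebra S C \<longleftrightarrow>
     (if unital C then inverse_closed S C else inverse_closed (UNIV \<times> S) (unitization C))"

section \<open>Banach *-algebras and \<open>C\<^sup>*\<close>-algebras\<close>

text \<open>
  The guard only serves to meet the totality requirements of \<open>Metric_space\<close>, whose distance must be
  nonnegative and symmetric off the carrier too.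
\<close>

definition norm_dist :: "('a, 'b, 'm) module_scheme \<Rightarrow> ('b \<Rightarrow> real) \<Rightarrow> 'b \<Rightarrow> 'b \<Rightarrow> real" where
  "norm_dist V n x y = (if x \<in> carrier V \<and> y \<in> carrier V then n (x \<ominus>\<^bsub>V\<^esub> y) else 0)"

definition norm_topology :: "('a, 'm) normed_star_alg_scheme \<Rightarrow> 'a topology" where
  "norm_topology A = Metric_space.mtopology (carrier A) (norm_dist A (nrm A))"

locale banach_star_algebra = star_algebra A for A :: "('a, 'm) normed_star_alg_scheme" +
  assumes nrm_eq_zero: "a \<in> carrier A \<Longrightarrow> nrm A a = 0 \<longleftrightarrow> a = \<zero>\<^bsub>A\<^esub>"
    and nrm_triangle: "\<lbrakk>a \<in> carrier A; b \<in> carrier A\<rbrakk> \<Longrightarrow> nrm A (a \<oplus>\<^bsub>A\<^esub> b) \<le> nrm A a + nrm A b"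
    and nrm_smult: "a \<in> carrier A \<Longrightarrow> nrm A (z \<odot>\<^bsub>A\<^esub> a) = cmod z * nrm A a"
    and nrm_mult: "\<lbrakk>a \<in> carrier A; b \<in> carrier A\<rbrakk> \<Longrightarrow> nrm A (a \<otimes>\<^bsub>A\<^esub> b) \<le> nrm A a * nrm A b"
    and nrm_star: "a \<in> carrier A \<Longrightarrow> nrm A (star A a) = nrm A a"
    and complete: "Metric_space.mcomplete (carrier A) (norm_dist A (nrm A))"

locale cstar_algebra = banach_star_algebra A for A :: "('a, 'm) normed_star_alg_scheme" +
  assumes cstar_identity: "a \<in> carrier A \<Longrightarrow> nrm A (star A a \<otimes>\<^bsub>A\<^esub> a) = (nrm A a)\<^sup>2"

text \<open>Sum of a family in norm, over the net of finite subfamilies.\<close>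

definition alg_sum :: "('a, 'm) normed_star_alg_scheme \<Rightarrow> ('i \<Rightarrow> 'a) \<Rightarrow> 'a" where
  "alg_sum A h =
     (THE s. limitin (norm_topology A) (\<lambda>F. finsum A h F) s (finite_subsets_at_top UNIV))"

subsection \<open>Enveloping \<open>C\<^sup>*\<close>-algebras\<close>

definition cstar_seminorm :: "('a, 'm) star_alg_scheme \<Rightarrow> ('a \<Rightarrow> real) \<Rightarrow> bool" where
  "cstar_seminorm B p \<longleftrightarrow>
     (\<forall>a\<in>carrier B. 0 \<le> p a \<and> p (star B a \<otimes>\<^bsub>B\<^esub> a) = (p a)\<^sup>2 \<and>
        (\<forall>z. p (z \<odot>\<^bsub>B\<^esub> a) = cmod z * p a) \<and>
        (\<forall>b\<in>carrier B. p (a \<oplus>\<^bsub>B\<^esub> b) \<le> p a + p b \<and> p (a \<otimes>\<^bsub>B\<^esub> b) \<le> p a * p b))"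

text \<open>
  \<open>(C, \<iota>)\<close> is the Hausdorff completion of \<open>B\<close> in its largest \<open>C\<^sup>*\<close>-seminorm: \<open>b \<mapsto> \<parallel>\<iota> b\<parallel>\<close> is a
  \<open>C\<^sup>*\<close>-seminorm since \<open>\<iota>\<close> is a *-homomorphism, and it dominates all others. The \<open>C\<^sup>*\<close>-seminorms
  on \<open>B\<close> are exactly the functions \<open>b \<mapsto> \<parallel>\<phi> b\<parallel>\<close> with \<open>\<phi>\<close> a *-homomorphism into a \<open>C\<^sup>*\<close>-algebra
  (equivalently, a *-representation on a Hilbert space). These conditions determine \<open>(C, \<iota>)\<close>
  up to isomorphism.
\<close>

definition enveloping :: "('b, 'm) normed_star_alg_scheme \<Rightarrow> ('c, 'n) normed_star_alg_scheme
    \<Rightarrow> ('b \<Rightarrow> 'c) \<Rightarrow> bool" where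
  "enveloping B C \<iota> \<longleftrightarrow> cstar_algebra C \<and> \<iota> \<in> star_hom B C \<and>
     norm_topology C closure_of (\<iota> ` carrier B) = carrier C \<and>
     (\<forall>p. cstar_seminorm B p \<longrightarrow> (\<forall>b\<in>carrier B. p b \<le> nrm C (\<iota> b)))"

definition spectral_in_enveloping :: "('b, 'm) normed_star_alg_scheme
    \<Rightarrow> ('c, 'n) normed_star_alg_scheme \<Rightarrow> ('b \<Rightarrow> 'c) \<Rightarrow> bool" where
  "spectral_in_enveloping B C \<iota> \<longleftrightarrow>
     inj_on \<iota> (carrier B) \<and> spectral_subalgebra (\<iota> ` carrier B) C"

section \<open>Bounded operators\<close>

text \<open>Operators are extensional functions, so that they are equal iff they agree on the carrier.\<close>

definition bounded_ops :: "(complex, 'v, 'm) module_scheme \<Rightarrow> ('v \<Rightarrow> real) \<Rightarrow> ('v \<Rightarrow> 'v) set" where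
  "bounded_ops V n = {T \<in> carrier V \<rightarrow>\<^sub>E carrier V.
     (\<forall>x\<in>carrier V. \<forall>y\<in>carrier V. T (x \<oplus>\<^bsub>V\<^esub> y) = T x \<oplus>\<^bsub>V\<^esub> T y) \<and>
     (\<forall>x\<in>carrier V. \<forall>z. T (z \<odot>\<^bsub>V\<^esub> x) = z \<odot>\<^bsub>V\<^esub> T x) \<and>
     (\<exists>K. \<forall>x\<in>carrier V. n (T x) \<le> K * n x)}"

record 'h hilbert = "(complex, 'h) module" +
  ip :: "'h \<Rightarrow> 'h \<Rightarrow> complex"

definition hnorm :: "('h, 'm) hilbert_scheme \<Rightarrow> 'h \<Rightarrow> real" where
  "hnorm H x = sqrt (Re (ip H x x))"

locale hilbert_space = module complex_ring H for H :: "('h, 'm) hilbert_scheme" +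
  assumes ip_add: "\<lbrakk>x \<in> carrier H; y \<in> carrier H; z \<in> carrier H\<rbrakk>
          \<Longrightarrow> ip H (x \<oplus>\<^bsub>H\<^esub> y) z = ip H x z + ip H y z"
    and ip_smult: "\<lbrakk>x \<in> carrier H; y \<in> carrier H\<rbrakk> \<Longrightarrow> ip H (c \<odot>\<^bsub>H\<^esub> x) y = c * ip H x y"
    and ip_commute: "\<lbrakk>x \<in> carrier H; y \<in> carrier H\<rbrakk> \<Longrightarrow> ip H y x = cnj (ip H x y)"
    and ip_nonneg: "x \<in> carrier H \<Longrightarrow> 0 \<le> Re (ip H x x)"
    and ip_definite: "\<lbrakk>x \<in> carrier H; ip H x x = 0\<rbrakk> \<Longrightarrow> x = \<zero>\<^bsub>H\<^esub>"
    and complete: "Metric_space.mcomplete (carrier H) (norm_dist H (hnorm H))"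

definition operator_algebra :: "('h, 'm) hilbert_scheme \<Rightarrow> ('h \<Rightarrow> 'h) normed_star_alg" where
  "operator_algebra H =
    \<lparr>carrier = bounded_ops H (hnorm H),
     monoid.mult = compose (carrier H),
     one = (\<lambda>x\<in>carrier H. x),
     zero = (\<lambda>x\<in>carrier H. \<zero>\<^bsub>H\<^esub>),
     add = (\<lambda>S T. \<lambda>x\<in>carrier H. S x \<oplus>\<^bsub>H\<^esub> T x),
     smult = (\<lambda>z T. \<lambda>x\<in>carrier H. z \<odot>\<^bsub>H\<^esub> T x),
     star = (\<lambda>T. THE S. S \<in> bounded_ops H (hnorm H) \<and>
               (\<forall>x\<in>carrier H. \<forall>y\<in>carrier H. ip H (T x) y = ip H x (S y))),
     nrm = (\<lambda>T. SUP x\<in>{x \<in> carrier H. hnorm H x \<le> 1}. hnorm H (T x))\<rparr>"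

section \<open>Multipliers\<close>

text \<open>
  Multipliers are double centralizers \<open>(l, r)\<close>, where a multiplier \<open>m\<close> acts by \<open>l a = m a\<close> and
  \<open>r a = a m\<close>. The norm of the multiplier algebra is not needed.
\<close>

definition multiplier_algebra ::
    "('a, 'm) normed_star_alg_scheme \<Rightarrow> (('a \<Rightarrow> 'a) \<times> ('a \<Rightarrow> 'a)) star_alg" where
  "multiplier_algebra A =
    \<lparr>carrier = {(l, r). l \<in> bounded_ops A (nrm A) \<and> r \<in> bounded_ops A (nrm A) \<and>
       (\<forall>a\<in>carrier A. \<forall>b\<in>carrier A.
          l (a \<otimes>\<^bsub>A\<^esub> b) = l a \<otimes>\<^bsub>A\<^esub> b \<and> r (a \<otimes>\<^bsub>A\<^esub> b) = a \<otimes>\<^bsub>A\<^esub> r b \<and>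
          r a \<otimes>\<^bsub>A\<^esub> b = a \<otimes>\<^bsub>A\<^esub> l b)},
     monoid.mult = (\<lambda>(l, r) (l', r'). (compose (carrier A) l l', compose (carrier A) r' r)),
     one = (\<lambda>a\<in>carrier A. a, \<lambda>a\<in>carrier A. a),
     zero = (\<lambda>a\<in>carrier A. \<zero>\<^bsub>A\<^esub>, \<lambda>a\<in>carrier A. \<zero>\<^bsub>A\<^esub>),
     add = (\<lambda>(l, r) (l', r'). (\<lambda>a\<in>carrier A. l a \<oplus>\<^bsub>A\<^esub> l' a, \<lambda>a\<in>carrier A. r a \<oplus>\<^bsub>A\<^esub> r' a)),
     smult = (\<lambda>z (l, r). (\<lambda>a\<in>carrier A. z \<odot>\<^bsub>A\<^esub> l a, \<lambda>a\<in>carrier A. z \<odot>\<^bsub>A\<^esub> r a)),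
     star = (\<lambda>(l, r). (\<lambda>a\<in>carrier A. star A (r (star A a)), \<lambda>a\<in>carrier A. star A (l (star A a))))\<rparr>"

abbreviation mult_left :: "('a \<Rightarrow> 'a) \<times> ('a \<Rightarrow> 'a) \<Rightarrow> 'a \<Rightarrow> 'a" where
  "mult_left m a \<equiv> fst m a"

abbreviation mult_right :: "'a \<Rightarrow> ('a \<Rightarrow> 'a) \<times> ('a \<Rightarrow> 'a) \<Rightarrow> 'a" where
  "mult_right a m \<equiv> snd m a"

definition unitary_multipliers ::
    "('a, 'm) normed_star_alg_scheme \<Rightarrow> (('a \<Rightarrow> 'a) \<times> ('a \<Rightarrow> 'a)) set" where
  "unitary_multipliers A = (let M = multiplier_algebra A in
     {u \<in> carrier M. star M u \<otimes>\<^bsub>M\<^esub> u = \<one>\<^bsub>M\<^esub> \<and> u \<otimes>\<^bsub>M\<^esub> star M u = \<one>\<^bsub>M\<^esub>})"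

text \<open>The extension of an automorphism \<open>\<phi>\<close> to multipliers, determined by \<open>\<phi>(m) \<phi>(a) = \<phi>(m a)\<close>.\<close>

definition extend_aut :: "('a, 'm) normed_star_alg_scheme \<Rightarrow> ('a \<Rightarrow> 'a)
    \<Rightarrow> ('a \<Rightarrow> 'a) \<times> ('a \<Rightarrow> 'a) \<Rightarrow> ('a \<Rightarrow> 'a) \<times> ('a \<Rightarrow> 'a)" where
  "extend_aut A \<phi> m =
     (\<lambda>a\<in>carrier A. \<phi> (mult_left m (inv_into (carrier A) \<phi> a)),
      \<lambda>a\<in>carrier A. \<phi> (mult_right (inv_into (carrier A) \<phi> a) m))"

section \<open>Group algebras\<close>

text \<open>
  The discrete group is a type of class \<open>group_add\<close>, whose addition need not be commutative: the
  products \<open>xy\<close> and \<open>y\<inverse>x\<close> read \<open>x + y\<close> and \<open>- y + x\<close>, and the unit is \<open>0\<close>.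
\<close>

definition ell1 :: "('g \<Rightarrow> complex) set" where
  "ell1 = {k. (\<lambda>x. cmod (k x)) summable_on UNIV}"

definition ell1_norm :: "('g \<Rightarrow> complex) \<Rightarrow> real" where
  "ell1_norm k = (\<Sum>\<^sub>\<infinity>x. cmod (k x))"

definition group_algebra :: "('g::group_add \<Rightarrow> complex) set \<Rightarrow> (('g \<Rightarrow> complex) \<Rightarrow> real)
    \<Rightarrow> ('g \<Rightarrow> complex) normed_star_alg" where
  "group_algebra L N =
    \<lparr>carrier = L,
     monoid.mult = (\<lambda>k l x. \<Sum>\<^sub>\<infinity>y. k y * l (- y + x)),
     one = (\<lambda>x. if x = 0 then 1 else 0),
     zero = (\<lambda>x. 0),
     add = (\<lambda>k l x. k x + l x),
     smult = (\<lambda>z k x. z * k x),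
     star = (\<lambda>k x. cnj (k (- x))),
     nrm = N\<rparr>"

text \<open>\<open>L\<close> with the norm \<open>N\<close> is an admissible algebra. Unitality does not require \<open>N 1 = 1\<close>.\<close>

definition admissible :: "('g::group_add \<Rightarrow> complex) set \<Rightarrow> (('g \<Rightarrow> complex) \<Rightarrow> real) \<Rightarrow> bool" where
  "admissible L N \<longleftrightarrow> L \<subseteq> ell1 \<and>
     (\<exists>K. \<forall>k\<in>L. ell1_norm k \<le> K * N k) \<and>
     (\<forall>k l. l \<in> L \<and> (\<forall>x. cmod (k x) \<le> cmod (l x)) \<longrightarrow> k \<in> L \<and> N k \<le> N l) \<and>
     banach_star_algebra (group_algebra L N) \<and> unital (group_algebra L N)"

definition twisted_system :: "('a, 'm) normed_star_alg_scheme \<Rightarrow> ('g::group_add \<Rightarrow> 'a \<Rightarrow> 'a)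
    \<Rightarrow> ('g \<Rightarrow> 'g \<Rightarrow> ('a \<Rightarrow> 'a) \<times> ('a \<Rightarrow> 'a)) \<Rightarrow> bool" where
  "twisted_system A \<alpha> \<omega> \<longleftrightarrow> (let M = multiplier_algebra A in
     cstar_algebra A \<and>
     (\<forall>x. \<alpha> x \<in> star_aut A) \<and>
     (\<forall>x y. \<omega> x y \<in> unitary_multipliers A) \<and>
     (\<forall>x y. \<forall>a\<in>carrier A.
        \<alpha> x (\<alpha> y a) = mult_left (\<omega> x y) (mult_right (\<alpha> (x + y) a) (star M (\<omega> x y)))) \<and>
     (\<forall>x y z. \<omega> x y \<otimes>\<^bsub>M\<^esub> \<omega> (x + y) z = extend_aut A (\<alpha> x) (\<omega> y z) \<otimes>\<^bsub>M\<^esub> \<omega> x (y + z)) \<and>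
     (\<forall>x. \<omega> x 0 = \<one>\<^bsub>M\<^esub> \<and> \<omega> 0 x = \<one>\<^bsub>M\<^esub>))"

text \<open>
  For admissible \<open>L\<close> the functions in the carrier are automatically absolutely summable,
  because \<open>L \<subseteq> ell1\<close>.
\<close>

definition twisted_algebra :: "('g::group_add \<Rightarrow> complex) set \<Rightarrow> (('g \<Rightarrow> complex) \<Rightarrow> real)
    \<Rightarrow> ('a, 'm) normed_star_alg_scheme \<Rightarrow> ('g \<Rightarrow> 'a \<Rightarrow> 'a)
    \<Rightarrow> ('g \<Rightarrow> 'g \<Rightarrow> ('a \<Rightarrow> 'a) \<times> ('a \<Rightarrow> 'a)) \<Rightarrow> ('g \<Rightarrow> 'a) normed_star_alg" where
  "twisted_algebra L N A \<alpha> \<omega> =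
    \<lparr>carrier = {f. (\<forall>x. f x \<in> carrier A) \<and> (\<lambda>x. complex_of_real (nrm A (f x))) \<in> L},
     monoid.mult = (\<lambda>f g x.
       alg_sum A (\<lambda>y. mult_right (f y \<otimes>\<^bsub>A\<^esub> \<alpha> y (g (- y + x))) (\<omega> y (- y + x)))),
     one = (\<lambda>x. if x = 0 then \<one>\<^bsub>A\<^esub> else \<zero>\<^bsub>A\<^esub>),
     zero = (\<lambda>x. \<zero>\<^bsub>A\<^esub>),
     add = (\<lambda>f g x. f x \<oplus>\<^bsub>A\<^esub> g x),
     smult = (\<lambda>z f x. z \<odot>\<^bsub>A\<^esub> f x),
     star = (\<lambda>f x. mult_left (star (multiplier_algebra A) (\<omega> x (- x))) (star A (\<alpha> x (f (- x))))),
     nrm = (\<lambda>f. N (\<lambda>x. complex_of_real (nrm A (f x))))\<rparr>"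

text \<open>
  HOL cannot quantify over all types inside a formula, so the \<open>C\<^sup>*\<close>-algebras \<open>B\<close> are those whose
  carrier is a subset of a given type \<open>'u\<close>, which plays the role of a universe. As a hypothesis
  this is formally weaker than the same condition for all \<open>C\<^sup>*\<close>-algebras.
\<close>

definition rigidly_symmetric :: "'u itself \<Rightarrow> ('g::group_add \<Rightarrow> complex) set
    \<Rightarrow> (('g \<Rightarrow> complex) \<Rightarrow> real) \<Rightarrow> bool" where
  "rigidly_symmetric _ L N \<longleftrightarrow> (\<forall>B :: 'u normed_star_alg. cstar_algebra B \<longrightarrow>
     symmetric_algebra (twisted_algebra L N B (\<lambda>x b. b) (\<lambda>x y. \<one>\<^bsub>multiplier_algebra B\<^esub>)))"

end

theory Submission
  imports Defs
begin


text \<open>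
  Symmetry of the twisted algebra \<open>F = L\<^sub>\<alpha>\<^sub>,\<^sub>\<omega>(G; A)\<close> is a statement about untwisted algebras in disguise. Let
  \<open>Q\<close> be the reduced twisted crossed product, that is, the completion of the twisted algebra \<open>\<ell>\<^sup>1(G; A)\<close> in the operator norm
  of its regular representation. Then \<open>\<Psi> f = (x \<mapsto> f(x) \<delta>\<^sub>x)\<close> is an isometric *-homomorphism of \<open>F\<close> into \<open>L(G; Q)\<close>
  with trivial action and trivial cocycle, because the twist is absorbed by the product of \<open>Q\<close>. The latter algebra is symmetric
  by rigid symmetry. Symmetry passes from it to \<open>F\<close>: for \<open>z\<close> off the positive half-line all
  \<open>1 - (t/z) f\<^sup>* f\<close> with \<open>0 \<le> t \<le> 1\<close> become invertible in the large algebra, their inverses are uniformly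
  bounded there, and so invertibility in \<open>F\<close> propagates from \<open>t = 0\<close> to \<open>t = 1\<close>
  (\<open>has_inverse_ray\<close>, \<open>symmetric_isometric\<close>, \<open>symmetric_F\<close>).

  In a symmetric algebra the spectral radius of \<open>a\<close> is at most Ptak's functional \<open>r(a\<^sup>* a)\<^bsup>1/2\<^esup>\<close>, which is a
  \<open>C\<^sup>*\<close>-seminorm and hence at most the norm of \<open>a\<close> in the enveloping \<open>C\<^sup>*\<close>-algebra. Inverse closedness
  follows by density: if \<open>d\<close> is the quasi-inverse of \<open>f\<close> in the \<open>C\<^sup>*\<close>-algebra and \<open>g \<in> F\<close> is close to
  \<open>d\<close>, then \<open>(1 + f) (1 + g) = 1 + y\<close> with \<open>y\<close> of small norm, so \<open>1 + y\<close> is invertible over \<open>F\<close>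
  (\<open>quasi_inverse\<close>). The canonical map is injective because the reduced norm
  dominates all values \<open>\<parallel>f(x)\<parallel>\<close> (\<open>nrm_le_red\<close>). A unit of the \<open>C\<^sup>*\<close>-algebra forces a unit of
  \<open>A\<close>, hence of \<open>F\<close> (\<open>unital_of_enveloping\<close>).

  For a faithful representation \<open>\<Phi>\<close> it remains to see that an invertible operator \<open>\<Phi> c\<close> has its inverse in the
  range. The operator \<open>\<Phi> (c\<^sup>* c)\<close> is bounded below, and then \<open>\<Phi>\<close> annihilates the negative part of
  \<open>c\<^sup>* c - t\<close> for small \<open>t > 0\<close>; by injectivity \<open>c\<^sup>* c\<close> is \<open>t\<close> plus a positive element
  (\<open>left_inverse_of_bounded_below\<close>).

  All this rests on a part of the theory of Banach *-algebras: the formula for the spectral radius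
  (\<open>rad_le_of_resolvent\<close>), Ptak's inequality (\<open>ptak\<close>), the Shirali--Ford theorem
  (\<open>shirali_ford\<close>), and the fact that self-adjoint elements of \<open>C\<^sup>*\<close>-algebras have real spectrum
  (\<open>cstar_hermitian\<close>). It is developed in a type class, which avoids carriers. Algebras given by carriers enter
  this setting as factors of one large product (\<open>'a uni\<close>).
\<close>

section \<open>Invertible elements and the Neumann series\<close>

definition has_inverse :: "'a::monoid_mult => bool" where
  "has_inverse x \<longleftrightarrow> (\<exists>y. x * y = 1 \<and> y * x = 1)"

definition minv :: "'a::monoid_mult => 'a" where
  "minv x = (SOME y. x * y = 1 \<and> y * x = 1)"

lemma has_inverseI: "x * y = 1 ==> y * x = 1 ==> has_inverse x"
  unfolding has_inverse_def by blast

lemma minv_right: "has_inverse x ==> x * minv x = 1"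
  and minv_left: "has_inverse x ==> minv x * x = 1"
  unfolding has_inverse_def minv_def by (metis (mono_tags, lifting) someI_ex)+

lemma left_right_inverse_eq: "y * x = 1 ==> x * z = 1 ==> y = (z::'a::monoid_mult)"
  by (metis mult.assoc mult.left_neutral mult.right_neutral)

lemma minv_unique: "x * y = 1 ==> y * x = 1 ==> minv x = (y::'a::monoid_mult)"
  by (meson has_inverseI left_right_inverse_eq minv_left)

lemma has_inverse_one_sided: "y * x = 1 ==> x * z = 1 ==> has_inverse (x::'a::monoid_mult)"
  using left_right_inverse_eq has_inverse_def by blast

lemma has_inverse_1 [simp]: "has_inverse 1"
  by (rule has_inverseI[of _ 1]) auto

lemma has_inverse_minv: "has_inverse x ==> has_inverse (minv x)"
  by (meson has_inverseI minv_left minv_right)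

lemma minv_mult_cancel:
  fixes x z :: "'a::monoid_mult"
  assumes "has_inverse x"
  shows "x * (minv x * z) = z" "minv x * (x * z) = z" "z * x * minv x = z" "z * minv x * x = z"
  using minv_left[OF assms] minv_right[OF assms] by (simp_all add: mult.assoc) (simp_all add: mult.assoc[symmetric])

lemma
  fixes x y :: "'a::monoid_mult"
  assumes "has_inverse x" "has_inverse y"
  shows has_inverse_mult: "has_inverse (x * y)" and minv_mult: "minv (x * y) = minv y * minv x"
proof -
  have 1: "x * y * (minv y * minv x) = 1" and 2: "minv y * minv x * (x * y) = 1"
    using assms by (simp_all add: mult.assoc minv_mult_cancel minv_left minv_right)
  show "has_inverse (x * y)" using 1 2 by (rule has_inverseI)
  show "minv (x * y) = minv y * minv x" using 1 2 by (rule minv_unique)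
qed

lemma has_inverse_uminus [simp]: "has_inverse (- x :: 'a::ring_1) \<longleftrightarrow> has_inverse x"
proof -
  have "has_inverse (- x)" if "has_inverse x" for x :: 'a
    using that by (intro has_inverseI[of _ "- minv x"]) (auto simp: minv_left minv_right)
  from this[of x] this[of "- x"] show ?thesis by auto
qed

lemma has_inverse_factor:
  fixes x y :: "'a::monoid_mult"
  assumes "has_inverse (x * y)" "x * y = y * x" shows "has_inverse x"
proof (rule has_inverse_one_sided)
  show "x * (y * minv (x * y)) = 1" using minv_right[OF assms(1)] by (simp add: mult.assoc)
  show "(minv (x * y) * y) * x = 1" using minv_left[OF assms(1)] assms(2) by (simp add: mult.assoc)
qed

lemma minv_commute:
  fixes x y :: "'a::monoid_mult"
  assumes "has_inverse x" "x * y = y * x" shows "minv x * y = y * minv x"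
proof -
  have "minv x * y = minv x * (y * x) * minv x" using minv_right[OF assms(1)] by (simp add: mult.assoc)
  also have "\<dots> = (minv x * x) * y * minv x" using assms(2) by (simp add: mult.assoc)
  finally show ?thesis using minv_left[OF assms(1)] by simp
qed

lemma one_minus_power_factor:
  "(1 - x) * (\<Sum>k<n. x ^ k) = 1 - (x::'a::ring_1) ^ n"
  "(\<Sum>k<n. x ^ k) * (1 - x) = 1 - (x::'a::ring_1) ^ n"
proof (induction n)
  case (Suc n)
  { case 1
    have "(1 - x) * (\<Sum>k<Suc n. x ^ k) = (1 - x) * (\<Sum>k<n. x ^ k) + (1 - x) * x ^ n" by (simp add: distrib_left)
    then show ?case unfolding Suc by (simp add: left_diff_distrib) }
  { case 2
    have "(\<Sum>k<Suc n. x ^ k) * (1 - x) = (\<Sum>k<n. x ^ k) * (1 - x) + x ^ n * (1 - x)" by (simp add: distrib_right)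
    then show ?case unfolding Suc by (simp add: right_diff_distrib power_commutes) }
qed auto

lemma neumann:
  fixes x :: "'a::{real_normed_algebra_1,banach}"
  assumes s: "summable (\<lambda>n. norm (x ^ n))"
  shows "has_inverse (1 - x)" "minv (1 - x) = (\<Sum>n. x ^ n)" "norm (minv (1 - x)) \<le> (\<Sum>n. norm (x ^ n))"
proof -
  have su: "summable (\<lambda>n. x ^ n)" using s by (rule summable_norm_cancel)
  have x0: "(\<lambda>n. x ^ n) \<longlonglongrightarrow> 0" using su by (rule summable_LIMSEQ_zero)
  have sm: "(\<lambda>n. \<Sum>k<n. x ^ k) \<longlonglongrightarrow> (\<Sum>n. x ^ n)" using su by (rule summable_LIMSEQ)
  have l: "(\<lambda>n. 1 - x ^ n) \<longlonglongrightarrow> 1 - 0" by (intro tendsto_intros x0)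
  have 1: "(1 - x) * (\<Sum>n. x ^ n) = 1"
    using LIMSEQ_unique[OF tendsto_mult[OF tendsto_const[of "1 - x"] sm]] l
    by (simp add: one_minus_power_factor)
  have 2: "(\<Sum>n. x ^ n) * (1 - x) = 1"
    using LIMSEQ_unique[OF tendsto_mult[OF sm tendsto_const[of "1 - x"]]] l
    by (simp add: one_minus_power_factor)
  show "has_inverse (1 - x)" using 1 2 by (rule has_inverseI)
  show m: "minv (1 - x) = (\<Sum>n. x ^ n)" using 1 2 by (rule minv_unique)
  show "norm (minv (1 - x)) \<le> (\<Sum>n. norm (x ^ n))" unfolding m by (rule summable_norm[OF s])
qed

lemma neumann_norm:
  fixes x :: "'a::{real_normed_algebra_1,banach}"
  assumes "norm x < 1"
  shows "has_inverse (1 - x)" "norm (minv (1 - x)) \<le> 1 / (1 - norm x)"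
proof -
  have g: "summable (\<lambda>n. norm x ^ n)" using assms by (simp add: summable_geometric)
  have s: "summable (\<lambda>n. norm (x ^ n))"
    by (rule summable_comparison_test'[OF g, of 0]) (simp add: norm_power_ineq)
  show "has_inverse (1 - x)" by (rule neumann[OF s])
  have "(\<Sum>n. norm (x ^ n)) \<le> (\<Sum>n. norm x ^ n)"
    by (rule suminf_le[OF _ s g]) (simp add: norm_power_ineq)
  also have "\<dots> = 1 / (1 - norm x)" using assms by (simp add: suminf_geometric)
  finally show "norm (minv (1 - x)) \<le> 1 / (1 - norm x)" using neumann(3)[OF s] by simp
qed

lemma has_inverse_perturb:
  fixes x y :: "'a::{real_normed_algebra_1,banach}"
  assumes x: "has_inverse x" and d: "norm (minv x) * norm (y - x) < 1"
  shows "has_inverse y"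
    "norm (minv y - minv x) \<le> (norm (minv x))\<^sup>2 * norm (y - x) / (1 - norm (minv x) * norm (y - x))"
proof -
  define u where "u = minv x * (x - y)"
  have nu: "norm u \<le> norm (minv x) * norm (y - x)"
    unfolding u_def using norm_mult_ineq[of "minv x" "x - y"] by (simp add: norm_minus_commute)
  have nu1: "norm u < 1" using nu d by simp
  have y: "y = x * (1 - u)"
    using minv_right[OF x] by (simp add: u_def algebra_simps mult.assoc[symmetric])
  have i: "has_inverse (1 - u)" by (rule neumann_norm[OF nu1])
  show hy: "has_inverse y" unfolding y by (intro has_inverse_mult x i)
  have my: "minv y = minv (1 - u) * minv x"
    unfolding y by (rule minv_mult[OF x i])
  have "minv (1 - u) - 1 = u * minv (1 - u)"
    using minv_right[OF i] by (simp add: algebra_simps)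
  moreover have "minv y - minv x = (minv (1 - u) - 1) * minv x"
    unfolding my by (simp add: left_diff_distrib)
  ultimately have "minv y - minv x = u * minv (1 - u) * minv x" by simp
  then have "norm (minv y - minv x) \<le> norm u * norm (minv (1 - u)) * norm (minv x)"
    by (simp add: order_trans[OF norm_mult_ineq] mult_right_mono norm_mult_ineq)
  also have "\<dots> \<le> norm u * (1 / (1 - norm u)) * norm (minv x)"
    using neumann_norm(2)[OF nu1] by (intro mult_right_mono mult_left_mono) auto
  also have "\<dots> = norm (minv x) * (norm u / (1 - norm u))" by simp
  also have "\<dots> \<le> norm (minv x) * ((norm (minv x) * norm (y - x)) / (1 - norm (minv x) * norm (y - x)))"
    using nu d nu1 by (intro mult_left_mono frac_le) auto
  finally show "norm (minv y - minv x) \<le> (norm (minv x))\<^sup>2 * norm (y - x) / (1 - norm (minv x) * norm (y - x))"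
    by (simp add: power2_eq_square mult.assoc)
qed

lemma continuous_on_minv:
  fixes f :: "'b::metric_space => 'a::{real_normed_algebra_1,banach}"
  assumes f: "continuous_on T f" and inv: "\<And>t. t \<in> T ==> has_inverse (f t)"
  shows "continuous_on T (\<lambda>t. minv (f t))"
  unfolding continuous_on_def
proof
  fix t assume t: "t \<in> T"
  let ?F = "at t within T"
  let ?K = "norm (minv (f t))"
  have ft: "(f \<longlongrightarrow> f t) ?F" using f t by (simp add: continuous_on_def)
  have d: "((\<lambda>s. norm (f s - f t)) \<longlongrightarrow> 0) ?F"
    using ft by (simp add: LIM_zero tendsto_norm_zero)
  have d1: "((\<lambda>s. ?K * norm (f s - f t)) \<longlongrightarrow> ?K * 0) ?F" by (intro tendsto_intros d)
  have ev: "\<forall>\<^sub>F s in ?F. ?K * norm (f s - f t) < 1"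
    using order_tendstoD(2)[OF d1, of 1] by simp
  have b: "\<forall>\<^sub>F s in ?F. norm (minv (f s) - minv (f t)) \<le> ?K\<^sup>2 * norm (f s - f t) / (1 - ?K * norm (f s - f t))"
    using ev by eventually_elim (rule has_inverse_perturb(2)[OF inv[OF t]])
  have "((\<lambda>s. ?K\<^sup>2 * norm (f s - f t) / (1 - ?K * norm (f s - f t))) \<longlongrightarrow> ?K\<^sup>2 * 0 / (1 - ?K * 0)) ?F"
    by (intro tendsto_intros d) auto
  then have "((\<lambda>s. minv (f s) - minv (f t)) \<longlongrightarrow> 0) ?F"
    by (intro Lim_null_comparison[OF b]) simp
  then show "((\<lambda>s. minv (f s)) \<longlongrightarrow> minv (f t)) ?F" by (simp add: LIM_zero_iff)
qed

section \<open>Spectral radius\<close>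

text \<open>The infimum of the rates of geometric growth of the powers; it equals Gelfand's limit.\<close>

definition rad :: "'a::real_normed_algebra_1 => real" where
  "rad x = Inf {r. 0 < r \<and> (\<exists>K. \<forall>n. norm (x ^ n) \<le> K * r ^ n)}"

lemma rad_set:
  fixes x :: "'a::real_normed_algebra_1"
  shows "bdd_below {r. 0 < r \<and> (\<exists>K. \<forall>n. norm (x ^ n) \<le> K * r ^ n)}"
    and "norm x + 1 \<in> {r. 0 < r \<and> (\<exists>K. \<forall>n. norm (x ^ n) \<le> K * r ^ n)}"
proof -
  show "bdd_below {r. 0 < r \<and> (\<exists>K. \<forall>n. norm (x ^ n) \<le> K * r ^ n)}" by (intro bdd_belowI[of _ 0]) auto
  have "norm (x ^ n) \<le> 1 * (norm x + 1) ^ n" for n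
    using order_trans[OF norm_power_ineq[of x n] power_mono[of "norm x" "norm x + 1" n]] by simp
  moreover have "0 < norm x + 1" using norm_ge_zero[of x] by linarith
  ultimately show "norm x + 1 \<in> {r. 0 < r \<and> (\<exists>K. \<forall>n. norm (x ^ n) \<le> K * r ^ n)}" by blast
qed

lemma rad_nonneg [simp]: "0 \<le> rad x"
  unfolding rad_def
proof (rule cInf_greatest)
  show "{r. 0 < r \<and> (\<exists>K. \<forall>n. norm (x ^ n) \<le> K * r ^ n)} \<noteq> {}" using rad_set(2)[of x] by blast
qed auto

lemma rad_leI:
  assumes "0 < r" "\<And>n. norm (x ^ n) \<le> K * r ^ n" shows "rad x \<le> r"
  unfolding rad_def using assms by (intro cInf_lower rad_set) auto

lemma rad_growth:
  assumes "rad x < r" obtains K where "0 < K" "\<And>n. norm (x ^ n) \<le> K * r ^ n"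
proof -
  obtain r' K where r': "0 < r'" "r' < r" "\<And>n. norm (x ^ n) \<le> K * r' ^ n"
    using cInf_lessD[OF _ assms[unfolded rad_def]] rad_set(2)[of x] by blast
  have K0: "0 < K" using r'(3)[of 0] by simp
  have "norm (x ^ n) \<le> K * r ^ n" for n

  proof -
    have "K * r' ^ n \<le> K * r ^ n" using K0 r' by (intro mult_left_mono power_mono) auto
    then show ?thesis using r'(3)[of n] by simp
  qed
  with K0 show ?thesis by (rule that)
qed

lemma rad_leI_less: "(\<And>r. c < r ==> rad x \<le> r) ==> rad x \<le> c"
  by (rule dense_ge) auto

lemma rad_le_norm: "rad x \<le> norm x"
proof (rule field_le_epsilon)
  fix e :: real assume "0 < e"
  then have "norm (x ^ n) \<le> 1 * (norm x + e) ^ n" for n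
    using order_trans[OF norm_power_ineq[of x n] power_mono[of "norm x" "norm x + e" n]] by simp
  then show "rad x \<le> norm x + e" using \<open>0 < e\<close> norm_ge_zero[of x] by (intro rad_leI[of _ _ 1]) (auto simp: add_nonneg_pos)
qed

lemma rad_summable:
  assumes "rad x < 1" shows "summable (\<lambda>n. norm (x ^ n))"
proof -
  obtain r where r: "rad x < r" "r < 1" using assms dense by blast
  obtain K where K: "0 < K" "\<And>n. norm (x ^ n) \<le> K * r ^ n" using rad_growth[OF r(1)] by blast
  have "0 \<le> r" using r(1) rad_nonneg[of x] by linarith
  then have "summable (\<lambda>n. K * r ^ n)" using r(2) by (intro summable_mult summable_geometric) simp
  then show ?thesis by (rule summable_comparison_test'[of _ 0]) (simp add: K)
qed

lemma rad_less_1_has_inverse: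
  fixes x :: "'a::{real_normed_algebra_1,banach}"
  shows "rad x < 1 ==> has_inverse (1 - x)"
  by (intro neumann(1) rad_summable)

lemma rad_commute_le: "rad (x * y) \<le> rad (y * x)" for x y :: "'a::real_normed_algebra_1"
proof (rule field_le_epsilon)
  fix e :: real assume e: "0 < e"
  define r where "r = rad (y * x) + e"
  have r: "rad (y * x) < r" "0 < r" using e by (auto simp: r_def add_nonneg_pos)
  obtain K where K: "0 < K" "\<And>n. norm ((y * x) ^ n) \<le> K * r ^ n" using rad_growth[OF r(1)] by blast
  have shift: "(x * y) ^ Suc n = x * (y * x) ^ n * y" for n
    by (induction n) (auto simp: mult.assoc)
  define M where "M = max 1 (norm x * K * norm y / r)"
  have "norm ((x * y) ^ n) \<le> M * r ^ n" for n
  proof (cases n)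
    case 0 then show ?thesis by (simp add: M_def)
  next
    case (Suc k)
    have "norm ((x * y) ^ n) \<le> norm x * norm ((y * x) ^ k) * norm y"
      unfolding Suc shift by (rule order_trans[OF norm_mult_ineq]) (intro mult_right_mono norm_mult_ineq norm_ge_zero)
    also have "\<dots> \<le> norm x * (K * r ^ k) * norm y" by (intro mult_right_mono mult_left_mono K) auto
    also have "\<dots> = (norm x * K * norm y / r) * r ^ n" using r by (simp add: Suc)
    also have "\<dots> \<le> M * r ^ n" using r by (intro mult_right_mono) (auto simp: M_def)
    finally show ?thesis .
  qed
  then show "rad (x * y) \<le> rad (y * x) + e" using rad_leI[OF r(2)] unfolding r_def by blast
qed

lemma rad_commute: "rad (x * y) = rad (y * x)" for x y :: "'a::real_normed_algebra_1"
  by (simp add: antisym rad_commute_le)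

text \<open>The inequality \<open>(rad x)\<^sup>2 \<le> rad (x * x)\<close> needs the odd powers, which cost one more factor \<open>norm x\<close>.\<close>

lemma rad_square: "rad (x * x) = (rad x)\<^sup>2" for x :: "'a::real_normed_algebra_1"
proof (rule antisym)
  have sq: "(x * x) ^ n = x ^ (2 * n)" for n by (simp add: power_mult power2_eq_square)
  show "rad (x * x) \<le> (rad x)\<^sup>2"
  proof (rule ccontr)
    assume "\<not> ?thesis"
    then have "rad x < sqrt (rad (x * x))" by (simp add: real_less_rsqrt)
    then obtain r where r: "rad x < r" "r < sqrt (rad (x * x))" using dense by blast
    have r0: "0 < r" using r(1) rad_nonneg[of x] by linarith
    obtain K where K: "0 < K" "\<And>n. norm (x ^ n) \<le> K * r ^ n" using rad_growth[OF r(1)] by blast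
    have "rad (x * x) \<le> r\<^sup>2"
      by (rule rad_leI[of _ _ K]) (use r0 K(2)[of "2 * _"] in \<open>auto simp: sq power_mult\<close>)
    moreover have "r\<^sup>2 < rad (x * x)"
      using power_strict_mono[OF r(2), of 2] r0 by simp
    ultimately show False by simp
  qed
  show "(rad x)\<^sup>2 \<le> rad (x * x)"
  proof (rule ccontr)
    assume "\<not> ?thesis"
    then have "sqrt (rad (x * x)) < rad x" by (simp add: real_less_lsqrt)
    then obtain r where r: "sqrt (rad (x * x)) < r" "r < rad x" using dense by blast
    have r0: "0 < r" using r(1) by (meson le_less_trans rad_nonneg real_sqrt_ge_zero)
    have "rad (x * x) < r\<^sup>2"
      using power_strict_mono[OF r(1), of 2] by simp
    then obtain K where K: "0 < K" "\<And>n. norm ((x * x) ^ n) \<le> K * (r\<^sup>2) ^ n" using rad_growth by blast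
    define M where "M = max K (norm x * K / r)"
    have MK: "K \<le> M" "norm x * K / r \<le> M" by (auto simp: M_def)
    have "norm (x ^ n) \<le> M * r ^ n" for n
    proof (cases "even n")
      case True
      then obtain k where k: "n = 2 * k" by blast
      have "norm (x ^ n) \<le> K * r ^ n" using K(2)[of k] by (simp add: k sq power_mult)
      also have "\<dots> \<le> M * r ^ n" using MK(1) r0 by (intro mult_right_mono) auto
      finally show ?thesis .
    next
      case False
      then obtain k where k: "n = Suc (2 * k)" using oddE by fastforce
      have "norm (x ^ n) \<le> norm x * norm (x ^ (2 * k))" by (simp add: k norm_mult_ineq)
      also have "\<dots> \<le> norm x * (K * r ^ (2 * k))"
        using K(2)[of k] by (intro mult_left_mono) (auto simp: sq power_mult)
      also have "\<dots> = (norm x * K / r) * r ^ n" using r0 by (simp add: k)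
      also have "\<dots> \<le> M * r ^ n" using MK(2) r0 by (intro mult_right_mono) auto
      finally show ?thesis .
    qed
    then have "rad x \<le> r" using rad_leI[OF r0] by blast
    then show False using r(2) by simp
  qed
qed

section \<open>Complex Banach *-algebras as a type class\<close>

class cbstar = real_normed_algebra_1 + banach +
  fixes cx :: "complex => 'a" and adj :: "'a => 'a"
  assumes cx_add: "cx (z + w) = cx z + cx w"
    and cx_mult: "cx (z * w) = cx z * cx w"
    and cx_of_real: "cx (complex_of_real r) = scaleR r 1"
    and cx_commute: "cx z * x = x * cx z"
    and norm_cx_mult: "norm (cx z * x) = cmod z * norm x"
    and adj_add: "adj (x + y) = adj x + adj y"
    and adj_mult: "adj (x * y) = adj y * adj x"
    and adj_adj [simp]: "adj (adj x) = x"
    and adj_cx [simp]: "adj (cx z) = cx (cnj z)"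
    and norm_adj [simp]: "norm (adj x) = norm x"

lemma cx_complex_of_real: "cx (complex_of_real r) = of_real r"
  by (metis cx_of_real of_real_def)

lemma cx_0 [simp]: "cx 0 = 0" and cx_1 [simp]: "cx 1 = 1"
  using cx_of_real[of 0] cx_of_real[of 1] by auto

lemma cx_minus [simp]: "cx (- z) = - cx z"
  using cx_add[of z "- z"] by (simp add: eq_neg_iff_add_eq_0 add.commute)

lemma cx_diff: "cx (z - w) = cx z - cx w"
  using cx_add[of z "- w"] by simp

lemma cx_power: "cx (z ^ n) = cx z ^ n"
  by (induction n) (auto simp: cx_mult)

lemma norm_cx [simp]: "norm (cx z) = cmod z"
  using norm_cx_mult[of z 1] by simp

lemma cx_mult_left: "cx z * (cx w * x) = cx (z * w) * x"
  by (simp add: cx_mult mult.assoc)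

lemma cx_mult_swap: "x * (cx z * y) = cx z * (x * y)"
  using cx_commute[of z x] by (simp add: mult.assoc[symmetric])

lemma scaleR_cx: "r *\<^sub>R x = cx (complex_of_real r) * (x::'a::cbstar)"
  by (simp add: cx_of_real)

lemma has_inverse_cx: "z \<noteq> 0 ==> has_inverse (cx z)"
  by (rule has_inverseI[of _ "cx (1 / z)"]) (auto simp: cx_mult[symmetric])

lemma has_inverse_cx_mult: "z \<noteq> 0 ==> has_inverse (cx z * x) \<longleftrightarrow> has_inverse x"
proof
  assume z: "z \<noteq> 0"
  { fix z :: complex and x :: 'a assume "z \<noteq> 0" "has_inverse x"
    then have "has_inverse (cx z * x)" by (intro has_inverse_mult has_inverse_cx) }
  note * = this
  show "has_inverse x ==> has_inverse (cx z * x)" using * z by blast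
  assume "has_inverse (cx z * x)"
  then have "has_inverse (cx (1 / z) * (cx z * x))" using * z by simp
  then show "has_inverse x" using z by (simp add: cx_mult_left)
qed

lemma adj_0 [simp]: "adj 0 = 0" and adj_1 [simp]: "adj 1 = 1"
  using adj_cx[of 0] adj_cx[of 1] by auto

lemma adj_minus [simp]: "adj (- x) = - adj x"
  using adj_add[of x "- x"] by (simp add: eq_neg_iff_add_eq_0 add.commute)

lemma adj_diff: "adj (x - y) = adj x - adj y"
  using adj_add[of x "- y"] by simp

lemma adj_power: "adj (x ^ n) = adj x ^ n"
  by (induction n) (auto simp: adj_mult power_commutes)

lemma adj_scaleR [simp]: "adj (r *\<^sub>R x) = r *\<^sub>R adj x"
  by (simp add: scaleR_cx adj_mult cx_commute)

lemma adj_of_real [simp]: "adj (of_real r) = of_real r"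
  by (simp add: of_real_def)

lemma bounded_linear_adj: "bounded_linear adj"
  by (rule bounded_linear_intro[of _ 1]) (auto simp: adj_add)

lemma adj_minv: "has_inverse x ==> adj (minv x) = minv (adj x)"
  by (rule minv_unique[symmetric]) (simp_all add: adj_mult[symmetric] minv_left minv_right)

lemma has_inverse_adj: "has_inverse x ==> has_inverse (adj x)"
  by (rule has_inverseI[of _ "adj (minv x)"]) (simp_all add: adj_mult[symmetric] minv_left minv_right)

lemma rad_adj [simp]: "rad (adj x) = rad x"
  unfolding rad_def by (simp add: adj_power[symmetric])

lemma rad_cx_mult: "rad (cx z * x) = cmod z * rad x"
proof -
  have le: "rad (cx z * x) \<le> cmod z * rad x" for z and x :: 'a
  proof (rule field_le_epsilon)
    fix e :: real assume e: "0 < e"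
    define r where "r = rad x + e / (cmod z + 1)"
    have r: "rad x < r"
    proof -
      have "0 < cmod z + 1" by (simp add: add_nonneg_pos)
      then show ?thesis using e by (simp add: r_def)
    qed
    obtain K where K: "0 < K" "\<And>n. norm (x ^ n) \<le> K * r ^ n" using rad_growth[OF r] by blast
    have r0: "0 < r" using r rad_nonneg[of x] by linarith
    have p: "(cx z * x) ^ n = cx (z ^ n) * x ^ n" for n
    proof (induction n)
      case (Suc n)
      have "x * (cx (z ^ n) * x ^ n) = cx (z ^ n) * (x * x ^ n)" by (rule cx_mult_swap)
      then show ?case by (simp add: Suc mult.assoc cx_mult_left)
    qed simp
    have z1: "0 < cmod z + 1" by (simp add: add_nonneg_pos)
    have "e * (cmod z / (cmod z + 1)) < e * 1"
      using e z1 by (intro mult_strict_left_mono) (simp_all add: divide_less_eq)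
    then have zr: "cmod z * r < cmod z * rad x + e"
      by (simp add: r_def distrib_left mult.commute)
    have "norm ((cx z * x) ^ n) \<le> K * (cmod z * rad x + e) ^ n" for n
    proof -
      have "norm ((cx z * x) ^ n) \<le> cmod z ^ n * (K * r ^ n)"
        unfolding p norm_cx_mult norm_power using K by (intro mult_left_mono) auto
      also have "\<dots> = K * (cmod z * r) ^ n" by (simp add: power_mult_distrib)
      also have "\<dots> \<le> K * (cmod z * rad x + e) ^ n"
        using zr r0 K by (intro mult_left_mono power_mono) auto
      finally show ?thesis .
    qed
    moreover have "0 < cmod z * rad x + e" using e by (simp add: add_nonneg_pos)
    ultimately show "rad (cx z * x) \<le> cmod z * rad x + e" by (rule rad_leI[rotated])
  qed
  show ?thesis
  proof (cases "z = 0")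
    case True
    have "rad (0::'a) = 0" using rad_le_norm[of "0::'a"] by (simp add: antisym)
    then show ?thesis using True by simp
  next
    case False
    have "rad x \<le> cmod (1 / z) * rad (cx z * x)"
      using le[of "1 / z" "cx z * x"] False by (simp add: cx_mult_left)
    then have "cmod z * rad x \<le> cmod z * (cmod (1 / z) * rad (cx z * x))" by (rule mult_left_mono) simp
    also have "\<dots> = rad (cx z * x)" using False by (simp add: norm_divide)
    finally show ?thesis using le[of z x] by simp
  qed
qed

lemma rad_less_has_inverse:
  fixes x :: "'a::cbstar"
  assumes "rad x < cmod z" shows "has_inverse (cx z - x)"
proof -
  have z: "z \<noteq> 0" using assms rad_nonneg[of x] by (metis norm_zero not_less)
  have "rad (cx (1 / z) * x) < 1" using assms z by (simp add: rad_cx_mult norm_divide)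
  then have "has_inverse (1 - cx (1 / z) * x)" by (rule rad_less_1_has_inverse)
  then have "has_inverse (cx z * (1 - cx (1 / z) * x))" using z by (simp add: has_inverse_cx_mult)
  moreover have "cx z * (1 - cx (1 / z) * x) = cx z - x" using z by (simp add: algebra_simps cx_mult_left)
  ultimately show ?thesis by simp
qed

section \<open>Resolvents and the spectral radius\<close>

lemma cis_power_sum_zero:
  assumes j: "0 < j" "j < n"
  shows "(\<Sum>k<n. (cis (2 * pi / n) ^ k) ^ j) = 0"
proof -
  let ?z = "cis (2 * pi / n) ^ j"
  have n: "n > 0" using j by simp
  have "?z \<noteq> 1"
  proof
    assume "?z = 1"
    then have "cis (real j * (2 * pi / real n)) = 1" by (simp only: Complex.DeMoivre)
    then have "cos (real j * (2 * pi / real n)) = 1" by (metis cis.simps(1) one_complex.simps(1))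
    then obtain m :: int where m: "real j * (2 * pi / real n) = of_int m * 2 * pi"
      by (auto simp: cos_one_2pi_int)
    then have "real j = of_int m * real n" using n by (simp add: field_simps)
    then have "int j = m * int n" by (metis of_int_eq_iff of_int_mult of_int_of_nat_eq)
    then have "int n dvd int j" by simp
    then show False using j by (auto dest: dvd_imp_le)
  qed
  moreover have "?z ^ n = 1"
  proof -
    have "?z ^ n = (cis (2 * pi / n) ^ n) ^ j" by (simp add: power_mult[symmetric] mult.commute)
    also have "cis (2 * pi / n) ^ n = 1" using n by (simp add: Complex.DeMoivre)
    finally show ?thesis by simp
  qed
  ultimately have "(\<Sum>k<n. ?z ^ k) = 0" by (simp add: geometric_sum)
  then show ?thesis by (simp add: power_mult[symmetric] mult.commute)
qed

text \<open>Averaging the resolvent over a rotation by the roots of unity isolates the powers of \<open>x ^ n\<close>: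
  this replaces Cauchy's integral formula in the proof that the spectrum controls the growth.\<close>

lemma resolvent_average:
  fixes x :: "'a::cbstar"
  assumes n: "0 < n" and inv: "\<And>k. k < n ==> has_inverse (1 - cx (cis (2 * pi / n) ^ k) * x)"
  defines "R \<equiv> (1 / real n) *\<^sub>R (\<Sum>k<n. minv (1 - cx (cis (2 * pi / n) ^ k) * x))"
  shows "R * (1 - x ^ n) = 1" "(1 - x ^ n) * R = 1"
proof -
  define z where "z = cis (2 * pi / n)"
  define u where "u k = cx (z ^ k) * x" for k
  have un: "u k ^ j = cx ((z ^ k) ^ j) * x ^ j" for k j
  proof (induction j)
    case (Suc j)
    have "u k ^ Suc j = u k * (cx ((z ^ k) ^ j) * x ^ j)" by (simp only: power_Suc Suc)
    also have "\<dots> = cx ((z ^ k) ^ j) * (u k * x ^ j)" by (rule cx_mult_swap)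
    also have "\<dots> = cx ((z ^ k) ^ j) * (cx (z ^ k) * (x * x ^ j))" by (simp only: u_def mult.assoc)
    also have "\<dots> = cx ((z ^ k) ^ Suc j) * x ^ Suc j" by (simp add: cx_mult_left mult.commute)
    finally show ?case .
  qed simp
  have zn: "z ^ n = 1" using n by (simp add: z_def Complex.DeMoivre)
  have unn: "u k ^ n = x ^ n" for k
    unfolding un by (simp add: power_mult[symmetric] mult.commute[of k]) (simp add: power_mult zn)
  have i: "has_inverse (1 - u k)" if "k < n" for k using inv[OF that] by (simp add: u_def z_def)
  have l: "minv (1 - u k) * (1 - x ^ n) = (\<Sum>j<n. cx ((z ^ k) ^ j) * x ^ j)" if "k < n" for k
  proof -
    have "minv (1 - u k) * (1 - x ^ n) = minv (1 - u k) * ((1 - u k) * (\<Sum>j<n. u k ^ j))"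
      by (simp only: one_minus_power_factor unn)
    then show ?thesis by (simp only: minv_mult_cancel[OF i[OF that]] un)
  qed
  have r: "(1 - x ^ n) * minv (1 - u k) = (\<Sum>j<n. cx ((z ^ k) ^ j) * x ^ j)" if "k < n" for k
  proof -
    have "(1 - x ^ n) * minv (1 - u k) = ((\<Sum>j<n. u k ^ j) * (1 - u k)) * minv (1 - u k)"
      by (simp only: one_minus_power_factor unn)
    then show ?thesis by (simp only: minv_mult_cancel[OF i[OF that]] un)
  qed
  have "(\<Sum>k<n. \<Sum>j<n. cx ((z ^ k) ^ j) * x ^ j) = (\<Sum>j<n. cx (\<Sum>k<n. (z ^ k) ^ j) * x ^ j)"
  proof -
    have cs: "cx (\<Sum>k<m. f k) = (\<Sum>k<m. cx (f k))" for f :: "nat => complex" and m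
      by (induction m) (auto simp: cx_add)
    show ?thesis by (subst sum.swap) (simp add: cs sum_distrib_right)
  qed
  also have "\<dots> = (\<Sum>j<n. if j = 0 then of_nat n else 0)"
  proof (rule sum.cong[OF refl])
    fix j assume "j \<in> {..<n}"
    then show "cx (\<Sum>k<n. (z ^ k) ^ j) * x ^ j = (if j = 0 then of_nat n else 0)"
      using cis_power_sum_zero[of j n] cx_complex_of_real[of "real n"] by (auto simp: z_def)
  qed
  also have "\<dots> = of_nat n" using n by simp
  finally have s: "(\<Sum>k<n. \<Sum>j<n. cx ((z ^ k) ^ j) * x ^ j) = of_nat n" .
  have R: "R = (1 / real n) *\<^sub>R (\<Sum>k<n. minv (1 - u k))" by (simp add: R_def u_def z_def)
  have o: "(1 / real n) *\<^sub>R (of_nat n :: 'a) = 1"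
  proof -
    have "(of_nat n :: 'a) = real n *\<^sub>R 1" by (metis of_real_def of_real_of_nat_eq)
    then show ?thesis using n by simp
  qed
  show "R * (1 - x ^ n) = 1" unfolding R using s o by (simp add: sum_distrib_right l)
  show "(1 - x ^ n) * R = 1" unfolding R using s o by (simp add: sum_distrib_left r)
qed

lemma norm_minv_average:
  fixes x y :: "'a::cbstar"
  assumes n: "0 < n" and e: "\<And>w. cmod w = 1 ==> has_inverse (1 - cx w * x) \<and> has_inverse (1 - cx w * y) \<and>
      norm (minv (1 - cx w * x) - minv (1 - cx w * y)) \<le> d"
  shows "has_inverse (1 - x ^ n)" "has_inverse (1 - y ^ n)"
    "norm (minv (1 - x ^ n) - minv (1 - y ^ n)) \<le> d"
proof -
  let ?w = "\<lambda>k. cis (2 * pi / n) ^ k"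
  have w: "cmod (?w k) = 1" for k by (simp add: norm_power)
  note X = resolvent_average[OF n, of x] and Y = resolvent_average[OF n, of y]
  have ex: "has_inverse (1 - cx (?w k) * x)" and ey: "has_inverse (1 - cx (?w k) * y)" for k
    using e[OF w] by blast+
  show "has_inverse (1 - x ^ n)" "has_inverse (1 - y ^ n)"
    using X(2)[OF ex] X(1)[OF ex] Y(2)[OF ey] Y(1)[OF ey] by (blast intro: has_inverseI)+
  have mx: "minv (1 - x ^ n) = (1 / real n) *\<^sub>R (\<Sum>k<n. minv (1 - cx (?w k) * x))"
    and my: "minv (1 - y ^ n) = (1 / real n) *\<^sub>R (\<Sum>k<n. minv (1 - cx (?w k) * y))"
    by (rule minv_unique[OF X(2)[OF ex] X(1)[OF ex]], rule minv_unique[OF Y(2)[OF ey] Y(1)[OF ey]])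
  have "norm (\<Sum>k<n. minv (1 - cx (?w k) * x) - minv (1 - cx (?w k) * y)) \<le> (\<Sum>k<n. d)"
    by (rule sum_norm_le) (use e w in auto)
  then show "norm (minv (1 - x ^ n) - minv (1 - y ^ n)) \<le> d"
    unfolding mx my scaleR_diff_right[symmetric] sum_subtractf[symmetric]
    using n by (simp add: divide_simps mult.commute)
qed

text \<open>Rickart's argument. On a disc where all resolvents exist they are uniformly continuous, so by
  \<open>norm_minv_average\<close> the inverse of \<open>1 - (s x) ^ n\<close> moves little with \<open>s\<close>, uniformly in \<open>n\<close>.
  Once \<open>(s x) ^ n\<close> tends to \<open>0\<close>, the powers stay bounded for slightly larger \<open>s\<close>; finitely many
  such steps reach the boundary of the disc.\<close>

lemma power_growth_of_resolvent:
  fixes x :: "'a::cbstar"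
  assumes t: "0 < t" and inv: "\<And>w. cmod w \<le> t ==> has_inverse (1 - cx w * x)"
  shows "rad x \<le> 1 / t"
proof -
  let ?R = "\<lambda>w. minv (1 - cx w * x)"
  have bl: "bounded_linear (\<lambda>w. cx w * x)"
    by (rule bounded_linear_intro[of _ "norm x"])
      (auto simp: cx_add distrib_right norm_cx_mult scaleR_cx cx_mult_left scaleR_conv_of_real)
  have "continuous_on (cball 0 t) ?R"
    by (intro continuous_on_minv continuous_intros linear_continuous_on bl) (use inv in auto)
  then have "uniformly_continuous_on (cball 0 t) ?R" by (intro compact_uniformly_continuous) auto
  then obtain d where d: "d > 0" "\<And>w v. w \<in> cball 0 t ==> v \<in> cball 0 t ==> dist v w < d ==> dist (?R v) (?R w) < 1 / 4"
    unfolding uniformly_continuous_on_def by (drule_tac x = "1 / 4" in spec) auto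
  have sx: "(s *\<^sub>R x) ^ n = s ^ n *\<^sub>R x ^ n" for s :: real and n by (rule scaleR_power)
  define D where "D = {s. 0 \<le> s \<and> s \<le> t \<and> (\<lambda>n. (s *\<^sub>R x) ^ n) \<longlonglongrightarrow> 0}"
  have step: "norm ((s' *\<^sub>R x) ^ n) \<le> 3"
    if s: "s \<in> D" "s \<le> s'" "s' < s + d" "s' \<le> t" and n: "n > 0" and ns: "norm ((s *\<^sub>R x) ^ n) < 1 / 5" for s s' n
  proof -
    have s0: "0 \<le> s" "s \<le> t" using s by (auto simp: D_def)
    have cw: "cx w * (r *\<^sub>R x) = cx (w * of_real r) * x" for w r
      by (simp add: scaleR_cx cx_mult_left)
    have n': "norm (minv (1 - (s' *\<^sub>R x) ^ n) - minv (1 - (s *\<^sub>R x) ^ n)) \<le> 1 / 4"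
      and i: "has_inverse (1 - (s' *\<^sub>R x) ^ n)"
    proof -
      { fix w :: complex assume w: "cmod w = 1"
        have "dist (w * of_real s') (w * of_real s) = cmod (w * of_real (s' - s))"
          by (simp add: dist_norm algebra_simps)
        also have "\<dots> = \<bar>s' - s\<bar>" using w by (simp only: norm_mult norm_of_real) simp
        also have "\<dots> < d" using s by simp
        finally have dd: "dist (w * of_real s') (w * of_real s) < d" .
        have m: "cmod (w * of_real s') \<le> t" "cmod (w * of_real s) \<le> t" using w s s0 by (auto simp: norm_mult)
        have "has_inverse (1 - cx w * (s' *\<^sub>R x)) \<and> has_inverse (1 - cx w * (s *\<^sub>R x)) \<and>
          norm (minv (1 - cx w * (s' *\<^sub>R x)) - minv (1 - cx w * (s *\<^sub>R x))) \<le> 1 / 4"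
          unfolding cw using inv m d(2)[OF _ _ dd] m by (auto simp: dist_norm less_imp_le) }
      note * = this
      show "norm (minv (1 - (s' *\<^sub>R x) ^ n) - minv (1 - (s *\<^sub>R x) ^ n)) \<le> 1 / 4"
        "has_inverse (1 - (s' *\<^sub>R x) ^ n)"
        using norm_minv_average[OF n *] by auto
    qed
    let ?u = "(s *\<^sub>R x) ^ n" and ?v = "(s' *\<^sub>R x) ^ n"
    have nu: "norm ?u < 1" using ns by simp
    have "minv (1 - ?u) - 1 = ?u * minv (1 - ?u)"
      using minv_right[OF neumann_norm(1)[OF nu]] by (simp add: algebra_simps)
    then have "norm (minv (1 - ?u) - 1) \<le> norm ?u * norm (minv (1 - ?u))"
      by (metis norm_mult_ineq)
    also have "\<dots> \<le> (1 / 5) * (1 / (1 - norm ?u))"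
      using neumann_norm(2)[OF nu] ns by (intro mult_mono) auto
    also have "\<dots> \<le> (1 / 5) * (1 / (1 - 1 / 5))"
      using ns by (intro mult_left_mono divide_left_mono) auto
    finally have a: "norm (minv (1 - ?u) - 1) \<le> 1 / 4" by simp
    define m where "m = minv (1 - ?v)"
    have m1: "norm (m - 1) \<le> 1 / 2"
      using norm_triangle_le[of "m - minv (1 - ?u)" "minv (1 - ?u) - 1" "1/2"] n' a by (simp add: m_def)
    have "norm (1 - m) < 1" using m1 by (simp add: norm_minus_commute)
    then have "norm (minv m) \<le> 1 / (1 - norm (1 - m))" using neumann_norm(2)[of "1 - m"] by simp
    also have "\<dots> \<le> 1 / (1 - 1 / 2)"
      using m1 by (intro divide_left_mono) (auto simp: norm_minus_commute)
    finally have b: "norm (minv m) \<le> 2" by simp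
    have "minv m = 1 - ?v" unfolding m_def using minv_left[OF i] minv_right[OF i] by (intro minv_unique)
    then have "?v = 1 - minv m" by simp
    then have "norm ?v \<le> norm (1::'a) + norm (minv m)" by (metis norm_triangle_ineq4)
    then show "norm ?v \<le> 3" using b by simp
  qed
  have bnd: "\<exists>K. \<forall>n. norm ((s' *\<^sub>R x) ^ n) \<le> K" if s: "s \<in> D" "s \<le> s'" "s' < s + d" "s' \<le> t" for s s'
  proof -
    have "\<forall>\<^sub>F n in sequentially. norm ((s *\<^sub>R x) ^ n) < 1 / 5"
      using s(1) tendsto_norm_zero[of "\<lambda>n. (s *\<^sub>R x) ^ n" sequentially] by (intro order_tendstoD[where y = 0]) (auto simp: D_def)
    then have "\<forall>\<^sub>F n in sequentially. norm ((s' *\<^sub>R x) ^ n) \<le> 3"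
      using eventually_gt_at_top[of 0] by eventually_elim (use step[OF s] in blast)
    then have "Bseq (\<lambda>n. (s' *\<^sub>R x) ^ n)" by (rule BfunI)
    then show ?thesis unfolding Bseq_def by blast
  qed
  have null: "s'' \<in> D" if s: "s \<in> D" "s \<le> s'" "s' < s + d" "s' \<le> t" "0 \<le> s''" "s'' < s'" for s s' s''
  proof -
    obtain K where K: "\<And>n. norm ((s' *\<^sub>R x) ^ n) \<le> K" using bnd[OF s(1-4)] by blast
    have lim: "(\<lambda>n. K * (s'' / s') ^ n) \<longlonglongrightarrow> K * 0" using s by (intro tendsto_intros LIMSEQ_realpow_zero) auto
    have le: "norm ((s'' *\<^sub>R x) ^ n) \<le> K * (s'' / s') ^ n" for n
    proof -
      have "(s'' *\<^sub>R x) ^ n = (s'' / s') ^ n *\<^sub>R (s' *\<^sub>R x) ^ n"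
        using s by (simp add: sx power_divide)
      moreover have nn: "0 \<le> (s'' / s') ^ n" using s by (intro zero_le_power divide_nonneg_nonneg) auto
      ultimately have "norm ((s'' *\<^sub>R x) ^ n) = (s'' / s') ^ n * norm ((s' *\<^sub>R x) ^ n)"
        by (simp only: norm_scaleR abs_of_nonneg[OF nn])
      also have "\<dots> \<le> (s'' / s') ^ n * K" using nn K by (intro mult_left_mono) auto
      finally show ?thesis by (simp only: mult.commute)
    qed
    have ev: "\<forall>\<^sub>F n in sequentially. norm ((s'' *\<^sub>R x) ^ n) \<le> K * (s'' / s') ^ n"
      by (rule always_eventually[OF allI[OF le]])
    have "(\<lambda>n. (s'' *\<^sub>R x) ^ n) \<longlonglongrightarrow> 0"
      by (rule Lim_null_comparison[OF ev]) (use lim in simp)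
    then show ?thesis using s by (simp add: D_def)
  qed
  have "0 \<in> D" using t by (auto simp: D_def power_0_left intro!: tendsto_eventually eventually_sequentiallyI[of 1])
  then have steps: "min (real k * (d / 3)) (t - d / 3) \<in> D \<or> t \<le> d / 3" for k
  proof (induction k)
    case 0
    show ?case
    proof (cases "t \<le> d / 3")
      case False
      then have "min (real 0 * (d / 3)) (t - d / 3) = 0" by (simp add: min_def)
      then show ?thesis using \<open>0 \<in> D\<close> by simp
    qed simp
  next
    case (Suc k)
    show ?case
    proof (cases "t \<le> d / 3")
      case False
      let ?s = "min (real k * (d / 3)) (t - d / 3)"
      let ?s2 = "min (real (Suc k) * (d / 3)) (t - d / 3)"
      have sD: "?s \<in> D" using Suc False by blast
      have r: "real (Suc k) * (d / 3) = real k * (d / 3) + d / 3" by (simp add: field_simps)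
      have le: "?s2 \<le> ?s + d / 3" "?s \<le> ?s2" "?s2 \<le> t - d / 3" unfolding r using d(1) by linarith+
      have "0 \<le> ?s" using sD unfolding D_def by blast
      then have "?s2 \<in> D" using d(1) le by (intro null[OF sD, of "?s2 + d / 6" "?s2"]) linarith+
      then show ?thesis by blast
    qed simp
  qed
  have "\<exists>s\<in>D. t - d / 3 \<le> s \<and> s \<le> t"
  proof (cases "t \<le> d / 3")
    case True
    show ?thesis by (rule bexI[OF _ \<open>0 \<in> D\<close>]) (use True t in linarith)
  next
    case False
    obtain k :: nat where k: "(t - d / 3) / (d / 3) < real k" using reals_Archimedean2 by blast
    then have "t - d / 3 < real k * (d / 3)" using d(1) by (simp add: divide_less_eq)
    then have "min (real k * (d / 3)) (t - d / 3) = t - d / 3" by linarith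
    then have "t - d / 3 \<in> D" using steps[of k] False by simp
    then show ?thesis by (rule bexI[rotated]) (use d(1) in linarith)
  qed
  then obtain s where s: "s \<in> D" "t - d / 3 \<le> s" "s \<le> t" by blast
  obtain K where K: "\<And>n. norm ((t *\<^sub>R x) ^ n) \<le> K"
  proof -
    have "t < s + d" using s d(1) by linarith
    then show ?thesis using bnd[OF s(1,3) _ order_refl] that by blast
  qed
  have "norm (x ^ n) \<le> K * (1 / t) ^ n" for n

  proof -
    have "t ^ n * norm (x ^ n) \<le> K" using K[of n] t by (simp add: sx)
    then have "norm (x ^ n) \<le> K / t ^ n" using t by (simp add: pos_le_divide_eq mult.commute)
    then show ?thesis by (simp add: power_one_over)
  qed
  then show "rad x \<le> 1 / t" using t by (intro rad_leI[of _ _ K]) auto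
qed

lemma rad_le_of_resolvent:
  fixes x :: "'a::cbstar"
  assumes r: "0 \<le> r" and inv: "\<And>z. r < cmod z ==> has_inverse (cx z - x)"
  shows "rad x \<le> r"
proof (rule rad_leI_less)
  fix s assume s: "r < s"
  then have s0: "0 < s" using r by simp
  have "rad x \<le> 1 / (1 / s)"
  proof (rule power_growth_of_resolvent)
    fix w :: complex assume w: "cmod w \<le> 1 / s"
    show "has_inverse (1 - cx w * x)"
    proof (cases "w = 0")
      case False
      have "s \<le> 1 / cmod w" using w s0 False by (simp add: field_simps)
      then have "r < cmod (1 / w)" using s by (simp add: norm_divide)
      then have "has_inverse (cx w * (cx (1 / w) - x))" using inv False by (simp add: has_inverse_cx_mult)
      moreover have "cx w * (cx (1 / w) - x) = 1 - cx w * x"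
        using False by (simp add: right_diff_distrib flip: cx_mult)
      ultimately show ?thesis by simp
    qed simp
  qed (use s0 in simp)
  then show "rad x \<le> s" by simp
qed

text \<open>The spectrum is compact, hence a strict inequality for its points is one for its radius.\<close>

lemma rad_less_of_resolvent:
  fixes x :: "'a::cbstar"
  assumes r: "0 < r" and inv: "\<And>z. r \<le> cmod z ==> has_inverse (cx z - x)"
  shows "rad x < r"
proof -
  define Sp where "Sp = {z. \<not> has_inverse (cx z - x)}"
  have "open {z. has_inverse (cx z - x)}"
    unfolding open_dist
  proof (intro ballI)
    fix z assume "z \<in> {z. has_inverse (cx z - x)}"
    then have z: "has_inverse (cx z - x)" by simp
    let ?M = "norm (minv (cx z - x)) + 1"
    have M: "?M > 0" by (simp add: add_nonneg_pos)
    have "has_inverse (cx w - x)" if "dist w z < 1 / ?M" for w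
    proof (rule has_inverse_perturb(1)[OF z])
      have e: "norm ((cx w - x) - (cx z - x)) = dist w z" by (simp add: dist_norm flip: cx_diff)
      have "norm (minv (cx z - x)) * dist w z \<le> ?M * dist w z" by (intro mult_right_mono) auto
      also have "\<dots> < 1" using that M by (simp add: field_simps)
      finally show "norm (minv (cx z - x)) * norm ((cx w - x) - (cx z - x)) < 1" unfolding e .
    qed
    then show "\<exists>e>0. \<forall>w. dist w z < e \<longrightarrow> w \<in> {z. has_inverse (cx z - x)}"
      using M by (intro exI[of _ "1 / ?M"]) auto
  qed
  then have cl: "closed Sp" unfolding Sp_def closed_def by (simp add: Collect_neg_eq[symmetric] Compl_eq)
  have "Sp \<subseteq> cball 0 r" using inv by (auto simp: Sp_def) (meson linorder_le_cases)
  then have co: "compact Sp" using cl by (meson bounded_cball bounded_subset compact_eq_bounded_closed)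
  obtain r' where r': "0 \<le> r'" "r' < r" "\<And>z. z \<in> Sp ==> cmod z \<le> r'"
  proof (cases "Sp = {}")
    case True then show ?thesis using that[of 0] r by auto
  next
    case False
    obtain z where z: "z \<in> Sp" "\<And>w. w \<in> Sp ==> cmod w \<le> cmod z"
      using continuous_attains_sup[OF co False, of cmod] continuous_on_norm_id by auto
    then show ?thesis using that[of "cmod z"] inv[of z] by (auto simp: Sp_def not_le[symmetric])
  qed
  have "rad x \<le> r'" by (rule rad_le_of_resolvent[OF r'(1)]) (use r'(3) Sp_def not_le in blast)
  then show ?thesis using r'(2) by simp
qed

section \<open>Binomial series\<close>

text \<open>The coefficients of \<open>(1 - y) powr a\<close>. For \<open>0 < a < 1\<close> all but the first are nonpositive and
  they are absolutely summable, so the series converges as soon as the powers of \<open>y\<close> are bounded.\<close>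

definition bcoeff :: "real => nat => real" where
  "bcoeff a n = (- 1) ^ n * (a gchoose n)"

lemma summable_bcoeff:
  assumes "0 < a" "a \<le> 1" shows "summable (\<lambda>n. \<bar>bcoeff a n\<bar>)"
proof -
  have p: "bcoeff a n = pochhammer (- a) n / fact n" for n a
    by (simp add: bcoeff_def gbinomial_pochhammer power_mult_distrib[symmetric] mult.assoc[symmetric] power_add[symmetric])
  have pochhammer_nonneg0: "0 \<le> pochhammer c n" if "0 \<le> c" for c :: real and n
    using that by (simp add: pochhammer_prod prod_nonneg)
  have neg: "bcoeff a (Suc n) \<le> 0" for n
  proof -
    have "0 \<le> pochhammer (1 - a) n" using assms by (intro pochhammer_nonneg0) auto
    then show ?thesis unfolding p pochhammer_rec using assms by (simp add: divide_le_0_iff mult_le_0_iff)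
  qed
  have tel: "(\<Sum>k\<le>m. bcoeff a k) \<ge> 0" for m
  proof -
    have "(\<Sum>k\<le>m. bcoeff a k) = bcoeff (a - 1) m"
      using gbinomial_sum_lower_neg[of a m] by (simp add: bcoeff_def mult.commute)
    also have "\<dots> \<ge> 0" unfolding p using assms by (intro divide_nonneg_pos pochhammer_nonneg0) auto
    finally show ?thesis .
  qed
  have "(\<Sum>k<m. \<bar>bcoeff a (Suc k)\<bar>) \<le> 1" for m
  proof -
    have "(\<Sum>k\<le>m. bcoeff a k) = 1 + (\<Sum>k<m. bcoeff a (Suc k))"
      by (simp add: sum.atMost_shift bcoeff_def)
    then show ?thesis using tel[of m] neg by (simp add: sum_negf abs_of_nonpos)
  qed
  then have "summable (\<lambda>k. \<bar>bcoeff a (Suc k)\<bar>)" by (intro summableI_nonneg_bounded) auto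
  then show ?thesis by (subst (asm) summable_Suc_iff)
qed

definition bser :: "real => 'a::{real_normed_algebra_1,banach} => 'a" where
  "bser a y = (\<Sum>n. bcoeff a n *\<^sub>R y ^ n)"

lemma bser_summable:
  fixes y :: "'a::{real_normed_algebra_1,banach}"
  assumes "0 < a" "a \<le> 1" "\<And>n. norm (y ^ n) \<le> K"
  shows "summable (\<lambda>n. norm (bcoeff a n *\<^sub>R y ^ n))"
proof (rule summable_comparison_test'[OF summable_mult2[OF summable_bcoeff[OF assms(1,2)], of K], of 0])
  fix n show "norm (norm (bcoeff a n *\<^sub>R y ^ n)) \<le> \<bar>bcoeff a n\<bar> * K"
    using assms(3)[of n] by (simp add: mult_left_mono)
qed

lemma bser_mult:
  fixes y :: "'a::{real_normed_algebra_1,banach}"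
  assumes a: "0 < a" "0 < b" "a + b \<le> 1" and y: "\<And>n. norm (y ^ n) \<le> K"
  shows "bser a y * bser b y = bser (a + b) y"
proof -
  have "bser a y * bser b y = (\<Sum>k. \<Sum>i\<le>k. (bcoeff a i *\<^sub>R y ^ i) * (bcoeff b (k - i) *\<^sub>R y ^ (k - i)))"
    unfolding bser_def using a y by (intro Cauchy_product bser_summable) auto
  also have "\<dots> = bser (a + b) y"
    unfolding bser_def
  proof (intro arg_cong[where f = suminf] ext)
    fix k
    have "(\<Sum>i\<le>k. (bcoeff a i *\<^sub>R y ^ i) * (bcoeff b (k - i) *\<^sub>R y ^ (k - i)))
        = (\<Sum>i\<le>k. (bcoeff a i * bcoeff b (k - i)) *\<^sub>R y ^ k)"
      by (intro sum.cong refl) (simp flip: power_add)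
    also have "\<dots> = (\<Sum>i\<le>k. bcoeff a i * bcoeff b (k - i)) *\<^sub>R y ^ k" by (simp add: scaleR_sum_left)
    also have "(\<Sum>i\<le>k. bcoeff a i * bcoeff b (k - i)) = (- 1) ^ k * (\<Sum>i\<le>k. (a gchoose i) * (b gchoose (k - i)))"
      unfolding sum_distrib_left bcoeff_def
    proof (rule sum.cong[OF refl])
      fix i assume "i \<in> {..k}"
      then have "(- 1::real) ^ k = (- 1) ^ i * (- 1) ^ (k - i)" by (simp flip: power_add)
      then show "(- 1) ^ i * (a gchoose i) * ((- 1) ^ (k - i) * (b gchoose (k - i))) = (- 1) ^ k * ((a gchoose i) * (b gchoose (k - i)))"
        by simp
    qed
    also have "\<dots> = bcoeff (a + b) k"
      using gbinomial_Vandermonde[of a b k] by (simp add: bcoeff_def atMost_atLeast0)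
    finally show "(\<Sum>i\<le>k. (bcoeff a i *\<^sub>R y ^ i) * (bcoeff b (k - i) *\<^sub>R y ^ (k - i))) = bcoeff (a + b) k *\<^sub>R y ^ k" .
  qed
  finally show ?thesis .
qed

lemma bser_1: "bser 1 y = 1 - (y::'a::{real_normed_algebra_1,banach})"
proof -
  have "bcoeff 1 n *\<^sub>R y ^ n = (if n = 0 then 1 else 0) + (if n = 1 then - y else 0)" for n
  proof -
    have "(1::real) gchoose n = of_nat (1 choose n)" by (metis binomial_gbinomial of_nat_1)
    then show ?thesis by (cases "n = 0 \<or> n = 1") (auto simp: bcoeff_def binomial_eq_0)
  qed
  then have "bser 1 y = (\<Sum>n. (if n = 0 then 1 else 0) + (if n = 1 then - y else 0))" by (simp add: bser_def)
  also have "\<dots> = (\<Sum>n\<in>{0,1::nat}. (if n = 0 then 1 else 0) + (if n = 1 then - y else 0))"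
    by (intro suminf_finite) auto
  finally show ?thesis by simp
qed

lemma bser_commute:
  fixes y z :: "'a::{real_normed_algebra_1,banach}"
  assumes "0 < a" "a \<le> 1" and y: "\<And>n. norm (y ^ n) \<le> K" and c: "y * z = z * y"
  shows "bser a y * z = z * bser a y"
proof -
  have s: "summable (\<lambda>n. bcoeff a n *\<^sub>R y ^ n)" using bser_summable[OF assms(1-3)] by (rule summable_norm_cancel)
  have p: "y ^ n * z = z * y ^ n" for n
  proof (induction n)
    case (Suc n)
    have "y ^ Suc n * z = y * (z * y ^ n)" by (simp add: mult.assoc Suc)
    also have "\<dots> = (y * z) * y ^ n" by (simp add: mult.assoc)
    also have "\<dots> = z * y ^ Suc n" unfolding c by (simp add: mult.assoc)
    finally show ?case .
  qed simp
  show ?thesis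
    unfolding bser_def suminf_mult2[OF s] suminf_mult[OF s] by (simp add: p flip: suminf_mult[OF s])
qed

lemma bser_adj:
  fixes y :: "'a::cbstar"
  assumes "0 < a" "a \<le> 1" and y: "\<And>n. norm (y ^ n) \<le> K" and c: "adj y = y"
  shows "adj (bser a y) = bser a y"
proof -
  have s: "summable (\<lambda>n. bcoeff a n *\<^sub>R y ^ n)" using bser_summable[OF assms(1-3)] by (rule summable_norm_cancel)
  show ?thesis unfolding bser_def bounded_linear.suminf[OF bounded_linear_adj s] by (simp add: adj_power c)
qed

section \<open>Hermitian Banach *-algebras\<close>

lemma cx_mult_mult: "(cx z * x) * (cx w * y) = cx (z * w) * (x * y)"
proof -
  have "(cx z * x) * (cx w * y) = cx z * (x * (cx w * y))" by (rule mult.assoc)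
  also have "x * (cx w * y) = cx w * (x * y)" by (rule cx_mult_swap)
  also have "cx z * (cx w * (x * y)) = cx (z * w) * (x * y)" by (rule cx_mult_left)
  finally show ?thesis .
qed

lemma adj_cx_mult: "adj (cx z * x) = cx (cnj z) * adj x"
  by (simp add: adj_mult cx_commute)

lemma adj_cx_mult_square: "adj (cx z * a) * (cx z * a) = cx (cnj z * z) * (adj a * a)"
  unfolding adj_cx_mult by (rule cx_mult_mult)

text \<open>For self-adjoint elements of a Hermitian algebra this says that the spectrum is in \<open>[0,\<infinity>)\<close>.\<close>

definition positive :: "'a::cbstar => bool" where
  "positive h \<longleftrightarrow> adj h = h \<and> (\<forall>t>0. has_inverse (of_real t + h))"

lemma positiveD: "positive h ==> 0 < t ==> has_inverse (of_real t + h)"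
  and positive_adj: "positive h ==> adj h = h"
  by (auto simp: positive_def)

lemma positive_of_real [simp]: "0 \<le> r ==> positive (of_real r :: 'a::cbstar)"
  unfolding positive_def
proof (intro conjI allI impI)
  fix t :: real assume "0 \<le> r" "0 < t"
  then have "has_inverse (cx (complex_of_real (t + r)) :: 'a)" by (intro has_inverse_cx) (simp only: of_real_eq_0_iff)
  then show "has_inverse (of_real t + of_real r :: 'a)" by (metis cx_complex_of_real of_real_add)
qed simp

lemma positive_0 [simp]: "positive 0"
  using positive_of_real[of 0] by simp

lemma positive_scaleR:
  fixes h :: "'a::cbstar"
  assumes "positive h" "0 \<le> c" shows "positive (c *\<^sub>R h)"
proof (cases "c = 0")
  case False
  then have c: "0 < c" using assms(2) by simp
  have "has_inverse (of_real t + c *\<^sub>R h)" if t: "0 < t" for t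
  proof -
    have "has_inverse (cx (of_real c) * (of_real (t / c) + h))"
      using positiveD[OF assms(1), of "t / c"] t c by (simp add: has_inverse_cx_mult)
    moreover have "cx (of_real c) * (of_real (t / c) + h) = of_real t + c *\<^sub>R h"
      using c by (simp add: distrib_left scaleR_cx cx_complex_of_real flip: of_real_mult)
    ultimately show ?thesis by simp
  qed
  then show ?thesis using positive_adj[OF assms(1)] by (simp add: positive_def)
qed simp

lemma positive_of_rad_le:
  fixes h :: "'a::cbstar"
  assumes "adj h = h" "rad h \<le> t" shows "positive (of_real t - h)"
  unfolding positive_def
proof (intro conjI allI impI)
  fix s :: real assume "0 < s"
  then have "rad h < cmod (of_real (s + t))" using assms(2) by (simp only: norm_of_real)
  from rad_less_has_inverse[OF this] show "has_inverse (of_real s + (of_real t - h))"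
    by (simp only: cx_complex_of_real) (simp add: algebra_simps)
qed (use assms in \<open>simp add: adj_diff\<close>)

lemma positive_eps:
  fixes h :: "'a::cbstar"
  assumes "adj h = h" "\<And>e. 0 < e ==> positive (of_real e + h)" shows "positive h"
  unfolding positive_def
proof (intro conjI allI impI assms(1))
  fix t :: real assume t: "0 < t"
  have "has_inverse (of_real (t / 2) + (of_real (t / 2) + h))" using assms(2)[of "t / 2"] t by (intro positiveD) auto
  moreover have "of_real (t / 2) + (of_real (t / 2) + h) = of_real t + h"
    by (simp only: add.assoc[symmetric] of_real_add[symmetric]) simp
  ultimately show "has_inverse (of_real t + h)" by simp
qed

lemma jacobson:
  fixes x y :: "'a::ring_1"
  assumes "has_inverse (1 - x * y)" shows "has_inverse (1 - y * x)"
proof (rule has_inverseI[of _ "1 + y * minv (1 - x * y) * x"])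
  let ?m = "minv (1 - x * y)"
  have r: "x * y * ?m = ?m - 1" using minv_right[OF assms] by (simp add: algebra_simps)
  have l: "?m * (x * y) = ?m - 1" using minv_left[OF assms] by (simp add: algebra_simps)
  have "(1 - y * x) * (1 + y * ?m * x) = 1 - y * x + y * (?m - x * y * ?m) * x" by (simp add: algebra_simps)
  then show "(1 - y * x) * (1 + y * ?m * x) = 1" unfolding r by simp
  have "(1 + y * ?m * x) * (1 - y * x) = 1 - y * x + y * (?m - ?m * (x * y)) * x" by (simp add: algebra_simps)
  then show "(1 + y * ?m * x) * (1 - y * x) = 1" unfolding l by simp
qed

lemma le_of_power_two_growth:
  fixes x y :: real
  assumes "0 \<le> x" "0 < y" "\<And>n. x ^ (2 ^ n) \<le> K * y ^ (2 ^ n)" shows "x \<le> y"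
proof (rule ccontr)
  assume "\<not> x \<le> y"
  then have q: "1 < x / y" using assms(2) by simp
  then obtain m where m: "K < (x / y) ^ m" using real_arch_pow by blast
  also have "\<dots> \<le> (x / y) ^ (2 ^ m)" using q by (intro power_increasing) (auto simp: less_imp_le)
  also have "\<dots> \<le> K" using assms(3)[of m] assms(2) by (simp add: power_divide divide_le_eq)
  finally show False by simp
qed

text \<open>Subalgebras are required to be closed under the inverses that exist in the whole type, so that invertibility does not depend on \<open>S\<close>.\<close>

locale unital_star_algebra =
  fixes S :: "'a::cbstar set"
  assumes closed_S: "closed S"
    and cx_mem [simp, intro]: "cx z \<in> S"
    and add_mem [simp, intro]: "x \<in> S ==> y \<in> S ==> x + y \<in> S"
    and mult_mem [simp, intro]: "x \<in> S ==> y \<in> S ==> x * y \<in> S"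
    and adj_mem [simp, intro]: "x \<in> S ==> adj x \<in> S"
    and minv_mem [intro]: "x \<in> S ==> has_inverse x ==> minv x \<in> S"
begin

lemma of_real_mem [simp, intro]: "of_real r \<in> S" by (metis cx_mem cx_complex_of_real)
lemma one_mem [simp, intro]: "1 \<in> S" using cx_mem[of 1] by simp
lemma zero_mem [simp, intro]: "0 \<in> S" using cx_mem[of 0] by simp
lemma minus_mem [simp, intro]: "x \<in> S ==> - x \<in> S" using mult_mem[OF cx_mem[of "- 1"], of x] by simp
lemma diff_mem [simp, intro]: "x \<in> S ==> y \<in> S ==> x - y \<in> S" using add_mem[of x "- y"] by simp
lemma scaleR_mem [simp, intro]: "x \<in> S ==> r *\<^sub>R x \<in> S" by (simp add: scaleR_cx)
lemma power_mem [simp, intro]: "x \<in> S ==> x ^ n \<in> S" by (induction n) auto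
lemma sum_mem [intro]: "(\<And>i. i \<in> I ==> f i \<in> S) ==> sum f I \<in> S" by (induction I rule: infinite_finite_induct) auto

lemma bser_mem:
  assumes "0 < a" "a \<le> 1" "\<And>n. norm (y ^ n) \<le> K" "y \<in> S" shows "bser a y \<in> S"
proof (rule closed_sequentially[OF closed_S])
  show "(\<lambda>m. \<Sum>n<m. bcoeff a n *\<^sub>R y ^ n) \<longlonglongrightarrow> bser a y"
    unfolding bser_def by (rule summable_LIMSEQ[OF summable_norm_cancel[OF bser_summable[OF assms(1-3)]]])
  show "(\<Sum>n<m. bcoeff a n *\<^sub>R y ^ n) \<in> S" for m using assms(4) by auto
qed

lemma self_adjoint_root:
  assumes y: "y \<in> S" "adj y = y" "rad y < 1"
  obtains k where "k \<in> S" "adj k = k" "k * k = 1 - y" "has_inverse k"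
proof -
  obtain K where K: "0 < K" "\<And>n. norm (y ^ n) \<le> K * 1 ^ n" using rad_growth[OF y(3)] by blast
  have b: "norm (y ^ n) \<le> K" for n using K(2)[of n] by simp
  define k where "k = bser (1/2) y"
  have kk: "k * k = 1 - y" using bser_mult[of "1/2" "1/2" y K] b by (simp add: k_def bser_1)
  show ?thesis
  proof
    show "k \<in> S" unfolding k_def by (rule bser_mem[of _ _ K]) (use b y in auto)
    show "adj k = k" unfolding k_def by (rule bser_adj[of _ _ K]) (use b y in auto)
    show "k * k = 1 - y" by (rule kk)
    show "has_inverse k" by (rule has_inverse_factor[of k k]) (use rad_less_1_has_inverse[OF y(3)] kk in auto)
  qed
qed

end

locale hermitian = unital_star_algebra +
  assumes real_spectrum: "h \<in> S ==> adj h = h ==> Im z \<noteq> 0 ==> has_inverse (cx z - h)"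
begin

lemma has_inverse_1_plus_skew:
  assumes "w \<in> S" "adj w = - w" shows "has_inverse (1 + w)"
proof -
  have a: "adj (cx \<i> * w) = cx \<i> * w" using assms(2) cx_commute[of \<i> w] by (simp add: adj_mult)
  have "has_inverse (cx (- \<i>) - cx \<i> * w)" by (rule real_spectrum) (use assms a in auto)
  then have "has_inverse (cx (- \<i>) * (1 + w))" by (simp add: distrib_left)
  then show ?thesis using has_inverse_cx_mult[of "- \<i>" "1 + w"] by simp
qed

lemma has_inverse_real_plus_skew:
  assumes y: "y \<in> S" "adj y = y" "rad y < 1" and v: "v \<in> S" "adj v = - v"
  shows "has_inverse (1 - y + v)"
proof -
  obtain k where k: "k \<in> S" "adj k = k" "k * k = 1 - y" "has_inverse k" using self_adjoint_root[OF y] .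
  define w where "w = minv k * v * minv k"
  have "has_inverse (1 + w)"
    using k v by (intro has_inverse_1_plus_skew) (auto simp: w_def adj_mult adj_minv mult.assoc)
  then have "has_inverse (k * (1 + w) * k)" using k by (intro has_inverse_mult)
  moreover have "k * (1 + w) * k = 1 - y + v"
    using k(3) by (simp add: w_def distrib_left distrib_right mult.assoc minv_mult_cancel[OF k(4)] minv_left[OF k(4)])
  ultimately show ?thesis by simp
qed

lemma has_inverse_1_minus:
  assumes b: "b \<in> S" "rad (adj b * b) < 1" shows "has_inverse (1 - b)"
proof -
  have v: "adj b - b \<in> S" "adj (adj b - b) = - (adj b - b)" using b by (auto simp: adj_diff)
  have 1: "has_inverse (1 - adj b * b + (adj b - b))"
    by (rule has_inverse_real_plus_skew[OF _ _ _ v]) (use b in \<open>auto simp: adj_mult\<close>)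
  have 2: "has_inverse (1 - b * adj b + (adj b - b))"
    by (rule has_inverse_real_plus_skew[OF _ _ _ v]) (use b in \<open>auto simp: adj_mult rad_commute[of b]\<close>)
  have e1: "(1 + adj b) * (1 - b) = 1 - adj b * b + (adj b - b)"
    and e2: "(1 - b) * (1 + adj b) = 1 - b * adj b + (adj b - b)" by (simp_all add: algebra_simps)
  show ?thesis
  proof (rule has_inverse_one_sided)
    show "(minv ((1 + adj b) * (1 - b)) * (1 + adj b)) * (1 - b) = 1"
      using 1 unfolding e1[symmetric] by (simp add: mult.assoc minv_left)
    show "(1 - b) * ((1 + adj b) * minv ((1 - b) * (1 + adj b))) = 1"
      using 2 unfolding e2[symmetric] by (simp add: mult.assoc[symmetric] minv_right)
  qed
qed

text \<open>Ptak's inequality. After scaling, \<open>(1 + a\<^sup>*) (1 - a)\<close> is \<open>1 - a\<^sup>* a\<close>, which has a self-adjoint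
  square root, plus a skew element, and similarly on the other side.\<close>

lemma ptak:
  assumes a: "a \<in> S" shows "(rad a)\<^sup>2 \<le> rad (adj a * a)"
proof -
  have "rad a \<le> sqrt (rad (adj a * a))"
  proof (rule rad_le_of_resolvent)
    fix z assume z: "sqrt (rad (adj a * a)) < cmod z"
    then have z0: "z \<noteq> 0" using real_sqrt_ge_zero[OF rad_nonneg[of "adj a * a"]] by (metis norm_zero not_less)
    have "(sqrt (rad (adj a * a)))\<^sup>2 < (cmod z)\<^sup>2" using z by (intro power_strict_mono) auto
    then have lt: "rad (adj a * a) < (cmod z)\<^sup>2" by simp
    define b where "b = cx (1 / z) * a"
    have "adj b * b = cx (cnj (1 / z) * (1 / z)) * (adj a * a)" unfolding b_def by (rule adj_cx_mult_square)
    then have "rad (adj b * b) = cmod (cnj (1 / z) * (1 / z)) * rad (adj a * a)" by (simp only: rad_cx_mult)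
    also have "cmod (cnj (1 / z) * (1 / z)) = 1 / (cmod z)\<^sup>2" by (simp add: norm_mult norm_divide power2_eq_square)
    finally have "rad (adj b * b) < 1" using lt z0 by (simp add: divide_less_eq)
    then have "has_inverse (cx z * (1 - b))" using has_inverse_1_minus[of b] a z0 by (simp add: b_def has_inverse_cx_mult)
    moreover have "cx z * (1 - b) = cx z - a" using z0 by (simp add: b_def right_diff_distrib cx_mult_left)
    ultimately show "has_inverse (cx z - a)" by simp
  qed simp
  then have "(rad a)\<^sup>2 \<le> (sqrt (rad (adj a * a)))\<^sup>2" by (intro power_mono) auto
  then show ?thesis by simp
qed

text \<open>Ptak's inequality gives \<open>(rad (x y))\<^sup>2 \<le> rad (x\<^sup>2 y\<^sup>2)\<close>. Iterating this along the powers of two and passing to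
  the growth rates of \<open>h ^ n\<close> and \<open>k ^ n\<close> removes the noncommutativity.\<close>

lemma rad_mult_le:
  assumes h: "h \<in> S" "adj h = h" and k: "k \<in> S" "adj k = k"
  shows "rad (h * k) \<le> rad h * rad k"
proof -
  have step: "(rad (x * y))\<^sup>2 \<le> rad ((x * x) * (y * y))" if "x \<in> S" "adj x = x" "y \<in> S" "adj y = y" for x y
  proof -
    have "(rad (x * y))\<^sup>2 \<le> rad (y * (x * x * y))" using ptak[of "x * y"] that by (simp add: adj_mult mult.assoc)
    also have "\<dots> = rad ((x * x) * (y * y))" by (subst rad_commute) (simp add: mult.assoc)
    finally show ?thesis .
  qed
  have it: "rad (h * k) ^ (2 ^ n) \<le> rad (h ^ (2 ^ n) * k ^ (2 ^ n))" for n
  proof (induction n)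
    case (Suc n)
    have "rad (h * k) ^ (2 ^ Suc n) = (rad (h * k) ^ (2 ^ n))\<^sup>2" by (simp add: power_mult[symmetric] mult.commute)
    also have "\<dots> \<le> (rad (h ^ (2 ^ n) * k ^ (2 ^ n)))\<^sup>2" using Suc by (intro power_mono) auto
    also have "\<dots> \<le> rad ((h ^ (2 ^ n) * h ^ (2 ^ n)) * (k ^ (2 ^ n) * k ^ (2 ^ n)))"
      using h k by (intro step) (auto simp: adj_power)
    also have "h ^ (2 ^ n) * h ^ (2 ^ n) = h ^ (2 ^ Suc n)" by (simp add: power_add[symmetric] mult_2)
    also have "k ^ (2 ^ n) * k ^ (2 ^ n) = k ^ (2 ^ Suc n)" by (simp add: power_add[symmetric] mult_2)
    finally show ?case .
  qed simp
  have "rad (h * k) \<le> c * d" if c: "rad h < c" and d: "rad k < d" for c d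
  proof -
    obtain K1 where K1: "0 < K1" "\<And>n. norm (h ^ n) \<le> K1 * c ^ n" using rad_growth[OF c] by blast
    obtain K2 where K2: "0 < K2" "\<And>n. norm (k ^ n) \<le> K2 * d ^ n" using rad_growth[OF d] by blast
    have cd: "0 < c" "0 < d" using c d rad_nonneg[of h] rad_nonneg[of k] by linarith+
    show ?thesis
    proof (rule le_of_power_two_growth[of _ _ "K1 * K2"])
      fix n
      have "rad (h * k) ^ (2 ^ n) \<le> norm (h ^ (2 ^ n)) * norm (k ^ (2 ^ n))"
        by (rule order_trans[OF it order_trans[OF rad_le_norm norm_mult_ineq]])
      also have "\<dots> \<le> (K1 * c ^ (2 ^ n)) * (K2 * d ^ (2 ^ n))" using K1 K2 cd by (intro mult_mono) auto
      finally show "rad (h * k) ^ (2 ^ n) \<le> K1 * K2 * (c * d) ^ (2 ^ n)" by (simp add: power_mult_distrib mult_ac)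
    qed (use cd in auto)
  qed
  then have *: "rad (h * k) \<le> (rad h + e) * (rad k + e)" if "0 < e" for e using that by simp
  have "((\<lambda>e. (rad h + e) * (rad k + e)) \<longlongrightarrow> (rad h + 0) * (rad k + 0)) (at_right 0)"
    by (intro tendsto_intros)
  moreover have "\<forall>\<^sub>F e in at_right 0. rad (h * k) \<le> (rad h + e) * (rad k + e)"
    using * by (auto simp: eventually_at_filter)
  ultimately show ?thesis by (intro tendsto_lowerbound[where F = "at_right (0::real)"]) auto
qed

lemma has_inverse_cx_add_positive:
  assumes h: "h \<in> S" "positive h" and w: "Im w \<noteq> 0 \<or> 0 < Re w" shows "has_inverse (cx w + h)"
proof (cases "Im w = 0")
  case True
  then have "w = of_real (Re w)" by (simp add: complex_eq_iff)
  then have "cx w = (of_real (Re w) :: 'a)" by (metis cx_complex_of_real)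
  moreover have "has_inverse (of_real (Re w) + h)" using w True by (intro positiveD[OF h(2)]) simp
  ultimately show ?thesis by simp
next
  case False
  then have "has_inverse (cx (- w) - h)" using h positive_adj by (intro real_spectrum) auto
  then have "has_inverse (- (cx w + h))" by simp
  then show ?thesis by (simp only: has_inverse_uminus)
qed

text \<open>The map \<open>s \<mapsto> s / (1 + s)\<close> sends \<open>[0,\<infinity>)\<close> into \<open>[0,1)\<close>.\<close>

lemma rad_resolvent_less_1:
  assumes h: "h \<in> S" "positive h" shows "rad (minv (1 + h) * h) < 1"
proof (rule rad_less_of_resolvent)
  have i: "has_inverse (1 + h)" using positiveD[OF h(2), of 1] by simp
  fix z assume z: "1 \<le> cmod z"
  have e: "cx z - minv (1 + h) * h = minv (1 + h) * (cx z + cx (z - 1) * h)"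
  proof -
    have "minv (1 + h) * ((1 + h) * cx z) = cx z" using i by (simp add: minv_mult_cancel)
    moreover have "(1 + h) * cx z - h = cx z + cx (z - 1) * h"
      using cx_commute[of z h] by (simp add: distrib_right left_diff_distrib cx_diff)
    ultimately show ?thesis by (metis right_diff_distrib)
  qed
  have "has_inverse (cx z + cx (z - 1) * h)"
  proof (cases "z = 1")
    case False
    define w where "w = z / (z - 1)"
    have "Im w \<noteq> 0 \<or> 0 < Re w"
    proof (rule ccontr)
      assume a: "\<not> ?thesis"
      define r where "r = - Re w"
      have r: "w = of_real (- r)" "0 \<le> r" using a by (auto simp: r_def complex_eq_iff)
      have "z * (w - 1) = w" using False by (simp add: w_def field_simps)
      then have "cmod z * cmod (w - 1) = cmod w" by (metis norm_mult)
      moreover have "cmod w = r" "cmod (w - 1) = r + 1"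
      proof -
        show "cmod w = r" using r by simp
        have "w - 1 = of_real (- (r + 1))" by (simp add: r(1))
        then show "cmod (w - 1) = r + 1" using r(2) by (simp only: norm_of_real)
      qed
      ultimately have "cmod z * (r + 1) = r" by simp
      moreover have "1 * (r + 1) \<le> cmod z * (r + 1)" using z r(2) by (intro mult_right_mono) auto
      ultimately show False by simp
    qed
    then have "has_inverse (cx (z - 1) * (cx w + h))"
      using has_inverse_cx_add_positive[OF h] False by (simp add: has_inverse_cx_mult)
    moreover have "cx (z - 1) * (cx w + h) = cx z + cx (z - 1) * h"
      using False by (simp add: distrib_left w_def flip: cx_mult)
    ultimately show ?thesis by simp
  qed simp
  then show "has_inverse (cx z - minv (1 + h) * h)"
    unfolding e using i by (intro has_inverse_mult has_inverse_minv)
qed simp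

text \<open>The factorization \<open>1 + h + k = (1 + h) (1 - (1 + h)\<^sup>-\<^sup>1 h k (1 + k)\<^sup>-\<^sup>1) (1 + k)\<close> and the
  submultiplicativity of the spectral radius on self-adjoint elements.\<close>

lemma positive_add:
  assumes h: "h \<in> S" "positive h" and k: "k \<in> S" "positive k" shows "positive (h + k)"
proof -
  have 1: "has_inverse (1 + (x + y))" if x: "x \<in> S" "positive x" and y: "y \<in> S" "positive y" for x y
  proof -
    have ix: "has_inverse (1 + x)" and iy: "has_inverse (1 + y)"
      using positiveD[OF x(2), of 1] positiveD[OF y(2), of 1] by auto
    define u where "u = minv (1 + x) * x"
    define v where "v = minv (1 + y) * y"
    have u': "u = x * minv (1 + x)" and v': "v = y * minv (1 + y)"
      unfolding u_def v_def using ix iy by (auto intro!: minv_commute simp: algebra_simps)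
    have "adj u = u" "adj v = v"
      using positive_adj[OF x(2)] positive_adj[OF y(2)] ix iy
      by (simp_all add: u_def v_def adj_mult adj_minv adj_add) (simp_all add: u_def[symmetric] v_def[symmetric] u' v')
    moreover have "u \<in> S" "v \<in> S" using x y ix iy by (auto simp: u_def v_def)
    ultimately have "rad (u * v) \<le> rad u * rad v" by (intro rad_mult_le)
    also have "\<dots> < 1 * 1"
      using rad_resolvent_less_1[OF x] rad_resolvent_less_1[OF y] unfolding u_def[symmetric] v_def[symmetric]
      by (intro mult_strict_mono') auto
    finally have "has_inverse (1 - u * v)" by (intro rad_less_1_has_inverse) simp
    then have "has_inverse ((1 + x) * (1 - u * v) * (1 + y))" using ix iy by (intro has_inverse_mult)
    moreover have "(1 + x) * (1 - u * v) * (1 + y) = 1 + (x + y)"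
    proof -
      have "(1 + x) * (u * v) * (1 + y) = ((1 + x) * u) * (v * (1 + y))" by (simp add: mult.assoc)
      also have "\<dots> = x * y" using ix iy by (simp add: u_def v' minv_mult_cancel mult.assoc minv_left)
      finally show ?thesis by (simp add: right_diff_distrib left_diff_distrib) (simp add: algebra_simps)
    qed
    ultimately show ?thesis by simp
  qed
  show ?thesis
    unfolding positive_def
  proof (intro conjI allI impI)
    show "adj (h + k) = h + k" using h k by (simp add: adj_add positive_adj)
    fix t :: real assume t: "0 < t"
    have "has_inverse (1 + ((1/t) *\<^sub>R h + (1/t) *\<^sub>R k))"
      using h k t by (intro 1 positive_scaleR scaleR_mem) auto
    then have "has_inverse (cx (of_real t) * (1 + ((1/t) *\<^sub>R h + (1/t) *\<^sub>R k)))"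
      using t by (simp add: has_inverse_cx_mult)
    moreover have "cx (of_real t) * (1 + ((1/t) *\<^sub>R h + (1/t) *\<^sub>R k)) = of_real t + (h + k)"
      using t by (simp add: distrib_left scaleR_cx[symmetric] cx_complex_of_real[symmetric] del: scaleR_scaleR)
        (simp add: scaleR_cx[symmetric])
    ultimately show "has_inverse (of_real t + (h + k))" by simp
  qed
qed

lemma positive_square:
  assumes h: "h \<in> S" "adj h = h" shows "positive (h * h)"
  unfolding positive_def
proof (intro conjI allI impI)
  show "adj (h * h) = h * h" using h by (simp add: adj_mult)
  fix t :: real assume t: "0 < t"
  define z where "z = \<i> * of_real (sqrt t)"
  have z: "Im z \<noteq> 0" "z * z = - of_real t" using t by (auto simp: z_def complex_eq_iff)
  have "has_inverse (cx z - h)" using h z by (intro real_spectrum) auto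
  moreover have "has_inverse (cx (- z) - h)" using h z by (intro real_spectrum) auto
  ultimately have "has_inverse ((cx z - h) * (cx (- z) - h))" by (intro has_inverse_mult)
  moreover have "(cx z - h) * (cx (- z) - h) = of_real t + h * h"
    using z(2) cx_commute[of z h] cx_complex_of_real[of t, where 'a = 'a]
    by (simp add: algebra_simps flip: cx_mult)
  ultimately show "has_inverse (of_real t + h * h)" by simp
qed

lemma rad_le_of_positive:
  assumes h: "h \<in> S" "adj h = h" and t: "0 \<le> t" "positive (of_real t + h)" "positive (of_real t - h)"
  shows "rad h \<le> t"
proof (rule rad_le_of_resolvent[OF t(1)])
  fix z assume z: "t < cmod z"
  show "has_inverse (cx z - h)"
  proof (cases "Im z = 0")
    case True
    then have zr: "z = of_real (Re z)" by (simp add: complex_eq_iff)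
    then have cz: "cx z = of_real (Re z)" by (metis cx_complex_of_real)
    have "cmod z = \<bar>Re z\<bar>" by (subst zr) simp
    then consider "t < Re z" | "Re z < - t" using z by linarith
    then show ?thesis
    proof cases
      case 1
      then have "has_inverse (of_real (Re z - t) + (of_real t - h))" using t by (intro positiveD) auto
      then show ?thesis by (simp add: cz)
    next
      case 2
      then have "has_inverse (of_real (- Re z - t) + (of_real t + h))" using t by (intro positiveD) auto
      moreover have "of_real (- Re z - t) + (of_real t + h) = - (cx z - h)" by (simp add: cz)
      ultimately show ?thesis by (simp only: has_inverse_uminus)
    qed
  qed (use real_spectrum h in auto)
qed

lemma rad_add_le:
  assumes h: "h \<in> S" "adj h = h" and k: "k \<in> S" "adj k = k" shows "rad (h + k) \<le> rad h + rad k"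
proof (rule rad_le_of_positive)
  have "positive ((of_real (rad h) - h) + (of_real (rad k) - k))"
    using h k by (intro positive_add positive_of_rad_le) auto
  then show "positive (of_real (rad h + rad k) - (h + k))" by (simp add: algebra_simps)
  have m: "rad (- x) = rad x" for x :: 'a using rad_cx_mult[of "- 1" x] by simp
  have "positive ((of_real (rad h) - - h) + (of_real (rad k) - - k))"
    using h k by (intro positive_add positive_of_rad_le) (auto simp: m)
  then show "positive (of_real (rad h + rad k) + (h + k))" by (simp add: algebra_simps)
qed (use h k in \<open>auto simp: adj_add\<close>)

lemma rad_mono:
  assumes u: "u \<in> S" "positive u" and v: "v \<in> S" "positive (v - u)" shows "rad u \<le> rad v"
proof (rule rad_le_of_positive)
  have au: "adj u = u" by (rule positive_adj[OF u(2)])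
  then have av: "adj v = v" using positive_adj[OF v(2)] by (simp add: adj_diff)
  show "positive (of_real (rad v) + u)" using u by (intro positive_add) auto
  have "positive ((of_real (rad v) - v) + (v - u))"
    using u v av by (intro positive_add positive_of_rad_le) auto
  then show "positive (of_real (rad v) - u)" by simp
qed (use u positive_adj in auto)

lemma positive_limit:
  assumes h: "h \<in> S" "adj h = h" and ap: "\<And>e. 0 < e ==> \<exists>f\<in>S. positive f \<and> norm (h - f) \<le> e"
  shows "positive h"
proof (rule positive_eps[OF h(2)])
  fix e :: real assume "0 < e"
  then obtain f where f: "f \<in> S" "positive f" "norm (h - f) \<le> e" using ap by blast
  have "rad (f - h) \<le> e" using rad_le_norm[of "f - h"] f(3) by (simp add: norm_minus_commute)
  then have "positive (f + (of_real e - (f - h)))"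
    using f h positive_adj by (intro positive_add positive_of_rad_le) (auto simp: adj_diff)
  then show "positive (of_real e + h)" by (simp add: algebra_simps)
qed

lemma sum_squares_cross:
  fixes x :: 'a
  defines "u \<equiv> x + adj x" and "v \<equiv> cx \<i> * (x - adj x)"
  shows "u * u + v * v = 2 *\<^sub>R (adj x * x + x * adj x)" "adj u = u" "adj v = v"
proof -
  show "adj u = u" by (simp add: u_def adj_add add.commute)
  show "adj v = v" using cx_commute[of \<i> "x - adj x"] by (simp add: v_def adj_mult adj_diff algebra_simps)
  have "v * v = cx (\<i> * \<i>) * ((x - adj x) * (x - adj x))" unfolding v_def by (rule cx_mult_mult)
  then have "v * v = - ((x - adj x) * (x - adj x))" by simp
  then show "u * u + v * v = 2 *\<^sub>R (adj x * x + x * adj x)"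
    by (simp add: u_def algebra_simps scaleR_2)
qed

text \<open>The element is half the sum of the squares of the self-adjoint elements \<open>x + x\<^sup>*\<close> and \<open>\<i> (x - x\<^sup>*)\<close>.\<close>

lemma positive_cross: "x \<in> S ==> positive (adj x * x + x * adj x)"
proof -
  assume x: "x \<in> S"
  note c = sum_squares_cross[of x]
  have "positive ((1/2) *\<^sub>R (2 *\<^sub>R (adj x * x + x * adj x)))"
    unfolding c(1)[symmetric] using c(2,3) x by (intro positive_scaleR positive_add positive_square) auto
  then show ?thesis by simp
qed

text \<open>Ptak's functional, the largest \<open>C\<^sup>*\<close>-seminorm of the algebra.\<close>

definition ptak_norm :: "'a => real" where "ptak_norm a = sqrt (rad (adj a * a))"

lemma ptak_norm_nonneg [simp]: "0 \<le> ptak_norm a" by (simp add: ptak_norm_def)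

lemma ptak_norm_square: "(ptak_norm a)\<^sup>2 = rad (adj a * a)" by (simp add: ptak_norm_def)

lemma rad_le_ptak_norm: "a \<in> S ==> rad a \<le> ptak_norm a"
  using ptak[of a] by (simp add: ptak_norm_def real_le_rsqrt)

lemma ptak_norm_cstar: "a \<in> S ==> ptak_norm (adj a * a) = (ptak_norm a)\<^sup>2"
  unfolding ptak_norm_def adj_mult adj_adj rad_square by simp

lemma ptak_norm_cx_mult: "ptak_norm (cx z * a) = cmod z * ptak_norm a"
proof -
  have "rad (adj (cx z * a) * (cx z * a)) = (cmod z)\<^sup>2 * rad (adj a * a)"
    unfolding adj_cx_mult_square by (simp add: rad_cx_mult norm_mult power2_eq_square)
  then show ?thesis by (simp add: ptak_norm_def real_sqrt_mult)
qed

lemma ptak_norm_mult: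
  assumes "a \<in> S" "b \<in> S" shows "ptak_norm (a * b) \<le> ptak_norm a * ptak_norm b"
proof -
  have "rad (adj (a * b) * (a * b)) = rad (adj b * ((adj a * a) * b))" by (simp add: adj_mult mult.assoc)
  also have "\<dots> = rad ((adj a * a) * (b * adj b))" by (subst rad_commute) (simp add: mult.assoc)
  also have "\<dots> \<le> rad (adj a * a) * rad (b * adj b)" using assms by (intro rad_mult_le) (auto simp: adj_mult)
  also have "rad (b * adj b) = rad (adj b * b)" by (rule rad_commute)
  finally show ?thesis by (simp add: ptak_norm_def flip: real_sqrt_mult)
qed

lemma rad_cross_le:
  assumes x: "x \<in> S" shows "rad (x + adj x) \<le> 2 * ptak_norm x"
proof -
  note c = sum_squares_cross[of x]
  let ?u = "x + adj x" and ?v = "cx \<i> * (x - adj x)"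
  have "(rad ?u)\<^sup>2 = rad (?u * ?u)" by (simp add: rad_square)
  also have "\<dots> \<le> rad (2 *\<^sub>R (adj x * x + x * adj x))"
  proof (rule rad_mono)
    have "2 *\<^sub>R (adj x * x + x * adj x) - ?u * ?u = ?v * ?v" using c(1) by (simp add: algebra_simps)
    then show "positive (2 *\<^sub>R (adj x * x + x * adj x) - ?u * ?u)" using c(3) x by (simp add: positive_square)
  qed (use c x in \<open>auto intro!: positive_square\<close>)
  also have "\<dots> = 2 * rad (adj x * x + x * adj x)" by (simp add: scaleR_cx rad_cx_mult)
  also have "\<dots> \<le> 2 * (rad (adj x * x) + rad (x * adj x))"
    using x by (intro mult_left_mono rad_add_le) (auto simp: adj_mult)
  also have "\<dots> = (2 * ptak_norm x)\<^sup>2" by (simp add: rad_commute[of x] power_mult_distrib ptak_norm_square)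
  finally show ?thesis by (rule power2_le_imp_le) simp
qed

lemma ptak_norm_add:
  assumes a: "a \<in> S" and b: "b \<in> S" shows "ptak_norm (a + b) \<le> ptak_norm a + ptak_norm b"
proof -
  let ?x = "adj a * b"
  have "(ptak_norm (a + b))\<^sup>2 = rad ((adj a * a + adj b * b) + (?x + adj ?x))"
    by (simp add: ptak_norm_square adj_add adj_mult algebra_simps)
  also have "\<dots> \<le> rad (adj a * a + adj b * b) + rad (?x + adj ?x)"
    using a b by (intro rad_add_le) (auto simp: adj_add adj_mult add.commute)
  also have "rad (adj a * a + adj b * b) \<le> rad (adj a * a) + rad (adj b * b)"
    using a b by (intro rad_add_le) (auto simp: adj_mult)
  also have "rad (?x + adj ?x) \<le> 2 * ptak_norm ?x" using a b by (intro rad_cross_le) auto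
  also have "ptak_norm ?x \<le> ptak_norm (adj a) * ptak_norm b" using a b by (intro ptak_norm_mult) auto
  also have "ptak_norm (adj a) = ptak_norm a" by (simp add: ptak_norm_def rad_commute)
  finally have "(ptak_norm (a + b))\<^sup>2 \<le> (ptak_norm a + ptak_norm b)\<^sup>2"
    by (simp add: power2_sum ptak_norm_square)
  then show ?thesis by (rule power2_le_imp_le) simp
qed

text \<open>The Shirali--Ford theorem, following Harris. The map \<open>a \<mapsto> 2 a (1 + a\<^sup>* a)\<^sup>-\<^sup>1\<close> keeps the spectral
  radius of \<open>a\<^sup>* a\<close> below \<open>1\<close> but multiplies negative spectral values by at least \<open>4\<close>.\<close>

lemma shirali_ford_step:
  assumes IH: "\<And>a. a \<in> S ==> rad (adj a * a) < 1 ==> positive (of_real d + adj a * a)" and d: "0 \<le> d"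
    and a: "a \<in> S" "rad (adj a * a) < 1"
  shows "positive (of_real (d / 4) + adj a * a)"
proof -
  define y where "y = adj a * a"
  have yS: "y \<in> S" and ay: "adj y = y" using a by (auto simp: y_def adj_mult)
  have "rad (- y) < 1" using a(2) rad_cx_mult[of "- 1" y] by (simp add: y_def)
  then have i: "has_inverse (1 + y)" using rad_less_1_has_inverse[of "- y"] by simp
  define m where "m = minv (1 + y)"
  have mS: "m \<in> S" and am: "adj m = m" using i yS ay by (auto simp: m_def adj_minv adj_add)
  have my: "m * y = y * m" unfolding m_def by (rule minv_commute[OF i]) (simp add: algebra_simps)
  have m1: "m * (1 + y) = 1" "(1 + y) * m = 1" by (simp_all add: m_def minv_left[OF i] minv_right[OF i])
  define b where "b = 2 *\<^sub>R (a * m)"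
  have bS: "b \<in> S" using a mS by (auto simp: b_def)
  have bb: "adj b * b = 4 *\<^sub>R (m * y * m)" by (simp add: b_def y_def adj_mult am mult.assoc)
  let ?c = "(1 - y) * m"
  have sq: "1 - adj b * b = ?c * ?c"
  proof -
    have "m * ((1 + y) * (1 + y) - 4 *\<^sub>R y) * m = (m * (1 + y)) * ((1 + y) * m) - 4 *\<^sub>R (m * y * m)"
      by (simp add: right_diff_distrib left_diff_distrib mult.assoc)
    then have "1 - adj b * b = m * ((1 + y) * (1 + y) - 4 *\<^sub>R y) * m" by (simp add: bb m1)
    also have "(1 + y) * (1 + y) - 4 *\<^sub>R y = (1 - y) * (1 - y)"
    proof -
      have "4 *\<^sub>R y = y + y + y + y" using scaleR_add_left[of 2 2 y] by (simp add: scaleR_2)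
      then show ?thesis by (simp add: algebra_simps)
    qed
    also have "m * ((1 - y) * (1 - y)) * m = (m * (1 - y)) * ((1 - y) * m)" by (simp add: mult.assoc)
    also have "m * (1 - y) = (1 - y) * m" by (simp add: right_diff_distrib left_diff_distrib my)
    finally show ?thesis .
  qed
  have pc: "positive (1 - adj b * b)"
    unfolding sq
  proof (rule positive_square)
    show "adj ?c = ?c" by (simp add: adj_mult adj_diff ay am) (simp add: right_diff_distrib left_diff_distrib my)
  qed (use yS mS in auto)
  have pc': "positive (1 - b * adj b)"
    unfolding positive_def
  proof (intro conjI allI impI)
    fix t :: real assume t: "0 < t"
    let ?z = "complex_of_real (1 + t)"
    have z: "?z \<noteq> 0" using t by (simp add: complex_eq_iff)
    have r: "of_real t + (1 - x) = cx ?z * (1 - cx (1 / ?z) * x)" for x :: 'a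
      using z by (simp add: right_diff_distrib cx_mult_left) (simp add: cx_add cx_complex_of_real)
    have "has_inverse (1 - cx (1 / ?z) * (adj b * b))"
      using positiveD[OF pc t] unfolding r has_inverse_cx_mult[OF z] .
    then have "has_inverse (1 - (cx (1 / ?z) * adj b) * b)" by (simp add: mult.assoc)
    then have "has_inverse (1 - b * (cx (1 / ?z) * adj b))" by (rule jacobson)
    then show "has_inverse (of_real t + (1 - b * adj b))"
      unfolding r has_inverse_cx_mult[OF z] by (simp only: cx_mult_swap)
  qed (simp add: adj_diff adj_mult)
  have "positive ((adj b * b + b * adj b) + (1 - b * adj b))"
    using bS by (intro positive_add positive_cross pc') auto
  then have "positive (of_real 1 + adj b * b)" by (simp add: algebra_simps)
  then have rb: "rad (adj b * b) \<le> 1"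
    using pc bS by (intro rad_le_of_positive) (auto simp: adj_mult)
  have pb: "positive (of_real d + adj b * b)"
  proof (rule positive_limit)
    fix e :: real assume e: "0 < e"
    define t where "t = max (1/2) (1 - e / (norm (adj b * b) + 1))"
    have n1: "0 < norm (adj b * b) + 1" by (simp add: add_nonneg_pos)
    have t: "0 < t" "t < 1" "1 - t \<le> e / (norm (adj b * b) + 1)" using e n1 by (auto simp: t_def)
    define b' where "b' = sqrt t *\<^sub>R b"
    have b': "adj b' * b' = t *\<^sub>R (adj b * b)" using t by (simp add: b'_def)
    have "rad (adj b' * b') = t * rad (adj b * b)" unfolding b' using t by (simp add: scaleR_cx rad_cx_mult)
    also have "\<dots> \<le> t * 1" using rb t by (intro mult_left_mono) auto
    also have "\<dots> < 1" using t by simp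
    finally have "positive (of_real d + adj b' * b')" using bS by (intro IH) (auto simp: b'_def)
    moreover have "norm ((of_real d + adj b * b) - (of_real d + adj b' * b')) \<le> e"
    proof -
      have "(of_real d + adj b * b) - (of_real d + adj b' * b') = (1 - t) *\<^sub>R (adj b * b)"
        unfolding b' by (simp add: scaleR_left_diff_distrib)
      then have "norm ((of_real d + adj b * b) - (of_real d + adj b' * b')) = (1 - t) * norm (adj b * b)"
        using t by simp
      also have "\<dots> \<le> e / (norm (adj b * b) + 1) * (norm (adj b * b) + 1)"
        using t e n1 by (intro mult_mono) (auto intro: less_imp_le)
      finally show ?thesis using n1 by simp
    qed
    moreover have "of_real d + adj b' * b' \<in> S" using bS by (auto simp: b'_def)
    ultimately show "\<exists>f\<in>S. positive f \<and> norm (of_real d + adj b * b - f) \<le> e" by blast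
  qed (use bS in \<open>auto simp: adj_mult adj_add\<close>)
  have "has_inverse (of_real s + y)" if s: "d / 4 < s" for s
  proof (cases "s < 1")
    case True
    have s0: "0 < s" using s d by linarith
    \<comment> \<open>the value \<open>- s\<close> of \<open>a\<^sup>* a\<close> corresponds to the value \<open>- \<mu>\<close> of \<open>b\<^sup>* b\<close>\<close>
    define q where "q = (1 - s)\<^sup>2"
    define \<mu> where "\<mu> = 4 * s / q"
    have q: "0 < q" "q < 1" using True s0 by (simp_all add: q_def abs_square_less_1)
    have "4 * s * q < 4 * s * 1" using q s0 by (intro mult_strict_left_mono) auto
    then have "4 * s < \<mu>" using q by (simp add: \<mu>_def pos_less_divide_eq)
    then have "d < \<mu>" using s by linarith
    then have "has_inverse (of_real (\<mu> - d) + (of_real d + adj b * b))" by (intro positiveD pb) auto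
    then have "has_inverse (of_real \<mu> + adj b * b)" by (simp add: add.assoc[symmetric] flip: of_real_add)
    then have h: "has_inverse ((1 + y) * (of_real \<mu> + adj b * b) * (1 + y))" using i by (intro has_inverse_mult)
    have ms: "\<mu> * (s + 1 / s) = 2 * \<mu> + 4"
    proof -
      have sq: "s * s + 1 = 2 * s + q" by (simp add: q_def power2_eq_square algebra_simps)
      have "\<mu> * (s + 1 / s) = 4 * (s * s + 1) / q" using s0 q by (simp add: \<mu>_def field_simps)
      also have "\<dots> = 2 * (4 * s / q) + 4" unfolding sq using q by (simp add: field_simps)
      finally show ?thesis by (simp add: \<mu>_def)
    qed
    have split: "p * (M + N) * p = p * M * p + p * N * p" for p M N :: 'a
      by (simp add: distrib_left distrib_right)
    have "(1 + y) * (4 *\<^sub>R (m * y * m)) * (1 + y) = 4 *\<^sub>R (((1 + y) * m) * y * (m * (1 + y)))"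
      by (simp only: mult_scaleR_left mult_scaleR_right mult.assoc)
    also have "\<dots> = 4 *\<^sub>R y" by (simp only: m1) simp
    finally have "(1 + y) * (of_real \<mu> + adj b * b) * (1 + y) = \<mu> *\<^sub>R ((1 + y) * (1 + y)) + 4 *\<^sub>R y"
      unfolding bb split by (simp add: of_real_def)
    also have "(1 + y) * (1 + y) = 1 + 2 *\<^sub>R y + y * y" by (simp add: algebra_simps scaleR_2)
    also have "\<mu> *\<^sub>R (1 + 2 *\<^sub>R y + y * y) + 4 *\<^sub>R y = \<mu> *\<^sub>R (1 + y * y) + (2 * \<mu> + 4) *\<^sub>R y"
      by (simp add: scaleR_add_right scaleR_add_left mult.commute)
    also have "\<dots> = (of_real s + y) * (\<mu> *\<^sub>R (of_real (1 / s) + y))"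
      unfolding ms[symmetric] using s0
      by (simp add: of_real_def algebra_simps scaleR_add_left)
    finally have h2: "has_inverse ((of_real s + y) * (\<mu> *\<^sub>R (of_real (1 / s) + y)))" using h by simp
    show ?thesis
      by (rule has_inverse_factor[OF h2]) (simp add: of_real_def algebra_simps)
  next
    case False
    then have "rad (- y) < cmod (of_real s)" using \<open>rad (- y) < 1\<close> by simp
    from rad_less_has_inverse[OF this] show ?thesis by (simp add: cx_complex_of_real)
  qed
  then have "has_inverse (of_real t + (of_real (d / 4) + y))" if "0 < t" for t
    using that by (simp add: add.assoc[symmetric] flip: of_real_add)
  then show ?thesis using ay by (simp add: positive_def y_def adj_add adj_mult)
qed

theorem shirali_ford:
  assumes a: "a \<in> S" shows "positive (adj a * a)"
proof -
  have p: "positive (of_real (1 / 4 ^ n) + adj x * x)" if "x \<in> S" "rad (adj x * x) < 1" for n x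
    using that
  proof (induction n arbitrary: x)
    case 0
    have "rad (- (adj x * x)) \<le> 1" using 0 rad_cx_mult[of "- 1" "adj x * x"] by simp
    then have "positive (of_real 1 - - (adj x * x))" by (intro positive_of_rad_le) (auto simp: adj_mult)
    then show ?case by simp
  next
    case (Suc n)
    have "positive (of_real ((1 / 4 ^ n) / 4) + adj x * x)" by (rule shirali_ford_step[OF Suc.IH]) (use Suc.prems in auto)
    then show ?case by (simp add: mult.commute)
  qed
  have 1: "positive (adj x * x)" if x: "x \<in> S" "rad (adj x * x) < 1" for x
  proof (rule positive_limit)
    fix e :: real assume "0 < e"
    then obtain n where n: "(1/4::real) ^ n < e" using real_arch_pow_inv[of e "1/4"] by auto
    have "norm (adj x * x - (of_real (1 / 4 ^ n) + adj x * x)) = norm (of_real (- ((1/4) ^ n)) :: 'a)"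
      by (simp add: power_one_over)
    also have "\<dots> \<le> e" using n by (simp only: norm_of_real) simp
    finally show "\<exists>f\<in>S. positive f \<and> norm (adj x * x - f) \<le> e" using p[OF x, of n] x by blast
  qed (use x in \<open>auto simp: adj_mult\<close>)
  define c where "c = rad (adj a * a) + 1"
  have c: "0 < c" by (simp add: c_def add_nonneg_pos)
  define x where "x = (1 / sqrt c) *\<^sub>R a"
  have x: "adj x * x = (1 / c) *\<^sub>R (adj a * a)" using c by (simp add: x_def)
  have "rad (adj x * x) = rad (adj a * a) / c" unfolding x using c by (simp add: scaleR_cx rad_cx_mult norm_divide)
  also have "\<dots> < 1" using c by (simp add: c_def)
  finally have "positive (c *\<^sub>R (adj x * x))" using a c by (intro positive_scaleR 1) (auto simp: x_def)
  then show ?thesis unfolding x using c by simp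
qed

end

section \<open>Arithmetic in *-algebras given by carriers\<close>

lemma complex_ring_simps [simp]:
  "carrier complex_ring = UNIV" "x \<otimes>\<^bsub>complex_ring\<^esub> y = x * y" "x \<oplus>\<^bsub>complex_ring\<^esub> y = x + y"
  "\<one>\<^bsub>complex_ring\<^esub> = 1" "\<zero>\<^bsub>complex_ring\<^esub> = 0"
  by (simp_all add: complex_ring_def)

lemma cring_complex_ring: "cring complex_ring"
proof (rule cringI)
  show "abelian_group complex_ring"
  proof (rule abelian_groupI)
    fix x assume "x \<in> carrier complex_ring"
    show "\<exists>y\<in>carrier complex_ring. y \<oplus>\<^bsub>complex_ring\<^esub> x = \<zero>\<^bsub>complex_ring\<^esub>" by (intro bexI[of _ "- x"]) auto
  qed auto
  show "comm_monoid complex_ring" by (rule comm_monoidI) auto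
qed (auto simp: algebra_simps)

lemma complex_ring_uminus [simp]: "\<ominus>\<^bsub>complex_ring\<^esub> z = - z"
proof -
  interpret cring complex_ring by (rule cring_complex_ring)
  show ?thesis by (rule minus_equality) auto
qed

lemma minus_zero_iff:
  assumes "abelian_group R" "a \<in> carrier R" "b \<in> carrier R" shows "a \<ominus>\<^bsub>R\<^esub> b = \<zero>\<^bsub>R\<^esub> \<longleftrightarrow> a = b"
proof -
  interpret abelian_group R by fact
  have "(a \<ominus>\<^bsub>R\<^esub> b) \<oplus>\<^bsub>R\<^esub> b = a" using assms(2,3) by (simp add: a_minus_def a_assoc l_neg)
  then show ?thesis using assms(2,3) by (auto simp: a_minus_def r_neg)
qed

context star_algebra
begin

declare mult_closed [simp, intro] star_closed [simp, intro] star_star [simp]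

lemma sm_closed [simp, intro]: "a \<in> carrier A ==> z \<odot>\<^bsub>A\<^esub> a \<in> carrier A" by simp
lemma sm_add: "a \<in> carrier A ==> (z + w) \<odot>\<^bsub>A\<^esub> a = z \<odot>\<^bsub>A\<^esub> a \<oplus>\<^bsub>A\<^esub> w \<odot>\<^bsub>A\<^esub> a"
  using smult_l_distr[of z w a] by simp
lemma sm_distr: "a \<in> carrier A ==> b \<in> carrier A ==> z \<odot>\<^bsub>A\<^esub> (a \<oplus>\<^bsub>A\<^esub> b) = z \<odot>\<^bsub>A\<^esub> a \<oplus>\<^bsub>A\<^esub> z \<odot>\<^bsub>A\<^esub> b"
  using smult_r_distr[of z a b] by simp
lemma sm_sm: "a \<in> carrier A ==> z \<odot>\<^bsub>A\<^esub> (w \<odot>\<^bsub>A\<^esub> a) = (z * w) \<odot>\<^bsub>A\<^esub> a"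
  using smult_assoc1[of z w a] by simp
lemma sm_one [simp]: "a \<in> carrier A ==> 1 \<odot>\<^bsub>A\<^esub> a = a" using smult_one[of a] by simp
lemma sm_0 [simp]: "a \<in> carrier A ==> 0 \<odot>\<^bsub>A\<^esub> a = \<zero>\<^bsub>A\<^esub>" using smult_l_null[of a] by simp
lemma sm_zero [simp]: "z \<odot>\<^bsub>A\<^esub> \<zero>\<^bsub>A\<^esub> = \<zero>\<^bsub>A\<^esub>" using smult_r_null[of z] by simp
lemma uminus_sm: "a \<in> carrier A ==> \<ominus>\<^bsub>A\<^esub> a = (- 1) \<odot>\<^bsub>A\<^esub> a"
  using smult_l_minus[of 1 a] by simp
lemma minus_sm: "a \<in> carrier A ==> b \<in> carrier A ==> a \<ominus>\<^bsub>A\<^esub> b = a \<oplus>\<^bsub>A\<^esub> (- 1) \<odot>\<^bsub>A\<^esub> b"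
  by (simp add: a_minus_def uminus_sm)

lemma mult_zero [simp]: "a \<in> carrier A ==> a \<otimes>\<^bsub>A\<^esub> \<zero>\<^bsub>A\<^esub> = \<zero>\<^bsub>A\<^esub>"
  using smult_mult_right[of a "\<zero>\<^bsub>A\<^esub>" 0] by simp
lemma zero_mult [simp]: "a \<in> carrier A ==> \<zero>\<^bsub>A\<^esub> \<otimes>\<^bsub>A\<^esub> a = \<zero>\<^bsub>A\<^esub>"
  using smult_mult_left[of "\<zero>\<^bsub>A\<^esub>" a 0] by simp
lemma star_zero [simp]: "star A \<zero>\<^bsub>A\<^esub> = \<zero>\<^bsub>A\<^esub>"
  using star_smult[of "\<zero>\<^bsub>A\<^esub>" 0] by simp

lemma minus_eq_zero_iff: "a \<in> carrier A ==> b \<in> carrier A ==> a \<ominus>\<^bsub>A\<^esub> b = \<zero>\<^bsub>A\<^esub> \<longleftrightarrow> a = b"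
  by (rule minus_zero_iff[OF M.abelian_group_axioms])

lemma unit_of_eq: "is_one A e ==> unit_of A = e"
  unfolding unit_of_def by (rule the_equality, assumption, unfold is_one_def, metis)

lemma is_one_unit_of: "unital A ==> is_one A (unit_of A)"
  using unit_of_eq by (auto simp: unital_def)

lemma unitization_simps:
  "carrier (unitization A) = UNIV \<times> carrier A"
  "x \<otimes>\<^bsub>unitization A\<^esub> y = (fst x * fst y, fst x \<odot>\<^bsub>A\<^esub> snd y \<oplus>\<^bsub>A\<^esub> fst y \<odot>\<^bsub>A\<^esub> snd x \<oplus>\<^bsub>A\<^esub> snd x \<otimes>\<^bsub>A\<^esub> snd y)"
  "x \<oplus>\<^bsub>unitization A\<^esub> y = (fst x + fst y, snd x \<oplus>\<^bsub>A\<^esub> snd y)"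
  "\<one>\<^bsub>unitization A\<^esub> = (1, \<zero>\<^bsub>A\<^esub>)"
  "\<zero>\<^bsub>unitization A\<^esub> = (0, \<zero>\<^bsub>A\<^esub>)"
  by (auto simp: unitization_def case_prod_beta)

lemma ring_unitization: "ring (unitization A)"
proof (rule ringI)
  show "abelian_group (unitization A)"
  proof (rule abelian_groupI)
    fix x assume "x \<in> carrier (unitization A)"
    then show "\<exists>y\<in>carrier (unitization A). y \<oplus>\<^bsub>unitization A\<^esub> x = \<zero>\<^bsub>unitization A\<^esub>"
      by (intro bexI[of _ "(- fst x, \<ominus>\<^bsub>A\<^esub> snd x)"]) (auto simp: unitization_simps M.l_neg)
  qed (auto simp: unitization_simps M.a_ac)
  show "monoid (unitization A)"
  proof (rule monoidI)
    fix x y z assume "x \<in> carrier (unitization A)" "y \<in> carrier (unitization A)" "z \<in> carrier (unitization A)"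
    then show "x \<otimes>\<^bsub>unitization A\<^esub> y \<otimes>\<^bsub>unitization A\<^esub> z = x \<otimes>\<^bsub>unitization A\<^esub> (y \<otimes>\<^bsub>unitization A\<^esub> z)"
      by (auto simp: unitization_simps mult_add_left mult_add_right smult_mult_left smult_mult_right
          sm_distr sm_sm mult_assoc M.a_ac mult_ac)
  qed (auto simp: unitization_simps)
  fix x y z assume "x \<in> carrier (unitization A)" "y \<in> carrier (unitization A)" "z \<in> carrier (unitization A)"
  then show "(x \<oplus>\<^bsub>unitization A\<^esub> y) \<otimes>\<^bsub>unitization A\<^esub> z = x \<otimes>\<^bsub>unitization A\<^esub> z \<oplus>\<^bsub>unitization A\<^esub> y \<otimes>\<^bsub>unitization A\<^esub> z"
    and "z \<otimes>\<^bsub>unitization A\<^esub> (x \<oplus>\<^bsub>unitization A\<^esub> y) = z \<otimes>\<^bsub>unitization A\<^esub> x \<oplus>\<^bsub>unitization A\<^esub> z \<otimes>\<^bsub>unitization A\<^esub> y"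
    by (auto simp: unitization_simps mult_add_left mult_add_right sm_distr sm_add M.a_ac algebra_simps)
qed

end

context banach_star_algebra
begin

lemma nrm_zero [simp]: "nrm A \<zero>\<^bsub>A\<^esub> = 0" using nrm_eq_zero[of "\<zero>\<^bsub>A\<^esub>"] by simp

lemma nrm_uminus [simp]: "a \<in> carrier A ==> nrm A (\<ominus>\<^bsub>A\<^esub> a) = nrm A a"
  by (simp add: uminus_sm nrm_smult)

lemma nrm_nonneg [simp]: assumes "a \<in> carrier A" shows "0 \<le> nrm A a"
  using nrm_triangle[of a "\<ominus>\<^bsub>A\<^esub> a"] assms by (simp add: M.r_neg)

lemma nrm_minus_commute: "a \<in> carrier A ==> b \<in> carrier A ==> nrm A (a \<ominus>\<^bsub>A\<^esub> b) = nrm A (b \<ominus>\<^bsub>A\<^esub> a)"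
  using nrm_uminus[of "a \<ominus>\<^bsub>A\<^esub> b"] by (simp add: M.minus_add a_minus_def M.a_ac)

end

text \<open>The metric notions only see the additive group and its norm.\<close>

lemma norm_dist_metric:
  fixes V :: "('a, 'b, 'm) module_scheme"
  assumes ag: "abelian_group V"
    and nn: "\<And>a. a \<in> carrier V ==> 0 \<le> n a" and n0: "\<And>a. a \<in> carrier V ==> n a = 0 \<longleftrightarrow> a = \<zero>\<^bsub>V\<^esub>"
    and nm: "\<And>a. a \<in> carrier V ==> n (\<ominus>\<^bsub>V\<^esub> a) = n a"
    and tri: "\<And>a b. a \<in> carrier V ==> b \<in> carrier V ==> n (a \<oplus>\<^bsub>V\<^esub> b) \<le> n a + n b"
  shows "Metric_space (carrier V) (norm_dist V n)"
proof -
  interpret abelian_group V by (rule ag)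
  show ?thesis
  proof
    fix x y show "0 \<le> norm_dist V n x y" by (simp add: norm_dist_def nn)
    show "norm_dist V n x y = norm_dist V n y x"
      using nm[of "x \<ominus>\<^bsub>V\<^esub> y"] by (auto simp: norm_dist_def minus_add a_minus_def a_ac)
    { assume "x \<in> carrier V" "y \<in> carrier V"
      then show "norm_dist V n x y = 0 \<longleftrightarrow> x = y" by (simp add: norm_dist_def n0 minus_zero_iff[OF ag]) }
    fix z assume xyz: "x \<in> carrier V" "y \<in> carrier V" "z \<in> carrier V"
    have "x \<ominus>\<^bsub>V\<^esub> z = (x \<ominus>\<^bsub>V\<^esub> y) \<oplus>\<^bsub>V\<^esub> (y \<ominus>\<^bsub>V\<^esub> z)"
    proof -
      have "(x \<ominus>\<^bsub>V\<^esub> y) \<oplus>\<^bsub>V\<^esub> (y \<ominus>\<^bsub>V\<^esub> z) = x \<oplus>\<^bsub>V\<^esub> ((\<ominus>\<^bsub>V\<^esub> y \<oplus>\<^bsub>V\<^esub> y) \<oplus>\<^bsub>V\<^esub> \<ominus>\<^bsub>V\<^esub> z)"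
        using xyz by (simp only: a_minus_def a_assoc minus_closed a_inv_closed add.m_closed)
      then show ?thesis using xyz by (simp add: l_neg) (simp add: a_minus_def)
    qed
    then show "norm_dist V n x z \<le> norm_dist V n x y + norm_dist V n y z"
      using xyz tri[of "x \<ominus>\<^bsub>V\<^esub> y" "y \<ominus>\<^bsub>V\<^esub> z"] by (simp add: norm_dist_def)
  qed
qed

lemma mcomplete_norm_distI:
  fixes R :: "('a, 'm) normed_star_alg_scheme"
  assumes ms: "Metric_space (carrier R) (norm_dist R (nrm R))"
    and conv: "\<And>s :: nat => 'a. (\<And>n. s n \<in> carrier R) ==> (\<And>e. 0 < e ==> \<exists>M. \<forall>m\<ge>M. \<forall>n\<ge>M. nrm R (s m \<ominus>\<^bsub>R\<^esub> s n) < e) ==>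
      \<exists>l\<in>carrier R. \<forall>e>0. \<exists>M. \<forall>n\<ge>M. nrm R (s n \<ominus>\<^bsub>R\<^esub> l) < e"
  shows "Metric_space.mcomplete (carrier R) (norm_dist R (nrm R))"
proof -
  interpret Metric_space "carrier R" "norm_dist R (nrm R)" by (rule ms)
  show ?thesis
    unfolding mcomplete_def
  proof (intro allI impI)
    fix s assume s: "MCauchy s"
    then have sR: "\<And>n. s n \<in> carrier R" by (auto simp: MCauchy_def)
    have "\<exists>M. \<forall>m\<ge>M. \<forall>n\<ge>M. nrm R (s m \<ominus>\<^bsub>R\<^esub> s n) < e" if "0 < e" for e
      using s that sR unfolding MCauchy_def norm_dist_def by simp
    then obtain l where l: "l \<in> carrier R" "\<forall>e>0. \<exists>M. \<forall>n\<ge>M. nrm R (s n \<ominus>\<^bsub>R\<^esub> l) < e" using conv[of s] sR by blast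
    then show "\<exists>x. limitin mtopology s x sequentially"
      by (intro exI[of _ l]) (auto simp: limitin_metric eventually_sequentially norm_dist_def sR)
  qed
qed

context banach_star_algebra
begin

lemma metric_space: "Metric_space (carrier A) (norm_dist A (nrm A))"
  by (rule norm_dist_metric) (auto simp: nrm_eq_zero nrm_triangle M.abelian_group_axioms)

lemma Cauchy_converges:
  assumes s: "\<And>n. s n \<in> carrier A" and c: "\<And>e. 0 < e ==> \<exists>M. \<forall>m\<ge>M. \<forall>n\<ge>M. nrm A (s m \<ominus>\<^bsub>A\<^esub> s n) < e"
  obtains l where "l \<in> carrier A" "(\<lambda>n. nrm A (s n \<ominus>\<^bsub>A\<^esub> l)) \<longlonglongrightarrow> 0"
proof -
  interpret Metric_space "carrier A" "norm_dist A (nrm A)" by (rule metric_space)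
  have "MCauchy s" using s c unfolding MCauchy_def norm_dist_def by (auto simp: image_subset_iff)
  then obtain l where l: "limitin mtopology s l sequentially" using complete by (auto simp: mcomplete_def)
  then have lA: "l \<in> carrier A" by (auto simp: limitin_metric)
  have "(\<lambda>n. nrm A (s n \<ominus>\<^bsub>A\<^esub> l)) \<longlonglongrightarrow> 0"
    using l lA s by (auto simp: limitin_metric norm_dist_def tendsto_iff)
  with lA show ?thesis by (rule that)
qed

lemma limitin_norm_topology:
  "limitin (norm_topology A) f l F \<longleftrightarrow> l \<in> carrier A \<and> (\<forall>e>0. \<forall>\<^sub>F x in F. f x \<in> carrier A \<and> nrm A (f x \<ominus>\<^bsub>A\<^esub> l) < e)"
proof -
  interpret Metric_space "carrier A" "norm_dist A (nrm A)" by (rule metric_space)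
  show ?thesis unfolding norm_topology_def limitin_metric norm_dist_def by (auto elim!: eventually_mono)
qed

end

section \<open>The product of all Banach *-algebras with carriers in a given type\<close>

text \<open>Adjoin a unit to every Banach *-algebra \<open>R\<close> whose carrier lies in \<open>'a\<close> and take the bounded families
  with the supremum norm. The result depends on \<open>'a\<close> only, so it is a type and can be made an instance of
  the class \<open>cbstar\<close>. Each \<open>R\<close> is one of the factors, and the theory of the preceding sections can be applied
  to it without mentioning carriers.\<close>

definition unit_norm :: "('a, 'm) normed_star_alg_scheme => complex \<times> 'a => real" where
  "unit_norm R x = cmod (fst x) + nrm R (snd x)"

text \<open>Values at records that are not Banach *-algebras are pinned, so that two families agree as soon as they agree at all
  Banach *-algebras.\<close>

typedef 'a uni = "{F :: 'a normed_star_alg => complex \<times> 'a.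
    (\<forall>R. banach_star_algebra R \<longrightarrow> snd (F R) \<in> carrier R) \<and>
    (\<forall>R. \<not> banach_star_algebra R \<longrightarrow> F R = (0, undefined)) \<and>
    (\<exists>K. \<forall>R. banach_star_algebra R \<longrightarrow> unit_norm R (F R) \<le> K)}"
proof (rule exI[of _ "\<lambda>R. if banach_star_algebra R then (0, \<zero>\<^bsub>R\<^esub>) else (0, undefined)"])
  have z: "\<zero>\<^bsub>R\<^esub> \<in> carrier R" "nrm R \<zero>\<^bsub>R\<^esub> = 0" if "banach_star_algebra R" for R :: "'a normed_star_alg"
  proof -
    interpret banach_star_algebra R by (rule that)
    show "\<zero>\<^bsub>R\<^esub> \<in> carrier R" "nrm R \<zero>\<^bsub>R\<^esub> = 0" by auto
  qed
  then show "(\<lambda>R. if banach_star_algebra R then (0, \<zero>\<^bsub>R\<^esub>) else (0, undefined)) \<in> {F :: 'a normed_star_alg => complex \<times> 'a.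
    (\<forall>R. banach_star_algebra R \<longrightarrow> snd (F R) \<in> carrier R) \<and>
    (\<forall>R. \<not> banach_star_algebra R \<longrightarrow> F R = (0, undefined)) \<and>
    (\<exists>K. \<forall>R. banach_star_algebra R \<longrightarrow> unit_norm R (F R) \<le> K)}"
    by (auto simp: unit_norm_def intro!: exI[of _ 0])
qed

text \<open>There is a Banach *-algebra on every type, hence the supremum that defines the norm is over a nonempty set.\<close>

definition zero_alg :: "'a normed_star_alg" where
  "zero_alg = \<lparr>carrier = {undefined}, monoid.mult = \<lambda>_ _. undefined, one = undefined, zero = undefined,
    add = \<lambda>_ _. undefined, smult = \<lambda>_ _. undefined, star = \<lambda>_. undefined, nrm = \<lambda>_. 0\<rparr>"

lemma banach_zero_alg: "banach_star_algebra (zero_alg :: 'a normed_star_alg)"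
proof -
  have ag: "abelian_group (zero_alg :: 'a normed_star_alg)"
    by (rule abelian_groupI) (auto simp: zero_alg_def)
  have "star_algebra (zero_alg :: 'a normed_star_alg)"
    by (intro star_algebra.intro star_algebra_axioms.intro moduleI cring_complex_ring ag) (auto simp: zero_alg_def)
  moreover have "Metric_space (carrier zero_alg) (norm_dist zero_alg (nrm (zero_alg :: 'a normed_star_alg)))"
    using abelian_group.a_inv_closed[OF ag] by (intro norm_dist_metric ag) (auto simp: zero_alg_def)
  then have "Metric_space.mcomplete (carrier zero_alg) (norm_dist zero_alg (nrm (zero_alg :: 'a normed_star_alg)))"
    by (rule mcomplete_norm_distI) (auto simp: zero_alg_def)
  ultimately show ?thesis
    by (intro banach_star_algebra.intro banach_star_algebra_axioms.intro) (auto simp: zero_alg_def)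
qed

lemma uni_mem: "banach_star_algebra R ==> snd (Rep_uni F R) \<in> carrier R"
  using Rep_uni[of F] by auto

lemma uni_eqI: "(\<And>R. banach_star_algebra R ==> Rep_uni F R = Rep_uni G R) ==> F = G"
proof -
  assume *: "\<And>R. banach_star_algebra R ==> Rep_uni F R = Rep_uni G R"
  have "Rep_uni F R = Rep_uni G R" for R
    using *[of R] Rep_uni[of F] Rep_uni[of G] by (cases "banach_star_algebra R") auto
  then show "F = G" by (simp add: Rep_uni_inject[symmetric] fun_eq_iff)
qed

definition uni_of :: "('a normed_star_alg => complex \<times> 'a) => 'a uni" where
  "uni_of f = Abs_uni (\<lambda>R. if banach_star_algebra R then f R else (0, undefined))"

lemma Rep_uni_of:
  assumes "\<And>R. banach_star_algebra R ==> snd (f R) \<in> carrier R"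
    and "\<And>R. banach_star_algebra R ==> unit_norm R (f R) \<le> K" and R: "banach_star_algebra R"
  shows "Rep_uni (uni_of f) R = f R"
  unfolding uni_of_def using R assms(1,2) by (subst Abs_uni_inverse) auto

definition uni_norm :: "'a uni => real" where
  "uni_norm F = Sup {unit_norm R (Rep_uni F R) | R. banach_star_algebra R}"

lemma unit_norm_le: "banach_star_algebra R ==> unit_norm R (Rep_uni F R) \<le> uni_norm F"
  unfolding uni_norm_def using Rep_uni[of F] by (intro cSup_upper) (auto simp: bdd_above_def)

lemma uni_norm_le: "(\<And>R. banach_star_algebra R ==> unit_norm R (Rep_uni F R) \<le> K) ==> uni_norm F \<le> K"
  unfolding uni_norm_def using banach_zero_alg by (intro cSup_least) auto

context banach_star_algebra
begin

lemma unit_norm_simps: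
  assumes x: "snd x \<in> carrier A" and y: "snd y \<in> carrier A"
  shows "0 \<le> unit_norm A x" "unit_norm A (x \<oplus>\<^bsub>unitization A\<^esub> y) \<le> unit_norm A x + unit_norm A y"
    "unit_norm A (x \<otimes>\<^bsub>unitization A\<^esub> y) \<le> unit_norm A x * unit_norm A y"
    "unit_norm A (smult (unitization A) z x) = cmod z * unit_norm A x"
    "unit_norm A (star (unitization A) x) = unit_norm A x"
    "unit_norm A x = 0 \<longleftrightarrow> x = (0, \<zero>\<^bsub>A\<^esub>)"
proof -
  note us = unitization_simps
  show "0 \<le> unit_norm A x" using x by (simp add: unit_norm_def)
  show "unit_norm A (x \<oplus>\<^bsub>unitization A\<^esub> y) \<le> unit_norm A x + unit_norm A y"
    using nrm_triangle[OF x y] norm_triangle_ineq[of "fst x" "fst y"] by (simp add: unit_norm_def us)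
  let ?a = "snd x" and ?b = "snd y" and ?z = "fst x" and ?w = "fst y"
  have "nrm A (?z \<odot>\<^bsub>A\<^esub> ?b \<oplus>\<^bsub>A\<^esub> ?w \<odot>\<^bsub>A\<^esub> ?a \<oplus>\<^bsub>A\<^esub> ?a \<otimes>\<^bsub>A\<^esub> ?b) \<le> cmod ?z * nrm A ?b + cmod ?w * nrm A ?a + nrm A ?a * nrm A ?b"
    using x y nrm_triangle[of "?z \<odot>\<^bsub>A\<^esub> ?b \<oplus>\<^bsub>A\<^esub> ?w \<odot>\<^bsub>A\<^esub> ?a" "?a \<otimes>\<^bsub>A\<^esub> ?b"] nrm_triangle[of "?z \<odot>\<^bsub>A\<^esub> ?b" "?w \<odot>\<^bsub>A\<^esub> ?a"] nrm_mult[of ?a ?b]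
    by (simp add: nrm_smult)
  then show "unit_norm A (x \<otimes>\<^bsub>unitization A\<^esub> y) \<le> unit_norm A x * unit_norm A y"
    by (simp add: unit_norm_def us norm_mult algebra_simps)
  show "unit_norm A (smult (unitization A) z x) = cmod z * unit_norm A x"
    using x by (simp add: unit_norm_def unitization_def case_prod_beta nrm_smult norm_mult distrib_left)
  show "unit_norm A (star (unitization A) x) = unit_norm A x"
    using x by (simp add: unit_norm_def unitization_def case_prod_beta nrm_star)
  have "unit_norm A x = 0 \<longleftrightarrow> cmod ?z = 0 \<and> nrm A ?a = 0"
    unfolding unit_norm_def by (rule add_nonneg_eq_0_iff) (use x in auto)
  also have "\<dots> \<longleftrightarrow> x = (0, \<zero>\<^bsub>A\<^esub>)" using x by (cases x) (auto simp: nrm_eq_zero)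
  finally show "unit_norm A x = 0 \<longleftrightarrow> x = (0, \<zero>\<^bsub>A\<^esub>)" .
qed

lemma unit_carrier:
  assumes x: "snd x \<in> carrier A" and y: "snd y \<in> carrier A"
  shows "snd (x \<oplus>\<^bsub>unitization A\<^esub> y) \<in> carrier A" "snd (x \<otimes>\<^bsub>unitization A\<^esub> y) \<in> carrier A"
    "snd (smult (unitization A) z x) \<in> carrier A" "snd (star (unitization A) x) \<in> carrier A" "\<zero>\<^bsub>A\<^esub> \<in> carrier A"
  using x y by (simp_all add: unitization_simps) (simp_all add: unitization_def case_prod_beta)

end

lemmas unit_norm_simps = banach_star_algebra.unit_norm_simps
lemmas unit_carrier = banach_star_algebra.unit_carrier

instantiation uni :: (type) real_normed_algebra_1
begin

definition "0 = uni_of (\<lambda>R. (0, \<zero>\<^bsub>R\<^esub>))"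
definition "1 = uni_of (\<lambda>R. (1, \<zero>\<^bsub>R\<^esub>))"
definition "F + G = uni_of (\<lambda>R. Rep_uni F R \<oplus>\<^bsub>unitization R\<^esub> Rep_uni G R)"
definition "F * G = uni_of (\<lambda>R. Rep_uni F R \<otimes>\<^bsub>unitization R\<^esub> Rep_uni G R)"
definition csm_uni :: "complex => 'a uni => 'a uni" where
  "csm_uni z F = uni_of (\<lambda>R. smult (unitization R) z (Rep_uni F R))"
definition "- F = csm_uni (- 1) (F :: 'a uni)"
definition "F - G = F + - (G :: 'a uni)"
definition "scaleR r F = csm_uni (complex_of_real r) F"
definition cx_uni' :: "complex => 'a uni" where "cx_uni' z = csm_uni z 1"
definition adj_uni' :: "'a uni => 'a uni" where "adj_uni' F = uni_of (\<lambda>R. star (unitization R) (Rep_uni F R))"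
definition "norm F = uni_norm F"
definition "dist F G = norm (F - G :: 'a uni)"
definition "sgn F = inverse (norm F) *\<^sub>R (F :: 'a uni)"
definition uniformity_uni: "uniformity = (INF e\<in>{0<..}. principal {(x :: 'a uni, y). dist x y < e})"
definition open_uni: "open (U :: 'a uni set) \<longleftrightarrow> (\<forall>x\<in>U. eventually (\<lambda>(x', y). x' = x \<longrightarrow> y \<in> U) uniformity)"

lemma Rep_uni_ops:
  assumes R: "banach_star_algebra R"
  shows "Rep_uni 0 R = (0, \<zero>\<^bsub>R\<^esub>)" "Rep_uni 1 R = (1, \<zero>\<^bsub>R\<^esub>)"
    "Rep_uni (F + G) R = Rep_uni F R \<oplus>\<^bsub>unitization R\<^esub> Rep_uni G R"
    "Rep_uni (F * G) R = Rep_uni F R \<otimes>\<^bsub>unitization R\<^esub> Rep_uni G R"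
    "Rep_uni (csm_uni z F) R = smult (unitization R) z (Rep_uni F R)"
    "Rep_uni (adj_uni' F) R = star (unitization R) (Rep_uni F R)"
proof -
  note b = unit_norm_le[of _ F] unit_norm_le[of _ G] and m = uni_mem[of _ F] uni_mem[of _ G]
  note un = unit_norm_simps[OF _ m(1) m(2)] and uc = unit_carrier[OF _ m(1) m(2)]
  have z: "nrm R' \<zero>\<^bsub>R'\<^esub> = 0" if "banach_star_algebra R'" for R' :: "'a normed_star_alg"
    by (rule banach_star_algebra.nrm_zero[OF that])
  show "Rep_uni 0 R = (0, \<zero>\<^bsub>R\<^esub>)" unfolding zero_uni_def
    by (rule Rep_uni_of[OF _ _ R, of _ 0]) (auto simp: uc unit_norm_def z)
  show "Rep_uni 1 R = (1, \<zero>\<^bsub>R\<^esub>)" unfolding one_uni_def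
    by (rule Rep_uni_of[OF _ _ R, of _ 1]) (auto simp: uc unit_norm_def z)
  show "Rep_uni (F + G) R = Rep_uni F R \<oplus>\<^bsub>unitization R\<^esub> Rep_uni G R" unfolding plus_uni_def
    by (rule Rep_uni_of[OF _ _ R, of _ "uni_norm F + uni_norm G"]) (auto simp: uc intro!: order_trans[OF un(2)] add_mono b)
  show "Rep_uni (F * G) R = Rep_uni F R \<otimes>\<^bsub>unitization R\<^esub> Rep_uni G R" unfolding times_uni_def
    by (rule Rep_uni_of[OF _ _ R, of _ "uni_norm F * uni_norm G"])
      (auto simp: uc intro!: order_trans[OF un(3)] mult_mono b intro: order_trans[OF un(1) b(1)] unit_norm_simps(1) m)
  show "Rep_uni (csm_uni z F) R = smult (unitization R) z (Rep_uni F R)" unfolding csm_uni_def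
    by (rule Rep_uni_of[OF _ _ R, of _ "cmod z * uni_norm F"]) (auto simp: uc un(4) intro!: mult_left_mono b)
  show "Rep_uni (adj_uni' F) R = star (unitization R) (Rep_uni F R)" unfolding adj_uni'_def
    by (rule Rep_uni_of[OF _ _ R, of _ "uni_norm F"]) (auto simp: uc un(5) b)
qed

lemma Rep_uni_uminus: "banach_star_algebra R ==> Rep_uni (- F) R = smult (unitization R) (- 1) (Rep_uni F R)"
  by (simp add: uminus_uni_def Rep_uni_ops)

lemma Rep_uni_diff:
  assumes R: "banach_star_algebra R"
  shows "Rep_uni (F - G) R = (fst (Rep_uni F R) - fst (Rep_uni G R), snd (Rep_uni F R) \<ominus>\<^bsub>R\<^esub> snd (Rep_uni G R))"
proof -
  interpret banach_star_algebra R by (rule R)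
  have us: "smult (unitization R) z x = (z * fst x, z \<odot>\<^bsub>R\<^esub> snd x)" for z x by (simp add: unitization_def case_prod_beta)
  show ?thesis
    using uni_mem[OF R] by (simp add: minus_uni_def Rep_uni_ops[OF R] Rep_uni_uminus[OF R] us unitization_simps minus_sm)
qed

lemma uni_algebra:
  fixes F G H :: "'a uni"
  shows "F + G + H = F + (G + H)" "F + G = G + F" "0 + F = F" "- F + F = 0"
    "F * G * H = F * (G * H)" "1 * F = F" "F * 1 = F" "(F + G) * H = F * H + G * H" "H * (F + G) = H * F + H * G"
    "csm_uni z F = cx_uni' z * F" "cx_uni' z * F = F * cx_uni' z" "cx_uni' (z + w) = (cx_uni' z + cx_uni' w :: 'a uni)" "cx_uni' (z * w) = (cx_uni' z * cx_uni' w :: 'a uni)"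
    "cx_uni' 1 = (1 :: 'a uni)" "adj_uni' (F + G) = adj_uni' F + adj_uni' G" "adj_uni' (F * G) = adj_uni' G * adj_uni' F" "adj_uni' (adj_uni' F) = F" "adj_uni' (cx_uni' z) = (cx_uni' (cnj z) :: 'a uni)"
proof (rule_tac [!] uni_eqI)
  fix R :: "'a normed_star_alg" assume R: "banach_star_algebra R"
  interpret banach_star_algebra R by (rule R)
  interpret U: ring "unitization R" by (rule ring_unitization)
  note [simp] = Rep_uni_ops[OF R] Rep_uni_uminus[OF R]
  have snd_m [simp]: "snd (Rep_uni F' R) \<in> carrier R" for F' by (rule uni_mem[OF R])
  have [simp]: "Rep_uni F' R \<in> carrier (unitization R)" for F' using snd_m[of F'] by (cases "Rep_uni F' R") (simp add: unitization_simps)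
  have us: "smult (unitization R) z x = (z * fst x, z \<odot>\<^bsub>R\<^esub> snd x)" "star (unitization R) x = (cnj (fst x), star R (snd x))" for z x
    by (simp_all add: unitization_def case_prod_beta)
  show "Rep_uni (F + G + H) R = Rep_uni (F + (G + H)) R" by (simp add: U.a_assoc)
  show "Rep_uni (F + G) R = Rep_uni (G + F) R" by (simp add: U.a_comm)
  show "Rep_uni (0 + F) R = Rep_uni F R" using U.l_zero[of "Rep_uni F R"] by (simp add: unitization_simps)
  show "Rep_uni (- F + F) R = Rep_uni 0 R" using M.l_neg[of "snd (Rep_uni F R)"] by (simp add: us unitization_simps uminus_sm)
  show "Rep_uni (F * G * H) R = Rep_uni (F * (G * H)) R" by (simp add: U.m_assoc)
  show "Rep_uni (1 * F) R = Rep_uni F R" using U.l_one[of "Rep_uni F R"] by (simp add: unitization_simps)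
  show "Rep_uni (F * 1) R = Rep_uni F R" using U.r_one[of "Rep_uni F R"] by (simp add: unitization_simps)
  show "Rep_uni ((F + G) * H) R = Rep_uni (F * H + G * H) R" by (simp add: U.l_distr)
  show "Rep_uni (H * (F + G)) R = Rep_uni (H * F + H * G) R" by (simp add: U.r_distr)
  show "Rep_uni (csm_uni z F) R = Rep_uni (cx_uni' z * F) R" by (simp add: cx_uni'_def us unitization_simps)
  show "Rep_uni (cx_uni' z * F) R = Rep_uni (F * cx_uni' z) R" by (simp add: cx_uni'_def us unitization_simps)
  show "Rep_uni (cx_uni' (z + w)) R = Rep_uni (cx_uni' z + cx_uni' w) R" by (simp add: cx_uni'_def us unitization_simps)
  show "Rep_uni (cx_uni' (z * w)) R = Rep_uni (cx_uni' z * cx_uni' w) R" by (simp add: cx_uni'_def us unitization_simps)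
  show "Rep_uni (cx_uni' 1) R = Rep_uni 1 R" by (simp add: cx_uni'_def us unitization_simps)
  show "Rep_uni (adj_uni' (F + G)) R = Rep_uni (adj_uni' F + adj_uni' G) R" by (simp add: us unitization_simps star_add)
  show "Rep_uni (adj_uni' (F * G)) R = Rep_uni (adj_uni' G * adj_uni' F) R"
    by (simp add: us unitization_simps star_add star_smult star_mult M.a_ac)
  show "Rep_uni (adj_uni' (adj_uni' F)) R = Rep_uni F R" by (simp add: us)
  show "Rep_uni (adj_uni' (cx_uni' z)) R = Rep_uni (cx_uni' (cnj z)) R" by (simp add: cx_uni'_def us)
qed

lemma uni_norm_props:
  fixes F G :: "'a uni"
  shows "norm F = 0 \<longleftrightarrow> F = 0" "norm (F + G) \<le> norm F + norm G" "norm (F * G) \<le> norm F * norm G"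
    "norm (csm_uni z F) = cmod z * norm F" "norm (adj_uni' F) = norm F" "norm (1 :: 'a uni) = 1"
proof -
  note m = uni_mem[of _ F] uni_mem[of _ G]
  note un = unit_norm_simps[OF _ m(1) m(2)]
  note b = unit_norm_le[of _ F] unit_norm_le[of _ G]
  have n0: "0 \<le> uni_norm F'" for F' :: "'a uni"
    using unit_norm_simps(1)[OF banach_zero_alg uni_mem[OF banach_zero_alg, of F'] uni_mem[OF banach_zero_alg, of F']]
      unit_norm_le[OF banach_zero_alg, of F'] by linarith
  show "norm F = 0 \<longleftrightarrow> F = 0"
  proof
    assume F0: "norm F = 0"
    show "F = 0"
    proof (rule uni_eqI)
      fix R :: "'a normed_star_alg" assume R: "banach_star_algebra R"
      have "unit_norm R (Rep_uni F R) = 0" using b(1)[OF R] un(1)[OF R R R] F0 by (simp add: norm_uni_def)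
      then show "Rep_uni F R = Rep_uni 0 R" using un(6)[OF R R R] R by (simp add: Rep_uni_ops)
    qed
  next
    assume "F = 0"
    then have "uni_norm F \<le> 0"
      by (intro uni_norm_le) (simp add: Rep_uni_ops unit_norm_def banach_star_algebra.nrm_zero)
    then show "norm F = 0" using n0[of F] by (simp add: norm_uni_def)
  qed
  show "norm (F + G) \<le> norm F + norm G" unfolding norm_uni_def
    by (rule uni_norm_le) (auto simp: Rep_uni_ops intro!: order_trans[OF un(2)] add_mono b)
  show "norm (F * G) \<le> norm F * norm G" unfolding norm_uni_def
    by (rule uni_norm_le) (auto simp: Rep_uni_ops intro!: order_trans[OF un(3)] mult_mono b n0 unit_norm_simps(1) m)
  show "norm (adj_uni' F) = norm F" unfolding norm_uni_def uni_norm_def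
    by (rule arg_cong[where f = Sup], rule Collect_cong) (metis Rep_uni_ops(6) un(5))
  show "norm (csm_uni z F) = cmod z * norm F"
  proof (rule antisym)
    show "norm (csm_uni z F) \<le> cmod z * norm F" unfolding norm_uni_def
      by (rule uni_norm_le) (auto simp: Rep_uni_ops un(4) intro!: mult_left_mono b)
    show "cmod z * norm F \<le> norm (csm_uni z F)"
    proof (cases "z = 0")
      case False
      have "uni_norm F \<le> uni_norm (csm_uni z F) / cmod z"
        using False unit_norm_le[of _ "csm_uni z F"] by (intro uni_norm_le) (simp add: Rep_uni_ops un(4) pos_le_divide_eq mult.commute)
      then show ?thesis using False by (simp add: norm_uni_def pos_le_divide_eq mult.commute)
    qed (simp add: norm_uni_def n0)
  qed
  have o: "unit_norm R (Rep_uni 1 R) = 1" if "banach_star_algebra R" for R :: "'a normed_star_alg"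
    using that by (simp add: Rep_uni_ops unit_norm_def banach_star_algebra.nrm_zero)
  show "norm (1 :: 'a uni) = 1" unfolding norm_uni_def
    by (rule antisym[OF uni_norm_le]) (use o unit_norm_le[OF banach_zero_alg, of 1] o[OF banach_zero_alg] in auto)
qed

instance
proof
  fix F G H :: "'a uni" and z w :: complex and r s :: real
  note ua = uni_algebra
  have un: "csm_uni z F = cx_uni' z * F" for z and F :: "'a uni" by (rule ua)
  have z0: "cx_uni' 0 = (0 :: 'a uni)"
  proof -
    have c: "cx_uni' 0 = (cx_uni' 0 + cx_uni' 0 :: 'a uni)" using ua(12)[of 0 0] by simp
    have "(0 :: 'a uni) = - cx_uni' 0 + (cx_uni' 0 + cx_uni' 0)" using c ua(4)[of "cx_uni' 0"] by simp
    also have "\<dots> = cx_uni' 0" using ua(1)[of "- cx_uni' 0" "cx_uni' 0" "cx_uni' 0 :: 'a uni"] ua(3,4) by simp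
    finally show ?thesis by simp
  qed
  show "F + G + H = F + (G + H)" by (rule ua(1))
  show "F + G = G + F" by (rule ua(2))
  show "0 + F = F" by (rule ua(3))
  show "- F + F = 0" by (rule ua(4))
  show "F - G = F + - G" by (rule minus_uni_def)
  show "F * G * H = F * (G * H)" by (rule ua(5))
  show "1 * F = F" by (rule ua(6))
  show "F * 1 = F" by (rule ua(7))
  show "(F + G) * H = F * H + G * H" by (rule ua(8))
  show "F * (G + H) = F * G + F * H" by (rule ua(9))
  show n1: "norm (1 :: 'a uni) = 1" by (rule uni_norm_props)
  show "(0 :: 'a uni) \<noteq> 1" using n1 uni_norm_props(1)[of 0] by auto
  show "r *\<^sub>R (F + G) = r *\<^sub>R F + r *\<^sub>R G" unfolding scaleR_uni_def un by (rule ua(9))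
  show "(r + s) *\<^sub>R F = r *\<^sub>R F + s *\<^sub>R F" unfolding scaleR_uni_def un of_real_add ua(12) by (rule ua(8))
  show "r *\<^sub>R s *\<^sub>R F = (r * s) *\<^sub>R F" unfolding scaleR_uni_def un of_real_mult ua(13) by (rule ua(5)[symmetric])
  show "1 *\<^sub>R F = F" unfolding scaleR_uni_def un of_real_1 ua(14) by (rule ua(6))
  show "r *\<^sub>R F * G = r *\<^sub>R (F * G)" unfolding scaleR_uni_def un by (rule ua(5))
  have "F * (cx_uni' (complex_of_real r) * G) = cx_uni' (complex_of_real r) * (F * G)" by (metis ua(5) ua(11))
  then show "F * r *\<^sub>R G = r *\<^sub>R (F * G)" by (simp add: scaleR_uni_def un)
  show "dist F G = norm (F - G)" by (rule dist_uni_def)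
  show "sgn F = inverse (norm F) *\<^sub>R F" by (rule sgn_uni_def)
  show "uniformity = (INF e\<in>{0<..}. principal {(x :: 'a uni, y). dist x y < e})" by (rule uniformity_uni)
  show "open U \<longleftrightarrow> (\<forall>x\<in>U. \<forall>\<^sub>F (x', y) in uniformity. x' = x \<longrightarrow> y \<in> U)" for U :: "'a uni set" by (rule open_uni)
  show "norm F = 0 \<longleftrightarrow> F = 0" "norm (F + G) \<le> norm F + norm G" "norm (F * G) \<le> norm F * norm G"
    by (rule uni_norm_props)+
  show "norm (r *\<^sub>R F) = \<bar>r\<bar> * norm F" by (simp add: scaleR_uni_def uni_norm_props)
qed

end

instance uni :: (type) banach
proof
  fix X :: "nat => 'a uni" assume X: "Cauchy X"
  have X': "\<exists>M. \<forall>m\<ge>M. \<forall>n\<ge>M. norm (X m - X n) < e" if "0 < e" for e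
    using CauchyD[OF X that] .
  define d where "d R x y = cmod (fst x - fst y) + nrm R (snd x \<ominus>\<^bsub>R\<^esub> snd y)" for R :: "'a normed_star_alg" and x y
  have dn: "d R (Rep_uni F R) (Rep_uni G R) \<le> norm (F - G)" if R: "banach_star_algebra R" for R and F G :: "'a uni"
  proof -
    interpret banach_star_algebra R by (rule R)
    have "Rep_uni (F - G) R = (fst (Rep_uni F R) - fst (Rep_uni G R), snd (Rep_uni F R) \<ominus>\<^bsub>R\<^esub> snd (Rep_uni G R))"
      by (rule Rep_uni_diff[OF R])
    then have "d R (Rep_uni F R) (Rep_uni G R) = unit_norm R (Rep_uni (F - G) R)" by (simp add: d_def unit_norm_def)
    then show ?thesis using unit_norm_le[OF R] by (simp add: norm_uni_def)
  qed
  have tri: "d R x z \<le> d R x y + d R y z" if R: "banach_star_algebra R"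
    and c: "snd x \<in> carrier R" "snd y \<in> carrier R" "snd z \<in> carrier R" for R x y z
  proof -
    interpret banach_star_algebra R by (rule R)
    interpret Metric_space "carrier R" "norm_dist R (nrm R)" by (rule metric_space)
    show ?thesis using triangle[OF c] c norm_triangle_ineq[of "fst x - fst y" "fst y - fst z"] by (simp add: d_def norm_dist_def)
  qed
  have "\<exists>l. snd l \<in> carrier R \<and> (\<lambda>n. d R (Rep_uni (X n) R) l) \<longlonglongrightarrow> 0" if R: "banach_star_algebra R" for R
  proof -
    interpret banach_star_algebra R by (rule R)
    have nn: "0 \<le> nrm R (snd (Rep_uni F R) \<ominus>\<^bsub>R\<^esub> snd (Rep_uni G R))" for F G
      using uni_mem[OF R] by simp
    have "Cauchy (\<lambda>n. fst (Rep_uni (X n) R))"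
      unfolding Cauchy_def dist_norm
    proof (intro allI impI)
      fix e :: real assume "0 < e"
      from X'[OF this] obtain M where M: "\<And>m n. m \<ge> M ==> n \<ge> M ==> norm (X m - X n) < e" by blast
      have "cmod (fst (Rep_uni (X m) R) - fst (Rep_uni (X n) R)) < e" if "m \<ge> M" "n \<ge> M" for m n
        using dn[OF R, of "X m" "X n"] nn[of "X m" "X n"] M[OF that] by (simp add: d_def)
      then show "\<exists>M. \<forall>m\<ge>M. \<forall>n\<ge>M. cmod (fst (Rep_uni (X m) R) - fst (Rep_uni (X n) R)) < e" by blast
    qed
    then obtain v where v: "(\<lambda>n. fst (Rep_uni (X n) R)) \<longlonglongrightarrow> v" using Cauchy_convergent convergentD by blast
    obtain l where l: "l \<in> carrier R" "(\<lambda>n. nrm R (snd (Rep_uni (X n) R) \<ominus>\<^bsub>R\<^esub> l)) \<longlonglongrightarrow> 0"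
    proof (rule Cauchy_converges[of "\<lambda>n. snd (Rep_uni (X n) R)"])
      fix e :: real assume "0 < e"
      from X'[OF this] obtain M where M: "\<And>m n. m \<ge> M ==> n \<ge> M ==> norm (X m - X n) < e" by blast
      have "nrm R (snd (Rep_uni (X m) R) \<ominus>\<^bsub>R\<^esub> snd (Rep_uni (X n) R)) < e" if "m \<ge> M" "n \<ge> M" for m n
        using dn[OF R, of "X m" "X n"] norm_ge_zero[of "fst (Rep_uni (X m) R) - fst (Rep_uni (X n) R)"] M[OF that]
        unfolding d_def by linarith
      then show "\<exists>M. \<forall>m\<ge>M. \<forall>n\<ge>M. nrm R (snd (Rep_uni (X m) R) \<ominus>\<^bsub>R\<^esub> snd (Rep_uni (X n) R)) < e" by blast
    qed (use uni_mem[OF R] in blast)+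
    have "(\<lambda>n. d R (Rep_uni (X n) R) (v, l)) \<longlonglongrightarrow> 0 + 0"
      unfolding d_def fst_conv snd_conv using v by (intro tendsto_add l(2)) (simp add: LIM_zero tendsto_norm_zero)
    then show ?thesis using l(1) by (intro exI[of _ "(v, l)"]) simp
  qed
  then obtain L where L: "\<And>R. banach_star_algebra R ==> snd (L R) \<in> carrier R"
      "\<And>R. banach_star_algebra R ==> (\<lambda>n. d R (Rep_uni (X n) R) (L R)) \<longlonglongrightarrow> 0" by metis
  have dL: "d R (Rep_uni (X n) R) (L R) \<le> e"
    if R: "banach_star_algebra R" and M: "\<And>m n. m \<ge> M ==> n \<ge> M ==> norm (X m - X n) < e" and n: "n \<ge> M" for R n M e
  proof (rule LIMSEQ_le_const[where X = "\<lambda>m. e + d R (Rep_uni (X m) R) (L R)"])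
    show "(\<lambda>m. e + d R (Rep_uni (X m) R) (L R)) \<longlonglongrightarrow> e"
      using tendsto_add[OF tendsto_const[of e] L(2)[OF R]] by simp
    show "\<exists>N. \<forall>m\<ge>N. d R (Rep_uni (X n) R) (L R) \<le> e + d R (Rep_uni (X m) R) (L R)"
    proof (intro exI[of _ M] allI impI)
      fix m assume "M \<le> m"
      then show "d R (Rep_uni (X n) R) (L R) \<le> e + d R (Rep_uni (X m) R) (L R)"
        using tri[OF R uni_mem[OF R, of "X n"] uni_mem[OF R, of "X m"] L(1)[OF R]] dn[OF R, of "X n" "X m"] M[OF n, of m] by simp
    qed
  qed
  obtain N where N: "\<And>m n. m \<ge> N ==> n \<ge> N ==> norm (X m - X n) < 1" using X'[of 1] by auto
  have bL: "unit_norm R (L R) \<le> 1 + norm (X N)" if R: "banach_star_algebra R" for R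
  proof -
    interpret banach_star_algebra R by (rule R)
    have c: "d R x (0, \<zero>\<^bsub>R\<^esub>) = unit_norm R x" if "snd x \<in> carrier R" for x
      using that by (simp add: d_def unit_norm_def a_minus_def uminus_sm)
    have c2: "d R x y = d R y x" if "snd x \<in> carrier R" "snd y \<in> carrier R" for x y
      using that by (simp add: d_def norm_minus_commute nrm_minus_commute)
    have "d R (L R) (0, \<zero>\<^bsub>R\<^esub>) \<le> d R (Rep_uni (X N) R) (L R) + d R (Rep_uni (X N) R) (0, \<zero>\<^bsub>R\<^esub>)"
      using tri[OF R L(1)[OF R] uni_mem[OF R, of "X N"], of "(0, \<zero>\<^bsub>R\<^esub>)"] c2[OF L(1)[OF R] uni_mem[OF R, of "X N"]] by simp
    also have "\<dots> \<le> 1 + norm (X N)"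
      using dL[OF R N order_refl] unit_norm_le[OF R, of "X N"] uni_mem[OF R, of "X N"] by (intro add_mono) (auto simp: c norm_uni_def)
    finally show ?thesis using c[OF L(1)[OF R]] by simp
  qed
  have RL: "Rep_uni (uni_of L) R = L R" if "banach_star_algebra R" for R
    by (rule Rep_uni_of[OF L(1) bL that])
  have "X \<longlonglongrightarrow> uni_of L"
  proof (rule metric_LIMSEQ_I)
    fix e :: real assume e: "0 < e"
    then obtain M where M: "\<And>m n. m \<ge> M ==> n \<ge> M ==> norm (X m - X n) < e / 2" using X'[of "e / 2"] by auto
    have "norm (X n - uni_of L) \<le> e / 2" if n: "n \<ge> M" for n
      unfolding norm_uni_def
    proof (rule uni_norm_le)
      fix R :: "'a normed_star_alg" assume R: "banach_star_algebra R"
      interpret banach_star_algebra R by (rule R)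
      have "Rep_uni (X n - uni_of L) R = (fst (Rep_uni (X n) R) - fst (L R), snd (Rep_uni (X n) R) \<ominus>\<^bsub>R\<^esub> snd (L R))"
        by (simp only: Rep_uni_diff[OF R] RL[OF R])
      then have "unit_norm R (Rep_uni (X n - uni_of L) R) = d R (Rep_uni (X n) R) (L R)" by (simp add: d_def unit_norm_def)
      then show "unit_norm R (Rep_uni (X n - uni_of L) R) \<le> e / 2" using dL[OF R M n] by simp
    qed
    then have "dist (X n) (uni_of L) \<le> e / 2" if "n \<ge> M" for n using that by (simp only: dist_norm)
    then have "dist (X n) (uni_of L) < e" if "n \<ge> M" for n using that e by fastforce
    then show "\<exists>M. \<forall>n\<ge>M. dist (X n) (uni_of L) < e" by blast
  qed
  then show "convergent X" by (rule convergentI)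
qed

instantiation uni :: (type) cbstar
begin

definition "cx = (cx_uni' :: complex => 'a uni)"
definition "adj = (adj_uni' :: 'a uni => 'a uni)"

instance
proof
  fix F G :: "'a uni" and z w :: complex and r :: real
  note ua = uni_algebra and defs = cx_uni_def adj_uni_def
  show "cx (z + w) = (cx z + cx w :: 'a uni)" unfolding defs by (rule ua(12))
  show "cx (z * w) = (cx z * cx w :: 'a uni)" unfolding defs by (rule ua(13))
  show "cx z * F = F * cx z" unfolding defs by (rule ua(11))
  show "adj (F + G) = adj F + adj G" unfolding defs by (rule ua(15))
  show "adj (F * G) = adj G * adj F" unfolding defs by (rule ua(16))
  show "adj (adj F) = F" unfolding defs by (rule ua(17))
  show "adj (cx z) = (cx (cnj z) :: 'a uni)" unfolding defs by (rule ua(18))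
  show "norm (adj F) = norm F" unfolding adj_uni_def by (rule uni_norm_props)
  show "norm (cx z * F) = cmod z * norm F" unfolding defs by (simp only: ua(10)[symmetric] uni_norm_props(4))
  show "cx (complex_of_real r) = (r *\<^sub>R 1 :: 'a uni)" by (simp add: scaleR_uni_def cx_uni_def cx_uni'_def)
qed

end

section \<open>A Banach *-algebra as a factor of the product\<close>

definition emb :: "'a normed_star_alg => 'a => 'a uni" where
  "emb A a = uni_of (\<lambda>R. if R = A then (0, a) else (0, \<zero>\<^bsub>R\<^esub>))"

definition prj :: "'a normed_star_alg => 'a uni => 'a" where "prj A F = snd (Rep_uni F A)"

definition chr :: "'a normed_star_alg => 'a uni => complex" where "chr A F = fst (Rep_uni F A)"

text \<open>The copy of the unitization of \<open>A\<close> inside the product: families that are scalar away from \<open>A\<close>, with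
  the same scalar everywhere.\<close>

definition unitized :: "'a normed_star_alg => 'a uni set" where
  "unitized A = {F. F = cx (chr A F) + emb A (prj A F)}"

lemmas Rep_simps = Rep_uni_ops[folded adj_uni_def]

lemma Rep_cx: "banach_star_algebra R ==> Rep_uni (cx z) R = (z, \<zero>\<^bsub>R\<^esub>)"
proof -
  assume R: "banach_star_algebra R"
  interpret banach_star_algebra R by (rule R)
  show ?thesis by (simp add: cx_uni_def cx_uni'_def Rep_uni_ops[OF R] unitization_def)
qed

locale uni_factor = banach_star_algebra A for A :: "'a normed_star_alg" (structure)
begin

lemma banach_A: "banach_star_algebra A" by (rule banach_star_algebra_axioms)

lemma Rep_emb:
  assumes "a \<in> carrier A" "banach_star_algebra R"
  shows "Rep_uni (emb A a) R = (if R = A then (0, a) else (0, \<zero>\<^bsub>R\<^esub>))"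
proof -
  have z: "\<zero>\<^bsub>R\<^esub> \<in> carrier R" "nrm R \<zero>\<^bsub>R\<^esub> = 0" if "banach_star_algebra R" for R :: "'a normed_star_alg"
  proof -
    interpret B: banach_star_algebra R by (rule that)
    show "\<zero>\<^bsub>R\<^esub> \<in> carrier R" "nrm R \<zero>\<^bsub>R\<^esub> = 0" by auto
  qed
  show ?thesis unfolding emb_def
    by (rule Rep_uni_of[OF _ _ assms(2), of _ "nrm A a"]) (use assms(1) z in \<open>auto simp: unit_norm_def\<close>)
qed

lemma prj_closed [simp, intro]: "prj A F \<in> carrier A" unfolding prj_def by (rule uni_mem[OF banach_A])

lemma prj_emb [simp]: "a \<in> carrier A ==> prj A (emb A a) = a"
  and chr_emb [simp]: "a \<in> carrier A ==> chr A (emb A a) = 0"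
  by (simp_all add: prj_def chr_def Rep_emb banach_A)

lemma unit_ops: "smult (unitization A) z x = (z * fst x, z \<odot> snd x)" "star (unitization A) x = (cnj (fst x), star A (snd x))"
  by (simp_all add: unitization_def case_prod_beta)

lemma prj_simps:
  "prj A 0 = \<zero>" "prj A 1 = \<zero>" "prj A (cx z) = \<zero>" "prj A (F + G) = prj A F \<oplus> prj A G"
  "prj A (F * G) = chr A F \<odot> prj A G \<oplus> chr A G \<odot> prj A F \<oplus> prj A F \<otimes> prj A G"
  "prj A (adj F) = star A (prj A F)" "prj A (F - G) = prj A F \<ominus> prj A G"
  by (simp_all add: prj_def chr_def Rep_simps[OF banach_A] Rep_cx[OF banach_A] Rep_uni_diff[OF banach_A] unit_ops unitization_simps)

lemma chr_simps:
  "chr A 0 = 0" "chr A 1 = 1" "chr A (cx z) = z" "chr A (F + G) = chr A F + chr A G"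
  "chr A (F * G) = chr A F * chr A G" "chr A (adj F) = cnj (chr A F)" "chr A (F - G) = chr A F - chr A G"
  by (simp_all add: prj_def chr_def Rep_simps[OF banach_A] Rep_cx[OF banach_A] Rep_uni_diff[OF banach_A] unit_ops unitization_simps)

lemma prj_cx_mult: "prj A (cx z * F) = z \<odot> prj A F"
  by (simp add: prj_simps chr_simps)

lemma norm_prj_chr: "cmod (chr A F) + nrm A (prj A F) \<le> norm F"
  using unit_norm_le[OF banach_A, of F] by (simp add: unit_norm_def norm_uni_def prj_def chr_def)

lemma norm_prj: "nrm A (prj A F) \<le> norm F" using norm_prj_chr[of F] norm_ge_zero[of "chr A F"] by linarith
lemma norm_chr: "cmod (chr A F) \<le> norm F" using norm_prj_chr[of F] nrm_nonneg[OF prj_closed, of F] by linarith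

lemma emb_eqI:
  assumes a: "a \<in> carrier A" and F: "\<And>R. banach_star_algebra R ==> R \<noteq> A ==> Rep_uni F R = (0, \<zero>\<^bsub>R\<^esub>)"
    "chr A F = 0" "prj A F = a"
  shows "F = emb A a"
proof (rule uni_eqI)
  fix R :: "'a normed_star_alg" assume R: "banach_star_algebra R"
  show "Rep_uni F R = Rep_uni (emb A a) R"
  proof (cases "R = A")
    case True
    then show ?thesis using Rep_emb[OF a R] F(2,3) by (simp add: prj_def chr_def prod_eq_iff)
  qed (simp add: Rep_emb[OF a R] F(1)[OF R])
qed

lemma emb_simps:
  assumes a: "a \<in> carrier A" and b: "b \<in> carrier A"
  shows "emb A (a \<oplus> b) = emb A a + emb A b" "emb A (a \<otimes> b) = emb A a * emb A b"
    "emb A (z \<odot> a) = cx z * emb A a" "emb A (star A a) = adj (emb A a)" "emb A \<zero> = 0"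
proof -
  have *: "\<zero>\<^bsub>R\<^esub> \<in> carrier R" "z \<odot>\<^bsub>R\<^esub> \<zero>\<^bsub>R\<^esub> = \<zero>\<^bsub>R\<^esub>" "star R \<zero>\<^bsub>R\<^esub> = \<zero>\<^bsub>R\<^esub>"
      "\<zero>\<^bsub>R\<^esub> \<oplus>\<^bsub>R\<^esub> \<zero>\<^bsub>R\<^esub> = \<zero>\<^bsub>R\<^esub>" "\<zero>\<^bsub>R\<^esub> \<otimes>\<^bsub>R\<^esub> \<zero>\<^bsub>R\<^esub> = \<zero>\<^bsub>R\<^esub>"
      "x \<otimes>\<^bsub>unitization R\<^esub> y = (fst x * fst y, fst x \<odot>\<^bsub>R\<^esub> snd y \<oplus>\<^bsub>R\<^esub> fst y \<odot>\<^bsub>R\<^esub> snd x \<oplus>\<^bsub>R\<^esub> snd x \<otimes>\<^bsub>R\<^esub> snd y)"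
      "x \<oplus>\<^bsub>unitization R\<^esub> y = (fst x + fst y, snd x \<oplus>\<^bsub>R\<^esub> snd y)"
      "star (unitization R) x = (cnj (fst x), star R (snd x))"
    if R: "banach_star_algebra R" for R :: "'a normed_star_alg" and x y z
  proof -
    interpret B: banach_star_algebra R by (rule R)
    show "\<zero>\<^bsub>R\<^esub> \<in> carrier R" "z \<odot>\<^bsub>R\<^esub> \<zero>\<^bsub>R\<^esub> = \<zero>\<^bsub>R\<^esub>" "star R \<zero>\<^bsub>R\<^esub> = \<zero>\<^bsub>R\<^esub>" "\<zero>\<^bsub>R\<^esub> \<oplus>\<^bsub>R\<^esub> \<zero>\<^bsub>R\<^esub> = \<zero>\<^bsub>R\<^esub>"
      "\<zero>\<^bsub>R\<^esub> \<otimes>\<^bsub>R\<^esub> \<zero>\<^bsub>R\<^esub> = \<zero>\<^bsub>R\<^esub>" by simp_all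
    show "star (unitization R) x = (cnj (fst x), star R (snd x))" by (simp add: unitization_def case_prod_beta)
  qed (simp_all add: unitization_def case_prod_beta)
  note [simp] = Rep_simps Rep_emb[OF a] Rep_emb[OF b] Rep_cx *
  show "emb A (a \<oplus> b) = emb A a + emb A b"
    by (rule emb_eqI[symmetric]) (use a b in \<open>simp_all add: prj_simps chr_simps\<close>)
  show "emb A (a \<otimes> b) = emb A a * emb A b"
    by (rule emb_eqI[symmetric]) (use a b in \<open>simp_all add: prj_simps chr_simps\<close>)
  show "emb A (z \<odot> a) = cx z * emb A a"
    by (rule emb_eqI[symmetric]) (use a b in \<open>simp_all add: prj_simps chr_simps\<close>)
  show "emb A (star A a) = adj (emb A a)"
    by (rule emb_eqI[symmetric]) (use a b in \<open>simp_all add: prj_simps chr_simps\<close>)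
  show "emb A \<zero> = 0" by (rule emb_eqI[symmetric]) (simp_all add: prj_simps chr_simps)
qed

lemma emb_zero [simp]: "emb A \<zero> = 0" by (rule emb_simps(5)[OF M.zero_closed M.zero_closed])
lemma emb_add: "a \<in> carrier A ==> b \<in> carrier A ==> emb A (a \<oplus> b) = emb A a + emb A b" by (rule emb_simps)
lemma emb_mult: "a \<in> carrier A ==> b \<in> carrier A ==> emb A (a \<otimes> b) = emb A a * emb A b" by (rule emb_simps)
lemma emb_smult: "a \<in> carrier A ==> emb A (z \<odot> a) = cx z * emb A a" by (rule emb_simps)
lemma emb_star: "a \<in> carrier A ==> emb A (star A a) = adj (emb A a)" by (rule emb_simps)
lemma emb_uminus: "a \<in> carrier A ==> emb A (\<ominus> a) = - emb A a" by (simp add: uminus_sm emb_smult)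
lemma emb_minus: "a \<in> carrier A ==> b \<in> carrier A ==> emb A (a \<ominus> b) = emb A a - emb A b"
  by (simp add: a_minus_def emb_add emb_uminus)
lemma emb_eq_iff: "a \<in> carrier A ==> b \<in> carrier A ==> emb A a = emb A b \<longleftrightarrow> a = b" by (metis prj_emb)

lemma norm_unitized: assumes a: "a \<in> carrier A" shows "norm (cx z + emb A a) = cmod z + nrm A a"
proof (rule antisym)
  show "norm (cx z + emb A a) \<le> cmod z + nrm A a"
    unfolding norm_uni_def
  proof (rule uni_norm_le)
    fix R :: "'a normed_star_alg" assume R: "banach_star_algebra R"
    interpret B: banach_star_algebra R by (rule R)
    show "unit_norm R (Rep_uni (cx z + emb A a) R) \<le> cmod z + nrm A a"
      using a by (simp add: Rep_simps[OF R] Rep_cx[OF R] Rep_emb[OF a R] unit_norm_def B.unitization_simps)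
  qed
  show "cmod z + nrm A a \<le> norm (cx z + emb A a)"
    using norm_prj_chr[of "cx z + emb A a"] a by (simp add: prj_simps chr_simps)
qed

lemma norm_emb [simp]: "a \<in> carrier A ==> norm (emb A a) = nrm A a"
  using norm_unitized[of a 0] by simp

lemma unitizedI [simp, intro]: "a \<in> carrier A ==> cx z + emb A a \<in> unitized A"
  by (simp add: unitized_def chr_simps prj_simps)

lemma emb_unitized [simp, intro]: "a \<in> carrier A ==> emb A a \<in> unitized A"
  using unitizedI[of a 0] by simp

lemma unitized_eq: "F \<in> unitized A ==> F = cx (chr A F) + emb A (prj A F)" by (simp add: unitized_def)

lemma unitizedE: assumes "F \<in> unitized A" obtains z a where "a \<in> carrier A" "F = cx z + emb A a"
  using unitized_eq[OF assms] prj_closed by blast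

lemma bounded_linear_emb_prj: "bounded_linear (\<lambda>F. emb A (prj A F))"
  by (rule bounded_linear_intro[of _ 1])
    (auto simp: prj_simps emb_add scaleR_cx chr_simps emb_smult norm_prj)

lemma bounded_linear_cx_chr: "bounded_linear (\<lambda>F. cx (chr A F) :: 'a uni)"
  by (rule bounded_linear_intro[of _ 1]) (auto simp: chr_simps cx_add scaleR_cx cx_mult norm_chr)

lemma closed_unitized: "closed (unitized A)"
  unfolding unitized_def
  by (intro closed_Collect_eq continuous_intros linear_continuous_on bounded_linear_emb_prj bounded_linear_cx_chr)

lemma unital_star_algebra_unitized: "unital_star_algebra (unitized A)"
proof
  show "closed (unitized A)" by (rule closed_unitized)
  show "cx z \<in> unitized A" for z using unitizedI[of "\<zero>" z] by simp
  fix x assume x: "x \<in> unitized A"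
  then obtain z a where za: "a \<in> carrier A" "x = cx z + emb A a" by (rule unitizedE)
  have "adj x = cx (cnj z) + emb A (star A a)" using za by (simp add: adj_add emb_star)
  then show "adj x \<in> unitized A" using za by simp
  { fix y assume "y \<in> unitized A"
    then obtain w b where wb: "b \<in> carrier A" "y = cx w + emb A b" by (rule unitizedE)
    have "x + y = cx (z + w) + emb A (a \<oplus> b)" using za wb by (simp add: cx_add emb_add)
    then show "x + y \<in> unitized A" using za wb by (metis unitizedI M.a_closed)
    have "x * y = cx (z * w) + emb A (z \<odot> b \<oplus> w \<odot> a \<oplus> a \<otimes> b)"
      using za wb cx_commute[of w "emb A a"]
      by (simp add: emb_add emb_smult emb_mult distrib_left distrib_right cx_mult)
    then show "x * y \<in> unitized A" using za wb by (metis unitizedI M.a_closed sm_closed mult_closed) }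
  assume i: "has_inverse x"
  let ?y = "minv x"
  have xy: "x * ?y = 1" by (rule minv_right[OF i])
  have z: "z * chr A ?y = 1" using arg_cong[OF xy, of "chr A"] za by (simp add: chr_simps)
  show "?y \<in> unitized A"
    unfolding unitized_def mem_Collect_eq
  proof (rule uni_eqI)
    fix R :: "'a normed_star_alg" assume R: "banach_star_algebra R"
    interpret B: banach_star_algebra R by (rule R)
    show "Rep_uni ?y R = Rep_uni (cx (chr A ?y) + emb A (prj A ?y)) R"
    proof (cases "R = A")
      case True
      then show ?thesis using R by (simp add: Rep_simps Rep_cx Rep_emb unitization_simps) (simp add: chr_def prj_def)
    next
      case False
      have m: "snd (Rep_uni ?y R) \<in> carrier R" by (rule uni_mem[OF R])
      have "Rep_uni (x * ?y) R = (1, \<zero>\<^bsub>R\<^esub>)" by (simp add: xy Rep_simps[OF R])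
      then have "z * fst (Rep_uni ?y R) = 1" "z \<odot>\<^bsub>R\<^esub> snd (Rep_uni ?y R) = \<zero>\<^bsub>R\<^esub>"
        using False m za R by (simp_all add: Rep_simps Rep_cx Rep_emb B.unitization_simps)
      moreover have z0: "z \<noteq> 0" using z by auto
      moreover have "(1 / z) \<odot>\<^bsub>R\<^esub> (z \<odot>\<^bsub>R\<^esub> snd (Rep_uni ?y R)) = snd (Rep_uni ?y R)" using m z0 by (simp add: B.sm_sm)
      ultimately have "fst (Rep_uni ?y R) = chr A ?y" "snd (Rep_uni ?y R) = \<zero>\<^bsub>R\<^esub>"
        using z by (metis mult_cancel_left, simp)
      then show ?thesis using False R by (simp add: Rep_simps Rep_cx Rep_emb B.unitization_simps prod_eq_iff)
    qed
  qed
qed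

sublocale unital_star_algebra "unitized A" by (rule unital_star_algebra_unitized)

subsection \<open>Spectra\<close>

lemma inverses_unitization:
  assumes a: "a \<in> carrier A"
  shows "(\<exists>b. inverses (unitization A) (z, \<ominus> a) b) \<longleftrightarrow> has_inverse (cx z - emb A a)"
proof -
  interpret U: ring "unitization A" by (rule ring_unitization)
  have one: "is_one (unitization A) (1, \<zero>)" using U.one_closed U.l_one U.r_one by (simp add: is_one_def unitization_simps(4))
  have u: "unit_of (unitization A) = (1, \<zero>)"
    unfolding unit_of_def by (rule the_equality, rule one) (metis one is_one_def)
  define h where "h x = cx (fst x) + emb A (snd x)" for x
  have hm: "h (x \<otimes>\<^bsub>unitization A\<^esub> y) = h x * h y" if "snd x \<in> carrier A" "snd y \<in> carrier A" for x y
    using that cx_commute[of "fst y" "emb A (snd x)"]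
    by (simp add: h_def unitization_simps emb_add emb_smult emb_mult distrib_left distrib_right cx_mult)
  have hi: "h x = h y ==> x = y" if "snd x \<in> carrier A" "snd y \<in> carrier A" for x y
    using that by (auto simp: h_def prod_eq_iff dest: arg_cong[of _ _ "chr A"] arg_cong[of _ _ "prj A"])
      (metis chr_simps(3,4) chr_emb add_0_right, metis prj_simps(3,4) prj_emb M.l_zero)
  have h0: "h (z, \<ominus> a) = cx z - emb A a" using a by (simp add: h_def emb_uminus)
  have h1: "h (1, \<zero>) = 1" by (simp add: h_def)
  show ?thesis
  proof
    assume "\<exists>b. inverses (unitization A) (z, \<ominus> a) b"
    then obtain b where b: "snd b \<in> carrier A" "(z, \<ominus> a) \<otimes>\<^bsub>unitization A\<^esub> b = (1, \<zero>)" "b \<otimes>\<^bsub>unitization A\<^esub> (z, \<ominus> a) = (1, \<zero>)"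
      by (auto simp: inverses_def u unitization_simps(1))
    show "has_inverse (cx z - emb A a)"
      using hm[of "(z, \<ominus> a)" b] hm[of b "(z, \<ominus> a)"] b a by (intro has_inverseI[of _ "h b"]) (simp_all add: h0 h1)
  next
    assume i: "has_inverse (cx z - emb A a)"
    let ?y = "minv (cx z - emb A a)"
    have "cx z - emb A a \<in> unitized A" using a by simp
    then have yU: "?y \<in> unitized A" using i by (rule minv_mem)
    define b where "b = (chr A ?y, prj A ?y)"
    have b: "snd b \<in> carrier A" "h b = ?y" using unitized_eq[OF yU] by (auto simp: b_def h_def)
    have c: "snd ((z, \<ominus> a) \<otimes>\<^bsub>unitization A\<^esub> b) \<in> carrier A" "snd (b \<otimes>\<^bsub>unitization A\<^esub> (z, \<ominus> a)) \<in> carrier A"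
      using a b by (simp_all add: unitization_simps)
    have "(z, \<ominus> a) \<otimes>\<^bsub>unitization A\<^esub> b = (1, \<zero>)"
      by (rule hi) (use a b c hm[of "(z, \<ominus> a)" b] minv_right[OF i] in \<open>simp_all add: h0 h1\<close>)
    moreover have "b \<otimes>\<^bsub>unitization A\<^esub> (z, \<ominus> a) = (1, \<zero>)"
      by (rule hi) (use a b c hm[of b "(z, \<ominus> a)"] minv_left[OF i] in \<open>simp_all add: h0 h1\<close>)
    ultimately have "inverses (unitization A) (z, \<ominus> a) b"
      using a b(1) by (cases b) (simp add: inverses_def u unitization_simps(1))
    then show "\<exists>b. inverses (unitization A) (z, \<ominus> a) b" by blast
  qed
qed

text \<open>Here the unit \<open>e\<close> is not the adjoined one, and \<open>z - a\<close> acts as \<open>z\<close> on the complementary idempotent \<open>1 - e\<close>.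
  This is why \<open>z = 0\<close> is excluded.\<close>

lemma inverses_unital:
  assumes e: "is_one A e" and a: "a \<in> carrier A" and z: "z \<noteq> 0"
  shows "(\<exists>b. inverses A (z \<odot> e \<ominus> a) b) \<longleftrightarrow> has_inverse (cx z - emb A a)"
proof -
  have u: "unit_of A = e" by (rule unit_of_eq[OF e])
  have ec: "e \<in> carrier A" using e by (simp add: is_one_def)
  have eb: "emb A e * emb A b = emb A b" "emb A b * emb A e = emb A b" if "b \<in> carrier A" for b
    using e that ec by (simp_all add: is_one_def flip: emb_mult)
  let ?E = "emb A e" and ?X = "cx z - emb A a"
  have zc: "z \<odot> e \<ominus> a \<in> carrier A" using ec a by simp
  have X: "emb A (z \<odot> e \<ominus> a) = ?X * ?E" "emb A (z \<odot> e \<ominus> a) = ?E * ?X"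
    using ec a eb[OF a] cx_commute[of z ?E] by (simp_all add: emb_minus emb_smult left_diff_distrib right_diff_distrib)
  have E1: "?X * (1 - ?E) = cx z * (1 - ?E)" "(1 - ?E) * ?X = cx z * (1 - ?E)"
    using eb[OF a] cx_commute[of z ?E] by (simp_all add: left_diff_distrib right_diff_distrib)
  show ?thesis
  proof
    assume "\<exists>b. inverses A (z \<odot> e \<ominus> a) b"
    then obtain b where b: "b \<in> carrier A" "(z \<odot> e \<ominus> a) \<otimes> b = e" "b \<otimes> (z \<odot> e \<ominus> a) = e"
      by (auto simp: inverses_def u)
    have b1: "?X * emb A b = ?E"
    proof -
      have "?X * (?E * emb A b) = ?E" using emb_mult[OF zc b(1)] by (simp add: b(2) X(1) mult.assoc)
      then show ?thesis using eb[OF b(1)] by simp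
    qed
    have b2: "emb A b * ?X = ?E"
    proof -
      have "(emb A b * ?E) * ?X = ?E" using emb_mult[OF b(1) zc] by (simp add: b(3) X(2) mult.assoc)
      then show ?thesis using eb[OF b(1)] by simp
    qed
    have zz: "cx z * cx (1 / z) = (1 :: 'a uni)" using z by (simp flip: cx_mult)
    show "has_inverse ?X"
    proof (rule has_inverseI[of _ "cx (1 / z) * (1 - ?E) + emb A b"])
      have "?X * (cx (1 / z) * (1 - ?E)) = 1 - ?E"
        unfolding cx_mult_swap[of ?X "1 / z" "1 - ?E"] E1 cx_mult_left using z by simp
      then show "?X * (cx (1 / z) * (1 - ?E) + emb A b) = 1" by (simp only: distrib_left b1) simp
      have "cx (1 / z) * (1 - ?E) * ?X = 1 - ?E"
        unfolding mult.assoc E1 cx_mult_left using z by simp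
      then show "(cx (1 / z) * (1 - ?E) + emb A b) * ?X = 1" by (simp only: distrib_right b2) simp
    qed
  next
    assume i: "has_inverse ?X"
    let ?b = "prj A (?E * minv ?X)"
    have U: "?E * minv ?X \<in> unitized A" using a ec i by (intro mult_mem minv_mem) auto
    have "chr A (?E * minv ?X) = 0" using ec by (simp add: chr_simps)
    then have b: "emb A ?b = ?E * minv ?X" using unitized_eq[OF U] by simp
    have c: "minv ?X * ?E = ?E * minv ?X" using minv_commute[OF i, of ?E] X by simp
    have "emb A ((z \<odot> e \<ominus> a) \<otimes> ?b) = ?E * ?X * (minv ?X * ?E)"
      using zc by (simp only: emb_mult[OF zc prj_closed] b X(2) c)
    also have "\<dots> = ?E" using i eb[OF ec] by (simp add: minv_mult_cancel mult.assoc)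
    finally have 1: "(z \<odot> e \<ominus> a) \<otimes> ?b = e" using zc ec by (simp add: emb_eq_iff)
    have "emb A (?b \<otimes> (z \<odot> e \<ominus> a)) = ?E * minv ?X * (?X * ?E)"
      using zc by (simp only: emb_mult[OF prj_closed zc] b X(1))
    also have "\<dots> = ?E" using i eb[OF ec] by (simp add: minv_mult_cancel mult.assoc)
    finally have 2: "?b \<otimes> (z \<odot> e \<ominus> a) = e" using zc ec by (simp add: emb_eq_iff)
    show "\<exists>b. inverses A (z \<odot> e \<ominus> a) b"
      using 1 2 zc by (intro exI[of _ ?b]) (simp add: inverses_def u)
  qed
qed

lemma spectrum_iff:
  assumes "a \<in> carrier A" "z \<noteq> 0"
  shows "z \<in> Defs.spectrum A a \<longleftrightarrow> \<not> has_inverse (cx z - emb A a)"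
proof (cases "unital A")
  case True
  have "z \<in> Defs.spectrum A a \<longleftrightarrow> \<not> (\<exists>b. inverses A (z \<odot> unit_of A \<ominus> a) b)"
    by (simp only: Defs.spectrum_def True if_True mem_Collect_eq)
  then show ?thesis by (simp only: inverses_unital[OF is_one_unit_of[OF True] assms])
next
  case False
  have "z \<in> Defs.spectrum A a \<longleftrightarrow> \<not> (\<exists>b. inverses (unitization A) (z, \<ominus> a) b)"
    by (simp only: Defs.spectrum_def False if_False mem_Collect_eq)
  then show ?thesis by (simp only: inverses_unitization[OF assms(1)])
qed

lemma symmetric_algebra_iff:
  "symmetric_algebra A \<longleftrightarrow> (\<forall>b\<in>carrier A. \<forall>z. z \<notin> complex_of_real ` {0..} \<longrightarrow> has_inverse (cx z - adj (emb A b) * emb A b))"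
proof -
  have "0 \<in> complex_of_real ` {0..}" by (auto intro: image_eqI[of _ _ 0])
  then have "z \<in> Defs.spectrum A (star A b \<otimes> b) \<longrightarrow> z \<in> complex_of_real ` {0..}"
    if "z \<notin> complex_of_real ` {0..} \<longrightarrow> has_inverse (cx z - adj (emb A b) * emb A b)" "b \<in> carrier A" for b z
    using that spectrum_iff[of "star A b \<otimes> b" z] by (cases "z = 0") (auto simp: emb_mult emb_star)
  moreover have "has_inverse (cx z - adj (emb A b) * emb A b)"
    if "z \<in> Defs.spectrum A (star A b \<otimes> b) \<longrightarrow> z \<in> complex_of_real ` {0..}" "b \<in> carrier A" "z \<notin> complex_of_real ` {0..}" for b z
    using that spectrum_iff[of "star A b \<otimes> b" z] \<open>0 \<in> complex_of_real ` {0..}\<close> by (cases "z = 0") (auto simp: emb_mult emb_star)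
  ultimately show ?thesis unfolding symmetric_algebra_def by blast
qed

lemma self_adjoint_unitized:
  assumes "h \<in> unitized A" "adj h = h"
  obtains r a where "a \<in> carrier A" "h = cx (complex_of_real r) + emb A a" "star A a = a"
proof -
  have "cnj (chr A h) = chr A h" using chr_simps(6)[of h] assms(2) by simp
  then have c: "chr A h = complex_of_real (Re (chr A h))" by (simp add: complex_eq_iff)
  show ?thesis
    by (rule that[of "prj A h" "Re (chr A h)"]) (use c assms unitized_eq[OF assms(1)] prj_simps(6)[of h] in auto)
qed

lemma hermitianI:
  assumes "\<And>a z. a \<in> carrier A ==> star A a = a ==> Im z \<noteq> 0 ==> has_inverse (cx z - emb A a)"
  shows "hermitian (unitized A)"
proof
  fix h z assume h: "h \<in> unitized A" "adj h = h" and z: "Im z \<noteq> 0"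
  obtain r a where ra: "a \<in> carrier A" "h = cx (complex_of_real r) + emb A a" "star A a = a"
    using self_adjoint_unitized[OF h] .
  have "has_inverse (cx (z - complex_of_real r) - emb A a)" using assms ra z by simp
  then show "has_inverse (cx z - h)" by (simp add: ra(2) cx_diff diff_diff_add)
qed

text \<open>If \<open>z\<close> is not real then \<open>z\<^sup>2\<close> is not in \<open>[0,\<infinity>)\<close>, and \<open>z\<^sup>2 - a\<^sup>2 = (z - a) (z + a)\<close>.\<close>

lemma symmetric_hermitian:
  assumes "symmetric_algebra A" shows "hermitian (unitized A)"
proof (rule hermitianI)
  fix a z assume a: "a \<in> carrier A" "star A a = a" and z: "Im z \<noteq> 0"
  have "z * z \<notin> complex_of_real ` {0..}"
  proof
    assume "z * z \<in> complex_of_real ` {0..}"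
    then obtain r where r: "0 \<le> r" "z * z = complex_of_real r" by auto
    then have "Re z * Im z = 0" "(Re z)\<^sup>2 - (Im z)\<^sup>2 = r" by (auto simp: complex_eq_iff power2_eq_square)
    then have "- ((Im z)\<^sup>2) = r" using z by auto
    moreover have "0 < (Im z)\<^sup>2" using z by simp
    ultimately show False using r(1) by linarith
  qed
  then have i: "has_inverse (cx (z * z) - emb A a * emb A a)"
    using assms a by (auto simp: symmetric_algebra_iff emb_star[symmetric])
  have e: "(cx z - emb A a) * (cx z + emb A a) = cx (z * z) - emb A a * emb A a"
    and e': "(cx z + emb A a) * (cx z - emb A a) = cx (z * z) - emb A a * emb A a"
    using cx_commute[of z "emb A a"] by (simp_all add: algebra_simps cx_mult)
  show "has_inverse (cx z - emb A a)"
    by (rule has_inverse_factor[of _ "cx z + emb A a"]) (use i e e' in auto)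
qed

end

section \<open>\<open>C\<^sup>*\<close>-algebras are Hermitian\<close>

lemma commuting_power_diff:
  fixes x y :: "'a::ring_1"
  assumes "x * y = y * x"
  shows "\<exists>S. x ^ n - y ^ n = (x - y) * S \<and> (\<forall>c. c * x = x * c \<longrightarrow> c * y = y * c \<longrightarrow> c * S = S * c)"
proof (induction n)
  case 0 show ?case by (intro exI[of _ 0]) simp
next
  case (Suc n)
  then obtain S where S: "x ^ n - y ^ n = (x - y) * S" "\<And>c. c * x = x * c ==> c * y = y * c ==> c * S = S * c" by blast
  have "x ^ Suc n - y ^ Suc n = (x - y) * x ^ n + y * (x ^ n - y ^ n)" by (simp add: algebra_simps)
  also have "y * (x ^ n - y ^ n) = (x - y) * (y * S)"
    unfolding S(1) using assms by (simp add: algebra_simps flip: mult.assoc)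
  finally have 1: "x ^ Suc n - y ^ Suc n = (x - y) * (x ^ n + y * S)" by (simp add: distrib_left)
  have 2: "c * (x ^ n + y * S) = (x ^ n + y * S) * c" if c: "c * x = x * c" "c * y = y * c" for c
  proof -
    have "c * x ^ n = x ^ n * c" using power_commuting_commutes[of x c n] c(1) by simp
    moreover have "c * (y * S) = y * S * c" by (metis c S(2) mult.assoc)
    ultimately show ?thesis by (simp add: distrib_left distrib_right)
  qed
  show ?case using 1 2 by blast
qed

lemma commuting_power_mult:
  fixes x y :: "'a::monoid_mult"
  assumes "x * y = y * x" shows "x ^ n * y ^ n = (x * y) ^ n"
proof (induction n)
  case (Suc n)
  have "x ^ Suc n * y ^ Suc n = x * (x ^ n * y) * y ^ n" by (simp add: mult.assoc)
  also have "x ^ n * y = y * x ^ n" by (rule power_commuting_commutes[OF assms])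
  finally show ?case by (simp add: mult.assoc Suc[symmetric])
qed simp

locale cstar_factor = cstar_algebra A for A :: "'a normed_star_alg" (structure)
begin

sublocale uni_factor A by unfold_locales

lemma norm_adj_mult: "a \<in> carrier A ==> norm (adj (emb A a) * emb A a) = (norm (emb A a))\<^sup>2"
  using cstar_identity[of a] by (simp flip: emb_star emb_mult)

lemma norm_adj_mult': "F \<in> unitized A ==> chr A F = 0 ==> norm (adj F * F) = (norm F)\<^sup>2"
proof -
  assume "F \<in> unitized A" "chr A F = 0"
  then have "F = emb A (prj A F)" using unitized_eq[of F] by simp
  then show ?thesis by (metis norm_adj_mult prj_closed)
qed

text \<open>If \<open>w\<close> is in the spectrum of a self-adjoint \<open>E\<close> then \<open>w (w + i t) ^ n\<close> is in the spectrum of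
  \<open>E (E + i t) ^ n\<close>, whose norm is at most \<open>\<parallel>E\<parallel> sqrt (\<parallel>E\<parallel>\<^sup>2 + t\<^sup>2) ^ n\<close>. For large \<open>n\<close> and suitable \<open>t\<close>
  this forces \<open>w\<close> to be real. The factor \<open>E\<close> keeps the polynomial inside the possibly non-unital algebra, where
  the \<open>C\<^sup>*\<close>-identity is available.\<close>

theorem cstar_hermitian: "hermitian (unitized A)"
proof (rule hermitianI)
  fix a w assume a: "a \<in> carrier A" "star A a = a" and w: "Im w \<noteq> 0"
  define E where "E = emb A a"
  have EU: "E \<in> unitized A" and aE: "adj E = E" and cE: "chr A E = 0"
    using a by (auto simp: E_def simp flip: emb_star)
  show "has_inverse (cx w - emb A a)"
  proof (rule ccontr)
    assume ni: "\<not> has_inverse (cx w - emb A a)"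
    have bound: "(cmod w)\<^sup>2 * ((cmod (w + \<i> * of_real t))\<^sup>2) ^ n \<le> (norm E)\<^sup>2 * ((norm E)\<^sup>2 + t\<^sup>2) ^ n" for t :: real and n
    proof -
      define v where "v = \<i> * complex_of_real t"
      define V where "V = E + cx v"
      define V' where "V' = E + cx (- v)"
      define W where "W = (cx (w + v) :: 'a uni)"
      define Q where "Q = E * V ^ n"
      have comm: "E * V = V * E" "V' * V = V * V'" "V' * E = E * V'"
        using cx_commute[of v E] by (simp_all add: V_def V'_def algebra_simps)
      have WV': "W * V = V * W" unfolding W_def by (rule cx_commute)
      have VV: "V' * V = E * E + cx (complex_of_real (t\<^sup>2))"
      proof -
        have "V' * V = E * E - cx (v * v)" using cx_commute[of v E] by (simp add: V_def V'_def algebra_simps cx_mult)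
        also have "v * v = - complex_of_real (t\<^sup>2)" by (simp add: v_def power2_eq_square algebra_simps)
        finally show ?thesis by simp
      qed
      have aV: "adj V = V'" by (simp add: V_def V'_def adj_add aE v_def)
      have "adj Q * Q = V' ^ n * E * (E * V ^ n)" by (simp add: Q_def adj_mult adj_power aV aE)
      also have "V' ^ n * E = E * V' ^ n" by (rule power_commuting_commutes[OF comm(3)])
      also have "E * V' ^ n * (E * V ^ n) = E * (V' ^ n * E) * V ^ n" by (simp add: mult.assoc)
      also have "V' ^ n * E = E * V' ^ n" by (rule power_commuting_commutes[OF comm(3)])
      also have "E * (E * V' ^ n) * V ^ n = E * E * (V' * V) ^ n"
        by (simp add: mult.assoc commuting_power_mult[OF comm(2)])
      finally have "norm (adj Q * Q) \<le> norm (E * E) * norm ((V' * V) ^ n)" by (metis norm_mult_ineq)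
      also have "\<dots> \<le> (norm E * norm E) * norm (V' * V) ^ n"
        by (intro mult_mono norm_mult_ineq norm_power_ineq) auto
      also have "\<dots> \<le> (norm E * norm E) * ((norm E)\<^sup>2 + t\<^sup>2) ^ n"
      proof (intro mult_left_mono power_mono)
        have "norm (V' * V) \<le> norm (E * E) + norm (cx (complex_of_real (t\<^sup>2)) :: 'a uni)"
          unfolding VV by (rule norm_triangle_ineq)
        also have "norm (cx (complex_of_real (t\<^sup>2)) :: 'a uni) = t\<^sup>2" by (simp only: norm_cx norm_of_real) simp
        also have "norm (E * E) + t\<^sup>2 \<le> (norm E)\<^sup>2 + t\<^sup>2" using norm_mult_ineq[of E E] by (simp add: power2_eq_square)
        finally show "norm (V' * V) \<le> (norm E)\<^sup>2 + t\<^sup>2" .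
      qed auto
      finally have nQ: "norm (adj Q * Q) \<le> (norm E)\<^sup>2 * ((norm E)\<^sup>2 + t\<^sup>2) ^ n" by (simp add: power2_eq_square)
      have "Q \<in> unitized A" "chr A Q = 0" using EU cE by (auto simp: Q_def V_def chr_simps)
      then have nQ2: "(norm Q)\<^sup>2 \<le> (norm E)\<^sup>2 * ((norm E)\<^sup>2 + t\<^sup>2) ^ n" using nQ norm_adj_mult'[of Q] by simp
      have "cmod (w * (w + v) ^ n) \<le> norm Q"
      proof (rule ccontr)
        assume "\<not> ?thesis"
        then have "rad Q < cmod (w * (w + v) ^ n)" using rad_le_norm[of Q] by linarith
        then have i: "has_inverse (cx (w * (w + v) ^ n) - Q)" by (rule rad_less_has_inverse)
        obtain S where S: "W ^ n - V ^ n = (W - V) * S" "\<And>c. c * W = W * c ==> c * V = V * c ==> c * S = S * c"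
          using commuting_power_diff[OF WV', of n] by blast
        have WV: "W - V = cx w - E" by (simp add: W_def V_def cx_add)
        have "cx (w * (w + v) ^ n) - Q = (cx w - E) * W ^ n + E * (W ^ n - V ^ n)"
          by (simp add: W_def Q_def cx_mult cx_power algebra_simps)
        also have "E * (W ^ n - V ^ n) = (cx w - E) * (E * S)"
          unfolding S(1) WV using cx_commute[of w E] by (simp add: algebra_simps flip: mult.assoc)
        finally have f: "cx (w * (w + v) ^ n) - Q = (cx w - E) * (W ^ n + E * S)" by (simp add: distrib_left)
        have cS: "(cx w - E) * S = S * (cx w - E)"
        proof (rule S(2))
          show "(cx w - E) * W = W * (cx w - E)" unfolding W_def by (rule cx_commute[symmetric])
          show "(cx w - E) * V = V * (cx w - E)"
            using cx_commute[of w E] cx_commute[of v E] cx_commute[of v "cx w :: 'a uni"] by (simp add: V_def algebra_simps)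
        qed
        have cW: "(cx w - E) * W ^ n = W ^ n * (cx w - E)" unfolding W_def cx_power[symmetric] by (rule cx_commute[symmetric])
        have cE': "(cx w - E) * E = E * (cx w - E)" using cx_commute[of w E] by (simp add: algebra_simps)
        have "(cx w - E) * (E * S) = E * S * (cx w - E)" by (metis cE' cS mult.assoc)
        then have "(cx w - E) * (W ^ n + E * S) = (W ^ n + E * S) * (cx w - E)"
          by (simp only: distrib_left distrib_right cW)
        then have "has_inverse (cx w - E)" using has_inverse_factor i f by metis
        then show False using ni by (simp add: E_def)
      qed
      then have lQ: "(cmod (w * (w + v) ^ n))\<^sup>2 \<le> (norm Q)\<^sup>2" by (rule power_mono) simp
      have eq: "(cmod (w * (w + v) ^ n))\<^sup>2 = (cmod w)\<^sup>2 * ((cmod (w + v))\<^sup>2) ^ n"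
        by (simp add: norm_mult norm_power power_mult_distrib power_mult[symmetric] mult.commute)
      show ?thesis using order_trans[OF lQ nQ2] by (simp only: eq v_def[symmetric])
    qed
    have w0: "0 < (cmod w)\<^sup>2" using w by auto
    have le: "(cmod (w + \<i> * of_real t))\<^sup>2 \<le> (norm E)\<^sup>2 + t\<^sup>2" for t :: real
    proof (rule ccontr)
      assume "\<not> ?thesis"
      then have lt: "(norm E)\<^sup>2 + t\<^sup>2 < (cmod (w + \<i> * of_real t))\<^sup>2" by simp
      define q where "q = (norm E)\<^sup>2 + t\<^sup>2"
      define p where "p = (cmod (w + \<i> * of_real t))\<^sup>2"
      have q: "0 \<le> q" "q < p" using lt by (auto simp: q_def p_def)
      show False
      proof (cases "q = 0")
        case True
        then have "norm E = 0" by (simp add: q_def add_nonneg_eq_0_iff)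
        then have "(cmod w)\<^sup>2 * p ^ 1 \<le> 0" using bound[of t 1] by (simp add: p_def)
        moreover have "0 < (cmod w)\<^sup>2 * p ^ 1" using w0 q by simp
        ultimately show False by linarith
      next
        case False
        then have q0: "0 < q" using q by simp
        then have "1 < p / q" using q by simp
        then obtain n where "(norm E)\<^sup>2 / (cmod w)\<^sup>2 < (p / q) ^ n" using real_arch_pow by blast
        then have "(norm E)\<^sup>2 * q ^ n < (cmod w)\<^sup>2 * p ^ n" using w0 q0 by (simp add: power_divide field_simps)
        then show False using bound[of t n] by (simp add: p_def q_def)
      qed
    qed
    \<comment> \<open>makes the cross term \<open>2 t Im w\<close> of \<open>\<bar>w + i t\<bar>\<^sup>2\<close> exceed \<open>\<parallel>E\<parallel>\<^sup>2\<close>\<close>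
    define t where "t = ((norm E)\<^sup>2 + 1) / (2 * Im w)"
    have "(cmod (w + \<i> * of_real t))\<^sup>2 = (Re w)\<^sup>2 + (Im w + t)\<^sup>2" by (simp add: cmod_power2)
    also have "\<dots> = (Re w)\<^sup>2 + (Im w)\<^sup>2 + 2 * Im w * t + t\<^sup>2" by (simp add: power2_sum)
    also have "2 * Im w * t = (norm E)\<^sup>2 + 1" using w by (simp add: t_def)
    finally show False using le[of t] by (smt (verit) zero_le_power2)
  qed
qed

sublocale hermitian "unitized A" by (rule cstar_hermitian)

text \<open>The \<open>C\<^sup>*\<close>-identity makes the norm multiplicative on the powers \<open>2 ^ n\<close>.\<close>

lemma rad_self_adjoint:
  assumes "a \<in> carrier A" "star A a = a" shows "rad (emb A a) = nrm A a"
proof (rule antisym)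
  show "rad (emb A a) \<le> nrm A a" using rad_le_norm[of "emb A a"] assms by simp
  define E where "E = emb A a"
  have E: "E \<in> unitized A" "adj E = E" "chr A E = 0" using assms by (auto simp: E_def simp flip: emb_star)
  have p: "norm (E ^ (2 ^ n)) = norm E ^ (2 ^ n) \<and> chr A (E ^ (2 ^ n)) = 0" for n
  proof (induction n)
    case (Suc n)
    have e: "E ^ (2 ^ Suc n) = adj (E ^ (2 ^ n)) * E ^ (2 ^ n)" by (simp add: adj_power E power_add[symmetric] mult_2)
    then have "norm (E ^ (2 ^ Suc n)) = (norm (E ^ (2 ^ n)))\<^sup>2" using Suc E by (simp add: norm_adj_mult')
    then show ?case using Suc e by (simp add: power_mult[symmetric] mult.commute chr_simps)
  qed (simp add: E)
  show "nrm A a \<le> rad (emb A a)"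
  proof (rule dense_ge)
    fix r assume r: "rad (emb A a) < r"
    obtain K where K: "0 < K" "\<And>n. norm (E ^ n) \<le> K * r ^ n" using rad_growth[OF r] unfolding E_def by blast
    have r0: "0 < r" using r rad_nonneg[of "emb A a"] by linarith
    have le: "norm E ^ (2 ^ n) \<le> K * r ^ (2 ^ n)" for n using K(2)[of "2 ^ n"] p[of n] by simp
    have "norm E \<le> r" by (rule le_of_power_two_growth[OF norm_ge_zero r0 le])
    then show "nrm A a \<le> r" using assms by (simp add: E_def)
  qed
qed

end

section \<open>Homomorphisms\<close>

text \<open>The unital extension of a homomorphism to the unitizations.\<close>

definition ulift :: "'a normed_star_alg => 'b normed_star_alg => ('a => 'b) => 'a uni => 'b uni" where
  "ulift A B \<phi> F = cx (chr A F) + emb B (\<phi> (prj A F))"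

locale uni_hom = A: uni_factor A + B: uni_factor B for A :: "'a normed_star_alg" and B :: "'b normed_star_alg" +
  fixes \<phi> assumes hom: "\<phi> \<in> star_hom A B"
begin

lemma hom_closed [simp, intro]: "a \<in> carrier A ==> \<phi> a \<in> carrier B"
  and hom_add: "a \<in> carrier A ==> b \<in> carrier A ==> \<phi> (a \<oplus>\<^bsub>A\<^esub> b) = \<phi> a \<oplus>\<^bsub>B\<^esub> \<phi> b"
  and hom_sm: "a \<in> carrier A ==> \<phi> (z \<odot>\<^bsub>A\<^esub> a) = z \<odot>\<^bsub>B\<^esub> \<phi> a"
  and hom_mult: "a \<in> carrier A ==> b \<in> carrier A ==> \<phi> (a \<otimes>\<^bsub>A\<^esub> b) = \<phi> a \<otimes>\<^bsub>B\<^esub> \<phi> b"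
  and hom_star: "a \<in> carrier A ==> \<phi> (star A a) = star B (\<phi> a)"
  using hom by (auto simp: star_hom_def)

lemma hom_zero: "\<phi> \<zero>\<^bsub>A\<^esub> = \<zero>\<^bsub>B\<^esub>" using hom_sm[of "\<zero>\<^bsub>A\<^esub>" 0] by simp

lemma hom_minus: "a \<in> carrier A ==> b \<in> carrier A ==> \<phi> (a \<ominus>\<^bsub>A\<^esub> b) = \<phi> a \<ominus>\<^bsub>B\<^esub> \<phi> b"
  by (simp add: A.minus_sm B.minus_sm hom_add hom_sm)

abbreviation "T \<equiv> ulift A B \<phi>"

lemma ulift_emb [simp]: "a \<in> carrier A ==> T (emb A a) = emb B (\<phi> a)" by (simp add: ulift_def)
lemma ulift_cx [simp]: "T (cx z) = cx z" by (simp add: ulift_def A.chr_simps A.prj_simps hom_zero)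
lemma ulift_1 [simp]: "T 1 = 1" using ulift_cx[of 1] by simp
lemma ulift_add: "T (F + G) = T F + T G"
  by (simp add: ulift_def A.chr_simps A.prj_simps hom_add B.emb_add cx_add)
lemma ulift_mult: "T (F * G) = T F * T G"
  using cx_commute[of "chr A G" "emb B (\<phi> (prj A F))"]
  by (simp add: ulift_def A.chr_simps A.prj_simps hom_add hom_sm hom_mult B.emb_add B.emb_smult B.emb_mult cx_mult distrib_left distrib_right)
lemma ulift_adj: "T (adj F) = adj (T F)"
  by (simp add: ulift_def A.chr_simps A.prj_simps hom_star B.emb_star adj_add)
lemma ulift_diff: "T (F - G) = T F - T G"
  by (simp add: ulift_def A.chr_simps A.prj_simps hom_minus B.emb_minus cx_diff)
lemma has_inverse_ulift: "has_inverse F ==> has_inverse (T F)"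
  by (rule has_inverseI[of _ "T (minv F)"]) (simp_all add: minv_left minv_right flip: ulift_mult)

end

text \<open>The spectral radius cannot grow under a homomorphism, and in a \<open>C\<^sup>*\<close>-algebra it is the norm of \<open>a\<^sup>* a\<close>.\<close>

lemma star_hom_contractive:
  fixes A :: "'a normed_star_alg" and B :: "'b normed_star_alg"
  assumes "banach_star_algebra A" "cstar_algebra B" "\<phi> \<in> star_hom A B" and a: "a \<in> carrier A"
  shows "nrm B (\<phi> a) \<le> nrm A a"
proof -
  interpret A: uni_factor A by (rule uni_factor.intro[OF assms(1)])
  interpret B: cstar_factor B by (rule cstar_factor.intro[OF assms(2)])
  interpret uni_hom A B \<phi> by unfold_locales (rule assms(3))
  define h where "h = star A a \<otimes>\<^bsub>A\<^esub> a"
  have h: "h \<in> carrier A" "star A h = h" using a by (simp_all add: h_def A.star_mult)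
  have "rad (emb B (\<phi> h)) \<le> nrm A h"
  proof (rule rad_le_of_resolvent)
    fix z assume "nrm A h < cmod z"
    then have "rad (emb A h) < cmod z" using rad_le_norm[of "emb A h"] h by simp
    then have "has_inverse (T (cx z - emb A h))" by (intro has_inverse_ulift rad_less_has_inverse)
    then show "has_inverse (cx z - emb B (\<phi> h))" using h by (simp add: ulift_diff)
  qed (use h in simp)
  then have "nrm B (\<phi> h) \<le> nrm A h" using B.rad_self_adjoint[of "\<phi> h"] h by (simp flip: hom_star)
  moreover have "nrm B (\<phi> h) = (nrm B (\<phi> a))\<^sup>2" using a by (simp add: h_def hom_mult hom_star B.cstar_identity)
  moreover have "nrm A h \<le> nrm A a * nrm A a" using A.nrm_mult[of "star A a" a] a by (simp add: h_def A.nrm_star)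
  ultimately have "(nrm B (\<phi> a))\<^sup>2 \<le> (nrm A a)\<^sup>2" by (simp add: power2_eq_square)
  then show ?thesis by (rule power2_le_imp_le) (use a in simp)
qed

lemma star_aut_inverse:
  assumes "\<phi> \<in> star_aut A" "star_algebra A" shows "inv_into (carrier A) \<phi> \<in> star_hom A A"
proof -
  interpret star_algebra A by fact
  have b: "bij_betw \<phi> (carrier A) (carrier A)" and h: "\<phi> \<in> star_hom A A" using assms(1) by (auto simp: star_aut_def)
  let ?i = "inv_into (carrier A) \<phi>"
  have i: "a \<in> carrier A ==> ?i a \<in> carrier A" "a \<in> carrier A ==> \<phi> (?i a) = a" for a
    using b by (auto simp: bij_betw_def intro: inv_into_into f_inv_into_f)
  have u: "?i b = a" if "a \<in> carrier A" "\<phi> a = b" for a b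
    using b that by (auto simp: bij_betw_def)
  show ?thesis
    unfolding star_hom_def
  proof (intro CollectI conjI ballI allI)
    show "?i \<in> carrier A \<rightarrow> carrier A" using i by auto
    fix a z assume a: "a \<in> carrier A"
    show "?i (z \<odot>\<^bsub>A\<^esub> a) = z \<odot>\<^bsub>A\<^esub> ?i a" using h i a by (intro u) (auto simp: star_hom_def)
    show "?i (star A a) = star A (?i a)" using h i a by (intro u) (auto simp: star_hom_def)
    fix b assume b: "b \<in> carrier A"
    show "?i (a \<oplus>\<^bsub>A\<^esub> b) = ?i a \<oplus>\<^bsub>A\<^esub> ?i b" using h i a b by (intro u) (auto simp: star_hom_def)
    show "?i (a \<otimes>\<^bsub>A\<^esub> b) = ?i a \<otimes>\<^bsub>A\<^esub> ?i b" using h i a b by (intro u) (auto simp: star_hom_def)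
  qed
qed

section \<open>Fell bundles with constant fibre\<close>

text \<open>The twisted product \<open>(a \<delta>\<^sub>x) (b \<delta>\<^sub>y) = a \<alpha>\<^sub>x(b) \<omega>(x,y) \<delta>\<^sub>x\<^sub>y\<close> and the involution, read on the coefficients:
  \<open>m x y a b\<close> is the coefficient of the product and \<open>s x b\<close> that of \<open>(b \<delta>\<^sub>-\<^sub>x)\<^sup>*\<close>. All that matters about
  the twisted system is that these maps satisfy the axioms of a Fell bundle.\<close>

locale fell_bundle = cstar_factor A for A :: "'a normed_star_alg" (structure) +
  fixes m :: "'g::group_add => 'g => 'a => 'a => 'a" and s :: "'g => 'a => 'a"
  assumes m_closed [simp, intro]: "a \<in> carrier A ==> b \<in> carrier A ==> m x y a b \<in> carrier A"
    and m_add_left: "a \<in> carrier A ==> a' \<in> carrier A ==> b \<in> carrier A ==> m x y (a \<oplus> a') b = m x y a b \<oplus> m x y a' b"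
    and m_add_right: "a \<in> carrier A ==> b \<in> carrier A ==> b' \<in> carrier A ==> m x y a (b \<oplus> b') = m x y a b \<oplus> m x y a b'"
    and m_sm_left: "a \<in> carrier A ==> b \<in> carrier A ==> m x y (k \<odot> a) b = k \<odot> m x y a b"
    and m_sm_right: "a \<in> carrier A ==> b \<in> carrier A ==> m x y a (k \<odot> b) = k \<odot> m x y a b"
    and m_norm: "a \<in> carrier A ==> b \<in> carrier A ==> nrm A (m x y a b) \<le> nrm A a * nrm A b"
    and m_assoc: "a \<in> carrier A ==> b \<in> carrier A ==> c \<in> carrier A ==> m (x + y) z (m x y a b) c = m x (y + z) a (m y z b c)"
    and s_closed [simp, intro]: "a \<in> carrier A ==> s x a \<in> carrier A"
    and s_add: "a \<in> carrier A ==> b \<in> carrier A ==> s x (a \<oplus> b) = s x a \<oplus> s x b"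
    and s_sm: "a \<in> carrier A ==> s x (k \<odot> a) = cnj k \<odot> s x a"
    and s_norm: "a \<in> carrier A ==> nrm A (s x a) = nrm A a"
    and s_s: "a \<in> carrier A ==> s x (s (- x) a) = a"
    and s_m: "a \<in> carrier A ==> b \<in> carrier A ==> s (- y + - x) (m x y a b) = m (- y) (- x) (s (- y) b) (s (- x) a)"
    and m_pos: "a \<in> carrier A ==> \<exists>c\<in>carrier A. m (- x) x (s (- x) a) a = star A c \<otimes> c \<and> nrm A c = nrm A a"
    and m_0: "a \<in> carrier A ==> b \<in> carrier A ==> m 0 x a b = a \<otimes> b"
    and s_0: "a \<in> carrier A ==> s 0 a = star A a"
    and m_one: "is_one A e ==> a \<in> carrier A ==> m x 0 a e = a"

definition tw_m :: "('a, 'm) normed_star_alg_scheme => ('g::group_add => 'a => 'a) => ('g => 'g => ('a => 'a) \<times> ('a => 'a))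
    => 'g => 'g => 'a => 'a => 'a" where
  "tw_m A \<alpha> \<omega> x y a b = mult_right (a \<otimes>\<^bsub>A\<^esub> \<alpha> x b) (\<omega> x y)"

definition tw_s :: "('a, 'm) normed_star_alg_scheme => ('g::group_add => 'a => 'a) => ('g => 'g => ('a => 'a) \<times> ('a => 'a))
    => 'g => 'a => 'a" where
  "tw_s A \<alpha> \<omega> x b = mult_left (star (multiplier_algebra A) (\<omega> x (- x))) (star A (\<alpha> x b))"

lemma fell_bundle_trivial:
  fixes B :: "'a normed_star_alg"
  assumes "cstar_algebra B"
  shows "fell_bundle B (tw_m B (\<lambda>x b. b) (\<lambda>(x :: 'g::group_add) y. \<one>\<^bsub>multiplier_algebra B\<^esub>))
    (tw_s B (\<lambda>x b. b) (\<lambda>(x :: 'g) y. \<one>\<^bsub>multiplier_algebra B\<^esub>))"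
proof -
  interpret cstar_factor B by (rule cstar_factor.intro[OF assms])
  have m: "tw_m B (\<lambda>x b. b) (\<lambda>(x :: 'g) y. \<one>\<^bsub>multiplier_algebra B\<^esub>) x y a b = a \<otimes>\<^bsub>B\<^esub> b"
    if "a \<in> carrier B" "b \<in> carrier B" for x y a b
    using that by (simp add: tw_m_def multiplier_algebra_def)
  have s: "tw_s B (\<lambda>x b. b) (\<lambda>(x :: 'g) y. \<one>\<^bsub>multiplier_algebra B\<^esub>) x a = star B a" if "a \<in> carrier B" for x a
    using that by (simp add: tw_s_def multiplier_algebra_def)
  show ?thesis
    by unfold_locales
      (auto simp: m s mult_add_left mult_add_right smult_mult_left smult_mult_right nrm_mult mult_assoc star_add star_smult nrm_star
        star_mult is_one_def)
qed

locale twisted = cstar_factor A for A :: "'a normed_star_alg" (structure) +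
  fixes \<alpha> :: "'g::group_add => 'a => 'a" and \<omega> :: "'g => 'g => ('a => 'a) \<times> ('a => 'a)"
  assumes tw: "twisted_system A \<alpha> \<omega>"
begin

text \<open>Left and right multiplication by \<open>\<omega> x y\<close> and by its adjoint.\<close>

definition "L x y a = fst (\<omega> x y) a"
definition "R x y a = snd (\<omega> x y) a"
definition "Ls x y a = star A (R x y (star A a))"
definition "Rs x y a = star A (L x y (star A a))"

lemma \<omega>_unitary: "\<omega> x y \<in> unitary_multipliers A" using tw by (simp add: twisted_system_def Let_def)

lemma \<omega>_mult: "\<omega> x y \<in> carrier (multiplier_algebra A)"
  using \<omega>_unitary[of x y] by (simp add: unitary_multipliers_def Let_def)

lemma LR_basic:
  assumes a: "a \<in> carrier A" and b: "b \<in> carrier A"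
  shows "L x y a \<in> carrier A" "R x y a \<in> carrier A"
    "R x y (a \<oplus> b) = R x y a \<oplus> R x y b" "R x y (z \<odot> a) = z \<odot> R x y a"
    "L x y (a \<otimes> b) = L x y a \<otimes> b" "R x y (a \<otimes> b) = a \<otimes> R x y b" "R x y a \<otimes> b = a \<otimes> L x y b"
  using \<omega>_mult[of x y] a b by (auto simp: multiplier_algebra_def bounded_ops_def L_def R_def PiE_def)

lemma L_closed [simp, intro]: "a \<in> carrier A ==> L x y a \<in> carrier A" and R_closed [simp, intro]: "a \<in> carrier A ==> R x y a \<in> carrier A"
  by (auto intro: LR_basic)
lemma Ls_closed [simp, intro]: "a \<in> carrier A ==> Ls x y a \<in> carrier A" and Rs_closed [simp, intro]: "a \<in> carrier A ==> Rs x y a \<in> carrier A"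
  by (auto simp: Ls_def Rs_def)

lemma star_LR:
  assumes "a \<in> carrier A"
  shows "star A (L x y a) = Rs x y (star A a)" "star A (R x y a) = Ls x y (star A a)"
    "star A (Ls x y a) = R x y (star A a)" "star A (Rs x y a) = L x y (star A a)"
  using assms by (simp_all add: Ls_def Rs_def)

lemma LRs_mult:
  assumes a: "a \<in> carrier A" and b: "b \<in> carrier A"
  shows "Ls x y (a \<otimes> b) = Ls x y a \<otimes> b" "Rs x y (a \<otimes> b) = a \<otimes> Rs x y b" "Rs x y a \<otimes> b = a \<otimes> Ls x y b"
proof -
  show "Ls x y (a \<otimes> b) = Ls x y a \<otimes> b" "Rs x y (a \<otimes> b) = a \<otimes> Rs x y b"
    using a b by (simp_all add: Ls_def Rs_def star_mult LR_basic)
  have "Rs x y a \<otimes> b = star A (star A b \<otimes> L x y (star A a))" using a b by (simp add: star_mult Rs_def)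
  also have "\<dots> = star A (R x y (star A b) \<otimes> star A a)" using a b by (simp add: LR_basic(7))
  also have "\<dots> = a \<otimes> Ls x y b" using a b by (simp add: star_mult Ls_def)
  finally show "Rs x y a \<otimes> b = a \<otimes> Ls x y b" .
qed

lemma unitary_cancel:
  assumes a: "a \<in> carrier A"
  shows "Ls x y (L x y a) = a" "L x y (Ls x y a) = a" "R x y (Rs x y a) = a" "Rs x y (R x y a) = a"
proof -
  obtain l r where lr: "\<omega> x y = (l, r)" by (cases "\<omega> x y")
  have "star (multiplier_algebra A) (\<omega> x y) \<otimes>\<^bsub>multiplier_algebra A\<^esub> \<omega> x y = \<one>\<^bsub>multiplier_algebra A\<^esub>"
    "\<omega> x y \<otimes>\<^bsub>multiplier_algebra A\<^esub> star (multiplier_algebra A) (\<omega> x y) = \<one>\<^bsub>multiplier_algebra A\<^esub>"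
    using \<omega>_unitary[of x y] by (simp_all add: unitary_multipliers_def Let_def)
  then have *: "compose (carrier A) (\<lambda>a\<in>carrier A. star A (r (star A a))) l = (\<lambda>a\<in>carrier A. a)"
    "compose (carrier A) r (\<lambda>a\<in>carrier A. star A (l (star A a))) = (\<lambda>a\<in>carrier A. a)"
    "compose (carrier A) l (\<lambda>a\<in>carrier A. star A (r (star A a))) = (\<lambda>a\<in>carrier A. a)"
    "compose (carrier A) (\<lambda>a\<in>carrier A. star A (l (star A a))) r = (\<lambda>a\<in>carrier A. a)"
    by (simp_all add: lr multiplier_algebra_def)
  have l: "l a \<in> carrier A" "r a \<in> carrier A" using L_closed[OF a, of x y] R_closed[OF a, of x y] by (simp_all add: L_def R_def lr)
  show "Ls x y (L x y a) = a" "L x y (Ls x y a) = a" "R x y (Rs x y a) = a" "Rs x y (R x y a) = a"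
    using a l *[THEN fun_cong[of _ _ a]] by (simp_all add: Ls_def Rs_def L_def R_def lr compose_def)
qed

lemma LR_norm: assumes a: "a \<in> carrier A" shows "nrm A (L x y a) = nrm A a" "nrm A (R x y a) = nrm A a" "nrm A (Ls x y a) = nrm A a"
proof -
  have l: "nrm A (L x y a) = nrm A a" if a: "a \<in> carrier A" for a
  proof -
    have "(nrm A (L x y a))\<^sup>2 = nrm A (Rs x y (star A a) \<otimes> L x y a)"
      using cstar_identity[of "L x y a"] a by (simp add: star_LR)
    also have "\<dots> = (nrm A a)\<^sup>2" using a by (simp add: LRs_mult unitary_cancel cstar_identity)
    finally show ?thesis using a by (simp add: power2_eq_iff_nonneg)
  qed
  show "nrm A (L x y a) = nrm A a" by (rule l[OF a])
  have ls: "nrm A (Ls x y a) = nrm A a" if a: "a \<in> carrier A" for a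
    using l[of "Ls x y a"] a by (simp add: unitary_cancel)
  show "nrm A (Ls x y a) = nrm A a" by (rule ls[OF a])
  have "nrm A (R x y a) = nrm A (star A (R x y a))" using a by (simp add: nrm_star)
  also have "\<dots> = nrm A a" using a by (simp add: star_LR ls nrm_star)
  finally show "nrm A (R x y a) = nrm A a" .
qed

lemma faithful:
  assumes "x \<in> carrier A" "y \<in> carrier A" "\<And>b. b \<in> carrier A ==> b \<otimes> x = b \<otimes> y" shows "x = y"
proof -
  have m: "b \<otimes> (x \<ominus> y) = \<zero>" if "b \<in> carrier A" for b
  proof -
    have "b \<otimes> (x \<ominus> y) = b \<otimes> x \<ominus> b \<otimes> y"
      using assms that by (simp add: minus_sm mult_add_right smult_mult_right)
    then show ?thesis using assms that by (simp add: minus_eq_zero_iff)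
  qed
  have "(nrm A (x \<ominus> y))\<^sup>2 = 0" using cstar_identity[of "x \<ominus> y"] m[of "star A (x \<ominus> y)"] assms by simp
  then show ?thesis using assms by (simp add: nrm_eq_zero minus_eq_zero_iff)
qed

lemma left_right_commute:
  assumes l: "\<And>a. a \<in> carrier A ==> l a \<in> carrier A" "\<And>a b. a \<in> carrier A ==> b \<in> carrier A ==> b \<otimes> l a = lr b \<otimes> a"
      "\<And>a. a \<in> carrier A ==> lr a \<in> carrier A"
    and r: "\<And>a. a \<in> carrier A ==> r a \<in> carrier A" "\<And>a b. a \<in> carrier A ==> b \<in> carrier A ==> r (b \<otimes> a) = b \<otimes> r a"
    and a: "a \<in> carrier A"
  shows "l (r a) = r (l a)"
proof (rule faithful)
  fix b assume b: "b \<in> carrier A"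
  have "b \<otimes> l (r a) = r (lr b \<otimes> a)" using assms b by simp
  also have "\<dots> = b \<otimes> r (l a)" using l(2)[OF a b, symmetric] r(2)[of "l a" b] assms b by simp
  finally show "b \<otimes> l (r a) = b \<otimes> r (l a)" .
qed (use assms in auto)

lemma LR_commute:
  assumes a: "a \<in> carrier A"
  shows "L x y (R x' y' a) = R x' y' (L x y a)" "L x y (Rs x' y' a) = Rs x' y' (L x y a)"
    "Ls x y (R x' y' a) = R x' y' (Ls x y a)" "Ls x y (Rs x' y' a) = Rs x' y' (Ls x y a)"
  by (rule left_right_commute[of "L x y" "R x y", OF _ _ _ _ _ a] left_right_commute[of "Ls x y" "Rs x y", OF _ _ _ _ _ a];
      simp add: LR_basic LRs_mult)+

lemma \<alpha>_aut: "\<alpha> x \<in> star_aut A" using tw by (simp add: twisted_system_def Let_def)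
lemma \<alpha>_hom: "\<alpha> x \<in> star_hom A A" and \<alpha>_bij: "bij_betw (\<alpha> x) (carrier A) (carrier A)"
  using \<alpha>_aut[of x] by (auto simp: star_aut_def)

lemma \<alpha>_simps:
  assumes "a \<in> carrier A" "b \<in> carrier A"
  shows "\<alpha> x a \<in> carrier A" "\<alpha> x (a \<oplus> b) = \<alpha> x a \<oplus> \<alpha> x b" "\<alpha> x (z \<odot> a) = z \<odot> \<alpha> x a"
    "\<alpha> x (a \<otimes> b) = \<alpha> x a \<otimes> \<alpha> x b" "\<alpha> x (star A a) = star A (\<alpha> x a)"
  using \<alpha>_hom[of x] assms by (auto simp: star_hom_def)

lemma \<alpha>_closed [simp, intro]: "a \<in> carrier A ==> \<alpha> x a \<in> carrier A" by (rule \<alpha>_simps)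

lemma \<alpha>_norm: assumes a: "a \<in> carrier A" shows "nrm A (\<alpha> x a) = nrm A a"
proof (rule antisym)
  have c: "cstar_algebra A" by unfold_locales
  show "nrm A (\<alpha> x a) \<le> nrm A a" by (rule star_hom_contractive[OF banach_A c \<alpha>_hom a])
  have "nrm A (inv_into (carrier A) (\<alpha> x) (\<alpha> x a)) \<le> nrm A (\<alpha> x a)"
    by (rule star_hom_contractive[OF banach_A c star_aut_inverse[OF \<alpha>_aut]]) (use a star_algebra_axioms in auto)
  then show "nrm A a \<le> nrm A (\<alpha> x a)" using \<alpha>_bij[of x] a by (simp add: bij_betw_def)
qed

lemma \<alpha>_\<alpha>: assumes a: "a \<in> carrier A" shows "\<alpha> x (\<alpha> y a) = L x y (Rs x y (\<alpha> (x + y) a))"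
proof -
  have "\<alpha> x (\<alpha> y a) = mult_left (\<omega> x y) (mult_right (\<alpha> (x + y) a) (star (multiplier_algebra A) (\<omega> x y)))"
    using tw a by (simp add: twisted_system_def Let_def)
  moreover have "mult_right b (star (multiplier_algebra A) (\<omega> x y)) = Rs x y b" if "b \<in> carrier A" for b
    using that by (cases "\<omega> x y") (simp add: multiplier_algebra_def Rs_def L_def)
  ultimately show ?thesis using a by (simp add: L_def)
qed

lemma cocycle: assumes a: "a \<in> carrier A" shows "R (x + y) z (R x y (\<alpha> x a)) = R x (y + z) (\<alpha> x (R y z a))"
proof -
  have "\<omega> x y \<otimes>\<^bsub>multiplier_algebra A\<^esub> \<omega> (x + y) z = extend_aut A (\<alpha> x) (\<omega> y z) \<otimes>\<^bsub>multiplier_algebra A\<^esub> \<omega> x (y + z)"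
    using tw by (simp add: twisted_system_def Let_def)
  from arg_cong[OF this, of snd] have "compose (carrier A) (snd (\<omega> (x + y) z)) (snd (\<omega> x y))
      = compose (carrier A) (snd (\<omega> x (y + z))) (\<lambda>a\<in>carrier A. \<alpha> x (snd (\<omega> y z) (inv_into (carrier A) (\<alpha> x) a)))"
    by (simp add: multiplier_algebra_def extend_aut_def case_prod_beta)
  from fun_cong[OF this, of "\<alpha> x a"] show ?thesis
    using a \<alpha>_bij[of x] by (simp add: compose_def R_def bij_betw_def)
qed

lemma \<omega>_0: assumes "a \<in> carrier A" shows "R x 0 a = a" "R 0 x a = a" "L x 0 a = a" "L 0 x a = a" "Ls x 0 a = a" "Ls 0 x a = a" "Rs x 0 a = a" "Rs 0 x a = a"
proof -
  have o: "\<omega> x 0 = \<one>\<^bsub>multiplier_algebra A\<^esub>" "\<omega> 0 x = \<one>\<^bsub>multiplier_algebra A\<^esub>"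
    using tw by (simp_all add: twisted_system_def Let_def)
  show "R x 0 a = a" "R 0 x a = a" "L x 0 a = a" "L 0 x a = a" "Ls x 0 a = a" "Ls 0 x a = a" "Rs x 0 a = a" "Rs 0 x a = a"
    using assms by (simp_all add: R_def L_def Ls_def Rs_def o multiplier_algebra_def)
qed

lemma \<alpha>_0: assumes a: "a \<in> carrier A" shows "\<alpha> 0 a = a"
proof -
  have "\<alpha> 0 (\<alpha> 0 a) = \<alpha> 0 a" using \<alpha>_\<alpha>[OF a, of 0 0] a by (simp add: \<omega>_0)
  then show ?thesis using \<alpha>_bij[of 0] a by (auto simp: bij_betw_def inj_on_def)
qed

lemma \<alpha>_R: assumes c: "c \<in> carrier A" shows "\<alpha> x (R y z c) = Rs x (y + z) (R (x + y) z (R x y (\<alpha> x c)))"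
  using cocycle[OF c, of x y z] c by (simp add: unitary_cancel)

abbreviation "m \<equiv> tw_m A \<alpha> \<omega>"
abbreviation "s \<equiv> tw_s A \<alpha> \<omega>"

lemma m_eq: "m x y a b = R x y (a \<otimes> \<alpha> x b)" by (simp add: tw_m_def R_def)

lemma s_eq: "a \<in> carrier A ==> s x a = Ls x (- x) (star A (\<alpha> x a))"
  by (cases "\<omega> x (- x)") (simp add: tw_s_def Ls_def R_def multiplier_algebra_def)

text \<open>Moving \<open>\<omega> x y\<close> past \<open>\<alpha> (x + y) c\<close> turns the latter into \<open>\<alpha> x (\<alpha> y c)\<close>. The cocycle identity then matches the two sides.\<close>

lemma twist_assoc:
  assumes a: "a \<in> carrier A" and b: "b \<in> carrier A" and c: "c \<in> carrier A"
  shows "m (x + y) z (m x y a b) c = m x (y + z) a (m y z b c)"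
proof -
  let ?p = "a \<otimes> \<alpha> x b"
  have "m (x + y) z (m x y a b) c = R (x + y) z (R x y ?p \<otimes> \<alpha> (x + y) c)" by (simp add: m_eq)
  also have "R x y ?p \<otimes> \<alpha> (x + y) c = ?p \<otimes> L x y (\<alpha> (x + y) c)"
    using a b c by (intro LR_basic(7)) auto
  also have "R (x + y) z \<dots> = ?p \<otimes> R (x + y) z (L x y (\<alpha> (x + y) c))"
    using a b c by (intro LR_basic(6)) auto
  also have "L x y (\<alpha> (x + y) c) = R x y (\<alpha> x (\<alpha> y c))"
    using c by (simp add: \<alpha>_\<alpha> LR_commute(1)[symmetric] unitary_cancel)
  also have "R (x + y) z (R x y (\<alpha> x (\<alpha> y c))) = R x (y + z) (\<alpha> x (R y z (\<alpha> y c)))" using c by (simp add: cocycle)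
  also have "?p \<otimes> R x (y + z) (\<alpha> x (R y z (\<alpha> y c))) = m x (y + z) a (m y z b c)"
    using a b c by (simp add: m_eq LR_basic \<alpha>_simps mult_assoc)
  finally show ?thesis .
qed

lemma twist_star_star:
  assumes b: "b \<in> carrier A" shows "s x (s (- x) b) = b"
proof -
  have "s x (s (- x) b) = Ls x (- x) (\<alpha> x (R (- x) x (\<alpha> (- x) b)))"
    using b by (simp add: s_eq \<alpha>_simps(5)[symmetric] star_LR)
  also have "\<alpha> x (R (- x) x (\<alpha> (- x) b)) = R x (- x) (\<alpha> x (\<alpha> (- x) b))"
    using b \<alpha>_R[of "\<alpha> (- x) b" x "- x" x] by (simp add: \<omega>_0)
  also have "\<alpha> x (\<alpha> (- x) b) = L x (- x) (Rs x (- x) b)" using b by (simp add: \<alpha>_\<alpha> \<alpha>_0)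
  finally show ?thesis using b by (simp add: LR_commute(1)[symmetric] unitary_cancel)
qed

lemma twist_star_mult:
  assumes a: "a \<in> carrier A" and b: "b \<in> carrier A"
  shows "s (- w + - y) (m y w a b) = m (- w) (- y) (s (- w) b) (s (- y) a)"
proof -
  define z where "z = - w + - y"
  have zy: "z + y = - w" and mz: "- z = y + w" and zyw: "- w - y = z" by (simp_all add: z_def add.assoc minus_add)
  define e1 where "e1 = star A (\<alpha> (- w) b)"
  define e2 where "e2 = star A (\<alpha> z a)"
  have e: "e1 \<in> carrier A" "e2 \<in> carrier A" using a b by (auto simp: e1_def e2_def)
  define d where "d = a \<otimes> \<alpha> y b"
  have d: "d \<in> carrier A" using a b by (simp add: d_def)
  have "s z (m y w a b) = Ls z (y + w) (star A (\<alpha> z (R y w d)))" using d by (simp add: s_eq m_eq mz d_def[symmetric])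
  also have "\<alpha> z (R y w d) = Rs z (y + w) (R (- w) w (R z y (\<alpha> z d)))" using d by (simp add: \<alpha>_R zy)
  also have "Ls z (y + w) (star A \<dots>) = Ls (- w) w (Ls z y (star A (\<alpha> z d)))" using d by (simp add: star_LR unitary_cancel)
  also have "star A (\<alpha> z d) = Rs z y (L z y e1) \<otimes> e2"
    using a b by (simp add: d_def \<alpha>_simps star_mult \<alpha>_\<alpha> star_LR zy e1_def e2_def)
  also have "Ls z y (Rs z y (L z y e1) \<otimes> e2) = Rs z y e1 \<otimes> e2"
    using e by (simp add: LRs_mult(1) LR_commute unitary_cancel)
  also have "Ls (- w) w (Rs z y e1 \<otimes> e2) = Ls (- w) w e1 \<otimes> Ls z y e2"
    using e by (simp add: LRs_mult(1) LR_commute) (simp add: LRs_mult)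
  finally have lhs: "s z (m y w a b) = Ls (- w) w e1 \<otimes> Ls z y e2" .
  have sy: "s (- y) a = star A (R (- y) y (\<alpha> (- y) a))" using a by (simp add: s_eq star_LR)
  have "\<alpha> (- w) (R (- y) y (\<alpha> (- y) a)) = R z y (R (- w) (- y) (\<alpha> (- w) (\<alpha> (- y) a)))"
    using a \<alpha>_R[of "\<alpha> (- y) a" "- w" "- y" y] by (simp add: \<omega>_0 zyw)
  also have "\<alpha> (- w) (\<alpha> (- y) a) = L (- w) (- y) (Rs (- w) (- y) (\<alpha> z a))" using a by (simp add: \<alpha>_\<alpha> zyw)
  also have "R (- w) (- y) \<dots> = L (- w) (- y) (\<alpha> z a)" using a by (simp add: LR_commute(1)[symmetric] unitary_cancel)
  finally have aR: "\<alpha> (- w) (R (- y) y (\<alpha> (- y) a)) = R z y (L (- w) (- y) (\<alpha> z a))" .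
  have "\<alpha> (- w) (s (- y) a) = star A (\<alpha> (- w) (R (- y) y (\<alpha> (- y) a)))"
    unfolding sy using a by (intro \<alpha>_simps) auto
  then have "\<alpha> (- w) (s (- y) a) = Ls z y (Rs (- w) (- y) e2)"
    unfolding aR using a by (simp add: star_LR e2_def)
  then have "m (- w) (- y) (s (- w) b) (s (- y) a) = R (- w) (- y) (Ls (- w) w e1 \<otimes> Ls z y (Rs (- w) (- y) e2))"
    using b by (simp add: m_eq s_eq e1_def)
  also have "\<dots> = Ls (- w) w e1 \<otimes> Ls z y e2"
    using e by (simp add: LR_basic LR_commute(3)[symmetric] unitary_cancel)
  finally show ?thesis using lhs by (simp add: z_def)
qed

lemma twist_positive:
  assumes a: "a \<in> carrier A"
  shows "\<exists>c\<in>carrier A. m (- x) x (s (- x) a) a = star A c \<otimes> c \<and> nrm A c = nrm A a"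
  using a by (intro bexI[of _ "R (- x) x (\<alpha> (- x) a)"]) (simp_all add: m_eq s_eq LR_basic star_LR LR_norm \<alpha>_norm)

sublocale fell_bundle A m s
proof unfold_locales
  fix a b a' b' c e x y
  assume a: "a \<in> carrier A"
  show "s x (s (- x) a) = a" by (rule twist_star_star[OF a])
  show "\<exists>c\<in>carrier A. m (- x) x (s (- x) a) a = star A c \<otimes> c \<and> nrm A c = nrm A a" by (rule twist_positive[OF a])
  show "s x a \<in> carrier A" "s x (z \<odot> a) = cnj z \<odot> s x a" "nrm A (s x a) = nrm A a" for z
    using a by (simp_all add: s_eq LR_norm \<alpha>_norm nrm_star \<alpha>_simps star_smult) (simp_all add: Ls_def LR_basic star_smult)
  show "s 0 a = star A a" using a by (simp add: s_eq \<omega>_0 \<alpha>_0)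
  { assume "is_one A e"
    then have e: "e \<in> carrier A" "\<And>b. b \<in> carrier A ==> b \<otimes> e = b \<and> e \<otimes> b = b" by (auto simp: is_one_def)
    obtain d where d: "d \<in> carrier A" "\<alpha> x d = e" using \<alpha>_bij[of x] e(1) by (metis bij_betw_iff_bijections)
    have "\<alpha> x e = e"
      using \<alpha>_simps(4)[OF d(1) e(1), of x] d e by simp
    then show "m x 0 a e = a" using a e by (simp add: m_eq \<omega>_0) }
  assume b: "b \<in> carrier A"
  show "m x y a b \<in> carrier A" using a b by (simp add: m_eq)
  show "m x y (z \<odot> a) b = z \<odot> m x y a b" "m x y a (z \<odot> b) = z \<odot> m x y a b" for z
    using a b by (simp_all add: m_eq smult_mult_left smult_mult_right \<alpha>_simps LR_basic(4))
  show "nrm A (m x y a b) \<le> nrm A a * nrm A b" using a b nrm_mult[of a "\<alpha> x b"] by (simp add: m_eq LR_norm \<alpha>_norm)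
  show "s x (a \<oplus> b) = s x a \<oplus> s x b" using a b by (simp add: s_eq \<alpha>_simps star_add Ls_def LR_basic)
  show "s (- y + - x) (m x y a b) = m (- y) (- x) (s (- y) b) (s (- x) a)" by (rule twist_star_mult[OF a b])
  show "m 0 x a b = a \<otimes> b" using a b by (simp add: m_eq \<omega>_0 \<alpha>_0)
  { assume c: "c \<in> carrier A"
    show "m (x + y) z (m x y a b) c = m x (y + z) a (m y z b c)" for z by (rule twist_assoc[OF a b c]) }
  { assume c: "a' \<in> carrier A"
    show "m x y (a \<oplus> a') b = m x y a b \<oplus> m x y a' b" using a b c by (simp add: m_eq mult_add_left LR_basic(3)) }
  { assume c: "b' \<in> carrier A"
    show "m x y a (b \<oplus> b') = m x y a b \<oplus> m x y a b'" using a b c by (simp add: m_eq mult_add_right \<alpha>_simps LR_basic(3)) }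
qed

end

section \<open>Sums in a Banach *-algebra\<close>

lemma infsum_real_bounded_linear:
  "bounded_linear h ==> f summable_on A ==> infsum (\<lambda>x. h (f x)) A = h (infsum f A)"
  by (rule infsumI, rule has_sum_bounded_linear) (auto simp: has_sum_infsum)

context uni_factor
begin

lemma emb_finsum:
  "finite F ==> (\<And>i. i \<in> F ==> h i \<in> carrier A) ==> finsum A h F \<in> carrier A \<and> emb A (finsum A h F) = (\<Sum>i\<in>F. emb A (h i))"
  by (induction F rule: finite_induct) (auto simp: M.finsum_insert Pi_def emb_add)

lemma alg_sum_emb:
  assumes h: "\<And>i. h i \<in> carrier A" and s: "(\<lambda>i. nrm A (h i)) summable_on UNIV"
  shows "alg_sum A h \<in> carrier A" "emb A (alg_sum A h) = (\<Sum>\<^sub>\<infinity>i. emb A (h i))"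
proof -
  have su: "(\<lambda>i. emb A (h i)) summable_on UNIV"
    by (rule abs_summable_summable) (use s h in simp)
  define v where "v = (\<Sum>\<^sub>\<infinity>i. emb A (h i))"
  have v: "((\<lambda>i. emb A (h i)) has_sum v) UNIV" unfolding v_def by (rule has_sum_infsum[OF su])
  have "emb A (prj A v) = (\<Sum>\<^sub>\<infinity>i. emb A (prj A (emb A (h i))))"
    unfolding v_def by (rule infsum_real_bounded_linear[OF bounded_linear_emb_prj su, symmetric])
  then have pv: "emb A (prj A v) = v" using h by (simp add: v_def)
  have iff: "limitin (norm_topology A) (\<lambda>F. finsum A h F) t (finite_subsets_at_top UNIV) \<longleftrightarrow> t \<in> carrier A \<and> emb A t = v" for t
  proof -
    have "limitin (norm_topology A) (\<lambda>F. finsum A h F) t (finite_subsets_at_top UNIV) \<longleftrightarrow>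
      t \<in> carrier A \<and> (\<forall>e>0. \<forall>\<^sub>F F in finite_subsets_at_top UNIV. finsum A h F \<in> carrier A \<and> nrm A (finsum A h F \<ominus> t) < e)"
      by (rule limitin_norm_topology)
    also have "\<dots> \<longleftrightarrow> t \<in> carrier A \<and> ((\<lambda>i. emb A (h i)) has_sum emb A t) UNIV"
    proof (rule conj_cong[OF refl])
      assume t: "t \<in> carrier A"
      have e: "\<forall>\<^sub>F F in finite_subsets_at_top UNIV. (finsum A h F \<in> carrier A \<and> nrm A (finsum A h F \<ominus> t) < e)
          \<longleftrightarrow> dist (\<Sum>i\<in>F. emb A (h i)) (emb A t) < e" for e
        unfolding eventually_finite_subsets_at_top
      proof (intro exI[of _ "{}"] conjI allI impI)
        fix F :: "'b set" assume "finite F \<and> {} \<subseteq> F \<and> F \<subseteq> UNIV"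
        then have F: "finsum A h F \<in> carrier A" "emb A (finsum A h F) = (\<Sum>i\<in>F. emb A (h i))" using emb_finsum[of F h] h by auto
        have "nrm A (finsum A h F \<ominus> t) = norm (emb A (finsum A h F \<ominus> t))" using F(1) t by simp
        also have "\<dots> = dist (\<Sum>i\<in>F. emb A (h i)) (emb A t)" using F t by (simp add: emb_minus dist_norm)
        finally show "(finsum A h F \<in> carrier A \<and> nrm A (finsum A h F \<ominus> t) < e) \<longleftrightarrow> dist (\<Sum>i\<in>F. emb A (h i)) (emb A t) < e"
          using F(1) by simp
      qed auto
      show "(\<forall>e>0. \<forall>\<^sub>F F in finite_subsets_at_top UNIV. finsum A h F \<in> carrier A \<and> nrm A (finsum A h F \<ominus> t) < e)
        \<longleftrightarrow> ((\<lambda>i. emb A (h i)) has_sum emb A t) UNIV"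
        unfolding has_sum_def tendsto_iff by (simp only: eventually_subst[OF e])
    qed
    also have "\<dots> \<longleftrightarrow> t \<in> carrier A \<and> emb A t = v" by (rule conj_cong[OF refl], rule iffI, erule has_sum_unique[OF _ v], use v in simp)
    finally show ?thesis .
  qed
  have "alg_sum A h = prj A v"
    unfolding alg_sum_def iff using pv by (intro the_equality) auto
  then show "alg_sum A h \<in> carrier A" "emb A (alg_sum A h) = (\<Sum>\<^sub>\<infinity>i. emb A (h i))" using pv by (auto simp: v_def)
qed

end

section \<open>Solid algebras of functions on a group\<close>

text \<open>The properties of an admissible algebra in terms of its nonnegative functions. The last one is
  completeness in the form of the Riesz--Fischer property.\<close>

definition rin :: "('g => complex) set => ('g => real) => bool" where
  "rin L k \<longleftrightarrow> (\<lambda>x. complex_of_real (k x)) \<in> L"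

definition rnorm :: "(('g => complex) => real) => ('g => real) => real" where
  "rnorm N k = N (\<lambda>x. complex_of_real (k x))"

locale solid_space =
  fixes L :: "('g::group_add => complex) set" and N :: "('g => complex) => real"
  assumes S_summable: "rin L k ==> (\<And>x. 0 \<le> k x) ==> k summable_on UNIV"
    and S_bound: "\<exists>K. \<forall>k. rin L k \<longrightarrow> (\<forall>x. 0 \<le> k x) \<longrightarrow> infsum k UNIV \<le> K * rnorm N k"
    and S_solid: "rin L l ==> (\<And>x. 0 \<le> k x) ==> (\<And>x. k x \<le> l x) ==> rin L k \<and> rnorm N k \<le> rnorm N l"
    and S_zero: "rin L (\<lambda>x. 0)" "rnorm N (\<lambda>x. 0) = 0"
    and S_add: "rin L k ==> rin L l ==> (\<And>x. 0 \<le> k x) ==> (\<And>x. 0 \<le> l x) ==> rin L (\<lambda>x. k x + l x) \<and> rnorm N (\<lambda>x. k x + l x) \<le> rnorm N k + rnorm N l"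
    and S_scale: "rin L k ==> (\<And>x. 0 \<le> k x) ==> 0 \<le> c ==> rin L (\<lambda>x. c * k x) \<and> rnorm N (\<lambda>x. c * k x) = c * rnorm N k"
    and S_conv: "rin L k ==> rin L l ==> (\<And>x. 0 \<le> k x) ==> (\<And>x. 0 \<le> l x) ==>
        rin L (\<lambda>x. \<Sum>\<^sub>\<infinity>y. k y * l (- y + x)) \<and> rnorm N (\<lambda>x. \<Sum>\<^sub>\<infinity>y. k y * l (- y + x)) \<le> rnorm N k * rnorm N l"
    and S_minus: "rin L k ==> (\<And>x. 0 \<le> k x) ==> rin L (\<lambda>x. k (- x)) \<and> rnorm N (\<lambda>x. k (- x)) = rnorm N k"
    and S_series: "(\<And>n x. 0 \<le> u n x) ==> (\<And>n. rin L (u n)) ==> summable (\<lambda>n. rnorm N (u n)) ==>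
        rin L (\<lambda>x. \<Sum>n. u n x) \<and> rnorm N (\<lambda>x. \<Sum>n. u n x) \<le> (\<Sum>n. rnorm N (u n))"
begin

lemma rnorm_nonneg: "rin L k ==> (\<And>x. 0 \<le> k x) ==> 0 \<le> rnorm N k"
  using S_solid[of k "\<lambda>x. 0"] S_zero by simp

lemma rnorm_pointwise: obtains K where "0 < K" "\<And>k x. rin L k ==> (\<And>x. 0 \<le> k x) ==> k x \<le> K * rnorm N k"
proof -
  obtain K where K: "\<And>k. rin L k ==> (\<And>x. 0 \<le> k x) ==> infsum k UNIV \<le> K * rnorm N k" using S_bound by blast
  have "k x \<le> max K 1 * rnorm N k" if k: "rin L k" "\<And>x. 0 \<le> k x" for k x
  proof -
    have "sum k {x} \<le> infsum k UNIV" by (rule finite_sum_le_infsum) (use k S_summable in auto)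
    also have "\<dots> \<le> K * rnorm N k" using K k by blast
    also have "\<dots> \<le> max K 1 * rnorm N k" using rnorm_nonneg[OF k] by (intro mult_right_mono) auto
    finally show ?thesis by simp
  qed
  moreover have "0 < max K 1" by linarith
  ultimately show ?thesis by (rule that[rotated])
qed

lemma rnorm_eq_0: assumes "rin L k" "\<And>x. 0 \<le> k x" "rnorm N k = 0" shows "k x = 0"
proof -
  obtain K where "0 < K" "\<And>k x. rin L k ==> (\<And>x. 0 \<le> k x) ==> k x \<le> K * rnorm N k" using rnorm_pointwise by blast
  from this(2)[of k x] assms show ?thesis by (simp add: antisym)
qed

end

lemma infsum_complex_of_real: "(\<Sum>\<^sub>\<infinity>x. complex_of_real (f x)) = complex_of_real (\<Sum>\<^sub>\<infinity>x. f x)"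
proof (cases "f summable_on UNIV")
  case True then show ?thesis by (rule infsum_real_bounded_linear[OF bounded_linear_of_real])
next
  case False
  have "\<not> (\<lambda>x. complex_of_real (f x)) summable_on UNIV"
  proof
    assume "(\<lambda>x. complex_of_real (f x)) summable_on UNIV"
    from summable_on_bounded_linear[OF bounded_linear_Re this] show False using False by simp
  qed
  then show ?thesis using False by (simp add: infsum_not_exists)
qed

lemma admissible_solid:
  assumes ad: "admissible L N" shows "solid_space L N"
proof -
  let ?G = "group_algebra L N"
  have bG: "banach_star_algebra ?G" and L1: "L \<subseteq> ell1" and Kb: "\<exists>K. \<forall>k\<in>L. ell1_norm k \<le> K * N k"
    and solid: "\<And>k l. l \<in> L ==> (\<And>x. cmod (k x) \<le> cmod (l x)) ==> k \<in> L \<and> N k \<le> N l"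
    using ad unfolding admissible_def by blast+
  interpret G: banach_star_algebra ?G by (rule bG)
  have gs: "carrier ?G = L" "k \<oplus>\<^bsub>?G\<^esub> l = (\<lambda>x. k x + l x)" "\<zero>\<^bsub>?G\<^esub> = (\<lambda>x. 0)" "nrm ?G = N" "z \<odot>\<^bsub>?G\<^esub> k = (\<lambda>x. z * k x)"
    "k \<otimes>\<^bsub>?G\<^esub> l = (\<lambda>x. \<Sum>\<^sub>\<infinity>y. k y * l (- y + x))" "star ?G k = (\<lambda>x. cnj (k (- x)))" for k l z
    by (simp_all add: group_algebra_def)
  note add = G.M.a_closed[unfolded gs] G.nrm_triangle[unfolded gs] and sc = G.sm_closed[unfolded gs] G.nrm_smult[unfolded gs]
    and mu = G.mult_closed[unfolded gs] G.nrm_mult[unfolded gs] and st = G.star_closed[unfolded gs] G.nrm_star[unfolded gs]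
    and ze = G.M.zero_closed[unfolded gs] G.nrm_zero[unfolded gs]
  note defs = rin_def rnorm_def
  have ell: "ell1_norm (\<lambda>x. complex_of_real (k x)) = infsum k UNIV" if "\<And>x. 0 \<le> k x" for k
    using that by (simp add: ell1_norm_def)
  obtain K where K: "\<And>k. k \<in> L ==> ell1_norm k \<le> K * N k" using Kb by blast
  have add': "rin L (\<lambda>x. k x + l x) \<and> rnorm N (\<lambda>x. k x + l x) \<le> rnorm N k + rnorm N l" if "rin L k" "rin L l" for k l
    using add that by (simp add: defs)
  have sc': "rin L (\<lambda>x. c * k x) \<and> rnorm N (\<lambda>x. c * k x) = \<bar>c\<bar> * rnorm N k" if "rin L k" for c k
    using sc[of "\<lambda>x. complex_of_real (k x)" "complex_of_real c"] that by (simp add: defs)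
  have solid': "rin L k \<and> rnorm N k \<le> rnorm N l" if "rin L l" "\<And>x. \<bar>k x\<bar> \<le> \<bar>l x\<bar>" for k l
    using solid[of "\<lambda>x. complex_of_real (l x)" "\<lambda>x. complex_of_real (k x)"] that by (simp add: defs)
  have zero': "rin L (\<lambda>x. 0)" "rnorm N (\<lambda>x. 0) = 0" using ze by (simp_all add: defs)
  show ?thesis
  proof
    fix k l :: "'a => real" and c :: real
    show "rin L (\<lambda>x. 0)" "rnorm N (\<lambda>x. 0) = 0" by (rule zero')+
    show "\<exists>K. \<forall>k. rin L k \<longrightarrow> (\<forall>x. 0 \<le> k x) \<longrightarrow> infsum k UNIV \<le> K * rnorm N k"
    proof (intro exI[of _ K] allI impI)
      fix k assume "rin L k" "\<forall>x. 0 \<le> k x"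
      then show "infsum k UNIV \<le> K * rnorm N k" using K[of "\<lambda>x. complex_of_real (k x)"] ell[of k] by (simp add: defs)
    qed
    assume k: "rin L k" and k0: "\<And>x. 0 \<le> k x"
    show "k summable_on UNIV"
    proof -
      have "(\<lambda>x. complex_of_real (k x)) \<in> ell1" using k L1 unfolding rin_def by blast
      then show ?thesis using k0 by (simp add: ell1_def)
    qed
    { assume "0 \<le> c" then show "rin L (\<lambda>x. c * k x) \<and> rnorm N (\<lambda>x. c * k x) = c * rnorm N k" using sc'[OF k, of c] by simp }
    show "rin L (\<lambda>x. k (- x)) \<and> rnorm N (\<lambda>x. k (- x)) = rnorm N k"
      using st[of "\<lambda>x. complex_of_real (k x)"] k by (simp add: defs)
    { assume l: "rin L l" and l0: "\<And>x. 0 \<le> l x"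
      show "rin L (\<lambda>x. k x + l x) \<and> rnorm N (\<lambda>x. k x + l x) \<le> rnorm N k + rnorm N l" by (rule add'[OF k l])
      show "rin L (\<lambda>x. \<Sum>\<^sub>\<infinity>y. k y * l (- y + x)) \<and> rnorm N (\<lambda>x. \<Sum>\<^sub>\<infinity>y. k y * l (- y + x)) \<le> rnorm N k * rnorm N l"
        using mu[of "\<lambda>x. complex_of_real (k x)" "\<lambda>x. complex_of_real (l x)"] k l
        by (simp add: defs flip: infsum_complex_of_real) }
  next
    fix k l :: "'a => real"
    assume "rin L l" "\<And>x. 0 \<le> k x" "\<And>x. k x \<le> l x"
    moreover from this have "\<bar>k x\<bar> \<le> \<bar>l x\<bar>" for x by (metis abs_ge_self abs_of_nonneg order_trans)
    ultimately show "rin L k \<and> rnorm N k \<le> rnorm N l" using solid'[of l k] by blast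
  next
    fix u :: "nat => 'a => real"
    assume u0: "\<And>n x. 0 \<le> u n x" and uL: "\<And>n. rin L (u n)" and su: "summable (\<lambda>n. rnorm N (u n))"
    have sums: "rin L (\<lambda>x. \<Sum>i\<in>I. u i x) \<and> rnorm N (\<lambda>x. \<Sum>i\<in>I. u i x) \<le> (\<Sum>i\<in>I. rnorm N (u i))" if "finite I" for I
      using that
    proof (induction I)
      case empty then show ?case using zero' by simp
    next
      case (insert i I)
      then show ?case using add'[of "u i" "\<lambda>x. \<Sum>i\<in>I. u i x"] uL[of i] by simp
    qed
    define P where "P n = (\<lambda>x. complex_of_real (\<Sum>i<n. u i x))" for n
    have PL: "P n \<in> L" and NP: "N (P n) \<le> (\<Sum>i<n. rnorm N (u i))" for n
      using sums[of "{..<n}"] by (simp_all add: defs P_def)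
    have mi: "k \<ominus>\<^bsub>?G\<^esub> l = (\<lambda>x. k x - l x)" if "k \<in> L" "l \<in> L" for k l
      using G.minus_sm[unfolded gs, OF that] by (simp add: fun_eq_iff)
    have n0: "0 \<le> rnorm N (u i)" for i using G.nrm_nonneg[unfolded gs] uL[of i] by (simp add: defs)
    have diff: "N (P m \<ominus>\<^bsub>?G\<^esub> P n) \<le> \<bar>(\<Sum>i<m. rnorm N (u i)) - (\<Sum>i<n. rnorm N (u i))\<bar>" for m n
    proof -
      have le: "N (P m \<ominus>\<^bsub>?G\<^esub> P n) \<le> \<bar>(\<Sum>i<m. rnorm N (u i)) - (\<Sum>i<n. rnorm N (u i))\<bar>" if mn: "n \<le> m" for m n
      proof -
        have "{..<m} = {..<n} \<union> {n..<m}" using mn by auto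
        then have sp: "(\<Sum>i<m. f i) = (\<Sum>i<n. f i) + (\<Sum>i\<in>{n..<m}. f i)" for f :: "nat => real"
          by (simp add: sum.union_disjoint ivl_disj_int)
        have "P m \<ominus>\<^bsub>?G\<^esub> P n = (\<lambda>x. complex_of_real (\<Sum>i\<in>{n..<m}. u i x))"
          unfolding mi[OF PL PL] unfolding P_def sp by simp
        then have "N (P m \<ominus>\<^bsub>?G\<^esub> P n) \<le> (\<Sum>i\<in>{n..<m}. rnorm N (u i))" using sums[of "{n..<m}"] by (simp add: defs)
        then show ?thesis unfolding sp using abs_ge_self by (simp add: sum_nonneg n0)
      qed
      show ?thesis
      proof (cases "n \<le> m")
        case False
        then have "N (P n \<ominus>\<^bsub>?G\<^esub> P m) \<le> \<bar>(\<Sum>i<n. rnorm N (u i)) - (\<Sum>i<m. rnorm N (u i))\<bar>" by (intro le) simp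
        then show ?thesis using G.nrm_minus_commute[unfolded gs, OF PL PL] by (simp add: abs_minus_commute)
      qed (rule le)
    qed
    have "Cauchy (\<lambda>n. \<Sum>i<n. rnorm N (u i))" by (rule LIMSEQ_imp_Cauchy[OF summable_LIMSEQ[OF su]])
    then have cau: "\<exists>M. \<forall>m\<ge>M. \<forall>n\<ge>M. N (P m \<ominus>\<^bsub>?G\<^esub> P n) < e" if "0 < e" for e
      using that diff unfolding Cauchy_def dist_real_def by (meson le_less_trans)
    obtain l where l: "l \<in> L" "(\<lambda>n. N (P n \<ominus>\<^bsub>?G\<^esub> l)) \<longlonglongrightarrow> 0"
      by (rule G.Cauchy_converges[unfolded gs, of P]) (use PL cau in auto)
    have "(\<lambda>n. P n x) \<longlonglongrightarrow> l x" for x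
    proof (rule LIM_zero_cancel, rule Lim_null_comparison)
      have pt: "cmod (k x) \<le> K * N k" if k: "k \<in> L" for k
      proof -
        have "sum (\<lambda>x. cmod (k x)) {x} \<le> infsum (\<lambda>x. cmod (k x)) UNIV"
          using L1 k by (intro finite_sum_le_infsum) (auto simp: ell1_def)
        then show ?thesis using K[OF k] by (simp add: ell1_norm_def)
      qed
      have "cmod (P n x - l x) \<le> K * N (P n \<ominus>\<^bsub>?G\<^esub> l)" for n
        using pt[of "P n \<ominus>\<^bsub>?G\<^esub> l"] G.M.minus_closed[unfolded gs, OF PL l(1)] by (simp add: mi[OF PL l(1)])
      then show "\<forall>\<^sub>F n in sequentially. norm (P n x - l x) \<le> K * N (P n \<ominus>\<^bsub>?G\<^esub> l)" by (rule always_eventually[OF allI])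
      show "(\<lambda>n. K * N (P n \<ominus>\<^bsub>?G\<^esub> l)) \<longlonglongrightarrow> 0" using tendsto_mult[OF tendsto_const[of K] l(2)] by simp
    qed
    then have lx: "l x = complex_of_real (\<Sum>n. u n x)" for x
    proof -
      assume a: "\<And>x. (\<lambda>n. P n x) \<longlonglongrightarrow> l x"
      have "(\<lambda>n. Re (P n x)) \<longlonglongrightarrow> Re (l x)" "(\<lambda>n. Im (P n x)) \<longlonglongrightarrow> Im (l x)" using a[of x] by (auto intro!: tendsto_intros)
      then have "(\<lambda>n. u n x) sums Re (l x)" "(\<lambda>n::nat. 0) \<longlonglongrightarrow> Im (l x)" by (auto simp: P_def sums_def)
      then show ?thesis using LIMSEQ_unique[OF tendsto_const, of 0 "Im (l x)"] by (auto simp: sums_iff complex_eq_iff)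
    qed
    have "N l \<le> (\<Sum>n. rnorm N (u n))"
    proof (rule LIMSEQ_le_const)
      show "(\<lambda>n. (\<Sum>n. rnorm N (u n)) + N (P n \<ominus>\<^bsub>?G\<^esub> l)) \<longlonglongrightarrow> (\<Sum>n. rnorm N (u n))"
        using tendsto_add[OF tendsto_const l(2)] by simp
      have "N l \<le> (\<Sum>n. rnorm N (u n)) + N (P n \<ominus>\<^bsub>?G\<^esub> l)" for n
      proof -
        have d: "(\<lambda>x. P n x - l x) \<in> L"
          using G.M.minus_closed[unfolded gs, OF PL l(1)] mi[OF PL l(1)] by metis
        have d2: "(\<lambda>x. (- 1) * (P n x - l x)) \<in> L" by (rule sc(1)[OF d])
        have "l = (\<lambda>x. P n x + (- 1) * (P n x - l x))" by (simp add: fun_eq_iff)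
        then have "N l \<le> N (P n) + N (\<lambda>x. (- 1) * (P n x - l x))" using add(2)[OF PL[of n] d2] by metis
        also have "N (\<lambda>x. (- 1) * (P n x - l x)) = N (P n \<ominus>\<^bsub>?G\<^esub> l)"
          using sc(2)[OF d, of "- 1"] unfolding mi[OF PL l(1)] by (simp only: norm_minus_cancel norm_one mult_1)
        also have "N (P n) \<le> (\<Sum>n. rnorm N (u n))"
          using NP[of n] sum_le_suminf[OF su, of "{..<n}"] n0 by (simp add: order_trans)
        finally show ?thesis by simp
      qed
      then show "\<exists>N'. \<forall>n\<ge>N'. N l \<le> (\<Sum>n. rnorm N (u n)) + N (P n \<ominus>\<^bsub>?G\<^esub> l)" by blast
    qed
    moreover have "l = (\<lambda>x. complex_of_real (\<Sum>n. u n x))" using lx by (simp add: fun_eq_iff)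
    ultimately show "rin L (\<lambda>x. \<Sum>n. u n x) \<and> rnorm N (\<lambda>x. \<Sum>n. u n x) \<le> (\<Sum>n. rnorm N (u n))" using l(1) by (simp add: defs)
  qed
qed

text \<open>The convolution is the sum of the product family over \<open>(y, z)\<close>, reindexed by \<open>z = - y + x\<close>.\<close>

lemma nonneg_summable_conv:
  fixes k l :: "'g::group_add => real"
  assumes k: "k summable_on UNIV" "\<And>x. 0 \<le> k x" and l: "l summable_on UNIV" "\<And>x. 0 \<le> l x"
  shows "(\<lambda>(x, y). k y * l (- y + x)) summable_on UNIV"
    "(\<lambda>(y, x). k y * l (- y + x)) summable_on UNIV"
proof -
  have r: "bij_betw (\<lambda>x. - y + x) UNIV UNIV" for y :: 'g
    by (rule bij_betwI[of _ _ _ "\<lambda>x. y + x"]) (auto simp flip: add.assoc)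
  have "(\<lambda>(y, x). k y * l (- y + x)) summable_on (SIGMA y:UNIV. UNIV)"
  proof (rule summable_on_SigmaI)
    fix y
    have "((\<lambda>x. l (- y + x)) has_sum infsum l UNIV) UNIV"
      using l(1) infsum_reindex_bij_betw[OF r[of y], of l] summable_on_reindex_bij_betw[OF r[of y], of l] by (metis has_sum_infsum)
    then show "((\<lambda>x. case (y, x) of (y, x) => k y * l (- y + x)) has_sum k y * infsum l UNIV) UNIV"
      by (simp add: has_sum_cmult_right)
  qed (use k l in \<open>auto intro: summable_on_cmult_left\<close>)
  then show "(\<lambda>(y, x). k y * l (- y + x)) summable_on UNIV" by simp
  then show "(\<lambda>(x, y). k y * l (- y + x)) summable_on UNIV"
    using summable_on_swap[of "\<lambda>(y, x). k y * l (- y + x)" UNIV UNIV] by simp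
qed

lemma solid_ell1: "solid_space (ell1 :: ('g::group_add => complex) set) ell1_norm"
proof -
  have rin: "rin ell1 k \<longleftrightarrow> (\<lambda>x. \<bar>k x\<bar>) summable_on UNIV" for k :: "'g => real" by (simp add: rin_def ell1_def)
  have rn: "rnorm ell1_norm k = (\<Sum>\<^sub>\<infinity>x. \<bar>k x\<bar>)" for k :: "'g => real" by (simp add: rnorm_def ell1_norm_def)
  show ?thesis
  proof
    fix k l :: "'g => real" and c :: real
    show "rin ell1 (\<lambda>x::'g. 0)" "rnorm ell1_norm (\<lambda>x::'g. 0) = 0" by (simp_all add: rin rn)
    show "\<exists>K. \<forall>k :: 'g => real. rin ell1 k \<longrightarrow> (\<forall>x. 0 \<le> k x) \<longrightarrow> infsum k UNIV \<le> K * rnorm ell1_norm k"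
      by (intro exI[of _ 1]) (simp add: rn)
    assume k: "rin ell1 k" and k0: "\<And>x. 0 \<le> k x"
    show ks: "k summable_on UNIV" using k k0 by (simp add: rin)
    { assume "0 \<le> c" then show "rin ell1 (\<lambda>x. c * k x) \<and> rnorm ell1_norm (\<lambda>x. c * k x) = c * rnorm ell1_norm k"
        using ks k0 by (simp add: rin rn summable_on_cmult_right infsum_cmult_right) }
    have u: "bij_betw (uminus :: 'g => 'g) UNIV UNIV" by (rule bij_betwI[of _ _ _ uminus]) auto
    show "rin ell1 (\<lambda>x. k (- x)) \<and> rnorm ell1_norm (\<lambda>x. k (- x)) = rnorm ell1_norm k"
      using ks k0 summable_on_reindex_bij_betw[OF u, of k] infsum_reindex_bij_betw[OF u, of k] by (simp add: rin rn)
    { assume l: "rin ell1 l" and l0: "\<And>x. 0 \<le> l x"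
      have ls: "l summable_on UNIV" using l l0 by (simp add: rin)
      show "rin ell1 (\<lambda>x. k x + l x) \<and> rnorm ell1_norm (\<lambda>x. k x + l x) \<le> rnorm ell1_norm k + rnorm ell1_norm l"
        using ks ls k0 l0 by (simp add: rin rn summable_on_add infsum_add)
      note sm = nonneg_summable_conv[OF ks k0 ls l0]
      let ?c = "\<lambda>x. \<Sum>\<^sub>\<infinity>y. k y * l (- y + x)"
      have c0: "0 \<le> ?c x" for x by (intro infsum_nonneg) (simp add: k0 l0)
      have r: "bij_betw (\<lambda>x. - y + x) UNIV UNIV" for y :: 'g
        by (rule bij_betwI[of _ _ _ "\<lambda>x. y + x"]) (auto simp flip: add.assoc)
      have "?c summable_on UNIV" using summable_on_Sigma_banach[of "\<lambda>x y. k y * l (- y + x)" UNIV "\<lambda>_. UNIV"] sm(1) by simp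
      moreover have "(\<Sum>\<^sub>\<infinity>x. ?c x) = (\<Sum>\<^sub>\<infinity>y. \<Sum>\<^sub>\<infinity>x. k y * l (- y + x))"
        using infsum_swap_banach[of "\<lambda>x y. k y * l (- y + x)" UNIV UNIV] sm(1) by simp
      moreover have "\<dots> = infsum k UNIV * infsum l UNIV"
        using ks ls infsum_reindex_bij_betw[OF r, of l] summable_on_reindex_bij_betw[OF r, of l]
        by (simp add: infsum_cmult_right infsum_cmult_left)
      ultimately show "rin ell1 ?c \<and> rnorm ell1_norm ?c \<le> rnorm ell1_norm k * rnorm ell1_norm l"
        using c0 k0 l0 by (simp add: rin rn) }
  next
    fix k l :: "'g => real"
    assume l: "rin ell1 l" and k: "\<And>x. 0 \<le> k x" "\<And>x. k x \<le> l x"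
    have l0: "0 \<le> l x" for x using k[of x] by linarith
    have ls: "l summable_on UNIV" using l l0 by (simp add: rin)
    have ks: "k summable_on UNIV" by (rule summable_on_comparison_test[OF ls]) (use k in auto)
    show "rin ell1 k \<and> rnorm ell1_norm k \<le> rnorm ell1_norm l"
      using infsum_mono[OF ks ls] k l0 ks by (simp add: rin rn)
  next
    fix u :: "nat => 'g => real"
    assume u0: "\<And>n x. 0 \<le> u n x" and uL: "\<And>n. rin ell1 (u n)" and su: "summable (\<lambda>n. rnorm ell1_norm (u n))"
    have us: "u n summable_on UNIV" for n using uL[of n] u0 by (simp add: rin)
    have rnu: "rnorm ell1_norm (u n) = infsum (u n) UNIV" for n using u0 by (simp add: rn)
    have fin: "(\<Sum>x\<in>F. u n x) \<le> rnorm ell1_norm (u n)" if "finite F" for F n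
      unfolding rnu using that us u0 by (intro finite_sum_le_infsum) auto
    have sx: "summable (\<lambda>n. u n x)" for x
      by (rule summable_comparison_test'[OF su, of 0]) (use fin[of "{x}"] u0 in auto)
    have s0: "0 \<le> (\<Sum>n. u n x)" for x by (rule suminf_nonneg[OF sx u0])
    have b: "(\<Sum>x\<in>F. \<Sum>n. u n x) \<le> (\<Sum>n. rnorm ell1_norm (u n))" if "finite F" for F
    proof -
      have "(\<Sum>x\<in>F. \<Sum>n. u n x) = (\<Sum>n. \<Sum>x\<in>F. u n x)" by (rule suminf_sum[symmetric]) (rule sx)
      also have "\<dots> \<le> (\<Sum>n. rnorm ell1_norm (u n))"
        by (rule suminf_le[OF _ _ su]) (use fin[OF that] sx in \<open>auto intro: summable_sum\<close>)
      finally show ?thesis .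
    qed
    have "(\<lambda>x. \<Sum>n. u n x) summable_on UNIV"
      by (rule nonneg_bdd_above_summable_on) (use s0 b in \<open>auto simp: bdd_above_def\<close>)
    then show "rin ell1 (\<lambda>x. \<Sum>n. u n x) \<and> rnorm ell1_norm (\<lambda>x. \<Sum>n. u n x) \<le> (\<Sum>n. rnorm ell1_norm (u n))"
      using s0 b by (auto simp: rin rn intro!: infsum_le_finite_sums)
  qed
qed

section \<open>Cross-sectional algebras of Fell bundles\<close>

definition fell_alg :: "('g::group_add => complex) set => (('g => complex) => real) => ('a, 'm) normed_star_alg_scheme
    => ('g => 'g => 'a => 'a => 'a) => ('g => 'a => 'a) => ('g => 'a) normed_star_alg" where
  "fell_alg L N A m s =
    \<lparr>carrier = {f. (\<forall>x. f x \<in> carrier A) \<and> (\<lambda>x. complex_of_real (nrm A (f x))) \<in> L},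
     monoid.mult = (\<lambda>f g x. alg_sum A (\<lambda>y. m y (- y + x) (f y) (g (- y + x)))),
     one = (\<lambda>x. if x = 0 then \<one>\<^bsub>A\<^esub> else \<zero>\<^bsub>A\<^esub>),
     zero = (\<lambda>x. \<zero>\<^bsub>A\<^esub>),
     add = (\<lambda>f g x. f x \<oplus>\<^bsub>A\<^esub> g x),
     smult = (\<lambda>z f x. z \<odot>\<^bsub>A\<^esub> f x),
     star = (\<lambda>f x. s x (f (- x))),
     nrm = (\<lambda>f. N (\<lambda>x. complex_of_real (nrm A (f x))))\<rparr>"

lemma twisted_algebra_fell: "twisted_algebra L N A \<alpha> \<omega> = fell_alg L N A (tw_m A \<alpha> \<omega>) (tw_s A \<alpha> \<omega>)"
  by (simp add: twisted_algebra_def fell_alg_def tw_m_def tw_s_def)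

definition single :: "('a, 'm) normed_star_alg_scheme => 'g => 'a => 'g => 'a" where
  "single A x a = (\<lambda>y. if y = x then a else \<zero>\<^bsub>A\<^esub>)"

lemma infsum_supported_at: "(\<And>y. y \<noteq> x ==> f y = 0) ==> (\<Sum>\<^sub>\<infinity>y. f y) = (f x :: 'a::real_normed_vector)"
  using infsum_cong_neutral[of "{x}" UNIV f f] by simp

context fell_bundle
begin

text \<open>Total versions of the structure maps on the normed space \<open>'a uni\<close>, to which the theory of infinite sums applies.\<close>

definition Mb :: "'g => 'g => 'a uni => 'a uni => 'a uni" where
  "Mb x y F G = emb A (m x y (prj A F) (prj A G))"

definition Sb :: "'g => 'a uni => 'a uni" where "Sb x F = emb A (s x (prj A F))"

lemma Mb_emb: "a \<in> carrier A ==> b \<in> carrier A ==> Mb x y (emb A a) (emb A b) = emb A (m x y a b)"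
  by (simp add: Mb_def)

lemma norm_Mb: "norm (Mb x y F G) \<le> norm F * norm G"
proof -
  have "norm (Mb x y F G) \<le> nrm A (prj A F) * nrm A (prj A G)" by (simp add: Mb_def m_norm)
  also have "\<dots> \<le> norm F * norm G" by (intro mult_mono norm_prj) auto
  finally show ?thesis .
qed

lemma bounded_bilinear_Mb: "bounded_bilinear (Mb x y)"
proof
  show "\<exists>K. \<forall>a b. norm (Mb x y a b) \<le> norm a * norm b * K" by (intro exI[of _ 1]) (simp add: norm_Mb)
qed (simp_all add: Mb_def prj_simps m_add_left m_add_right m_sm_left m_sm_right emb_add emb_smult scaleR_cx chr_simps)

lemma bounded_linear_Sb: "bounded_linear (Sb x)"
proof (rule bounded_linear_intro[of _ 1])
  fix F show "norm (Sb x F) \<le> norm F * 1" by (simp add: Sb_def s_norm norm_prj)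
qed (simp_all add: Sb_def prj_simps s_add s_sm emb_add emb_smult scaleR_cx chr_simps)

lemma Mb_assoc: "Mb (x + y) z (Mb x y F G) H = Mb x (y + z) F (Mb y z G H)"
  by (simp add: Mb_def m_assoc)

lemma m_zero: "a \<in> carrier A ==> m x y \<zero> a = \<zero>" "a \<in> carrier A ==> m x y a \<zero> = \<zero>"
  using m_sm_left[of "\<zero>" a x y 0] m_sm_right[of a "\<zero>" x y 0] by auto

lemma s_zero [simp]: "s x \<zero> = \<zero>" using s_sm[of "\<zero>" x 0] by simp

end

locale fell_algebra = fell_bundle A m s + solid_space L N
  for A :: "'a normed_star_alg" (structure) and m :: "'g::group_add => 'g => 'a => 'a => 'a" and s
    and L :: "('g => complex) set" and N
begin

abbreviation "F \<equiv> fell_alg L N A m s"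

lemma F_carrier: "f \<in> carrier F \<longleftrightarrow> (\<forall>x. f x \<in> carrier A) \<and> rin L (\<lambda>x. nrm A (f x))"
  by (simp add: fell_alg_def rin_def)

lemma F_ops: "\<zero>\<^bsub>F\<^esub> = (\<lambda>x. \<zero>)" "f \<oplus>\<^bsub>F\<^esub> g = (\<lambda>x. f x \<oplus> g x)" "z \<odot>\<^bsub>F\<^esub> f = (\<lambda>x. z \<odot> f x)"
  "star F f = (\<lambda>x. s x (f (- x)))" "nrm F f = rnorm N (\<lambda>x. nrm A (f x))"
  by (simp_all add: fell_alg_def rnorm_def)

lemma F_mult: "f \<otimes>\<^bsub>F\<^esub> g = (\<lambda>x. alg_sum A (\<lambda>y. m y (- y + x) (f y) (g (- y + x))))" by (simp add: fell_alg_def)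

lemma F_value [simp, intro]: "f \<in> carrier F ==> f x \<in> carrier A" by (simp add: F_carrier)

lemma F_rin: "f \<in> carrier F ==> rin L (\<lambda>x. nrm A (f x))" by (simp add: F_carrier)

lemma F_summable: "f \<in> carrier F ==> (\<lambda>x. nrm A (f x)) summable_on UNIV"
  by (rule S_summable) (auto simp: F_carrier)

lemma F_bounded: assumes "f \<in> carrier F" shows "nrm A (f x) \<le> infsum (\<lambda>x. nrm A (f x)) UNIV"
proof -
  have "sum (\<lambda>x. nrm A (f x)) {x} \<le> infsum (\<lambda>x. nrm A (f x)) UNIV"
    by (rule finite_sum_le_infsum) (use assms F_summable in auto)
  then show ?thesis by simp
qed

lemma F_intro:
  assumes "\<And>x. f x \<in> carrier A" "rin L k" "\<And>x. nrm A (f x) \<le> k x"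
  shows "f \<in> carrier F" "nrm F f \<le> rnorm N k"
  using S_solid[OF assms(2), of "\<lambda>x. nrm A (f x)"] assms by (auto simp: F_carrier F_ops)

lemma mult_summable:
  assumes f: "f \<in> carrier F" and g: "g \<in> carrier F"
  shows "(\<lambda>y. nrm A (f y) * nrm A (g (- y + x))) summable_on UNIV"
    "(\<lambda>y. nrm A (m y (- y + x) (f y) (g (- y + x)))) summable_on UNIV"
proof -
  let ?C = "infsum (\<lambda>x. nrm A (g x)) UNIV"
  have 1: "(\<lambda>y. nrm A (f y) * ?C) summable_on UNIV" by (intro summable_on_cmult_left F_summable f)
  show 2: "(\<lambda>y. nrm A (f y) * nrm A (g (- y + x))) summable_on UNIV"
    by (rule summable_on_comparison_test[OF 1]) (use f g in \<open>auto intro!: mult_left_mono F_bounded\<close>)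
  show "(\<lambda>y. nrm A (m y (- y + x) (f y) (g (- y + x)))) summable_on UNIV"
    by (rule summable_on_comparison_test[OF 2]) (use f g in \<open>auto intro!: m_norm\<close>)
qed

lemma mult_value:
  assumes f: "f \<in> carrier F" and g: "g \<in> carrier F"
  shows "(f \<otimes>\<^bsub>F\<^esub> g) x \<in> carrier A"
    "emb A ((f \<otimes>\<^bsub>F\<^esub> g) x) = (\<Sum>\<^sub>\<infinity>y. Mb y (- y + x) (emb A (f y)) (emb A (g (- y + x))))"
  using alg_sum_emb[of "\<lambda>y. m y (- y + x) (f y) (g (- y + x))"] mult_summable(2)[OF f g] f g
  by (simp_all add: F_mult Mb_emb)

lemma mult_emb_summable:
  assumes f: "f \<in> carrier F" and g: "g \<in> carrier F"
  shows "(\<lambda>y. Mb y (- y + x) (emb A (f y)) (emb A (g (- y + x)))) summable_on UNIV"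
  by (rule abs_summable_summable) (use mult_summable(2)[OF f g] f g in \<open>simp add: Mb_emb\<close>)

lemma mult_norm_value:
  assumes f: "f \<in> carrier F" and g: "g \<in> carrier F"
  shows "nrm A ((f \<otimes>\<^bsub>F\<^esub> g) x) \<le> (\<Sum>\<^sub>\<infinity>y. nrm A (f y) * nrm A (g (- y + x)))"
proof -
  have ms: "(\<lambda>y. norm (Mb y (- y + x) (emb A (f y)) (emb A (g (- y + x))))) summable_on UNIV"
    using mult_summable(2)[OF f g] f g by (simp add: Mb_emb)
  have "nrm A ((f \<otimes>\<^bsub>F\<^esub> g) x) = norm (emb A ((f \<otimes>\<^bsub>F\<^esub> g) x))" using mult_value(1)[OF f g] by simp
  also have "\<dots> \<le> (\<Sum>\<^sub>\<infinity>y. norm (Mb y (- y + x) (emb A (f y)) (emb A (g (- y + x)))))"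
    unfolding mult_value(2)[OF f g] by (rule norm_infsum_bound[OF ms])
  also have "\<dots> \<le> (\<Sum>\<^sub>\<infinity>y. nrm A (f y) * nrm A (g (- y + x)))"
    by (rule infsum_mono[OF ms mult_summable(1)[OF f g]]) (use f g in \<open>simp add: Mb_emb m_norm\<close>)
  finally show ?thesis .
qed

lemma mult_F:
  assumes f: "f \<in> carrier F" and g: "g \<in> carrier F"
  shows "f \<otimes>\<^bsub>F\<^esub> g \<in> carrier F" "nrm F (f \<otimes>\<^bsub>F\<^esub> g) \<le> nrm F f * nrm F g"
proof -
  have c: "rin L (\<lambda>x. \<Sum>\<^sub>\<infinity>y. nrm A (f y) * nrm A (g (- y + x)))"
    "rnorm N (\<lambda>x. \<Sum>\<^sub>\<infinity>y. nrm A (f y) * nrm A (g (- y + x))) \<le> nrm F f * nrm F g"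
    using S_conv[OF F_rin[OF f] F_rin[OF g]] f g by (simp_all add: F_ops)
  note * = F_intro[OF mult_value(1)[OF f g] c(1) mult_norm_value[OF f g]]
  show "f \<otimes>\<^bsub>F\<^esub> g \<in> carrier F" by (rule *)
  show "nrm F (f \<otimes>\<^bsub>F\<^esub> g) \<le> nrm F f * nrm F g" using *(2) c(2) by simp
qed

lemma F_eqI: "f \<in> carrier F ==> g \<in> carrier F ==> (\<And>x. emb A (f x) = emb A (g x)) ==> f = g"
  by (auto simp: fun_eq_iff emb_eq_iff)

lemma add_F: "f \<in> carrier F ==> g \<in> carrier F ==> f \<oplus>\<^bsub>F\<^esub> g \<in> carrier F \<and> nrm F (f \<oplus>\<^bsub>F\<^esub> g) \<le> nrm F f + nrm F g"
proof -
  assume f: "f \<in> carrier F" and g: "g \<in> carrier F"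
  have k: "rin L (\<lambda>x. nrm A (f x) + nrm A (g x))" "rnorm N (\<lambda>x. nrm A (f x) + nrm A (g x)) \<le> nrm F f + nrm F g"
    using S_add[OF F_rin[OF f] F_rin[OF g]] f g by (simp_all add: F_ops)
  have v: "(f \<oplus>\<^bsub>F\<^esub> g) x \<in> carrier A" "nrm A ((f \<oplus>\<^bsub>F\<^esub> g) x) \<le> nrm A (f x) + nrm A (g x)" for x
    using f g by (simp_all add: F_ops nrm_triangle)
  show ?thesis using F_intro(1)[OF v(1) k(1) v(2)] order_trans[OF F_intro(2)[OF v(1) k(1) v(2)] k(2)] by blast
qed

lemma sm_F: "f \<in> carrier F ==> z \<odot>\<^bsub>F\<^esub> f \<in> carrier F \<and> nrm F (z \<odot>\<^bsub>F\<^esub> f) = cmod z * nrm F f"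
  using S_scale[OF F_rin, of f "cmod z"] by (simp add: F_carrier F_ops nrm_smult)

lemma star_F: "f \<in> carrier F ==> star F f \<in> carrier F \<and> nrm F (star F f) = nrm F f"
  using S_minus[OF F_rin, of f] by (simp add: F_carrier F_ops s_norm)

lemma zero_F: "\<zero>\<^bsub>F\<^esub> \<in> carrier F" using S_zero by (simp add: F_carrier F_ops)

lemma assoc_F:
  assumes f: "f \<in> carrier F" and g: "g \<in> carrier F" and h: "h \<in> carrier F"
  shows "(f \<otimes>\<^bsub>F\<^esub> g) \<otimes>\<^bsub>F\<^esub> h = f \<otimes>\<^bsub>F\<^esub> (g \<otimes>\<^bsub>F\<^esub> h)"
proof (rule F_eqI)
  show "(f \<otimes>\<^bsub>F\<^esub> g) \<otimes>\<^bsub>F\<^esub> h \<in> carrier F" "f \<otimes>\<^bsub>F\<^esub> (g \<otimes>\<^bsub>F\<^esub> h) \<in> carrier F" by (intro mult_F f g h)+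
  fix x
  let ?f = "\<lambda>x. emb A (f x)" and ?g = "\<lambda>x. emb A (g x)" and ?h = "\<lambda>x. emb A (h x)"
  let ?T = "\<lambda>z y. Mb z (- z + x) (Mb y (- y + z) (?f y) (?g (- y + z))) (?h (- z + x))"
  let ?C = "infsum (\<lambda>x. nrm A (h x)) UNIV"
  have "(\<lambda>(z, y). nrm A (f y) * nrm A (g (- y + z))) summable_on UNIV"
    using f g by (intro nonneg_summable_conv F_summable) auto
  then have "(\<lambda>p. (case p of (z, y) => nrm A (f y) * nrm A (g (- y + z))) * ?C) summable_on UNIV" by (rule summable_on_cmult_left)
  then have "(\<lambda>p. norm (case p of (z, y) => ?T z y)) summable_on UNIV"
  proof (rule summable_on_comparison_test)
    fix p :: "'g \<times> 'g"
    obtain z y where p: "p = (z, y)" by (cases p)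
    have "norm (?T z y) \<le> norm (Mb y (- y + z) (?f y) (?g (- y + z))) * norm (?h (- z + x))" by (rule norm_Mb)
    also have "\<dots> \<le> (norm (?f y) * norm (?g (- y + z))) * ?C"
      using h by (intro mult_mono norm_Mb) (auto simp: F_bounded)
    finally show "norm (case p of (z, y) => ?T z y) \<le> (case p of (z, y) => nrm A (f y) * nrm A (g (- y + z))) * ?C"
      using f g by (simp add: p)
  qed auto
  then have T: "(\<lambda>(z, y). ?T z y) summable_on UNIV \<times> UNIV" by (simp add: abs_summable_summable)
  have "emb A (((f \<otimes>\<^bsub>F\<^esub> g) \<otimes>\<^bsub>F\<^esub> h) x) = (\<Sum>\<^sub>\<infinity>z. Mb z (- z + x) (\<Sum>\<^sub>\<infinity>y. Mb y (- y + z) (?f y) (?g (- y + z))) (?h (- z + x)))"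
    using f g h by (simp add: mult_value(2) mult_F)
  also have "\<dots> = (\<Sum>\<^sub>\<infinity>z. \<Sum>\<^sub>\<infinity>y. ?T z y)"
    by (intro infsum_cong infsum_real_bounded_linear[symmetric] mult_emb_summable f g
        bounded_bilinear.bounded_linear_left[OF bounded_bilinear_Mb])
  also have "\<dots> = (\<Sum>\<^sub>\<infinity>y. \<Sum>\<^sub>\<infinity>z. ?T z y)" by (rule infsum_swap_banach[OF T])
  also have "\<dots> = (\<Sum>\<^sub>\<infinity>y. \<Sum>\<^sub>\<infinity>w. Mb y (- y + x) (?f y) (Mb w (- w + (- y + x)) (?g w) (?h (- w + (- y + x)))))"
  proof (rule infsum_cong)
    fix y :: 'g
    have "bij_betw (\<lambda>w. y + w) UNIV UNIV" by (rule bij_betwI[of _ _ _ "\<lambda>w. - y + w"]) (auto simp flip: add.assoc)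
    from infsum_reindex_bij_betw[OF this, of "\<lambda>z. ?T z y"]
    have "(\<Sum>\<^sub>\<infinity>z. ?T z y) = (\<Sum>\<^sub>\<infinity>w. ?T (y + w) y)" by simp
    also have "\<dots> = (\<Sum>\<^sub>\<infinity>w. Mb y (- y + x) (?f y) (Mb w (- w + (- y + x)) (?g w) (?h (- w + (- y + x)))))"
    proof (rule infsum_cong)
      fix w
      have e: "- y + (y + w) = w" "w + (- w + (- y + x)) = - y + x" by simp_all
      have e': "- (y + w) + x = - w + (- y + x)" by (simp only: Groups.minus_add add.assoc)
      show "?T (y + w) y = Mb y (- y + x) (?f y) (Mb w (- w + (- y + x)) (?g w) (?h (- w + (- y + x))))"
        unfolding e e' using Mb_assoc[of y w "- w + (- y + x)"] by (simp only: e)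
    qed
    finally show "(\<Sum>\<^sub>\<infinity>z. ?T z y) = (\<Sum>\<^sub>\<infinity>w. Mb y (- y + x) (?f y) (Mb w (- w + (- y + x)) (?g w) (?h (- w + (- y + x)))))" .
  qed
  also have "\<dots> = (\<Sum>\<^sub>\<infinity>y. Mb y (- y + x) (?f y) (\<Sum>\<^sub>\<infinity>w. Mb w (- w + (- y + x)) (?g w) (?h (- w + (- y + x)))))"
    by (intro infsum_cong infsum_real_bounded_linear mult_emb_summable g h
        bounded_bilinear.bounded_linear_right[OF bounded_bilinear_Mb])
  also have "\<dots> = emb A ((f \<otimes>\<^bsub>F\<^esub> (g \<otimes>\<^bsub>F\<^esub> h)) x)"
    using f g h by (simp add: mult_value(2) mult_F)
  finally show "emb A (((f \<otimes>\<^bsub>F\<^esub> g) \<otimes>\<^bsub>F\<^esub> h) x) = emb A ((f \<otimes>\<^bsub>F\<^esub> (g \<otimes>\<^bsub>F\<^esub> h)) x)" .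
qed

lemma star_mult_F:
  assumes f: "f \<in> carrier F" and g: "g \<in> carrier F"
  shows "star F (f \<otimes>\<^bsub>F\<^esub> g) = star F g \<otimes>\<^bsub>F\<^esub> star F f"
proof (rule F_eqI)
  have sf: "star F f \<in> carrier F" and sg: "star F g \<in> carrier F" using star_F f g by auto
  show "star F (f \<otimes>\<^bsub>F\<^esub> g) \<in> carrier F" "star F g \<otimes>\<^bsub>F\<^esub> star F f \<in> carrier F"
    using star_F mult_F f g sf sg by auto
  fix x
  have "emb A (star F (f \<otimes>\<^bsub>F\<^esub> g) x) = Sb x (emb A ((f \<otimes>\<^bsub>F\<^esub> g) (- x)))"
    using mult_value(1)[OF f g] by (simp add: Sb_def F_ops)
  also have "\<dots> = (\<Sum>\<^sub>\<infinity>y. Sb x (Mb y (- y + - x) (emb A (f y)) (emb A (g (- y + - x)))))"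
    unfolding mult_value(2)[OF f g] by (rule infsum_real_bounded_linear[symmetric, OF bounded_linear_Sb mult_emb_summable[OF f g]])
  also have "\<dots> = (\<Sum>\<^sub>\<infinity>y. Mb (x + y) (- y) (emb A (star F g (x + y))) (emb A (star F f (- y))))"
  proof (rule infsum_cong)
    fix y
    define w where "w = - y + - x"
    have x: "x = - w + - y" and xy: "x + y = - w" by (simp_all add: w_def Groups.minus_add add.assoc)
    have "s x (m y w (f y) (g w)) = m (- w) (- y) (s (- w) (g w)) (s (- y) (f y))"
      unfolding x by (rule s_m) (use f g in auto)
    then show "Sb x (Mb y (- y + - x) (emb A (f y)) (emb A (g (- y + - x)))) = Mb (x + y) (- y) (emb A (star F g (x + y))) (emb A (star F f (- y)))"
      using f g unfolding w_def[symmetric] xy by (simp add: Sb_def Mb_def F_ops)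
  qed
  also have "\<dots> = (\<Sum>\<^sub>\<infinity>v. Mb v (- v + x) (emb A (star F g v)) (emb A (star F f (- v + x))))"
  proof -
    have "bij_betw (\<lambda>y. x + y) UNIV UNIV" by (rule bij_betwI[of _ _ _ "\<lambda>w. - x + w"]) (auto simp flip: add.assoc)
    from infsum_reindex_bij_betw[OF this, of "\<lambda>v. Mb v (- v + x) (emb A (star F g v)) (emb A (star F f (- v + x)))"]
    moreover have "- (x + y) + x = - y" for y by (simp add: Groups.minus_add add.assoc)
    ultimately show ?thesis by (simp only:)
  qed
  also have "\<dots> = emb A ((star F g \<otimes>\<^bsub>F\<^esub> star F f) x)" by (rule mult_value(2)[OF sg sf, symmetric])
  finally show "emb A (star F (f \<otimes>\<^bsub>F\<^esub> g) x) = emb A ((star F g \<otimes>\<^bsub>F\<^esub> star F f) x)" .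
qed

lemma star_algebra_F: "star_algebra F"
proof -
  have ag: "abelian_group F"
  proof (rule abelian_groupI)
    fix f assume f: "f \<in> carrier F"
    show "\<exists>g\<in>carrier F. g \<oplus>\<^bsub>F\<^esub> f = \<zero>\<^bsub>F\<^esub>"
    proof
      show "(- 1) \<odot>\<^bsub>F\<^esub> f \<in> carrier F" using sm_F[OF f] by blast
      have "(- 1) \<odot> f x \<oplus> f x = \<zero>" for x using sm_add[of "f x" "- 1" 1] f by simp
      then show "(- 1) \<odot>\<^bsub>F\<^esub> f \<oplus>\<^bsub>F\<^esub> f = \<zero>\<^bsub>F\<^esub>" by (simp add: F_ops)
    qed
  qed (use add_F zero_F in \<open>auto simp: F_ops M.a_ac\<close>)
  have mod: "module complex_ring F"
    by (rule moduleI[OF cring_complex_ring ag]) (use sm_F in \<open>auto simp: F_ops sm_add sm_distr sm_sm\<close>)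
  have emb_sum: "emb A ((f \<otimes>\<^bsub>F\<^esub> g) x) = (\<Sum>\<^sub>\<infinity>y. Mb y (- y + x) (emb A (f y)) (emb A (g (- y + x))))"
    if "f \<in> carrier F" "g \<in> carrier F" for f g x by (rule mult_value(2)[OF that])
  note bil = bounded_bilinear_Mb
  show ?thesis
  proof (intro star_algebra.intro mod star_algebra_axioms.intro)
    fix f g h and z :: complex
    assume f: "f \<in> carrier F"
    show "star F f \<in> carrier F" using star_F[OF f] by blast
    show "star F (star F f) = f" using f by (simp add: F_ops s_s)
    show "star F (z \<odot>\<^bsub>F\<^esub> f) = cnj z \<odot>\<^bsub>F\<^esub> star F f" using f by (simp add: F_ops s_sm)
    assume g: "g \<in> carrier F"
    show "f \<otimes>\<^bsub>F\<^esub> g \<in> carrier F" by (rule mult_F[OF f g])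
    show "star F (f \<oplus>\<^bsub>F\<^esub> g) = star F f \<oplus>\<^bsub>F\<^esub> star F g" using f g by (simp add: F_ops s_add)
    show "star F (f \<otimes>\<^bsub>F\<^esub> g) = star F g \<otimes>\<^bsub>F\<^esub> star F f" by (rule star_mult_F[OF f g])
    have zf: "z \<odot>\<^bsub>F\<^esub> f \<in> carrier F" and zg: "z \<odot>\<^bsub>F\<^esub> g \<in> carrier F" and fg: "f \<otimes>\<^bsub>F\<^esub> g \<in> carrier F" and fag: "f \<oplus>\<^bsub>F\<^esub> g \<in> carrier F"
      using sm_F f g mult_F(1)[OF f g] add_F[OF f g] by blast+
    have zfg: "z \<odot>\<^bsub>F\<^esub> (f \<otimes>\<^bsub>F\<^esub> g) \<in> carrier F" using sm_F[OF fg] by blast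
    have e: "emb A ((z \<odot>\<^bsub>F\<^esub> (f \<otimes>\<^bsub>F\<^esub> g)) x) = (\<Sum>\<^sub>\<infinity>y. cx z * Mb y (- y + x) (emb A (f y)) (emb A (g (- y + x))))" for x
    proof -
      have "emb A ((z \<odot>\<^bsub>F\<^esub> (f \<otimes>\<^bsub>F\<^esub> g)) x) = cx z * emb A ((f \<otimes>\<^bsub>F\<^esub> g) x)" using fg by (simp add: F_ops emb_smult)
      also have "\<dots> = (\<Sum>\<^sub>\<infinity>y. cx z * Mb y (- y + x) (emb A (f y)) (emb A (g (- y + x))))"
        unfolding emb_sum[OF f g] by (rule infsum_real_bounded_linear[symmetric, OF bounded_linear_mult_right mult_emb_summable[OF f g]])
      finally show ?thesis .
    qed
    show "z \<odot>\<^bsub>F\<^esub> f \<otimes>\<^bsub>F\<^esub> g = z \<odot>\<^bsub>F\<^esub> (f \<otimes>\<^bsub>F\<^esub> g)"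
      by (rule F_eqI[OF mult_F(1)[OF zf g] zfg], unfold e emb_sum[OF zf g])
        (use f g in \<open>simp add: F_ops Mb_def m_sm_left prj_cx_mult emb_smult\<close>)
    show "f \<otimes>\<^bsub>F\<^esub> (z \<odot>\<^bsub>F\<^esub> g) = z \<odot>\<^bsub>F\<^esub> (f \<otimes>\<^bsub>F\<^esub> g)"
      by (rule F_eqI[OF mult_F(1)[OF f zg] zfg], unfold e emb_sum[OF f zg])
        (use f g in \<open>simp add: F_ops Mb_def m_sm_right prj_cx_mult emb_smult\<close>)
    assume h: "h \<in> carrier F"
    show "f \<otimes>\<^bsub>F\<^esub> g \<otimes>\<^bsub>F\<^esub> h = f \<otimes>\<^bsub>F\<^esub> (g \<otimes>\<^bsub>F\<^esub> h)" by (rule assoc_F[OF f g h])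
    have gah: "g \<oplus>\<^bsub>F\<^esub> h \<in> carrier F" using add_F[OF g h] by blast
    have addv: "emb A ((p \<oplus>\<^bsub>F\<^esub> q) x) = emb A (p x) + emb A (q x)" if "p \<in> carrier F" "q \<in> carrier F" for p q x
      using that by (simp add: F_ops emb_add)
    show "(f \<oplus>\<^bsub>F\<^esub> g) \<otimes>\<^bsub>F\<^esub> h = f \<otimes>\<^bsub>F\<^esub> h \<oplus>\<^bsub>F\<^esub> g \<otimes>\<^bsub>F\<^esub> h"
    proof (rule F_eqI)
      show "emb A (((f \<oplus>\<^bsub>F\<^esub> g) \<otimes>\<^bsub>F\<^esub> h) x) = emb A ((f \<otimes>\<^bsub>F\<^esub> h \<oplus>\<^bsub>F\<^esub> g \<otimes>\<^bsub>F\<^esub> h) x)" for x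
        unfolding addv[OF mult_F(1)[OF f h] mult_F(1)[OF g h]] emb_sum[OF fag h] emb_sum[OF f h] emb_sum[OF g h] addv[OF f g]
          bounded_bilinear.add_left[OF bil]
        by (rule infsum_add[OF mult_emb_summable[OF f h] mult_emb_summable[OF g h]])
    qed (use f g h fag add_F mult_F in auto)
    show "f \<otimes>\<^bsub>F\<^esub> (g \<oplus>\<^bsub>F\<^esub> h) = f \<otimes>\<^bsub>F\<^esub> g \<oplus>\<^bsub>F\<^esub> f \<otimes>\<^bsub>F\<^esub> h"
    proof (rule F_eqI)
      show "emb A ((f \<otimes>\<^bsub>F\<^esub> (g \<oplus>\<^bsub>F\<^esub> h)) x) = emb A ((f \<otimes>\<^bsub>F\<^esub> g \<oplus>\<^bsub>F\<^esub> f \<otimes>\<^bsub>F\<^esub> h) x)" for x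
        unfolding addv[OF mult_F(1)[OF f g] mult_F(1)[OF f h]] emb_sum[OF f gah] emb_sum[OF f h] emb_sum[OF f g] addv[OF g h]
          bounded_bilinear.add_right[OF bil]
        by (rule infsum_add[OF mult_emb_summable[OF f g] mult_emb_summable[OF f h]])
    qed (use f g h gah add_F mult_F in auto)
  qed
qed

lemma F_minus_value: "f \<in> carrier F ==> g \<in> carrier F ==> (f \<ominus>\<^bsub>F\<^esub> g) x = f x \<ominus> g x"
  using star_algebra.minus_sm[OF star_algebra_F, of f g] by (simp add: F_ops minus_sm)

lemma nrm_F_nonneg: "f \<in> carrier F ==> 0 \<le> nrm F f"
  using rnorm_nonneg[of "\<lambda>x. nrm A (f x)"] by (simp add: F_carrier F_ops)

lemma nrm_F_eq_0: assumes "f \<in> carrier F" shows "nrm F f = 0 \<longleftrightarrow> f = \<zero>\<^bsub>F\<^esub>"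
proof
  assume "nrm F f = 0"
  then have "rnorm N (\<lambda>x. nrm A (f x)) = 0" by (simp only: F_ops)
  then have "nrm A (f x) = 0" for x
    by (rule rnorm_eq_0[OF F_rin[OF assms], rotated]) (use assms in simp)
  then show "f = \<zero>\<^bsub>F\<^esub>" using assms by (simp add: F_ops fun_eq_iff nrm_eq_zero)
next
  assume "f = \<zero>\<^bsub>F\<^esub>" then show "nrm F f = 0" using S_zero by (simp add: F_ops)
qed

text \<open>Along a rapidly convergent subsequence the norms of the differences are summable in \<open>L\<close>, so the telescoping series
  converges pointwise and is dominated by an element of \<open>L\<close>.\<close>

lemma banach_F: "banach_star_algebra F"
proof -
  interpret SA: star_algebra F by (rule star_algebra_F)
  have um: "nrm F (\<ominus>\<^bsub>F\<^esub> f) = nrm F f" if "f \<in> carrier F" for f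
    using sm_F[OF that, of "- 1"] that by (simp add: SA.uminus_sm)
  have ms: "Metric_space (carrier F) (norm_dist F (nrm F))"
    by (rule norm_dist_metric[OF SA.M.abelian_group_axioms]) (use nrm_F_nonneg nrm_F_eq_0 um add_F in auto)
  have "Metric_space.mcomplete (carrier F) (norm_dist F (nrm F))"
  proof (rule mcomplete_norm_distI[OF ms])
    fix f :: "nat => 'g => 'a"
    assume f: "\<And>n. f n \<in> carrier F" and cau: "\<And>e. 0 < e ==> \<exists>M. \<forall>m\<ge>M. \<forall>n\<ge>M. nrm F (f m \<ominus>\<^bsub>F\<^esub> f n) < e"
    have "\<exists>M. \<forall>m\<ge>M. \<forall>n\<ge>M. nrm F (f m \<ominus>\<^bsub>F\<^esub> f n) < (1/2) ^ k" for k by (rule cau) simp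
    then obtain M where M: "\<And>k m n. M k \<le> m ==> M k \<le> n ==> nrm F (f m \<ominus>\<^bsub>F\<^esub> f n) < (1/2) ^ k" by metis
    define r where "r k = sum M {..k} + k" for k
    have rM: "M k \<le> r k" "r k \<le> r (Suc k)" "k \<le> r k" for k
      using member_le_sum[of k "{..k}" M] by (simp_all add: r_def)
    define d where "d k = f (r (Suc k)) \<ominus>\<^bsub>F\<^esub> f (r k)" for k
    have dF: "d k \<in> carrier F" for k using f by (simp add: d_def)
    define u where "u k = (\<lambda>x. nrm A (d k x))" for k
    have u0: "0 \<le> u k x" and uL: "rin L (u k)" for k x using dF[of k] by (auto simp: u_def F_carrier)
    have un: "rnorm N (u k) = nrm F (d k)" for k by (simp add: u_def F_ops)
    have uk: "rnorm N (u k) \<le> (1/2) ^ k" for k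
      unfolding un d_def using M[of k "r (Suc k)" "r k"] rM[of k] by (simp add: less_imp_le)
    have su: "summable (\<lambda>k. rnorm N (u k))"
      by (rule summable_comparison_test'[of "\<lambda>k. (1/2) ^ k" 0])
        (use uk rnorm_nonneg[OF uL u0] in \<open>auto simp: summable_geometric\<close>)
    obtain K where K: "0 < K" "\<And>k x. rin L k ==> (\<And>x. 0 \<le> k x) ==> k x \<le> K * rnorm N k" using rnorm_pointwise by blast
    have sx: "summable (\<lambda>k. norm (emb A (d k x)))" for x
      by (rule summable_comparison_test'[OF summable_mult[OF su, of K], of 0])
        (use K(2)[OF uL u0] dF in \<open>auto simp: u_def\<close>)
    define G where "G n x = emb A (f (r n) x) + (\<Sum>k. emb A (d (k + n) x))" for n x
    have G_Suc: "G (Suc n) x = G n x" for n x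
    proof -
      have s: "summable (\<lambda>k. emb A (d (k + n) x))"
        using summable_ignore_initial_segment[OF summable_norm_cancel[OF sx]] .
      have "(\<Sum>k. emb A (d (k + n) x)) = emb A (d (0 + n) x) + (\<Sum>k. emb A (d (Suc k + n) x))"
        using suminf_split_head[OF s] by simp
      moreover have "emb A (d n x) = emb A (f (r (Suc n)) x) - emb A (f (r n) x)"
        using f by (simp add: d_def F_minus_value emb_minus)
      ultimately show ?thesis by (simp add: G_def)
    qed
    have G0: "G n x = G 0 x" for n x by (induction n) (simp_all add: G_Suc)
    have Gp: "emb A (prj A (G 0 x)) = G 0 x" for x
    proof -
      have s: "summable (\<lambda>k. emb A (d k x))" by (rule summable_norm_cancel[OF sx])
      have "emb A (prj A (\<Sum>k. emb A (d k x))) = (\<Sum>k. emb A (prj A (emb A (d k x))))"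
        by (rule bounded_linear.suminf[OF bounded_linear_emb_prj s])
      then show ?thesis using f dF by (simp add: G_def prj_simps emb_add)
    qed
    define g where "g x = prj A (G 0 x)" for x
    have g: "g x \<in> carrier A" "emb A (g x) = G n x" for n x using Gp[of x] G0[of n x] by (simp_all add: g_def)
    have tail: "nrm A (g x \<ominus> f (r n) x) \<le> (\<Sum>k. u (k + n) x)" for n x
    proof -
      have "nrm A (g x \<ominus> f (r n) x) = norm (\<Sum>k. emb A (d (k + n) x))"
        using g(2)[of x n] f g(1) by (simp add: G_def emb_minus flip: norm_emb)
      also have "\<dots> \<le> (\<Sum>k. norm (emb A (d (k + n) x)))"
        by (rule summable_norm) (rule summable_ignore_initial_segment[OF sx])
      finally show ?thesis using dF by (simp add: u_def)
    qed
    have tailN: "rin L (\<lambda>x. \<Sum>k. u (k + n) x) \<and> rnorm N (\<lambda>x. \<Sum>k. u (k + n) x) \<le> (\<Sum>k. rnorm N (u (k + n)))" for n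
      by (rule S_series) (use u0 uL su in \<open>auto intro: summable_ignore_initial_segment\<close>)
    have gfr: "(\<lambda>x. g x \<ominus> f (r n) x) \<in> carrier F" "nrm F (\<lambda>x. g x \<ominus> f (r n) x) \<le> (\<Sum>k. rnorm N (u (k + n)))" for n
      using F_intro[of "\<lambda>x. g x \<ominus> f (r n) x" "\<lambda>x. \<Sum>k. u (k + n) x"] tail tailN f g by (auto intro: order_trans)
    have gF: "g \<in> carrier F"
    proof -
      have "(\<lambda>x. g x \<ominus> f (r 0) x) \<oplus>\<^bsub>F\<^esub> f (r 0) \<in> carrier F" using add_F[OF gfr(1) f] by blast
      moreover have "(\<lambda>x. g x \<ominus> f (r 0) x) \<oplus>\<^bsub>F\<^esub> f (r 0) = g"
        using g f by (simp add: F_ops fun_eq_iff a_minus_def M.a_assoc M.l_neg)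
      ultimately show ?thesis by simp
    qed
    have gm: "(\<lambda>x. g x \<ominus> f n x) = g \<ominus>\<^bsub>F\<^esub> f n" for n using gF f by (simp add: F_minus_value fun_eq_iff)
    show "\<exists>l\<in>carrier F. \<forall>e>0. \<exists>M. \<forall>n\<ge>M. nrm F (f n \<ominus>\<^bsub>F\<^esub> l) < e"
    proof (intro bexI[OF _ gF] allI impI)
      fix e :: real assume e: "0 < e"
      obtain M1 where M1: "\<And>m n. M1 \<le> m ==> M1 \<le> n ==> nrm F (f m \<ominus>\<^bsub>F\<^esub> f n) < e / 2" using cau[of "e / 2"] e by auto
      have "(\<lambda>n. \<Sum>k. rnorm N (u (k + n))) \<longlonglongrightarrow> 0" by (rule suminf_exist_split2[OF su])
      then have "\<forall>\<^sub>F n in sequentially. (\<Sum>k. rnorm N (u (k + n))) < e / 2" using e by (intro order_tendstoD) auto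
      moreover have "\<forall>\<^sub>F n in sequentially. M1 \<le> r n"
        using eventually_ge_at_top[of M1] by eventually_elim (rule order_trans[OF _ rM(3)])
      ultimately obtain n where n: "(\<Sum>k. rnorm N (u (k + n))) < e / 2" "M1 \<le> r n"
        by (metis (mono_tags, lifting) eventually_conj eventually_happens sequentially_bot)
      have "nrm F (f p \<ominus>\<^bsub>F\<^esub> g) < e" if p: "M1 \<le> p" for p
      proof -
        have "f p \<ominus>\<^bsub>F\<^esub> g = (f p \<ominus>\<^bsub>F\<^esub> f (r n)) \<oplus>\<^bsub>F\<^esub> \<ominus>\<^bsub>F\<^esub> (g \<ominus>\<^bsub>F\<^esub> f (r n))"
        proof -
          have "(f p \<ominus>\<^bsub>F\<^esub> f (r n)) \<oplus>\<^bsub>F\<^esub> \<ominus>\<^bsub>F\<^esub> (g \<ominus>\<^bsub>F\<^esub> f (r n)) = f p \<oplus>\<^bsub>F\<^esub> ((\<ominus>\<^bsub>F\<^esub> f (r n) \<oplus>\<^bsub>F\<^esub> f (r n)) \<oplus>\<^bsub>F\<^esub> \<ominus>\<^bsub>F\<^esub> g)"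
            using f gF by (simp add: a_minus_def SA.M.minus_add SA.M.a_ac)
          then show ?thesis using f gF by (simp add: SA.M.l_neg a_minus_def)
        qed
        then have "nrm F (f p \<ominus>\<^bsub>F\<^esub> g) \<le> nrm F (f p \<ominus>\<^bsub>F\<^esub> f (r n)) + nrm F (g \<ominus>\<^bsub>F\<^esub> f (r n))"
          using add_F[of "f p \<ominus>\<^bsub>F\<^esub> f (r n)" "\<ominus>\<^bsub>F\<^esub> (g \<ominus>\<^bsub>F\<^esub> f (r n))"] um[of "g \<ominus>\<^bsub>F\<^esub> f (r n)"] f gF by simp
        then show ?thesis using M1[OF p n(2)] gfr(2)[of n] n(1) unfolding gm by linarith
      qed
      then show "\<exists>M. \<forall>n\<ge>M. nrm F (f n \<ominus>\<^bsub>F\<^esub> g) < e" by blast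
    qed
  qed
  then show ?thesis
    by (intro banach_star_algebra.intro star_algebra_F banach_star_algebra_axioms.intro)
      (use nrm_F_eq_0 add_F sm_F mult_F star_F in auto)
qed

sublocale F: uni_factor F by (rule uni_factor.intro[OF banach_F])

lemma mult_single_right:
  assumes f: "f \<in> carrier F" and b: "single A y b \<in> carrier F" "b \<in> carrier A"
  shows "f \<otimes>\<^bsub>F\<^esub> single A y b = (\<lambda>x. m (x - y) y (f (x - y)) b)"
proof
  fix x
  have iff: "- v + x = y \<longleftrightarrow> v = x - y" for v by (metis add_diff_cancel diff_add_cancel minus_add_cancel add_minus_cancel)
  have "emb A ((f \<otimes>\<^bsub>F\<^esub> single A y b) x) = Mb (x - y) y (emb A (f (x - y))) (emb A b)"
    unfolding mult_value(2)[OF f b(1)]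
    by (subst infsum_supported_at[of "x - y"]) (use f b iff in \<open>auto simp: single_def Mb_def m_zero prj_simps\<close>)
  then show "(f \<otimes>\<^bsub>F\<^esub> single A y b) x = m (x - y) y (f (x - y)) b"
    using f b mult_value(1)[OF f b(1)] by (simp add: Mb_emb emb_eq_iff)
qed

lemma mult_single_left:
  assumes g: "g \<in> carrier F" and a: "single A y a \<in> carrier F" "a \<in> carrier A"
  shows "single A y a \<otimes>\<^bsub>F\<^esub> g = (\<lambda>x. m y (- y + x) a (g (- y + x)))"
proof
  fix x
  have "emb A ((single A y a \<otimes>\<^bsub>F\<^esub> g) x) = Mb y (- y + x) (emb A a) (emb A (g (- y + x)))"
    unfolding mult_value(2)[OF a(1) g]
    by (subst infsum_supported_at[of y]) (use g a in \<open>auto simp: single_def Mb_def m_zero prj_simps\<close>)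
  then show "(single A y a \<otimes>\<^bsub>F\<^esub> g) x = m y (- y + x) a (g (- y + x))"
    using g a mult_value(1)[OF a(1) g] by (simp add: Mb_emb emb_eq_iff)
qed

lemma single_F:
  assumes k: "rin L k" "0 < k x" "\<And>y. 0 \<le> k y" and a: "a \<in> carrier A" shows "single A x a \<in> carrier F"
proof (rule F_intro(1))
  have "rin L (\<lambda>y. (nrm A a / k x) * k y)" using S_scale[OF k(1,3), of "nrm A a / k x"] k(2) a by simp
  then show "rin L (\<lambda>y. (nrm A a / k x) * k y)" .
  show "nrm A (single A x a y) \<le> (nrm A a / k x) * k y" for y using k a by (simp add: single_def)
qed (use a in \<open>simp add: single_def\<close>)

lemma is_one_F:
  assumes e: "is_one A e" and s1: "single A 0 e \<in> carrier F" shows "is_one F (single A 0 e)"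
proof -
  have ec: "e \<in> carrier A" and el: "\<And>a. a \<in> carrier A ==> e \<otimes> a = a" using e by (auto simp: is_one_def)
  show ?thesis
    unfolding is_one_def
    by (auto simp: s1 mult_single_left[OF _ s1 ec] mult_single_right[OF _ s1 ec] m_one[OF e] m_0 ec el)
qed

end

section \<open>The \<open>C\<^sup>*\<close>-seminorm of a positive map\<close>

text \<open>For an operator-valued positive map \<open>\<epsilon>\<close>, the operator seminorm of left multiplication on the
  \<open>\<epsilon>\<close>-inner product module \<open>\<langle>g, h\<rangle> = \<epsilon> (g\<^sup>* h)\<close> can be defined by order alone, as the least \<open>c\<close> with
  \<open>\<langle>x g, x g\<rangle> \<le> c\<^sup>2 \<langle>g, g\<rangle>\<close> for all \<open>g\<close>. This avoids the Cauchy--Schwarz inequality for modules.\<close>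

locale positive_map = unital_star_algebra S + T: hermitian T
  for S :: "'x::cbstar set" and T :: "'y::cbstar set" +
  fixes I :: "'x set" and \<epsilon> :: "'x => 'y"
  assumes I_S: "I \<subseteq> S"
    and I_mult: "x \<in> S ==> g \<in> I ==> x * g \<in> I"
    and I_add: "g \<in> I ==> h \<in> I ==> g + h \<in> I"
    and \<epsilon>_add: "\<epsilon> (x + y) = \<epsilon> x + \<epsilon> y"
    and \<epsilon>_scaleR: "\<epsilon> (r *\<^sub>R x) = r *\<^sub>R \<epsilon> x"
    and \<epsilon>_mem: "\<epsilon> x \<in> T"
    and \<epsilon>_pos: "g \<in> I ==> positive (\<epsilon> (adj g * g))"
begin

lemma \<epsilon>_diff: "\<epsilon> (x - y) = \<epsilon> x - \<epsilon> y"
  using \<epsilon>_add[of "x - y" y] by simp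

lemma I_scaleR: "g \<in> I ==> r *\<^sub>R g \<in> I"
  using I_mult[of "of_real r" g] by (simp add: scaleR_conv_of_real)

lemma I_diff: "g \<in> I ==> h \<in> I ==> g - h \<in> I"
  using I_add[of g "(- 1) *\<^sub>R h"] I_scaleR[of h "- 1"] by simp

definition bnd :: "'x => real => bool" where
  "bnd x c \<longleftrightarrow> 0 \<le> c \<and> (\<forall>g\<in>I. positive (\<epsilon> (c\<^sup>2 *\<^sub>R (adj g * g) - adj (x * g) * (x * g))))"

definition pn :: "'x => real" where "pn x = Inf {c. bnd x c}"

lemma bnd_mono: assumes "bnd x c" "c \<le> d" shows "bnd x d"
  unfolding bnd_def
proof (intro conjI ballI)
  show "0 \<le> d" using assms by (simp add: bnd_def)
  fix g assume g: "g \<in> I"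
  have cd: "0 \<le> d\<^sup>2 - c\<^sup>2" using assms by (simp add: bnd_def power_mono)
  have "positive (\<epsilon> (c\<^sup>2 *\<^sub>R (adj g * g) - adj (x * g) * (x * g)) + (d\<^sup>2 - c\<^sup>2) *\<^sub>R \<epsilon> (adj g * g))"
    using assms g cd by (intro T.positive_add positive_scaleR \<epsilon>_pos \<epsilon>_mem T.scaleR_mem) (auto simp: bnd_def)
  also have "\<epsilon> (c\<^sup>2 *\<^sub>R (adj g * g) - adj (x * g) * (x * g)) + (d\<^sup>2 - c\<^sup>2) *\<^sub>R \<epsilon> (adj g * g)
      = \<epsilon> (d\<^sup>2 *\<^sub>R (adj g * g) - adj (x * g) * (x * g))"
    by (simp add: \<epsilon>_diff \<epsilon>_scaleR scaleR_left_diff_distrib)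
  finally show "positive (\<epsilon> (d\<^sup>2 *\<^sub>R (adj g * g) - adj (x * g) * (x * g)))" .
qed

text \<open>Every Banach *-algebra norm dominates: \<open>c\<^sup>2 - x\<^sup>* x\<close> has a self-adjoint square root.\<close>

lemma bnd_norm: assumes x: "x \<in> S" and c: "norm x < c" shows "bnd x c"
  unfolding bnd_def
proof (intro conjI ballI)
  have c0: "0 < c" using c norm_ge_zero[of x] by linarith
  then show "0 \<le> c" by simp
  fix g assume g: "g \<in> I"
  define y where "y = (1 / c\<^sup>2) *\<^sub>R (adj x * x)"
  have "norm (adj x * x) \<le> norm x * norm x" using norm_mult_ineq[of "adj x" x] by simp
  also have "\<dots> < c * c" using c by (intro mult_strict_mono') auto
  finally have "norm y < 1" using c0 by (simp add: y_def power2_eq_square)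
  then have "rad y < 1" using rad_le_norm[of y] by linarith
  then obtain k where k: "k \<in> S" "adj k = k" "k * k = 1 - y"
    using self_adjoint_root[of y] x by (auto simp: y_def adj_mult)
  have "adj (k * g) * (k * g) = adj g * (k * k) * g" by (simp add: adj_mult k(2) mult.assoc)
  also have "\<dots> = adj g * g - (1 / c\<^sup>2) *\<^sub>R (adj (x * g) * (x * g))"
    unfolding k(3) by (simp add: y_def adj_mult right_diff_distrib left_diff_distrib mult.assoc)
  finally have "c\<^sup>2 *\<^sub>R (adj (k * g) * (k * g)) = c\<^sup>2 *\<^sub>R (adj g * g) - adj (x * g) * (x * g)"
    using c0 by (simp add: scaleR_right_diff_distrib)
  moreover have "positive (\<epsilon> (c\<^sup>2 *\<^sub>R (adj (k * g) * (k * g))))"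
    unfolding \<epsilon>_scaleR using g k by (intro positive_scaleR \<epsilon>_pos I_mult) auto
  ultimately show "positive (\<epsilon> (c\<^sup>2 *\<^sub>R (adj g * g) - adj (x * g) * (x * g)))" by simp
qed

lemma bnd_set: "bdd_below {c. bnd x c}" "x \<in> S ==> {c. bnd x c} \<noteq> {}"
  by (auto simp: bnd_def intro: bdd_belowI[of _ 0]) (use bnd_norm[of x "norm x + 1"] in \<open>unfold bnd_def, fastforce\<close>)

lemma pn_nonneg: "x \<in> S ==> 0 \<le> pn x"
  unfolding pn_def using bnd_set(2) by (intro cInf_greatest) (auto simp: bnd_def)

lemma pn_le: "bnd x c ==> pn x \<le> c"
  unfolding pn_def by (rule cInf_lower) (auto simp: bnd_set)

lemma pn_bnd: assumes "x \<in> S" "pn x < c" shows "bnd x c"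
proof -
  obtain d where "bnd x d" "d < c" using cInf_lessD[of "{c. bnd x c}" c] bnd_set(2) assms by (auto simp: pn_def)
  then show ?thesis by (intro bnd_mono[of x d c]) auto
qed

lemma pn_le_norm: "x \<in> S ==> pn x \<le> norm x" by (rule dense_ge) (auto intro: pn_le bnd_norm)

lemma bnd_mult:
  assumes x: "x \<in> S" "bnd x c" and y: "y \<in> S" "bnd y d" shows "bnd (x * y) (c * d)"
  unfolding bnd_def
proof (intro conjI ballI)
  show "0 \<le> c * d" using x y by (simp add: bnd_def)
  fix g assume g: "g \<in> I"
  have "positive (\<epsilon> (c\<^sup>2 *\<^sub>R (adj (y * g) * (y * g)) - adj (x * (y * g)) * (x * (y * g)))
      + c\<^sup>2 *\<^sub>R \<epsilon> (d\<^sup>2 *\<^sub>R (adj g * g) - adj (y * g) * (y * g)))"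
    using x y g I_mult[OF y(1) g] by (intro T.positive_add positive_scaleR \<epsilon>_mem T.scaleR_mem) (auto simp: bnd_def)
  then show "positive (\<epsilon> ((c * d)\<^sup>2 *\<^sub>R (adj g * g) - adj (x * y * g) * (x * y * g)))"
    by (simp add: \<epsilon>_diff \<epsilon>_scaleR mult.assoc power_mult_distrib scaleR_right_diff_distrib)
qed

text \<open>The optimal constant comes from \<open>\<langle>w, w\<rangle> \<ge> 0\<close> for \<open>w = (d/c)\<^bsup>1/2\<^esup> u - (c/d)\<^bsup>1/2\<^esup> v\<close>, where \<open>u = x g\<close> and \<open>v = y g\<close>.\<close>

lemma bnd_add:
  assumes x: "x \<in> S" "bnd x c" "0 < c" and y: "y \<in> S" "bnd y d" "0 < d" shows "bnd (x + y) (c + d)"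
  unfolding bnd_def
proof (intro conjI ballI)
  show "0 \<le> c + d" using x y by simp
  fix g assume g: "g \<in> I"
  define r where "r = sqrt (d / c)"
  have r: "0 < r" "r * r = d / c" "(1 / r) * (1 / r) = c / d" using x y by (simp_all add: r_def real_sqrt_divide)
  define u where "u = x * g"
  define v where "v = y * g"
  have uv: "u \<in> I" "v \<in> I" using x y g I_mult by (auto simp: u_def v_def)
  define w where "w = r *\<^sub>R u - (1 / r) *\<^sub>R v"
  have wI: "w \<in> I" using uv by (auto simp: w_def intro!: I_diff I_scaleR)
  have ww: "adj w * w = (d / c) *\<^sub>R (adj u * u) - adj u * v - adj v * u + (c / d) *\<^sub>R (adj v * v)"
    using r by (simp add: w_def adj_diff right_diff_distrib left_diff_distrib scaleR_right_diff_distrib flip: r(2,3))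
  have s: "(c + d)\<^sup>2 = (1 + d / c) * c\<^sup>2 + (1 + c / d) * d\<^sup>2"
    using x y by (simp add: power2_eq_square field_simps)
  have "positive (\<epsilon> (adj w * w) + ((1 + d / c) *\<^sub>R \<epsilon> (c\<^sup>2 *\<^sub>R (adj g * g) - adj u * u)
      + (1 + c / d) *\<^sub>R \<epsilon> (d\<^sup>2 *\<^sub>R (adj g * g) - adj v * v)))"
    using x y g wI unfolding u_def v_def
    by (intro T.positive_add positive_scaleR \<epsilon>_pos \<epsilon>_mem T.scaleR_mem T.add_mem) (auto simp: bnd_def)
  also have "\<epsilon> (adj w * w) + ((1 + d / c) *\<^sub>R \<epsilon> (c\<^sup>2 *\<^sub>R (adj g * g) - adj u * u)
      + (1 + c / d) *\<^sub>R \<epsilon> (d\<^sup>2 *\<^sub>R (adj g * g) - adj v * v))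
      = \<epsilon> (adj w * w + ((1 + d / c) *\<^sub>R (c\<^sup>2 *\<^sub>R (adj g * g) - adj u * u) + (1 + c / d) *\<^sub>R (d\<^sup>2 *\<^sub>R (adj g * g) - adj v * v)))"
    by (simp only: \<epsilon>_add \<epsilon>_scaleR)
  also have "adj w * w + ((1 + d / c) *\<^sub>R (c\<^sup>2 *\<^sub>R (adj g * g) - adj u * u) + (1 + c / d) *\<^sub>R (d\<^sup>2 *\<^sub>R (adj g * g) - adj v * v))
      = (c + d)\<^sup>2 *\<^sub>R (adj g * g) - adj (u + v) * (u + v)"
    unfolding ww s by (simp only: adj_add scaleR_right_diff_distrib scaleR_left_distrib distrib_left distrib_right scaleR_scaleR scaleR_one)
      (simp add: algebra_simps)
  finally show "positive (\<epsilon> ((c + d)\<^sup>2 *\<^sub>R (adj g * g) - adj ((x + y) * g) * ((x + y) * g)))"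
    by (simp add: u_def v_def distrib_right)
qed

text \<open>With \<open>v = x\<^sup>* x g - c g\<close>, the sum of \<open>\<langle>v, v\<rangle>\<close> and \<open>c\<^sup>2 \<langle>g, g\<rangle> - \<langle>x\<^sup>* x g, x\<^sup>* x g\<rangle>\<close> is
  \<open>2 c (c \<langle>g, g\<rangle> - \<langle>x g, x g\<rangle>)\<close>.\<close>

lemma bnd_root:
  assumes x: "x \<in> S" and b: "bnd (adj x * x) c" and c: "0 < c" shows "bnd x (sqrt c)"
  unfolding bnd_def
proof (intro conjI ballI)
  fix g assume g: "g \<in> I"
  let ?w = "adj x * x"
  let ?v = "?w * g - c *\<^sub>R g"
  have vI: "?v \<in> I" using x g by (intro I_diff I_mult I_scaleR) auto
  have vv: "adj ?v * ?v = adj (?w * g) * (?w * g) - (2 * c) *\<^sub>R (adj (x * g) * (x * g)) + c\<^sup>2 *\<^sub>R (adj g * g)"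
    by (simp add: adj_diff adj_mult right_diff_distrib left_diff_distrib mult.assoc power2_eq_square)
      (simp add: scaleR_left_distrib[symmetric] algebra_simps flip: scaleR_add_left)
  have "positive ((1 / (2 * c)) *\<^sub>R (\<epsilon> (adj ?v * ?v) + \<epsilon> (c\<^sup>2 *\<^sub>R (adj g * g) - adj (?w * g) * (?w * g))))"
    using b g vI c by (intro positive_scaleR T.positive_add \<epsilon>_pos \<epsilon>_mem) (auto simp: bnd_def)
  also have "(1 / (2 * c)) *\<^sub>R (\<epsilon> (adj ?v * ?v) + \<epsilon> (c\<^sup>2 *\<^sub>R (adj g * g) - adj (?w * g) * (?w * g)))
      = \<epsilon> ((1 / (2 * c)) *\<^sub>R (adj ?v * ?v + (c\<^sup>2 *\<^sub>R (adj g * g) - adj (?w * g) * (?w * g))))"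
    by (simp only: \<epsilon>_add \<epsilon>_scaleR)
  also have "adj ?v * ?v + (c\<^sup>2 *\<^sub>R (adj g * g) - adj (?w * g) * (?w * g)) = (2 * c) *\<^sub>R (c *\<^sub>R (adj g * g) - adj (x * g) * (x * g))"
  proof -
    have "c\<^sup>2 *\<^sub>R (adj g * g) + c\<^sup>2 *\<^sub>R (adj g * g) = (2 * c) *\<^sub>R (c *\<^sub>R (adj g * g))"
      by (simp add: power2_eq_square flip: scaleR_add_left)
    then show ?thesis unfolding vv scaleR_right_diff_distrib by simp
  qed
  finally show "positive (\<epsilon> ((sqrt c)\<^sup>2 *\<^sub>R (adj g * g) - adj (x * g) * (x * g)))" using c by simp
qed (use c in simp)

lemma bnd_cx_mult: assumes "bnd x c" shows "bnd (cx z * x) (cmod z * c)"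
  unfolding bnd_def
proof (intro conjI ballI)
  show "0 \<le> cmod z * c" using assms by (simp add: bnd_def)
  fix g assume g: "g \<in> I"
  have zz: "cnj z * z = complex_of_real ((cmod z)\<^sup>2)" by (metis complex_norm_square mult.commute)
  have "adj (cx z * x * g) * (cx z * x * g) = (cmod z)\<^sup>2 *\<^sub>R (adj (x * g) * (x * g))"
    by (simp only: mult.assoc adj_cx_mult_square zz scaleR_cx)
  then have "\<epsilon> ((cmod z * c)\<^sup>2 *\<^sub>R (adj g * g) - adj (cx z * x * g) * (cx z * x * g))
      = (cmod z)\<^sup>2 *\<^sub>R \<epsilon> (c\<^sup>2 *\<^sub>R (adj g * g) - adj (x * g) * (x * g))"
    by (simp add: \<epsilon>_diff \<epsilon>_scaleR power_mult_distrib scaleR_right_diff_distrib)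
  then show "positive (\<epsilon> ((cmod z * c)\<^sup>2 *\<^sub>R (adj g * g) - adj (cx z * x * g) * (cx z * x * g)))"
    using assms g by (simp add: positive_scaleR bnd_def)
qed

lemma pn_mult: assumes "x \<in> S" "y \<in> S" shows "pn (x * y) \<le> pn x * pn y"
proof -
  have *: "pn (x * y) \<le> (pn x + e) * (pn y + e)" if "0 < e" for e
    using that assms by (intro pn_le bnd_mult pn_bnd) auto
  have "((\<lambda>e. (pn x + e) * (pn y + e)) \<longlongrightarrow> (pn x + 0) * (pn y + 0)) (at_right 0)" by (intro tendsto_intros)
  moreover have "\<forall>\<^sub>F e in at_right 0. pn (x * y) \<le> (pn x + e) * (pn y + e)" using * by (auto simp: eventually_at_filter)
  ultimately show ?thesis by (intro tendsto_lowerbound[where F = "at_right (0::real)"]) auto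
qed

lemma pn_add: assumes "x \<in> S" "y \<in> S" shows "pn (x + y) \<le> pn x + pn y"
proof (rule field_le_epsilon)
  fix e :: real assume e: "0 < e"
  have "pn (x + y) \<le> (pn x + e / 2) + (pn y + e / 2)"
    using assms e pn_nonneg[of x] pn_nonneg[of y] by (intro pn_le bnd_add pn_bnd) auto
  then show "pn (x + y) \<le> pn x + pn y + e" by simp
qed

lemma pn_root: assumes x: "x \<in> S" shows "(pn x)\<^sup>2 \<le> pn (adj x * x)"
proof (rule dense_ge)
  fix c assume c: "pn (adj x * x) < c"
  have c0: "0 < c" using c pn_nonneg[of "adj x * x"] x by auto
  have "pn x \<le> sqrt c" using c x c0 by (intro pn_le bnd_root pn_bnd) auto
  then have "(pn x)\<^sup>2 \<le> (sqrt c)\<^sup>2" using pn_nonneg[OF x] by (intro power_mono) auto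
  then show "(pn x)\<^sup>2 \<le> c" using c0 by simp
qed

lemma pn_adj_le: assumes x: "x \<in> S" shows "pn x \<le> pn (adj x)"
proof (cases "pn x = 0")
  case True then show ?thesis using pn_nonneg[of "adj x"] x by simp
next
  case False
  have "pn x * pn x \<le> pn (adj x) * pn x"
    using pn_root[OF x] pn_mult[of "adj x" x] x by (simp add: power2_eq_square)
  then show ?thesis using False pn_nonneg[OF x] by (simp add: mult_le_cancel_right)
qed

lemma pn_adj: "x \<in> S ==> pn (adj x) = pn x"
  using pn_adj_le[of x] pn_adj_le[of "adj x"] by simp

lemma pn_cstar: "x \<in> S ==> pn (adj x * x) = (pn x)\<^sup>2"
  using pn_root[of x] pn_mult[of "adj x" x] by (simp add: pn_adj power2_eq_square)

lemma pn_cx_mult: assumes x: "x \<in> S" shows "pn (cx z * x) = cmod z * pn x"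
proof -
  have le: "pn (cx z * x) \<le> cmod z * pn x" if x: "x \<in> S" for z x
  proof -
    have *: "pn (cx z * x) \<le> cmod z * (pn x + e)" if "0 < e" for e
      using that x by (intro pn_le bnd_cx_mult pn_bnd) auto
    have "((\<lambda>e. cmod z * (pn x + e)) \<longlongrightarrow> cmod z * (pn x + 0)) (at_right 0)" by (intro tendsto_intros)
    moreover have "\<forall>\<^sub>F e in at_right 0. pn (cx z * x) \<le> cmod z * (pn x + e)" using * by (auto simp: eventually_at_filter)
    ultimately show ?thesis by (intro tendsto_lowerbound[where F = "at_right (0::real)"]) auto
  qed
  show ?thesis
  proof (cases "z = 0")
    case True then show ?thesis using le[OF x, of 0] pn_nonneg[of 0] by simp
  next
    case False
    have "pn x \<le> cmod (1 / z) * pn (cx z * x)" using le[of "cx z * x" "1 / z"] False x by (simp add: cx_mult_left)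
    then have "cmod z * pn x \<le> cmod z * (cmod (1 / z) * pn (cx z * x))" by (intro mult_left_mono) auto
    also have "\<dots> = pn (cx z * x)" using False by (simp add: norm_divide)
    finally show ?thesis using le[OF x] by (simp add: antisym)
  qed
qed

end

section \<open>The reduced \<open>C\<^sup>*\<close>-norm of a cross-sectional algebra\<close>

lemma (in hermitian) positive_infsum:
  assumes t: "\<And>i. i \<in> I ==> t i \<in> S \<and> positive (t i)" and su: "t summable_on I"
  shows "infsum t I \<in> S" "positive (infsum t I)"
proof -
  have fin: "sum t F \<in> S \<and> positive (sum t F)" if "finite F" "F \<subseteq> I" for F
    using that by (induction F rule: finite_induct) (use t in \<open>auto intro!: positive_add\<close>)
  have ap: "\<exists>F. finite F \<and> F \<subseteq> I \<and> norm (infsum t I - sum t F) \<le> e" if "0 < e" for e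
    using infsum_finite_approximation[OF su that] by (auto simp: dist_norm norm_minus_commute)
  show S: "infsum t I \<in> S"
  proof -
    have "infsum t I \<in> closure S" unfolding closure_approachable dist_norm
    proof (intro allI impI)
      fix e :: real assume "0 < e"
      then obtain F where "finite F" "F \<subseteq> I" "norm (infsum t I - sum t F) \<le> e / 2" using ap[of "e / 2"] by auto
      then show "\<exists>y\<in>S. norm (y - infsum t I) < e"
        using fin[of F] \<open>0 < e\<close> by (intro bexI[of _ "sum t F"]) (auto simp: norm_minus_commute)
    qed
    then show ?thesis using closed_S by simp
  qed
  have "adj (infsum t I) = (\<Sum>\<^sub>\<infinity>i\<in>I. adj (t i))" by (rule infsum_real_bounded_linear[symmetric, OF bounded_linear_adj su])
  also have "\<dots> = infsum t I" by (rule infsum_cong) (use t positive_adj in blast)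
  finally have a: "adj (infsum t I) = infsum t I" .
  show "positive (infsum t I)"
  proof (rule positive_limit[OF S a])
    fix e :: real assume "0 < e"
    then obtain F where "finite F" "F \<subseteq> I" "norm (infsum t I - sum t F) \<le> e" using ap by blast
    then show "\<exists>f\<in>S. positive f \<and> norm (infsum t I - f) \<le> e" using fin[of F] by blast
  qed
qed

context fell_algebra
begin

text \<open>The conditional expectation onto the fibre over \<open>0\<close>. The seminorm that it defines is the norm of the regular
  representation of \<open>F\<close> on the Hilbert module \<open>\<ell>\<^sup>2(G; A)\<close>.\<close>

definition at0 :: "('g => 'a) uni => 'a uni" where "at0 X = emb A (prj F X 0)"

text \<open>The value at \<open>0\<close> of \<open>g\<^sup>* g\<close> is the \<open>\<ell>\<^sup>2\<close> sum of the fibre squares, indexed here by the position of \<open>g\<close>; the convolution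
  sum runs over its negative.\<close>

lemma square_at_0:
  assumes g: "g \<in> carrier F"
  shows "(\<lambda>x. emb A (m (- x) x (s (- x) (g x)) (g x))) summable_on UNIV"
    "emb A ((star F g \<otimes>\<^bsub>F\<^esub> g) 0) = (\<Sum>\<^sub>\<infinity>x. emb A (m (- x) x (s (- x) (g x)) (g x)))"
proof -
  have sg: "star F g \<in> carrier F" using star_F[OF g] by blast
  have u: "bij_betw (uminus :: 'g => 'g) UNIV UNIV" by (rule bij_betwI[of _ _ _ uminus]) auto
  let ?t = "\<lambda>y. Mb y (- y + 0) (emb A (star F g y)) (emb A (g (- y + 0)))"
  have t: "?t (- x) = emb A (m (- x) x (s (- x) (g x)) (g x))" for x
    using g by (simp add: Mb_emb F_ops)
  show "(\<lambda>x. emb A (m (- x) x (s (- x) (g x)) (g x))) summable_on UNIV"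
    using mult_emb_summable[OF sg g, of 0] summable_on_reindex_bij_betw[OF u, of ?t] unfolding t by blast
  show "emb A ((star F g \<otimes>\<^bsub>F\<^esub> g) 0) = (\<Sum>\<^sub>\<infinity>x. emb A (m (- x) x (s (- x) (g x)) (g x)))"
    unfolding mult_value(2)[OF sg g] using infsum_reindex_bij_betw[OF u, of ?t] unfolding t by simp
qed

lemma term_positive:
  assumes a: "a \<in> carrier A"
  shows "emb A (m (- x) x (s (- x) a) a) \<in> unitized A" "positive (emb A (m (- x) x (s (- x) a) a))"
proof -
  show "emb A (m (- x) x (s (- x) a) a) \<in> unitized A" using a by auto
  obtain c where c: "c \<in> carrier A" "m (- x) x (s (- x) a) a = star A c \<otimes> c" using m_pos[OF a] by blast
  show "positive (emb A (m (- x) x (s (- x) a) a))"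
    unfolding c(2) using shirali_ford[of "emb A c"] c by (simp add: emb_mult emb_star)
qed

lemma square_positive: "g \<in> carrier F ==> positive (emb A ((star F g \<otimes>\<^bsub>F\<^esub> g) 0))"
  unfolding square_at_0(2) by (rule positive_infsum(2)) (use square_at_0(1) term_positive in auto)

text \<open>Each fibre value is dominated by the value of the square at the unit.\<close>

lemma square_dominates:
  assumes g: "g \<in> carrier F"
  shows "positive (emb A ((star F g \<otimes>\<^bsub>F\<^esub> g) 0) - emb A (m (- x) x (s (- x) (g x)) (g x)))"
proof -
  let ?t = "\<lambda>x. emb A (m (- x) x (s (- x) (g x)) (g x))"
  have su: "?t summable_on UNIV" by (rule square_at_0(1)[OF g])
  have su': "?t summable_on UNIV - {x}" by (rule summable_on_subset_banach[OF su]) auto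
  have "infsum ?t ((UNIV - {x}) \<union> {x}) = infsum ?t (UNIV - {x}) + infsum ?t {x}"
    by (rule infsum_Un_disjoint) (use su' in auto)
  moreover have "(UNIV - {x}) \<union> {x} = UNIV" by auto
  ultimately have "infsum ?t UNIV - ?t x = infsum ?t (UNIV - {x})" by simp
  moreover have "positive (infsum ?t (UNIV - {x}))"
    by (rule positive_infsum(2)) (use su' g term_positive in auto)
  ultimately show ?thesis unfolding square_at_0(2)[OF g] by simp
qed

sublocale P: positive_map "unitized F" "unitized A" "emb F ` carrier F" at0
proof unfold_locales
  show "emb F ` carrier F \<subseteq> unitized F" by auto
  fix X Y :: "('g => 'a) uni" and r :: real
  show "at0 (X + Y) = at0 X + at0 Y" by (simp add: at0_def F.prj_simps F_ops emb_add F_value)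
  have "prj F (r *\<^sub>R X) 0 = complex_of_real r \<odot> prj F X 0" by (simp add: scaleR_cx F.prj_cx_mult F_ops)
  then show "at0 (r *\<^sub>R X) = r *\<^sub>R at0 X" by (simp add: at0_def emb_smult F_value scaleR_cx)
  show "at0 X \<in> unitized A" by (simp add: at0_def F_value)
  { assume "X \<in> emb F ` carrier F"
    then obtain g where g: "g \<in> carrier F" "X = emb F g" by blast
    have "adj X * X = emb F (star F g \<otimes>\<^bsub>F\<^esub> g)" using g by (simp add: F.emb_mult F.emb_star)
    then show "positive (at0 (adj X * X))" using square_positive[OF g(1)] g by (simp add: at0_def)
    assume "Y \<in> emb F ` carrier F"
    then obtain h where h: "h \<in> carrier F" "Y = emb F h" by blast
    then have "X + Y = emb F (g \<oplus>\<^bsub>F\<^esub> h)" using g by (simp add: F.emb_add)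
    then show "X + Y \<in> emb F ` carrier F" using g h by blast }
  assume X: "X \<in> unitized F" and "Y \<in> emb F ` carrier F"
  then obtain h where h: "h \<in> carrier F" "Y = emb F h" by blast
  have "X * Y \<in> unitized F" using X h by auto
  moreover have "chr F (X * Y) = 0" using h by (simp add: F.chr_simps)
  ultimately have "X * Y = emb F (prj F (X * Y))" using F.unitized_eq[of "X * Y"] by simp
  then show "X * Y \<in> emb F ` carrier F" by blast
qed

definition red :: "('g => 'a) => real" where "red f = P.pn (emb F f)"

lemma red_cstar_seminorm: "cstar_seminorm F red"
  unfolding cstar_seminorm_def red_def
proof (intro ballI conjI allI)
  fix f assume f: "f \<in> carrier F"
  then have f': "emb F f \<in> unitized F" by auto
  show "0 \<le> P.pn (emb F f)" by (rule P.pn_nonneg[OF f'])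
  show "P.pn (emb F (star F f \<otimes>\<^bsub>F\<^esub> f)) = (P.pn (emb F f))\<^sup>2"
    using P.pn_cstar[OF f'] f by (simp add: F.emb_mult F.emb_star)
  show "P.pn (emb F (z \<odot>\<^bsub>F\<^esub> f)) = cmod z * P.pn (emb F f)" for z
    using P.pn_cx_mult[OF f', of z] f by (simp add: F.emb_smult)
  fix g assume g: "g \<in> carrier F"
  then have g': "emb F g \<in> unitized F" by auto
  show "P.pn (emb F (f \<oplus>\<^bsub>F\<^esub> g)) \<le> P.pn (emb F f) + P.pn (emb F g)" using P.pn_add[OF f' g'] f g by (simp add: F.emb_add)
  show "P.pn (emb F (f \<otimes>\<^bsub>F\<^esub> g)) \<le> P.pn (emb F f) * P.pn (emb F g)" using P.pn_mult[OF f' g'] f g by (simp add: F.emb_mult)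
qed

lemma red_le_nrm: "f \<in> carrier F ==> red f \<le> nrm F f"
  using P.pn_le_norm[of "emb F f"] by (simp add: red_def)

lemma term_norm: "a \<in> carrier A ==> nrm A (m (- x) x (s (- x) a) a) = (nrm A a)\<^sup>2"
  using m_pos[of a x] cstar_identity by force

text \<open>In terms of the bundle, \<open>a\<close> is \<open>b\<^sup>* b\<close> and the last norm is that of \<open>b a = b b\<^sup>* b\<close>, the square of which is \<open>\<parallel>a\<^sup>3\<parallel>\<close>.\<close>

lemma fibre_cube:
  fixes x :: 'g
  assumes b: "b \<in> carrier A"
  defines "a \<equiv> m (- x) x (s (- x) b) b"
  shows "a \<in> carrier A" "star A a = a" "nrm A a = (nrm A b)\<^sup>2" "(nrm A (m x 0 b a))\<^sup>2 \<ge> (nrm A b) ^ 6"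
proof -
  show aA: "a \<in> carrier A" using b by (simp add: a_def)
  show na: "nrm A a = (nrm A b)\<^sup>2" using term_norm[OF b] by (simp add: a_def)
  obtain c where c: "c \<in> carrier A" "a = star A c \<otimes> c" using m_pos[OF b, of x] by (auto simp: a_def)
  show sa: "star A a = a" using c by (simp add: star_mult)
  have "s (- 0 + - x) (m x 0 b a) = m (- 0) (- x) (s (- 0) a) (s (- x) b)" by (rule s_m[OF b aA])
  then have sv: "s (- x) (m x 0 b a) = m 0 (- x) a (s (- x) b)" using aA sa by (simp add: s_0)
  have "m (- x) x (s (- x) (m x 0 b a)) (m x 0 b a) = m (0 + - x) x (m 0 (- x) a (s (- x) b)) (m x 0 b a)" by (simp add: sv)
  also have "\<dots> = m 0 (- x + x) a (m (- x) x (s (- x) b) (m x 0 b a))"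
    using m_assoc[of a "s (- x) b" "m x 0 b a" 0 "- x" x] aA b by simp
  also have "m (- x) x (s (- x) b) (m x 0 b a) = m (- x + x) 0 (m (- x) x (s (- x) b) b) a"
    using m_assoc[of "s (- x) b" b a "- x" x 0] aA b by simp
  also have "\<dots> = a \<otimes> a" using aA by (simp add: m_0 flip: a_def)
  finally have "m (- x) x (s (- x) (m x 0 b a)) (m x 0 b a) = a \<otimes> (a \<otimes> a)" using aA by (simp add: m_0)
  then have n: "(nrm A (m x 0 b a))\<^sup>2 = nrm A (a \<otimes> (a \<otimes> a))" using term_norm[of "m x 0 b a" x] aA b by simp
  have sq: "nrm A (d \<otimes> d) = (nrm A d)\<^sup>2" if "d \<in> carrier A" "star A d = d" for d using cstar_identity[of d] that by simp
  have "(nrm A a) ^ 4 = nrm A ((a \<otimes> a) \<otimes> (a \<otimes> a))"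
    using sq[of "a \<otimes> a"] sq[of a] aA sa by (simp add: star_mult power_mult[symmetric])
  also have "\<dots> \<le> nrm A a * nrm A (a \<otimes> (a \<otimes> a))" using aA nrm_mult[of a "a \<otimes> (a \<otimes> a)"] by (simp add: mult_assoc)
  finally have le: "nrm A a * (nrm A a) ^ 3 \<le> nrm A a * nrm A (a \<otimes> (a \<otimes> a))" by (simp add: eval_nat_numeral)
  have "(nrm A a) ^ 3 \<le> nrm A (a \<otimes> (a \<otimes> a))"
  proof (cases "nrm A a = 0")
    case True then show ?thesis using aA by simp
  next
    case False
    then have "0 < nrm A a" using aA by (simp add: less_le)
    then show ?thesis using le by simp
  qed
  then show "(nrm A (m x 0 b a))\<^sup>2 \<ge> (nrm A b) ^ 6" unfolding n by (simp add: na flip: power_mult)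
qed

text \<open>Without a unit in \<open>A\<close> the regular representation is tested on \<open>a \<delta>\<^sub>0\<close> with \<open>a = b\<^sup>* b\<close>, where \<open>b = f x\<close>. This vector has
  norm \<open>\<parallel>b\<parallel>\<^sup>2\<close>, and the component of its image at \<open>x\<close> has norm \<open>\<parallel>b\<parallel>\<^sup>3\<close>.\<close>

lemma nrm_le_red:
  assumes k: "rin L k" "0 < k 0" "\<And>y. 0 \<le> k y" and f: "f \<in> carrier F"
  shows "nrm A (f x) \<le> red f"
proof (rule dense_ge)
  fix c assume c: "red f < c"
  define b where "b = f x"
  have b: "b \<in> carrier A" using f by (simp add: b_def)
  define a where "a = m (- x) x (s (- x) b) b"
  note fc = fibre_cube[OF b, of x, folded a_def]
  have s1: "single A 0 a \<in> carrier F" by (rule single_F[OF k fc(1)])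
  define g where "g = (single A 0 a :: 'g => 'a)"
  have g: "g \<in> carrier F" by (simp add: g_def s1)
  have "P.bnd (emb F f) c" using c f by (intro P.pn_bnd) (auto simp: red_def)
  then have "positive (at0 (c\<^sup>2 *\<^sub>R (adj (emb F g) * emb F g) - adj (emb F f * emb F g) * (emb F f * emb F g)))" and c0: "0 \<le> c"
    using g by (auto simp: P.bnd_def)
  moreover have "adj (emb F g) * emb F g = emb F (star F g \<otimes>\<^bsub>F\<^esub> g)" "emb F f * emb F g = emb F (f \<otimes>\<^bsub>F\<^esub> g)"
      "adj (emb F (f \<otimes>\<^bsub>F\<^esub> g)) * emb F (f \<otimes>\<^bsub>F\<^esub> g) = emb F (star F (f \<otimes>\<^bsub>F\<^esub> g) \<otimes>\<^bsub>F\<^esub> (f \<otimes>\<^bsub>F\<^esub> g))"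
    using f g by (simp_all add: F.emb_mult F.emb_star)
  ultimately have 1: "positive (c\<^sup>2 *\<^sub>R emb A ((star F g \<otimes>\<^bsub>F\<^esub> g) 0) - emb A ((star F (f \<otimes>\<^bsub>F\<^esub> g) \<otimes>\<^bsub>F\<^esub> (f \<otimes>\<^bsub>F\<^esub> g)) 0))"
    using f g by (simp add: P.\<epsilon>_diff P.\<epsilon>_scaleR) (simp add: at0_def)
  have "(star F g \<otimes>\<^bsub>F\<^esub> g) 0 = m 0 0 (star F g 0) a"
    using mult_single_right[of "star F g" 0 a] g s1 fc(1) by (simp add: g_def)
  then have gg: "(star F g \<otimes>\<^bsub>F\<^esub> g) 0 = a \<otimes> a" using fc by (simp add: F_ops g_def single_def s_0 m_0)
  let ?v = "m x 0 b a"
  have fg: "(f \<otimes>\<^bsub>F\<^esub> g) x = ?v" using mult_single_right[OF f s1 fc(1)] by (simp add: g_def b_def)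
  let ?u = "emb A (m (- x) x (s (- x) ?v) ?v)"
  have v: "?v \<in> carrier A" using b fc by simp
  have 2: "positive (emb A ((star F (f \<otimes>\<^bsub>F\<^esub> g) \<otimes>\<^bsub>F\<^esub> (f \<otimes>\<^bsub>F\<^esub> g)) 0) - ?u)"
    using square_dominates[of "f \<otimes>\<^bsub>F\<^esub> g" x] f g by (simp add: fg)
  have fgF: "star F (f \<otimes>\<^bsub>F\<^esub> g) \<otimes>\<^bsub>F\<^esub> (f \<otimes>\<^bsub>F\<^esub> g) \<in> carrier F" using f g by simp
  have "positive ((c\<^sup>2 *\<^sub>R emb A (a \<otimes> a) - emb A ((star F (f \<otimes>\<^bsub>F\<^esub> g) \<otimes>\<^bsub>F\<^esub> (f \<otimes>\<^bsub>F\<^esub> g)) 0))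
      + (emb A ((star F (f \<otimes>\<^bsub>F\<^esub> g) \<otimes>\<^bsub>F\<^esub> (f \<otimes>\<^bsub>F\<^esub> g)) 0) - ?u))"
    using 1 2 fc v F_value[OF fgF, of 0] unfolding gg by (intro positive_add) auto
  then have "positive (c\<^sup>2 *\<^sub>R emb A (a \<otimes> a) - ?u)" by simp
  then have "rad ?u \<le> rad (c\<^sup>2 *\<^sub>R emb A (a \<otimes> a))"
    using term_positive[OF v] fc by (intro rad_mono) auto
  also have "\<dots> = c\<^sup>2 * rad (emb A (a \<otimes> a))" by (simp add: scaleR_cx rad_cx_mult norm_power)
  also have "rad (emb A (a \<otimes> a)) = (nrm A b) ^ 4"
    using fc cstar_identity[of a] by (subst rad_self_adjoint) (auto simp: star_mult simp flip: power_mult)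
  also have "rad ?u = (nrm A ?v)\<^sup>2"
  proof -
    obtain d where d: "d \<in> carrier A" "m (- x) x (s (- x) ?v) ?v = star A d \<otimes> d" using m_pos[OF v] by blast
    then have "rad ?u = nrm A (m (- x) x (s (- x) ?v) ?v)" using v by (intro rad_self_adjoint) (auto simp: star_mult)
    then show ?thesis using term_norm[OF v] by simp
  qed
  finally have "(nrm A b) ^ 6 \<le> c\<^sup>2 * (nrm A b) ^ 4" using fc(4) by linarith
  then have le: "(nrm A b) ^ 4 * (nrm A b)\<^sup>2 \<le> (nrm A b) ^ 4 * c\<^sup>2"
    by (simp add: mult.commute flip: power_add)
  show "nrm A (f x) \<le> c"
  proof (cases "nrm A b = 0")
    case True then show ?thesis using c0 by (simp add: b_def)
  next
    case False
    then have "0 < nrm A b" using b by (simp add: less_le)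
    then have "(nrm A b)\<^sup>2 \<le> c\<^sup>2" by (intro mult_left_le_imp_le[OF le]) simp
    then show ?thesis using c0 power2_le_imp_le[of "nrm A b" c] by (simp add: b_def)
  qed
qed

end

section \<open>Completion in a \<open>C\<^sup>*\<close>-norm\<close>

text \<open>The completion has to live on a prescribed type. Cauchy sequences are countable, so when
  \<open>'x\<close> is infinite a chosen representative of each class of Cauchy sequences is stored as a
  function \<open>'x \<Rightarrow> 'x\<close>.\<close>

locale cstar_normed = uni_factor R for R :: "'x normed_star_alg" +
  fixes p :: "'x => real"
  assumes p_cstar: "cstar_seminorm R p" and p_0: "a \<in> carrier R ==> p a = 0 ==> a = \<zero>\<^bsub>R\<^esub>"
    and inf: "infinite (UNIV :: 'x set)"
begin

definition E :: "'x uni set" where "E = emb R ` carrier R"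
definition P :: "'x uni => real" where "P F = p (prj R F)"

lemma E_prj [simp]: "F \<in> E ==> emb R (prj R F) = F" by (auto simp: E_def)

lemma E_closed [simp]:
  assumes F: "F \<in> E"
  shows "G \<in> E ==> F + G \<in> E" "G \<in> E ==> F * G \<in> E" "cx z * F \<in> E" "adj F \<in> E" "G \<in> E ==> F - G \<in> E" "0 \<in> E"
  using F by (auto simp: E_def simp flip: emb_add emb_mult emb_smult emb_star emb_minus)
    (use emb_zero in \<open>fastforce simp del: emb_zero\<close>)

lemma P_cstar: "0 \<le> P F" "P (cx z * F) = cmod z * P F" "P (F + G) \<le> P F + P G"
    "F \<in> E ==> G \<in> E ==> P (F * G) \<le> P F * P G" "F \<in> E ==> P (adj F * F) = (P F)\<^sup>2"
  using p_cstar
  by (auto simp: P_def cstar_seminorm_def prj_cx_mult prj_simps(4) E_def simp flip: emb_mult emb_star)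

lemma P_zero [simp]: "P 0 = 0" using P_cstar(2)[of 0 0] by simp
lemma P_uminus: "P (- F) = P F" using P_cstar(2)[of "- 1" F] by simp
lemma P_commute: "P (F - G) = P (G - F)" using P_uminus[of "F - G"] by simp
lemma P_triangle: "P (F - H) \<le> P (F - G) + P (G - H)" using P_cstar(3)[of "F - G" "G - H"] by simp
lemma P_abs: "\<bar>P F - P G\<bar> \<le> P (F - G)"
  using P_triangle[of F 0 G] P_triangle[of G 0 F] P_commute[of F G] by simp
lemma P_adj: assumes F: "F \<in> E" shows "P (adj F) = P F"
proof -
  have le: "P G \<le> P (adj G)" if G: "G \<in> E" for G
  proof (cases "P G = 0")
    case True then show ?thesis using P_cstar(1) by simp
  next
    case False
    have "P G * P G \<le> P (adj G) * P G" using P_cstar(4)[of "adj G" G] P_cstar(5)[of G] G by (simp add: power2_eq_square)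
    moreover have "0 < P G" using False P_cstar(1)[of G] by linarith
    ultimately show ?thesis by simp
  qed
  show ?thesis using le[OF F] le[of "adj F"] F by simp
qed

definition Cau :: "(nat => 'x uni) set" where
  "Cau = {s. range s \<subseteq> E \<and> ((\<lambda>i. P (s (fst i) - s (snd i))) \<longlongrightarrow> 0) (sequentially \<times>\<^sub>F sequentially)}"

definition eqv :: "(nat => 'x uni) => (nat => 'x uni) => bool" where
  "eqv s t \<longleftrightarrow> (\<lambda>n. P (s n - t n)) \<longlonglongrightarrow> 0"

lemma null: "(f \<longlongrightarrow> 0) F ==> (\<And>x. 0 \<le> g x) ==> (\<And>x. g x \<le> f x) ==> (g \<longlongrightarrow> (0::real)) F"
  by (rule tendsto_sandwich[of "\<lambda>_. 0"]) auto

lemma Cau_E [simp]: "s \<in> Cau ==> s n \<in> E" by (auto simp: Cau_def)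

lemma CauI':
  "(\<And>n. s n \<in> E) ==> ((\<lambda>i. P (s (fst i) - s (snd i))) \<longlongrightarrow> 0) (sequentially \<times>\<^sub>F sequentially) ==> s \<in> Cau"
  by (auto simp: Cau_def)

lemma Cau_cauchy: assumes "s \<in> Cau" "0 < e" obtains N where "\<And>m n. N \<le> m ==> N \<le> n ==> P (s m - s n) < e"
proof -
  have "\<forall>\<^sub>F i in sequentially \<times>\<^sub>F sequentially. P (s (fst i) - s (snd i)) < e"
    using assms P_cstar(1) by (auto simp: Cau_def tendsto_iff)
  then show ?thesis using that unfolding eventually_prod_sequentially by auto
qed

lemma CauI:
  assumes "\<And>n. s n \<in> E" "\<And>e. 0 < e ==> \<exists>N. \<forall>m\<ge>N. \<forall>n\<ge>N. P (s m - s n) < e"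
  shows "s \<in> Cau"
  unfolding Cau_def tendsto_iff eventually_prod_sequentially using assms P_cstar(1) by (auto simp: P_commute)

lemma Cau_lim: assumes s: "s \<in> Cau" shows "convergent (\<lambda>n. P (s n))"
proof -
  have "Cauchy (\<lambda>n. P (s n))"
  proof (rule metric_CauchyI)
    fix e :: real assume "0 < e"
    then obtain N where N: "\<And>m n. N \<le> m ==> N \<le> n ==> P (s m - s n) < e" using Cau_cauchy[OF s] by blast
    then show "\<exists>M. \<forall>m\<ge>M. \<forall>n\<ge>M. dist (P (s m)) (P (s n)) < e"
      using P_abs unfolding dist_real_def by (meson order_le_less_trans)
  qed
  then show ?thesis by (rule real_Cauchy_convergent)
qed

lemma Cau_bounded: assumes s: "s \<in> Cau" obtains K where "0 \<le> K" "\<And>n. P (s n) \<le> K"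
proof -
  have "Bseq (\<lambda>n. P (s n))" by (rule convergent_imp_Bseq[OF Cau_lim[OF s]])
  then obtain K where "0 < K" "\<And>n. norm (P (s n)) \<le> K" by (auto simp: Bseq_def)
  then show ?thesis using that[of K] P_cstar(1) by auto
qed

lemma mult_diff_bound:
  assumes "F \<in> E" "G \<in> E" "F' \<in> E" "G' \<in> E"
  shows "P (F * G - F' * G') \<le> P F * P (G - G') + P (F - F') * P G'"
proof -
  have "F * G - F' * G' = F * (G - G') + (F - F') * G'" by (simp add: algebra_simps)
  then have "P (F * G - F' * G') \<le> P (F * (G - G')) + P ((F - F') * G')" using P_cstar(3) by metis
  also have "\<dots> \<le> P F * P (G - G') + P (F - F') * P G'" using assms by (intro add_mono P_cstar(4)) auto
  finally show ?thesis .
qed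

lemma mult_null:
  assumes s: "s \<in> Cau" "s' \<in> Cau" and t: "t \<in> Cau" "t' \<in> Cau"
    and "((\<lambda>i. P (s (f i) - s' (g i))) \<longlongrightarrow> 0) F" "((\<lambda>i. P (t (f i) - t' (g i))) \<longlongrightarrow> 0) F"
  shows "((\<lambda>i. P (s (f i) * t (f i) - s' (g i) * t' (g i))) \<longlongrightarrow> 0) F"
proof -
  obtain K where K: "0 \<le> K" "\<And>n. P (s n) \<le> K" using Cau_bounded[OF s(1)] by blast
  obtain L where L: "0 \<le> L" "\<And>n. P (t' n) \<le> L" using Cau_bounded[OF t(2)] by blast
  have "((\<lambda>i. K * P (t (f i) - t' (g i)) + P (s (f i) - s' (g i)) * L) \<longlongrightarrow> 0) F"
    by (intro tendsto_add_zero tendsto_mult_right_zero tendsto_mult_left_zero assms)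
  then show ?thesis
  proof (rule null)
    fix i
    have "P (s (f i) * t (f i) - s' (g i) * t' (g i))
        \<le> P (s (f i)) * P (t (f i) - t' (g i)) + P (s (f i) - s' (g i)) * P (t' (g i))"
      using s t by (intro mult_diff_bound) auto
    also have "\<dots> \<le> K * P (t (f i) - t' (g i)) + P (s (f i) - s' (g i)) * L"
      by (intro add_mono mult_mono K L) (auto simp: P_cstar(1) K(1))
    finally show "P (s (f i) * t (f i) - s' (g i) * t' (g i)) \<le> K * P (t (f i) - t' (g i)) + P (s (f i) - s' (g i)) * L" .
  qed (rule P_cstar(1))
qed

lemma add_bound: "P ((F + G) - (F' + G')) \<le> P (F - F') + P (G - G')"
  using P_cstar(3)[of "F - F'" "G - G'"] by (simp add: algebra_simps)

lemma cx_diff_bound: "P (cx z * F - cx z * F') = cmod z * P (F - F')"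
  by (simp add: P_cstar(2) flip: right_diff_distrib)

lemma adj_diff_bound: "F \<in> E ==> F' \<in> E ==> P (adj F - adj F') = P (F - F')"
  by (simp add: P_adj flip: adj_diff)

lemma Cau_closed [simp]:
  assumes s: "s \<in> Cau"
  shows "t \<in> Cau ==> (\<lambda>n. s n + t n) \<in> Cau" "t \<in> Cau ==> (\<lambda>n. s n * t n) \<in> Cau"
    "(\<lambda>n. cx z * s n) \<in> Cau" "(\<lambda>n. adj (s n)) \<in> Cau"
proof -
  let ?F = "sequentially \<times>\<^sub>F sequentially :: (nat \<times> nat) filter"
  have ls: "((\<lambda>i. P (s (fst i) - s (snd i))) \<longlongrightarrow> 0) ?F" using s by (simp add: Cau_def)
  { assume t: "t \<in> Cau"
    have lt: "((\<lambda>i. P (t (fst i) - t (snd i))) \<longlongrightarrow> 0) ?F" using t by (simp add: Cau_def)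
    show "(\<lambda>n. s n + t n) \<in> Cau"
      by (rule CauI'[OF _ null[OF tendsto_add_zero[OF ls lt] P_cstar(1) add_bound]]) (use s t in simp)
    show "(\<lambda>n. s n * t n) \<in> Cau"
      by (rule CauI'[OF _ mult_null[OF s s t t ls lt]]) (use s t in simp) }
  show "(\<lambda>n. cx z * s n) \<in> Cau"
    by (rule CauI', use s in simp, unfold cx_diff_bound, rule tendsto_mult_right_zero[OF ls])
  have "P (adj (s i) - adj (s j)) = P (s i - s j)" for i j using s by (simp add: adj_diff_bound)
  then show "(\<lambda>n. adj (s n)) \<in> Cau" by (intro CauI') (use s ls in simp_all)
qed

lemma Cau_diff [simp]: "s \<in> Cau ==> (\<lambda>n. - s n) \<in> Cau" "s \<in> Cau ==> t \<in> Cau ==> (\<lambda>n. s n - t n) \<in> Cau"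
  using Cau_closed(3)[of s "- 1"] Cau_closed(1)[of s "\<lambda>n. cx (- 1) * t n"] Cau_closed(3)[of t "- 1"] by simp_all

lemma Cau_const [simp]: "F \<in> E ==> (\<lambda>_. F) \<in> Cau" by (auto simp: Cau_def)

lemma eqv_refl: "eqv s s" by (simp add: eqv_def)
lemma eqv_sym: "eqv s t ==> eqv t s" by (simp add: eqv_def P_commute)
lemma eqv_trans: "eqv s t ==> eqv t u ==> eqv s u"
  unfolding eqv_def by (drule (1) tendsto_add_zero) (auto elim: null simp: P_cstar(1) P_triangle)

lemma eqv_ops:
  assumes s: "s \<in> Cau" "s' \<in> Cau" "eqv s s'"
  shows "t \<in> Cau ==> t' \<in> Cau ==> eqv t t' ==> eqv (\<lambda>n. s n + t n) (\<lambda>n. s' n + t' n)"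
    "t \<in> Cau ==> t' \<in> Cau ==> eqv t t' ==> eqv (\<lambda>n. s n * t n) (\<lambda>n. s' n * t' n)"
    "eqv (\<lambda>n. cx z * s n) (\<lambda>n. cx z * s' n)" "eqv (\<lambda>n. adj (s n)) (\<lambda>n. adj (s' n))"
    "lim (\<lambda>n. P (s n)) = lim (\<lambda>n. P (s' n))"
proof -
  have ls: "(\<lambda>i. P (s i - s' i)) \<longlonglongrightarrow> 0" using s by (simp add: eqv_def)
  { assume t: "t \<in> Cau" "t' \<in> Cau" "eqv t t'"
    then have lt: "(\<lambda>i. P (t i - t' i)) \<longlonglongrightarrow> 0" by (simp add: eqv_def)
    show "eqv (\<lambda>n. s n + t n) (\<lambda>n. s' n + t' n)"
      unfolding eqv_def by (rule null[OF tendsto_add_zero[OF ls lt] P_cstar(1) add_bound])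
    show "eqv (\<lambda>n. s n * t n) (\<lambda>n. s' n * t' n)"
      unfolding eqv_def using mult_null[OF s(1,2) t(1,2), of "\<lambda>i. i" "\<lambda>i. i"] ls lt by simp }
  show "eqv (\<lambda>n. cx z * s n) (\<lambda>n. cx z * s' n)"
    using tendsto_mult_right_zero[OF ls, of "cmod z"] by (simp add: eqv_def cx_diff_bound)
  show "eqv (\<lambda>n. adj (s n)) (\<lambda>n. adj (s' n))" using s ls by (simp add: eqv_def adj_diff_bound)
  have "(\<lambda>n. P (s n) - P (s' n)) \<longlonglongrightarrow> 0"
    by (rule tendsto_rabs_zero_cancel, rule null[OF ls]) (auto simp: P_abs)
  moreover have "(\<lambda>n. P (s' n)) \<longlonglongrightarrow> lim (\<lambda>n. P (s' n))" using Cau_lim[OF s(2)] by (simp add: convergent_LIMSEQ_iff)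
  ultimately have "(\<lambda>n. (P (s n) - P (s' n)) + P (s' n)) \<longlonglongrightarrow> 0 + lim (\<lambda>n. P (s' n))" by (rule tendsto_add)
  then show "lim (\<lambda>n. P (s n)) = lim (\<lambda>n. P (s' n))" by (simp add: limI)
qed

definition idx :: "nat => 'x" where "idx = (SOME f. inj f)"

lemma inj_idx: "inj idx"
  unfolding idx_def using inf by (metis infinite_countable_subset someI_ex)

text \<open>\<open>cl\<close> encodes the class of a Cauchy sequence, and \<open>dec\<close> recovers a representative from the code.\<close>

definition rep :: "(nat => 'x uni) => nat => 'x uni" where "rep s = (SOME t. t \<in> Cau \<and> eqv s t)"
definition cl :: "(nat => 'x uni) => 'x => 'x" where "cl s = (\<lambda>x. prj R (rep s (inv_into UNIV idx x)))"

lemma rep: "s \<in> Cau ==> rep s \<in> Cau \<and> eqv s (rep s)"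
  unfolding rep_def by (rule someI[of _ s]) (simp add: eqv_refl)

lemma cl_eq_iff: assumes s: "s \<in> Cau" and t: "t \<in> Cau" shows "cl s = cl t \<longleftrightarrow> eqv s t"
proof
  assume "cl s = cl t"
  then have "cl s (idx n) = cl t (idx n)" for n by simp
  then have "prj R (rep s n) = prj R (rep t n)" for n by (simp add: cl_def inv_f_f[OF inj_idx])
  then have "rep s n = rep t n" for n using E_prj rep[OF s] rep[OF t] Cau_E by metis
  then have "rep s = rep t" by blast
  then show "eqv s t" using rep[OF s] rep[OF t] by (metis eqv_sym eqv_trans)
next
  assume "eqv s t"
  then have "eqv s u \<longleftrightarrow> eqv t u" for u by (metis eqv_sym eqv_trans)
  then show "cl s = cl t" by (simp add: cl_def rep_def)
qed

definition dec :: "('x => 'x) => nat => 'x uni" where "dec u = (SOME s. s \<in> Cau \<and> cl s = u)"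

lemma dec: "s \<in> Cau ==> dec (cl s) \<in> Cau" "s \<in> Cau ==> eqv (dec (cl s)) s"
  using someI[of "\<lambda>t. t \<in> Cau \<and> cl t = cl s" s] cl_eq_iff[of "dec (cl s)" s] by (auto simp: dec_def)

definition Q :: "('x => 'x) normed_star_alg" where
  "Q = \<lparr>carrier = cl ` Cau,
     monoid.mult = (\<lambda>u v. cl (\<lambda>n. dec u n * dec v n)),
     one = cl (\<lambda>_. 0),
     zero = cl (\<lambda>_. 0),
     add = (\<lambda>u v. cl (\<lambda>n. dec u n + dec v n)),
     smult = (\<lambda>z u. cl (\<lambda>n. cx z * dec u n)),
     star = (\<lambda>u. cl (\<lambda>n. adj (dec u n))),
     nrm = (\<lambda>u. lim (\<lambda>n. P (dec u n)))\<rparr>"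

lemma Q_ops:
  "carrier Q = cl ` Cau" "\<zero>\<^bsub>Q\<^esub> = cl (\<lambda>_. 0)"
  "s \<in> Cau ==> t \<in> Cau ==> cl s \<oplus>\<^bsub>Q\<^esub> cl t = cl (\<lambda>n. s n + t n)"
  "s \<in> Cau ==> t \<in> Cau ==> cl s \<otimes>\<^bsub>Q\<^esub> cl t = cl (\<lambda>n. s n * t n)"
  "s \<in> Cau ==> z \<odot>\<^bsub>Q\<^esub> cl s = cl (\<lambda>n. cx z * s n)"
  "s \<in> Cau ==> star Q (cl s) = cl (\<lambda>n. adj (s n))"
  "s \<in> Cau ==> nrm Q (cl s) = lim (\<lambda>n. P (s n))"
  by (auto simp: Q_def cl_eq_iff dec intro!: eqv_ops)

lemma zero_E [simp]: "0 \<in> E" unfolding E_def by (metis emb_zero image_eqI M.zero_closed)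

lemma star_algebra_Q: "star_algebra Q"
proof -
  have ag: "abelian_group Q"
  proof (rule abelian_groupI)
    fix u assume "u \<in> carrier Q"
    then obtain s where s: "s \<in> Cau" "u = cl s" by (auto simp: Q_ops)
    show "\<exists>v\<in>carrier Q. v \<oplus>\<^bsub>Q\<^esub> u = \<zero>\<^bsub>Q\<^esub>"
      using s by (intro bexI[of _ "cl (\<lambda>n. cx (- 1) * s n)"]) (auto simp: Q_ops)
  qed (auto simp: Q_ops algebra_simps)
  have mod: "module complex_ring Q"
    by (rule moduleI[OF cring_complex_ring ag]) (auto simp: Q_ops cx_add distrib_left distrib_right cx_mult_left)
  have "adj F * cx z = cx z * adj F" "F * (cx z * G) = cx z * (F * G)" for z :: complex and F G :: "'x uni"
    by (rule cx_commute[symmetric]) (rule cx_mult_swap)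
  then show ?thesis
    by (intro star_algebra.intro mod star_algebra_axioms.intro)
      (auto simp: Q_ops mult.assoc distrib_left distrib_right adj_add adj_mult)
qed

lemma Q_minus: assumes "s \<in> Cau" "t \<in> Cau" shows "cl s \<ominus>\<^bsub>Q\<^esub> cl t = cl (\<lambda>n. s n - t n)"
proof -
  show "cl s \<ominus>\<^bsub>Q\<^esub> cl t = cl (\<lambda>n. s n - t n)"
    using star_algebra.minus_sm[OF star_algebra_Q, of "cl s" "cl t"] assms by (simp add: Q_ops)
qed

lemma nrm_Q: "s \<in> Cau ==> (\<lambda>n. P (s n)) \<longlonglongrightarrow> nrm Q (cl s)"
  using Cau_lim by (simp add: Q_ops convergent_LIMSEQ_iff)

lemma nrm_Q_eqI: "s \<in> Cau ==> (\<lambda>n. P (s n)) \<longlonglongrightarrow> c ==> nrm Q (cl s) = c"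
  using nrm_Q LIMSEQ_unique by blast

definition q :: "'x => 'x => 'x" where "q a = cl (\<lambda>_. emb R a)"

lemma emb_E [simp]: "a \<in> carrier R ==> emb R a \<in> E" by (simp add: E_def)

lemma q_hom: "q \<in> star_hom R Q"
  by (auto simp: star_hom_def q_def Q_ops emb_add emb_mult emb_smult emb_star)

lemma nrm_q: "a \<in> carrier R ==> nrm Q (q a) = p a"
  unfolding q_def by (rule nrm_Q_eqI) (auto simp: P_def)

lemma normed_Q:
  assumes u: "u \<in> carrier Q"
  shows "0 \<le> nrm Q u" "nrm Q u = 0 \<longleftrightarrow> u = \<zero>\<^bsub>Q\<^esub>" "nrm Q (z \<odot>\<^bsub>Q\<^esub> u) = cmod z * nrm Q u"
    "nrm Q (star Q u) = nrm Q u" "nrm Q (star Q u \<otimes>\<^bsub>Q\<^esub> u) = (nrm Q u)\<^sup>2"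
    "v \<in> carrier Q ==> nrm Q (u \<oplus>\<^bsub>Q\<^esub> v) \<le> nrm Q u + nrm Q v"
    "v \<in> carrier Q ==> nrm Q (u \<otimes>\<^bsub>Q\<^esub> v) \<le> nrm Q u * nrm Q v"
proof -
  obtain s where s: "s \<in> Cau" "u = cl s" using u by (auto simp: Q_ops)
  note ls = nrm_Q[OF s(1), folded s(2)]
  show "0 \<le> nrm Q u" by (rule LIMSEQ_le_const[OF ls]) (simp add: P_cstar(1))
  have "nrm Q u = 0 \<longleftrightarrow> (\<lambda>n. P (s n)) \<longlonglongrightarrow> 0" using ls LIMSEQ_unique by metis
  then show "nrm Q u = 0 \<longleftrightarrow> u = \<zero>\<^bsub>Q\<^esub>" using s cl_eq_iff[of s "\<lambda>_. 0"] by (simp add: Q_ops eqv_def)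
  show "nrm Q (z \<odot>\<^bsub>Q\<^esub> u) = cmod z * nrm Q u"
    unfolding s(2) Q_ops(5)[OF s(1)]
    by (rule nrm_Q_eqI) (use s ls in \<open>auto simp: P_cstar(2) intro!: tendsto_mult_left\<close>)
  show "nrm Q (star Q u) = nrm Q u"
    unfolding s(2) Q_ops(6)[OF s(1)] by (rule nrm_Q_eqI) (use s ls in \<open>auto simp: P_adj\<close>)
  show "nrm Q (star Q u \<otimes>\<^bsub>Q\<^esub> u) = (nrm Q u)\<^sup>2"
  proof -
    have "star Q u \<otimes>\<^bsub>Q\<^esub> u = cl (\<lambda>n. adj (s n) * s n)" using s by (simp add: Q_ops)
    then show ?thesis using s ls by (auto simp: P_cstar(5) intro!: nrm_Q_eqI tendsto_power)
  qed
  assume v: "v \<in> carrier Q"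
  obtain t where t: "t \<in> Cau" "v = cl t" using v by (auto simp: Q_ops)
  note lt = nrm_Q[OF t(1), folded t(2)]
  have "(\<lambda>n. P (s n + t n)) \<longlonglongrightarrow> nrm Q (u \<oplus>\<^bsub>Q\<^esub> v)" using s t nrm_Q[of "\<lambda>n. s n + t n"] by (simp add: Q_ops)
  then show "nrm Q (u \<oplus>\<^bsub>Q\<^esub> v) \<le> nrm Q u + nrm Q v"
    by (rule LIMSEQ_le[OF _ tendsto_add[OF ls lt]]) (simp add: P_cstar(3))
  have "(\<lambda>n. P (s n * t n)) \<longlonglongrightarrow> nrm Q (u \<otimes>\<^bsub>Q\<^esub> v)" using s t nrm_Q[of "\<lambda>n. s n * t n"] by (simp add: Q_ops)
  then show "nrm Q (u \<otimes>\<^bsub>Q\<^esub> v) \<le> nrm Q u * nrm Q v"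
    by (rule LIMSEQ_le[OF _ tendsto_mult[OF ls lt]]) (use s t in \<open>simp add: P_cstar(4)\<close>)
qed

lemma const_dist: assumes "s \<in> Cau" "t \<in> Cau" shows "(\<lambda>n. P (s n - t n)) \<longlonglongrightarrow> nrm Q (cl s \<ominus>\<^bsub>Q\<^esub> cl t)"
  using nrm_Q[OF Cau_diff(2)[OF assms]] Q_minus[OF assms] by simp

lemma cstar_algebra_Q: "cstar_algebra Q"
proof -
  interpret Q: star_algebra Q by (rule star_algebra_Q)
  have um: "nrm Q (\<ominus>\<^bsub>Q\<^esub> u) = nrm Q u" if "u \<in> carrier Q" for u using normed_Q(3)[OF that, of "- 1"] that by (simp add: Q.uminus_sm)
  have ms: "Metric_space (carrier Q) (norm_dist Q (nrm Q))"
    by (rule norm_dist_metric[OF Q.M.abelian_group_axioms]) (use normed_Q um in auto)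
  have "Metric_space.mcomplete (carrier Q) (norm_dist Q (nrm Q))"
  proof (rule mcomplete_norm_distI[OF ms])
    fix u :: "nat => 'x => 'x"
    assume u: "\<And>n. u n \<in> carrier Q" and c: "\<And>e. 0 < e ==> \<exists>M. \<forall>m\<ge>M. \<forall>n\<ge>M. nrm Q (u m \<ominus>\<^bsub>Q\<^esub> u n) < e"
    have "\<forall>k. \<exists>s. s \<in> Cau \<and> u k = cl s" using u by (auto simp: Q_ops)
    then obtain s where s: "\<And>k. s k \<in> Cau" "\<And>k. u k = cl (s k)" by metis
    have "\<exists>N. \<forall>m n. N \<le> m \<longrightarrow> N \<le> n \<longrightarrow> P (s k m - s k n) < 1 / Suc k" for k using Cau_cauchy[OF s(1), of "1 / Suc k" k] by (metis of_nat_0_less_iff zero_less_Suc zero_less_divide_1_iff)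
    then obtain N where N: "\<And>k m n. N k \<le> m ==> N k \<le> n ==> P (s k m - s k n) < 1 / Suc k" by metis
    \<comment> \<open>a diagonal choice: \<open>u k\<close> is within \<open>1 / Suc k\<close> of the image of \<open>d k\<close>\<close>
    define d where "d k = s k (N k)" for k
    have dE: "d k \<in> E" for k using s(1) by (simp add: d_def)
    define D where "D k = cl (\<lambda>_. d k)" for k
    have DQ: "D k \<in> carrier Q" for k using dE by (auto simp: D_def Q_ops)
    have tri: "nrm Q (a \<ominus>\<^bsub>Q\<^esub> b) \<le> nrm Q (a \<ominus>\<^bsub>Q\<^esub> b') + nrm Q (b' \<ominus>\<^bsub>Q\<^esub> b)" if "a \<in> carrier Q" "b \<in> carrier Q" "b' \<in> carrier Q" for a b b'
      using Metric_space.triangle[OF ms that(1,3,2)] that by (simp add: norm_dist_def)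
    have com: "nrm Q (a \<ominus>\<^bsub>Q\<^esub> b) = nrm Q (b \<ominus>\<^bsub>Q\<^esub> a)" if "a \<in> carrier Q" "b \<in> carrier Q" for a b
      using Metric_space.commute[OF ms, of a b] that by (simp add: norm_dist_def)
    have uD: "nrm Q (u k \<ominus>\<^bsub>Q\<^esub> D k) \<le> 1 / Suc k" for k
    proof -
      have "(\<lambda>n. P (s k n - d k)) \<longlonglongrightarrow> nrm Q (u k \<ominus>\<^bsub>Q\<^esub> D k)" unfolding s(2) D_def by (rule const_dist) (use s dE in auto)
      moreover have "\<forall>n\<ge>N k. P (s k n - d k) \<le> 1 / Suc k" using N[of k _ "N k"] by (auto simp: d_def intro: less_imp_le)
      ultimately show ?thesis by (intro LIMSEQ_le_const2) auto
    qed
    have dd: "P (d i - d j) = nrm Q (D i \<ominus>\<^bsub>Q\<^esub> D j)" for i j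
      using const_dist[of "\<lambda>_. d i" "\<lambda>_. d j"] dE by (auto simp: D_def intro: LIMSEQ_unique[OF tendsto_const])
    have small: "\<exists>M. \<forall>k\<ge>M. 1 / real (Suc k) < e" if "0 < e" for e
    proof -
      obtain M where "1 / real (Suc M) < e" by (rule nat_approx_posE[OF \<open>0 < e\<close>])
      moreover have "1 / real (Suc k) \<le> 1 / real (Suc M)" if "M \<le> k" for k using that by (simp add: frac_le)
      ultimately show ?thesis by (meson order_le_less_trans)
    qed
    have dC: "d \<in> Cau"
    proof (rule CauI[OF dE])
      fix e :: real assume e: "0 < e"
      obtain M where M: "\<And>m n. M \<le> m ==> M \<le> n ==> nrm Q (u m \<ominus>\<^bsub>Q\<^esub> u n) < e / 3" using c[of "e / 3"] e by auto
      obtain M' where M': "\<And>k. M' \<le> k ==> 1 / real (Suc k) < e / 3" using small[of "e / 3"] e by auto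
      have "P (d m - d n) < e" if mn: "max M M' \<le> m" "max M M' \<le> n" for m n
      proof -
        have "nrm Q (D m \<ominus>\<^bsub>Q\<^esub> D n) \<le> nrm Q (D m \<ominus>\<^bsub>Q\<^esub> u m) + (nrm Q (u m \<ominus>\<^bsub>Q\<^esub> u n) + nrm Q (u n \<ominus>\<^bsub>Q\<^esub> D n))"
          using tri[OF DQ DQ u, of m n m] tri[OF u DQ u, of m n n] by linarith
        then show ?thesis using com[OF DQ u, of m m] uD[of m] uD[of n] M[of m n] M'[of m] M'[of n] mn unfolding dd by auto
      qed
      then show "\<exists>N. \<forall>m\<ge>N. \<forall>n\<ge>N. P (d m - d n) < e" by blast
    qed
    show "\<exists>l\<in>carrier Q. \<forall>e>0. \<exists>M. \<forall>n\<ge>M. nrm Q (u n \<ominus>\<^bsub>Q\<^esub> l) < e"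
    proof (intro bexI[of _ "cl d"] allI impI)
      show clQ: "cl d \<in> carrier Q" using dC by (simp add: Q_ops)
      fix e :: real assume e: "0 < e"
      obtain M where M: "\<And>m n. M \<le> m ==> M \<le> n ==> P (d m - d n) < e / 3" using Cau_cauchy[OF dC, of "e / 3"] e by auto
      obtain M' where M': "\<And>k. M' \<le> k ==> 1 / real (Suc k) < e / 3" using small[of "e / 3"] e by auto
      have "nrm Q (u k \<ominus>\<^bsub>Q\<^esub> cl d) < e" if k: "max M M' \<le> k" for k
      proof -
        have "(\<lambda>n. P (d k - d n)) \<longlonglongrightarrow> nrm Q (D k \<ominus>\<^bsub>Q\<^esub> cl d)" unfolding D_def by (rule const_dist) (use dE dC in auto)
        moreover have "\<forall>n\<ge>M. P (d k - d n) \<le> e / 3" using M k by (auto intro: less_imp_le)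
        ultimately have "nrm Q (D k \<ominus>\<^bsub>Q\<^esub> cl d) \<le> e / 3" by (intro LIMSEQ_le_const2) auto
        then show ?thesis using tri[OF u clQ DQ, of k k] uD[of k] M'[of k] k e by auto
      qed
      then show "\<exists>M. \<forall>n\<ge>M. nrm Q (u n \<ominus>\<^bsub>Q\<^esub> cl d) < e" by blast
    qed
  qed
  then show ?thesis
    by (intro cstar_algebra.intro banach_star_algebra.intro star_algebra_Q banach_star_algebra_axioms.intro
        cstar_algebra_axioms.intro) (use normed_Q in auto)
qed

end

section \<open>Symmetry\<close>

text \<open>An isometric extension of Banach algebras can only enlarge the set of invertible elements by
  whole pieces: on a connected set of elements that become invertible in the large algebra, either
  all or none are invertible in the small one, because the norms of the inverses stay bounded.\<close>

lemma (in uni_hom) has_inverse_ray: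
  assumes iso: "\<And>a. a \<in> carrier A ==> nrm B (\<phi> a) = nrm A a" and v: "v \<in> unitized A"
    and ray: "\<And>t. 0 \<le> t ==> t \<le> 1 ==> has_inverse (1 - t *\<^sub>R T v)"
  shows "has_inverse (1 - v)"
proof -
  have isoT: "norm (T F) = norm F" if "F \<in> unitized A" for F
    using that by (rule A.unitizedE) (simp add: ulift_add iso A.norm_unitized B.norm_unitized)
  have Tt: "T (1 - t *\<^sub>R v) = 1 - t *\<^sub>R T v" for t by (simp add: ulift_diff ulift_mult scaleR_cx)
  have "continuous_on {0..1} (\<lambda>t. minv (1 - t *\<^sub>R T v))"
    by (rule continuous_on_minv) (use ray in \<open>auto intro!: continuous_intros\<close>)
  then have "bounded ((\<lambda>t. minv (1 - t *\<^sub>R T v)) ` {0..1})"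
    by (intro compact_imp_bounded compact_continuous_image) auto
  then obtain M where M0: "0 < M" and M: "\<And>t. t \<in> {0..1} ==> norm (minv (1 - t *\<^sub>R T v)) \<le> M"
    by (auto simp: bounded_pos)
  have bound: "norm (minv (1 - t *\<^sub>R v)) \<le> M" if t: "t \<in> {0..1}" and i: "has_inverse (1 - t *\<^sub>R v)" for t
  proof -
    have m: "minv (1 - t *\<^sub>R v) \<in> unitized A" using v i by (intro A.minv_mem) auto
    have "minv (1 - t *\<^sub>R T v) = T (minv (1 - t *\<^sub>R v))"
      by (rule minv_unique) (simp_all add: minv_left minv_right i flip: Tt ulift_mult)
    then show ?thesis using isoT[OF m] M[OF t] by simp
  qed
  obtain n where n: "M * norm v + 1 < real n" using reals_Archimedean2 by blast
  have n0: "0 < real n" using n M0 by (smt (verit) mult_nonneg_nonneg norm_ge_zero)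
  have "has_inverse (1 - (real k / real n) *\<^sub>R v)" if "k \<le> n" for k
    using that
  proof (induction k)
    case (Suc k)
    define t where "t = real k / real n"
    have t: "t \<in> {0..1}" using Suc.prems n0 by (simp add: t_def)
    have i: "has_inverse (1 - t *\<^sub>R v)" using Suc by (simp add: t_def)
    show ?case
    proof (rule has_inverse_perturb[OF i])
      have "(1 - (real (Suc k) / real n) *\<^sub>R v) - (1 - t *\<^sub>R v) = - ((1 / real n) *\<^sub>R v)"
        using n0 by (simp add: t_def add_divide_distrib scaleR_left_distrib)
      then have "norm ((1 - (real (Suc k) / real n) *\<^sub>R v) - (1 - t *\<^sub>R v)) = norm v / real n" by simp
      then have "norm (minv (1 - t *\<^sub>R v)) * norm ((1 - (real (Suc k) / real n) *\<^sub>R v) - (1 - t *\<^sub>R v)) \<le> M * (norm v / real n)"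
        using bound[OF t i] n0 by (simp only:) (intro mult_right_mono, auto)
      also have "\<dots> < 1" using n n0 by (simp add: field_simps)
      finally show "norm (minv (1 - t *\<^sub>R v)) * norm ((1 - (real (Suc k) / real n) *\<^sub>R v) - (1 - t *\<^sub>R v)) < 1" .
    qed
  qed simp
  from this[of n] show ?thesis using n0 by simp
qed

text \<open>Only the ray from \<open>0\<close> matters for symmetry, since the complement of the positive half-line
  is star-shaped in the inverse variable.\<close>

lemma (in uni_hom) symmetric_isometric:
  assumes iso: "\<And>a. a \<in> carrier A ==> nrm B (\<phi> a) = nrm A a" and sym: "symmetric_algebra B"
  shows "symmetric_algebra A"
  unfolding A.symmetric_algebra_iff
proof (intro ballI allI impI)
  fix b z assume b: "b \<in> carrier A" and z: "z \<notin> complex_of_real ` {0..}"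
  have z0: "z \<noteq> 0" using z by (auto intro: image_eqI[of _ _ 0])
  let ?h = "adj (emb A b) * emb A b"
  let ?k = "adj (emb B (\<phi> b)) * emb B (\<phi> b)"
  have Tv: "T (cx (1 / z) * ?h) = cx (1 / z) * ?k" using b by (simp add: ulift_mult ulift_adj)
  have "has_inverse (1 - cx (1 / z) * ?h)"
  proof (rule has_inverse_ray[OF iso])
    show "cx (1 / z) * ?h \<in> unitized A" using b by auto
    fix t :: real assume t: "0 \<le> t" "t \<le> 1"
    show "has_inverse (1 - t *\<^sub>R T (cx (1 / z) * ?h))"
    proof (cases "t = 0")
      case False
      have "z / complex_of_real t \<notin> complex_of_real ` {0..}"
      proof
        assume "z / complex_of_real t \<in> complex_of_real ` {0..}"
        then obtain r where "0 \<le> r" "z / complex_of_real t = complex_of_real r" by auto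
        then have "z = complex_of_real (r * t)" "0 \<le> r * t" using False t by (auto simp: field_simps)
        then show False using z by blast
      qed
      then have "has_inverse (cx (z / complex_of_real t) - ?k)" using sym b unfolding B.symmetric_algebra_iff by blast
      then have "has_inverse (cx (complex_of_real t / z) * (cx (z / complex_of_real t) - ?k))"
        using False z0 by (simp add: has_inverse_cx_mult)
      moreover have "cx (complex_of_real t / z) * (cx (z / complex_of_real t) - ?k) = 1 - t *\<^sub>R T (cx (1 / z) * ?h)"
        using False z0 unfolding Tv right_diff_distrib scaleR_cx cx_mult_left cx_mult[symmetric] by simp
      ultimately show ?thesis by simp
    qed simp
  qed
  then have "has_inverse (cx z * (1 - cx (1 / z) * ?h))" using z0 by (simp add: has_inverse_cx_mult)
  moreover have "cx z * (1 - cx (1 / z) * ?h) = cx z - ?h" using z0 by (simp add: right_diff_distrib cx_mult_left)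
  ultimately show "has_inverse (cx z - ?h)" by simp
qed

locale rigid_fell_algebra = fell_algebra A m s L N
  for A :: "'a normed_star_alg" (structure) and m :: "'g::group_add => 'g => 'a => 'a => 'a" and s L N +
  assumes rigid: "rigidly_symmetric TYPE(('g => 'a) => ('g => 'a)) L N"
begin

text \<open>A nonzero complex vector space is infinite. The completion is formed on \<open>'g \<Rightarrow> 'a\<close>, which has to be infinite for that.\<close>

lemma infinite_type:
  assumes a: "a \<in> carrier A" "a \<noteq> \<zero>" shows "infinite (UNIV :: ('g => 'a) set)"
proof
  assume fin: "finite (UNIV :: ('g => 'a) set)"
  have "inj (\<lambda>z. (\<lambda>_. z \<odot> a) :: 'g => 'a)"
  proof (rule injI)
    fix z w assume "(\<lambda>_. z \<odot> a) = (\<lambda>_ :: 'g. w \<odot> a)"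
    then have e: "z \<odot> a = w \<odot> a" by metis
    have "(z - w) \<odot> a = z \<odot> a \<oplus> (- 1) \<odot> (w \<odot> a)" using a by (simp add: sm_sm flip: sm_add)
    also have "\<dots> = \<zero>" unfolding e using a by (simp add: sm_sm flip: sm_add)
    finally have "nrm A ((z - w) \<odot> a) = 0" by simp
    then show "z = w" using a by (simp add: nrm_smult nrm_eq_zero)
  qed
  then have "finite (UNIV :: complex set)" using fin by (meson finite_imageD finite_subset subset_UNIV)
  then show False using infinite_UNIV_char_0 by blast
qed

text \<open>The fibre over \<open>x\<close> sits in the cross-sectional \<open>C\<^sup>*\<close>-algebra as the functions supported at \<open>x\<close>,
  and \<open>f \<mapsto> (x \<mapsto> f x)\<close> is a *-homomorphism into the untwisted algebra with those coefficients:
  the twist is absorbed by the product of the coefficient algebra.\<close>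

theorem symmetric_F: "symmetric_algebra F"
proof (cases "carrier A = {\<zero>}")
  case True
  have "emb F b = 0" if b: "b \<in> carrier F" for b
  proof -
    have "b = \<zero>\<^bsub>F\<^esub>" using F_value[OF b] True by (auto simp: F_ops fun_eq_iff)
    then show ?thesis by simp
  qed
  then show ?thesis unfolding F.symmetric_algebra_iff by (auto simp: image_iff intro!: has_inverse_cx)
next
  case False
  then obtain a0 where a0: "a0 \<in> carrier A" "a0 \<noteq> \<zero>" using M.zero_closed by blast
  interpret S1: solid_space "ell1 :: ('g => complex) set" ell1_norm by (rule solid_ell1)
  interpret E: fell_algebra A m s ell1 ell1_norm by unfold_locales
  define k where "k x = (\<lambda>y :: 'g. if y = x then 1 else 0 :: real)" for x
  have k: "rin ell1 (k x)" "0 < k x x" "\<And>y. 0 \<le> k x y" for x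
  proof -
    have "(\<lambda>y. cmod (complex_of_real (k x y))) summable_on UNIV"
      using finite_nonzero_values_imp_summable_on[of UNIV "\<lambda>y. cmod (complex_of_real (k x y))"] by (auto simp: k_def)
    then show "rin ell1 (k x)" by (simp add: rin_def ell1_def)
  qed (auto simp: k_def)
  have sE [simp]: "single A x a \<in> carrier E.F" if "a \<in> carrier A" for x a by (rule E.single_F[OF k that])
  have red_single: "E.red (single A x a) = nrm A a" if a: "a \<in> carrier A" for x a
  proof (rule antisym)
    have "E.red (single A x a) \<le> nrm E.F (single A x a)" using a by (intro E.red_le_nrm) simp
    also have "\<dots> = (\<Sum>\<^sub>\<infinity>y. if y = x then nrm A a else 0)"
      unfolding E.F_ops(5) rnorm_def ell1_norm_def using a by (intro infsum_cong) (auto simp: single_def)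
    also have "\<dots> = nrm A a" using infsum_supported_at[of x "\<lambda>y. if y = x then nrm A a else 0"] by simp
    finally show "E.red (single A x a) \<le> nrm A a" .
    show "nrm A a \<le> E.red (single A x a)"
      using E.nrm_le_red[OF k[of 0] sE[OF a, of x], of x] by (metis single_def)
  qed
  interpret K: cstar_normed E.F E.red
  proof
    show "cstar_seminorm E.F E.red" by (rule E.red_cstar_seminorm)
    show "infinite (UNIV :: ('g => 'a) set)" by (rule infinite_type[OF a0])
    fix f assume f: "f \<in> carrier E.F" "E.red f = 0"
    then have "nrm A (f x) = 0" for x using E.nrm_le_red[OF k[of 0] f(1), of x] by (intro antisym) auto
    then show "f = \<zero>\<^bsub>E.F\<^esub>" using f by (auto simp: E.F_ops nrm_eq_zero)
  qed
  let ?m = "tw_m K.Q (\<lambda>(x :: 'g) b. b) (\<lambda>x y. \<one>\<^bsub>multiplier_algebra K.Q\<^esub>)"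
  let ?s = "tw_s K.Q (\<lambda>(x :: 'g) b. b) (\<lambda>x y. \<one>\<^bsub>multiplier_algebra K.Q\<^esub>)"
  interpret Q: cstar_algebra K.Q by (rule K.cstar_algebra_Q)
  interpret fQ: fell_bundle K.Q ?m ?s by (rule fell_bundle_trivial) (rule K.cstar_algebra_Q)
  interpret D: fell_algebra K.Q ?m ?s L N by unfold_locales
  have symD: "symmetric_algebra D.F"
    using rigid K.cstar_algebra_Q unfolding rigidly_symmetric_def twisted_algebra_fell by blast
  interpret q: uni_hom E.F K.Q K.q by unfold_locales (rule K.q_hom)
  define \<Psi> where "\<Psi> f = (\<lambda>x. K.q (single A x (f x)))" for f :: "'g => 'a"
  have nrm_\<Psi>: "nrm K.Q (\<Psi> f x) = nrm A (f x)" if "f \<in> carrier F" for f x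
    using that by (simp add: \<Psi>_def K.nrm_q red_single)
  have \<Psi>_value: "\<Psi> f x \<in> carrier K.Q" if "f \<in> carrier F" for f x using that by (simp add: \<Psi>_def)
  have \<Psi>_closed: "\<Psi> f \<in> carrier D.F" if "f \<in> carrier F" for f
    using that nrm_\<Psi> \<Psi>_value F_rin by (simp add: D.F_carrier)
  have single_ops: "single A x (a \<oplus> b) = single A x a \<oplus>\<^bsub>E.F\<^esub> single A x b"
    "single A x (z \<odot> a) = z \<odot>\<^bsub>E.F\<^esub> single A x a" "single A x (s x a) = star E.F (single A (- x) a)"
    "single A (y + x) (m y x a b) = single A y a \<otimes>\<^bsub>E.F\<^esub> single A x b"
    if "a \<in> carrier A" "b \<in> carrier A" for x y z a b
  proof -
    show "single A (y + x) (m y x a b) = single A y a \<otimes>\<^bsub>E.F\<^esub> single A x b"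
      unfolding E.mult_single_left[OF sE[OF that(2)] sE[OF that(1)] that(1)]
    proof
      fix z
      have "- y + z = x \<longleftrightarrow> z = y + x" by (metis add.assoc left_minus right_minus add_0)
      then show "single A (y + x) (m y x a b) z = m y (- y + z) a (single A x b (- y + z))"
        using that by (simp add: single_def m_zero)
    qed
  qed (use that in \<open>auto simp: single_def E.F_ops fun_eq_iff minus_equation_iff\<close>)
  have Ds: "?s x c = star K.Q c" and Dm: "?m x y c d = c \<otimes>\<^bsub>K.Q\<^esub> d"
    if "c \<in> carrier K.Q" "d \<in> carrier K.Q" for c d and x y :: 'g
    using that by (auto simp: tw_s_def tw_m_def multiplier_algebra_def)
  have mult: "\<Psi> (f \<otimes>\<^bsub>F\<^esub> g) = \<Psi> f \<otimes>\<^bsub>D.F\<^esub> \<Psi> g" if f: "f \<in> carrier F" and g: "g \<in> carrier F" for f g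
  proof (rule D.F_eqI)
    show "\<Psi> (f \<otimes>\<^bsub>F\<^esub> g) \<in> carrier D.F" using f g by (intro \<Psi>_closed mult_F)
    show "\<Psi> f \<otimes>\<^bsub>D.F\<^esub> \<Psi> g \<in> carrier D.F" using f g by (intro D.mult_F \<Psi>_closed)
    fix x
    define \<Lambda> where "\<Lambda> G = emb K.Q (K.q (single A x (prj A G)))" for G
    have \<Lambda>: "bounded_linear \<Lambda>"
    proof (rule bounded_linear_intro[of _ 1])
      fix G show "norm (\<Lambda> G) \<le> norm G * 1" using norm_prj[of G] by (simp add: \<Lambda>_def K.nrm_q red_single)
    qed (simp_all add: \<Lambda>_def prj_simps(4) prj_cx_mult scaleR_cx single_ops(1) single_ops(2)[OF _ M.zero_closed] q.hom_add q.hom_sm fQ.emb_add fQ.emb_smult)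
    have "emb K.Q (\<Psi> (f \<otimes>\<^bsub>F\<^esub> g) x) = \<Lambda> (emb A ((f \<otimes>\<^bsub>F\<^esub> g) x))" using mult_value(1)[OF f g, of x] by (simp add: \<Lambda>_def \<Psi>_def)
    also have "\<dots> = (\<Sum>\<^sub>\<infinity>y. \<Lambda> (Mb y (- y + x) (emb A (f y)) (emb A (g (- y + x)))))"
      unfolding mult_value(2)[OF f g] by (rule infsum_real_bounded_linear[symmetric, OF \<Lambda> mult_emb_summable[OF f g]])
    also have "\<dots> = (\<Sum>\<^sub>\<infinity>y. fQ.Mb y (- y + x) (emb K.Q (\<Psi> f y)) (emb K.Q (\<Psi> g (- y + x))))"
    proof (rule infsum_cong)
      fix y
      have "single A x (m y (- y + x) (f y) (g (- y + x))) = single A y (f y) \<otimes>\<^bsub>E.F\<^esub> single A (- y + x) (g (- y + x))"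
        using single_ops(4)[of "f y" "g (- y + x)" y "- y + x"] f g by (simp add: add.assoc[symmetric])
      then have "K.q (single A x (m y (- y + x) (f y) (g (- y + x)))) = \<Psi> f y \<otimes>\<^bsub>K.Q\<^esub> \<Psi> g (- y + x)"
        using f g by (simp add: q.hom_mult \<Psi>_def)
      then show "\<Lambda> (Mb y (- y + x) (emb A (f y)) (emb A (g (- y + x)))) = fQ.Mb y (- y + x) (emb K.Q (\<Psi> f y)) (emb K.Q (\<Psi> g (- y + x)))"
        using f g \<Psi>_value by (simp add: \<Lambda>_def Mb_emb fQ.Mb_emb Dm)
    qed
    also have "\<dots> = emb K.Q ((\<Psi> f \<otimes>\<^bsub>D.F\<^esub> \<Psi> g) x)" by (rule D.mult_value(2)[symmetric, OF \<Psi>_closed[OF f] \<Psi>_closed[OF g]])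
    finally show "emb K.Q (\<Psi> (f \<otimes>\<^bsub>F\<^esub> g) x) = emb K.Q ((\<Psi> f \<otimes>\<^bsub>D.F\<^esub> \<Psi> g) x)" .
  qed
  have "\<Psi> \<in> star_hom F D.F"
    unfolding star_hom_def
  proof (intro CollectI conjI ballI allI funcsetI)
    fix f z assume f: "f \<in> carrier F"
    show "\<Psi> f \<in> carrier D.F" by (rule \<Psi>_closed[OF f])
    show "\<Psi> (z \<odot>\<^bsub>F\<^esub> f) = z \<odot>\<^bsub>D.F\<^esub> \<Psi> f" using f by (simp add: \<Psi>_def F_ops D.F_ops single_ops(2)[OF _ M.zero_closed] q.hom_sm)
    have "K.q (single A x (s x (f (- x)))) = star K.Q (K.q (single A (- x) (f (- x))))" for x
      using f by (simp add: single_ops(3)[OF _ M.zero_closed] q.hom_star)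
    then show "\<Psi> (star F f) = star D.F (\<Psi> f)"
      using f Ds[OF \<Psi>_value[OF f] Q.M.zero_closed] by (simp add: F_ops D.F_ops \<Psi>_def)
    fix g assume g: "g \<in> carrier F"
    show "\<Psi> (f \<oplus>\<^bsub>F\<^esub> g) = \<Psi> f \<oplus>\<^bsub>D.F\<^esub> \<Psi> g" using f g by (simp add: \<Psi>_def F_ops D.F_ops single_ops q.hom_add)
    show "\<Psi> (f \<otimes>\<^bsub>F\<^esub> g) = \<Psi> f \<otimes>\<^bsub>D.F\<^esub> \<Psi> g" by (rule mult[OF f g])
  qed
  then interpret \<Psi>: uni_hom F D.F \<Psi> by unfold_locales
  show ?thesis
    by (rule \<Psi>.symmetric_isometric[OF _ symD]) (use nrm_\<Psi> in \<open>simp add: F_ops D.F_ops\<close>)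
qed

end

section \<open>Inverse closedness in the enveloping \<open>C\<^sup>*\<close>-algebra\<close>

context uni_factor
begin

lemma is_one_unitization: "is_one (unitization A) (1, \<zero>)"
proof -
  interpret U: ring "unitization A" by (rule ring_unitization)
  show ?thesis using U.one_closed U.l_one U.r_one by (simp add: is_one_def unitization_simps(4))
qed

lemma emb_unitization_mult:
  assumes "a \<in> carrier A" "b \<in> carrier A"
  shows "(z, a) \<otimes>\<^bsub>unitization A\<^esub> (w, b) = (v, c) ==> (cx z + emb A a) * (cx w + emb A b) = cx v + emb A c"
  using assms cx_commute[of w "emb A a"]
  by (auto simp: unitization_simps emb_add emb_smult emb_mult distrib_left distrib_right cx_mult)

lemma closed_emb: "closed (emb A ` carrier A)"
proof -
  have "emb A ` carrier A = unitized A \<inter> {F. cx (chr A F) = (0 :: 'a uni)}"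
  proof -
    have "F \<in> emb A ` carrier A" if "F \<in> unitized A" "cx (chr A F) = (0 :: 'a uni)" for F
      using unitized_eq[OF that(1)] that(2) prj_closed[of F] by auto
    then show ?thesis by (auto simp: chr_emb)
  qed
  moreover have "closed {F. cx (chr A F) = (0 :: 'a uni)}"
    by (intro closed_Collect_eq linear_continuous_on bounded_linear_cx_chr continuous_on_const)
  ultimately show ?thesis using closed_unitized by auto
qed

text \<open>An approximate left unit is close to a left unit: \<open>u \<mapsto> u - y u + y\<close> is a contraction.\<close>

lemma left_unit_of_approximate:
  assumes y: "y \<in> carrier A" and c: "c < 1" "0 \<le> c"
    and yc: "\<And>a. a \<in> carrier A ==> nrm A (a \<ominus> y \<otimes> a) \<le> c * nrm A a"
  obtains u where "u \<in> carrier A" "\<And>a. a \<in> carrier A ==> u \<otimes> a = a"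
proof -
  let ?S = "emb A ` carrier A"
  let ?f = "\<lambda>U. U - emb A y * U + emb A y"
  have fS: "?f ` ?S \<subseteq> ?S"
  proof (clarify)
    fix a assume a: "a \<in> carrier A"
    have "?f (emb A a) = emb A (a \<ominus> y \<otimes> a \<oplus> y)" using a y by (simp add: emb_add emb_minus emb_mult)
    then show "?f (emb A a) \<in> ?S" using a y by auto
  qed
  have contr: "dist (?f U) (?f V) \<le> c * dist U V" if UV: "U \<in> ?S" "V \<in> ?S" for U V
  proof -
    obtain a b where ab: "a \<in> carrier A" "b \<in> carrier A" "U = emb A a" "V = emb A b" using UV by blast
    have "?f U - ?f V = emb A ((a \<ominus> b) \<ominus> y \<otimes> (a \<ominus> b))"
      using ab y by (simp add: emb_minus emb_mult right_diff_distrib)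
    moreover have "U - V = emb A (a \<ominus> b)" using ab by (simp add: emb_minus)
    ultimately show ?thesis using yc[of "a \<ominus> b"] ab y by (simp add: dist_norm)
  qed
  have "\<exists>!U. U \<in> ?S \<and> ?f U = U"
    by (rule Banach_fix[of ?S c ?f]) (use closed_emb fS contr c in \<open>auto simp: complete_eq_closed\<close>)
  then obtain u where u: "u \<in> carrier A" "?f (emb A u) = emb A u" by blast
  have yu: "emb A y * emb A u = emb A y" using u(2) by simp
  show thesis
  proof (rule that[OF u(1)])
    fix a assume a: "a \<in> carrier A"
    let ?d = "u \<otimes> a \<ominus> a"
    have d: "?d \<in> carrier A" using u a by simp
    have "emb A (y \<otimes> ?d) = 0"
      using y u a d by (simp add: emb_mult emb_minus right_diff_distrib yu flip: mult.assoc)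
    then have "emb A (?d \<ominus> y \<otimes> ?d) = emb A ?d" using y d by (simp add: emb_minus[of ?d "y \<otimes> ?d"])
    then have "nrm A ?d \<le> c * nrm A ?d" using yc[OF d] d y by (simp add: emb_eq_iff)
    then have "(1 - c) * nrm A ?d \<le> 0" by (simp add: algebra_simps)
    then have "nrm A ?d = 0" using c d nrm_nonneg[OF d] by (simp add: mult_le_0_iff)
    then show "u \<otimes> a = a" using d u a by (simp add: nrm_eq_zero minus_eq_zero_iff)
  qed
qed

lemma unital_of_left_unit:
  assumes u: "u \<in> carrier A" "\<And>a. a \<in> carrier A ==> u \<otimes> a = a" shows "is_one A u"
proof -
  have r: "a \<otimes> star A u = a" if a: "a \<in> carrier A" for a
    using arg_cong[OF u(2)[of "star A a"], of "star A"] a u(1) by (simp add: star_mult star_star)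
  have "u = star A u" using r[OF u(1)] u(2)[of "star A u"] u(1) by simp
  then show ?thesis using u r by (simp add: is_one_def)
qed

end

text \<open>\<open>B\<close> plays the role of the enveloping \<open>C\<^sup>*\<close>-algebra of the symmetric Banach *-algebra \<open>A\<close>. Its
  norm dominates Ptak's functional \<open>r (a\<^sup>* a) ^ (1/2)\<close>, which in turn dominates the spectral radius.\<close>

locale envelope = A: uni_factor A + B: cstar_factor B + uni_hom A B \<phi>
  for A :: "'a normed_star_alg" and B :: "'b normed_star_alg" and \<phi> +
  fixes p
  assumes env: "enveloping A B \<phi>" and sym: "symmetric_algebra A"
    and p: "cstar_seminorm A p" "\<And>a. a \<in> carrier A ==> p a = 0 ==> a = \<zero>\<^bsub>A\<^esub>"
    and units: "unital B ==> unital A"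
begin

sublocale H: hermitian "unitized A" by (rule A.symmetric_hermitian[OF sym])

lemma dominates: "cstar_seminorm A q ==> a \<in> carrier A ==> q a \<le> nrm B (\<phi> a)"
  using env by (auto simp: enveloping_def)

lemma dense: assumes d: "d \<in> carrier B" "0 < e" obtains g where "g \<in> carrier A" "norm (emb B d - emb B (\<phi> g)) < e"
proof -
  interpret M: Metric_space "carrier B" "norm_dist B (nrm B)" by (rule B.metric_space)
  have "d \<in> M.mtopology closure_of (\<phi> ` carrier A)" using env d by (simp add: enveloping_def norm_topology_def)
  then obtain g where g: "g \<in> carrier A" "norm_dist B (nrm B) d (\<phi> g) < e"
    using d(2) unfolding M.metric_closure_of by auto
  then show ?thesis using d by (intro that[of g]) (auto simp: norm_dist_def simp flip: B.emb_minus)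
qed

lemma hom_eq_iff: assumes "a \<in> carrier A" "b \<in> carrier A" shows "\<phi> a = \<phi> b \<longleftrightarrow> a = b"
proof
  assume e: "\<phi> a = \<phi> b"
  have d: "a \<ominus>\<^bsub>A\<^esub> b \<in> carrier A" using assms by simp
  have "\<phi> (a \<ominus>\<^bsub>A\<^esub> b) = \<zero>\<^bsub>B\<^esub>" using assms e by (simp add: hom_minus B.minus_eq_zero_iff)
  then have "p (a \<ominus>\<^bsub>A\<^esub> b) \<le> 0" using dominates[OF p(1) d] by simp
  moreover have "0 \<le> p (a \<ominus>\<^bsub>A\<^esub> b)" using p(1) d by (auto simp: cstar_seminorm_def)
  ultimately show "a = b" using p(2)[OF d] assms by (simp add: A.minus_eq_zero_iff)
qed simp

lemma ptak_seminorm: "cstar_seminorm A (\<lambda>a. H.ptak_norm (emb A a))"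
  unfolding cstar_seminorm_def
  by (auto simp: A.emb_mult A.emb_star A.emb_add A.emb_smult H.ptak_norm_cstar H.ptak_norm_cx_mult
      intro!: H.ptak_norm_add H.ptak_norm_mult)

lemma rad_le: "a \<in> carrier A ==> rad (emb A a) \<le> nrm B (\<phi> a)"
  using H.rad_le_ptak_norm[of "emb A a"] dominates[OF ptak_seminorm, of a] by simp

text \<open>Approximate \<open>d\<close> by \<open>g \<in> A\<close>. Then \<open>(1 + f) (1 + g) = 1 + y\<close> with \<open>\<parallel>\<phi> y\<parallel> < 1\<close>, so that the spectral radius of \<open>y\<close> is below \<open>1\<close>.\<close>

lemma quasi_inverse:
  assumes f: "f \<in> carrier A" and d: "d \<in> carrier B"
    and 1: "(1 + emb B (\<phi> f)) * (1 + emb B d) = 1" and 2: "(1 + emb B d) * (1 + emb B (\<phi> f)) = 1"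
  shows "d \<in> \<phi> ` carrier A"
proof -
  let ?X = "1 + emb A f" and ?TX = "1 + emb B (\<phi> f)"
  have n: "0 < norm ?TX" using 1 by (metis mult_zero_left zero_less_norm_iff zero_neq_one)
  obtain g where g: "g \<in> carrier A" "norm (emb B d - emb B (\<phi> g)) < 1 / norm ?TX" using dense[OF d, of "1 / norm ?TX"] n by auto
  define y where "y = f \<oplus>\<^bsub>A\<^esub> g \<oplus>\<^bsub>A\<^esub> f \<otimes>\<^bsub>A\<^esub> g"
  have y: "y \<in> carrier A" using f g by (simp add: y_def)
  have Xy: "?X * (1 + emb A g) = 1 + emb A y" using f g by (simp add: y_def A.emb_add A.emb_mult algebra_simps)
  have "?TX * (1 + emb B (\<phi> g)) = 1 + emb B (\<phi> y)" using arg_cong[OF Xy, of T] f g y by (simp add: ulift_mult ulift_add)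
  moreover have "?TX * (1 + emb B (\<phi> g)) = 1 - ?TX * (emb B d - emb B (\<phi> g))"
    using 1 by (simp add: distrib_left right_diff_distrib eq_neg_iff_add_eq_0)
  ultimately have "emb B (\<phi> y) = - (?TX * (emb B d - emb B (\<phi> g)))" by (simp add: algebra_simps)
  then have "norm (emb B (\<phi> y)) \<le> norm ?TX * norm (emb B d - emb B (\<phi> g))" using norm_mult_ineq by simp
  also have "\<dots> < 1" using g(2) n by (simp add: field_simps)
  finally have "rad (emb A y) < 1" using rad_le[OF y] y by simp
  then have i: "has_inverse (1 + emb A y)"
    using rad_less_1_has_inverse[of "- emb A y"] rad_cx_mult[of "- 1" "emb A y"] by simp
  define W where "W = (1 + emb A g) * minv (1 + emb A y)"
  have XW: "?X * W = 1" using minv_right[OF i] by (simp add: W_def Xy flip: mult.assoc)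
  have WU: "W \<in> unitized A" unfolding W_def using g y i by (intro A.mult_mem A.minv_mem A.add_mem) auto
  have "chr A W = 1" using arg_cong[OF XW, of "chr A"] f by (simp add: A.chr_simps A.chr_emb)
  then have W: "W = 1 + emb A (prj A W)" using A.unitized_eq[OF WU] by simp
  have "?TX * (1 + emb B (\<phi> (prj A W))) = 1"
    using arg_cong[OF XW, of T] f by (subst (asm) W) (simp add: ulift_mult ulift_add)
  then have "1 + emb B (\<phi> (prj A W)) = 1 + emb B d" using 2 by (metis mult.assoc mult_1_left mult_1_right)
  then show ?thesis using d by (auto simp: B.emb_eq_iff intro!: image_eqI[of _ _ "prj A W"])
qed

lemma star_subalgebra_range: "star_subalgebra (\<phi> ` carrier A) B"
  unfolding star_subalgebra_def
  by (auto simp: hom_zero[symmetric] simp flip: hom_add hom_mult hom_sm hom_star)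

text \<open>The projection \<open>e' - \<phi> e\<close> annihilates the dense range of \<open>\<phi>\<close>.\<close>

lemma hom_one: assumes e: "is_one A e" and e': "is_one B e'" shows "\<phi> e = e'"
proof -
  have ec: "e \<in> carrier A" "e' \<in> carrier B" using e e' by (auto simp: is_one_def)
  define r where "r = e' \<ominus>\<^bsub>B\<^esub> \<phi> e"
  have r: "r \<in> carrier B" using ec by (simp add: r_def)
  obtain g where g: "g \<in> carrier A" "norm (emb B e' - emb B (\<phi> g)) < 1" using dense[OF ec(2), of 1] by auto
  have "e' \<otimes>\<^bsub>B\<^esub> \<phi> g = \<phi> g" "\<phi> e \<otimes>\<^bsub>B\<^esub> \<phi> g = \<phi> g" "r \<otimes>\<^bsub>B\<^esub> e' = r"
    using e e' g ec r by (simp_all add: is_one_def flip: hom_mult)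
  then have "emb B e' * emb B (\<phi> g) = emb B (\<phi> g)" "emb B (\<phi> e) * emb B (\<phi> g) = emb B (\<phi> g)" "emb B r * emb B e' = emb B r"
    using g ec r by (metis B.emb_mult hom_closed)+
  moreover have "emb B r = emb B e' - emb B (\<phi> e)" using ec by (simp add: r_def B.emb_minus)
  ultimately have "emb B r = emb B r * (emb B e' - emb B (\<phi> g))" by (simp add: right_diff_distrib left_diff_distrib)
  then have "norm (emb B r) \<le> norm (emb B r) * norm (emb B e' - emb B (\<phi> g))" using norm_mult_ineq by metis
  then have "norm (emb B r) = 0" using g(2) norm_ge_zero[of "emb B r"] by (smt (verit) mult_less_cancel_left2)
  then show ?thesis using r ec by (simp add: B.nrm_eq_zero r_def B.minus_eq_zero_iff)
qed

lemma inverses_range: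
  assumes f: "f \<in> carrier A" and d: "d \<in> carrier B"
    and 1: "(cx z + emb B (\<phi> f)) * (cx w + emb B d) = 1" "(cx w + emb B d) * (cx z + emb B (\<phi> f)) = 1" and zw: "z * w = 1"
  shows "d \<in> \<phi> ` carrier A"
proof -
  have zw': "w * z = 1" and w0: "w \<noteq> 0" using zw by (auto simp: mult.commute)
  have X: "1 + emb B (\<phi> (w \<odot>\<^bsub>A\<^esub> f)) = cx w * (cx z + emb B (\<phi> f))"
    using f zw' by (simp add: hom_sm B.emb_smult distrib_left flip: cx_mult)
  have Y: "1 + emb B (z \<odot>\<^bsub>B\<^esub> d) = cx z * (cx w + emb B d)"
    using d zw by (simp add: B.emb_smult distrib_left flip: cx_mult)
  have "z \<odot>\<^bsub>B\<^esub> d \<in> \<phi> ` carrier A"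
    by (rule quasi_inverse[of "w \<odot>\<^bsub>A\<^esub> f"]) (use f d zw zw' in \<open>simp_all add: X Y cx_mult_mult 1\<close>)
  then obtain g where g: "g \<in> carrier A" "z \<odot>\<^bsub>B\<^esub> d = \<phi> g" by blast
  have "d = \<phi> (w \<odot>\<^bsub>A\<^esub> g)" using d zw' g by (simp add: hom_sm B.sm_sm flip: g(2))
  then show ?thesis using g by blast
qed

lemma inverse_closed_unital: assumes u: "unital B" shows "inverse_closed (\<phi> ` carrier A) B"
  unfolding inverse_closed_def
proof (intro conjI u star_subalgebra_range ballI allI impI)
  obtain e where e: "is_one A e" using units[OF u] by (auto simp: unital_def)
  obtain e' where e': "is_one B e'" using u by (auto simp: unital_def)
  have ee: "\<phi> e = e'" by (rule hom_one[OF e e'])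
  have ec: "e \<in> carrier A" "e' \<in> carrier B" using e e' by (auto simp: is_one_def)
  fix a b assume "a \<in> \<phi> ` carrier A" and i: "inverses B a b"
  then obtain f where f: "f \<in> carrier A" "a = \<phi> f" by blast
  have b: "b \<in> carrier B" "\<phi> f \<otimes>\<^bsub>B\<^esub> b = e'" "b \<otimes>\<^bsub>B\<^esub> \<phi> f = e'" using i f B.unit_of_eq[OF e'] by (auto simp: inverses_def)
  let ?e = "emb B e'" and ?a = "emb B (\<phi> f)" and ?b = "emb B b"
  have ab: "?a * ?b = ?e" "?b * ?a = ?e" using b f by (simp_all flip: B.emb_mult)
  have u: "?e * ?a = ?a" "?a * ?e = ?a" "?e * ?b = ?b" "?b * ?e = ?b" "?e * ?e = ?e"
    using e' f b(1) ec by (simp_all add: is_one_def flip: B.emb_mult)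
  have X: "1 + emb B (\<phi> (f \<ominus>\<^bsub>A\<^esub> e)) = 1 + (?a - ?e)" using f ec by (simp add: hom_minus B.emb_minus ee)
  have Y: "1 + emb B (b \<ominus>\<^bsub>B\<^esub> e') = 1 + (?b - ?e)" using b(1) ec by (simp add: B.emb_minus)
  have "b \<ominus>\<^bsub>B\<^esub> e' \<in> \<phi> ` carrier A"
    by (rule quasi_inverse[of "f \<ominus>\<^bsub>A\<^esub> e"], unfold X Y)
      (use f ec b(1) in \<open>simp_all add: distrib_left distrib_right right_diff_distrib left_diff_distrib ab u\<close>)
  then obtain g where g: "g \<in> carrier A" "b \<ominus>\<^bsub>B\<^esub> e' = \<phi> g" by blast
  have "emb B b = emb B (\<phi> (g \<oplus>\<^bsub>A\<^esub> e))" using g ec b(1) by (simp add: hom_add B.emb_add ee B.emb_minus flip: g(2))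
  then have "b = \<phi> (g \<oplus>\<^bsub>A\<^esub> e)" using g ec b(1) by (simp add: B.emb_eq_iff)
  then show "b \<in> \<phi> ` carrier A" using g ec by blast
qed

theorem spectral: "spectral_in_enveloping A B \<phi>"
  unfolding spectral_in_enveloping_def
proof
  show "inj_on \<phi> (carrier A)" using hom_eq_iff by (auto simp: inj_on_def)
  have "inverse_closed (UNIV \<times> \<phi> ` carrier A) (unitization B)"
    unfolding inverse_closed_def
  proof (intro conjI ballI allI impI)
    show "unital (unitization B)" using B.is_one_unitization by (auto simp: unital_def)
    have "star (unitization B) (z, a) = (cnj z, star B a)" "w \<odot>\<^bsub>unitization B\<^esub> (z, a) = (w * z, w \<odot>\<^bsub>B\<^esub> a)" for z w a
      by (simp_all add: unitization_def)
    moreover define S where "S = \<phi> ` carrier A"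
    moreover have "S \<subseteq> carrier B" "\<zero>\<^bsub>B\<^esub> \<in> S" "\<And>a b. a \<in> S ==> b \<in> S ==> a \<oplus>\<^bsub>B\<^esub> b \<in> S \<and> a \<otimes>\<^bsub>B\<^esub> b \<in> S"
        "\<And>a z. a \<in> S ==> z \<odot>\<^bsub>B\<^esub> a \<in> S \<and> star B a \<in> S"
      using star_subalgebra_range unfolding star_subalgebra_def S_def by blast+
    ultimately show "star_subalgebra (UNIV \<times> \<phi> ` carrier A) (unitization B)"
      unfolding star_subalgebra_def by (auto simp: B.unitization_simps simp flip: S_def)
    have u1: "unit_of (unitization B) = (1, \<zero>\<^bsub>B\<^esub>)"
      unfolding unit_of_def by (rule the_equality, rule B.is_one_unitization) (metis B.is_one_unitization is_one_def)
    fix x y assume "x \<in> UNIV \<times> \<phi> ` carrier A" and i: "inverses (unitization B) x y"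
    then obtain z f where x: "x = (z, \<phi> f)" "f \<in> carrier A" by blast
    obtain w d where y: "y = (w, d)" by (cases y)
    have d: "d \<in> carrier B" and xy: "(z, \<phi> f) \<otimes>\<^bsub>unitization B\<^esub> (w, d) = (1, \<zero>\<^bsub>B\<^esub>)" "(w, d) \<otimes>\<^bsub>unitization B\<^esub> (z, \<phi> f) = (1, \<zero>\<^bsub>B\<^esub>)"
      using i by (auto simp: inverses_def u1 x y B.unitization_simps(1))
    have "z * w = 1" using xy(1) by (simp add: B.unitization_simps)
    then have "d \<in> \<phi> ` carrier A"
      using inverses_range[OF x(2) d, of z w] B.emb_unitization_mult[OF hom_closed[OF x(2)] d xy(1)]
        B.emb_unitization_mult[OF d hom_closed[OF x(2)] xy(2)] by simp
    then show "y \<in> UNIV \<times> \<phi> ` carrier A" by (simp add: y)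
  qed
  then show "spectral_subalgebra (\<phi> ` carrier A) B"
    using inverse_closed_unital by (simp add: spectral_subalgebra_def)
qed

end

context rigid_fell_algebra
begin

text \<open>A nonnegative \<open>k \<in> L\<close> with \<open>k x > 0\<close> gives, by convolution with its reflection, an element of \<open>L\<close> that is positive at
  \<open>0\<close>. So if there is none, the algebra vanishes.\<close>

lemma weight_or_trivial:
  obtains k where "rin L k" "0 < k 0" "\<And>x. 0 \<le> k x" | "carrier F = {\<zero>\<^bsub>F\<^esub>}"
proof (cases "carrier F = {\<zero>\<^bsub>F\<^esub>}")
  case False
  then obtain f where f: "f \<in> carrier F" "f \<noteq> \<zero>\<^bsub>F\<^esub>" using F.M.zero_closed by blast
  then obtain x where x: "f x \<noteq> \<zero>" by (auto simp: F_ops fun_eq_iff)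
  let ?k = "\<lambda>x. nrm A (f x)"
  have k0: "0 \<le> ?k y" for y using f by simp
  note k = F_rin[OF f(1)]
  have km: "rin L (\<lambda>y. ?k (- y))" using S_minus[OF k k0] by blast
  have "rin L (\<lambda>x. \<Sum>\<^sub>\<infinity>y. ?k y * ?k (- (- y + x)))" using S_conv[OF k km k0 k0] by blast
  moreover have "0 < (\<Sum>\<^sub>\<infinity>y. ?k y * ?k (- (- y + 0)))"
  proof -
    have s: "(\<lambda>y. ?k y * ?k y) summable_on UNIV"
    proof -
      obtain K where K: "\<And>k x. rin L k ==> (\<And>x. 0 \<le> k x) ==> k x \<le> K * rnorm N k" using rnorm_pointwise by blast
      show ?thesis
      proof (rule summable_on_comparison_test)
      show "(\<lambda>y. (K * rnorm N ?k) * ?k y) summable_on UNIV" by (rule summable_on_cmult_right[OF F_summable[OF f(1)]])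
      show "?k y * ?k y \<le> (K * rnorm N ?k) * ?k y" for y using K[OF k k0, of y] k0[of y] by (rule mult_right_mono)
      qed (use k0 in simp)
    qed
    have "0 < nrm A (f x)" using x f nrm_eq_zero[of "f x"] nrm_nonneg[of "f x"] F_value[OF f(1), of x] by linarith
    then have "0 < sum (\<lambda>y. ?k y * ?k y) {x}" by simp
    also have "\<dots> \<le> (\<Sum>\<^sub>\<infinity>y. ?k y * ?k y)" by (rule finite_sum_le_infsum[OF s]) (use k0 in auto)
    finally show ?thesis by simp
  qed
  ultimately show ?thesis using that(1)[of "\<lambda>x. \<Sum>\<^sub>\<infinity>y. ?k y * ?k (- (- y + x))"] k0 by (simp add: infsum_nonneg)
qed (use that in blast)

text \<open>If the enveloping \<open>C\<^sup>*\<close>-algebra has a unit, some \<open>g \<in> F\<close> is close to it, and then \<open>g 0\<close> is an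
  approximate left unit of the fibre over \<open>0\<close>.\<close>

lemma unital_of_enveloping:
  fixes C :: "'c normed_star_alg"
  assumes env: "enveloping F C \<iota>" and uC: "unital C" and k: "rin L k" "0 < k 0" "\<And>x. 0 \<le> k x"
  shows "unital F"
proof -
  have C: "cstar_algebra C" and hom: "\<iota> \<in> star_hom F C" and dom: "\<And>p f. cstar_seminorm F p ==> f \<in> carrier F ==> p f \<le> nrm C (\<iota> f)"
    using env by (auto simp: enveloping_def)
  interpret C: cstar_factor C by (rule cstar_factor.intro[OF C])
  interpret i: uni_hom F C \<iota> by unfold_locales (rule hom)
  obtain e where e: "is_one C e" using uC by (auto simp: unital_def)
  then have ec: "e \<in> carrier C" by (simp add: is_one_def)
  define K where "K = rnorm N k / k 0"
  have K0: "0 \<le> K" using rnorm_nonneg[OF k(1,3)] k(2) by (simp add: K_def)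
  have sF: "single A 0 a \<in> carrier F" and sK: "nrm F (single A 0 a) \<le> K * nrm A a" if a: "a \<in> carrier A" for a
  proof -
    show "single A 0 a \<in> carrier F" by (rule single_F[OF k a])
    have sc: "rin L (\<lambda>y. (nrm A a / k 0) * k y)" "rnorm N (\<lambda>y. (nrm A a / k 0) * k y) = (nrm A a / k 0) * rnorm N k"
      using S_scale[OF k(1,3), of "nrm A a / k 0"] k(2) a by auto
    have "nrm F (single A 0 a) \<le> rnorm N (\<lambda>y. (nrm A a / k 0) * k y)"
      by (rule F_intro(2)[OF _ sc(1)]) (use a k in \<open>auto simp: single_def\<close>)
    also have "\<dots> = K * nrm A a" unfolding sc(2) by (simp add: K_def)
    finally show "nrm F (single A 0 a) \<le> K * nrm A a" .
  qed
  \<comment> \<open>\<open>K\<close> is the norm of \<open>a \<mapsto> a \<delta>\<^sub>0\<close>, and \<open>\<epsilon>\<close> is chosen to make the defect of \<open>g 0\<close> at most \<open>1/2\<close>.\<close>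
  define \<epsilon> where "\<epsilon> = 1 / (2 * (K + 1))"
  have \<epsilon>: "0 < \<epsilon>" "\<epsilon> * K \<le> 1 / 2" using K0 by (auto simp: \<epsilon>_def field_simps)
  interpret M: Metric_space "carrier C" "norm_dist C (nrm C)" by (rule C.metric_space)
  have "e \<in> M.mtopology closure_of (\<iota> ` carrier F)" using env ec by (simp add: enveloping_def norm_topology_def)
  then obtain g where g: "g \<in> carrier F" "norm_dist C (nrm C) e (\<iota> g) < \<epsilon>"
    using \<epsilon>(1) unfolding M.metric_closure_of by auto
  have eg: "nrm C (e \<ominus>\<^bsub>C\<^esub> \<iota> g) \<le> \<epsilon>" using g ec by (simp add: norm_dist_def)
  have approx: "nrm A (a \<ominus> g 0 \<otimes> a) \<le> 1 / 2 * nrm A a" if a: "a \<in> carrier A" for a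
  proof -
    let ?f = "single A (0 :: 'g) a"
    have f: "?f \<in> carrier F" by (rule sF[OF a])
    let ?h = "?f \<ominus>\<^bsub>F\<^esub> g \<otimes>\<^bsub>F\<^esub> ?f"
    have h: "?h \<in> carrier F" using f g by simp
    have "?h 0 = ?f 0 \<ominus> (g \<otimes>\<^bsub>F\<^esub> ?f) 0" by (rule F_minus_value[OF f mult_F(1)[OF g(1) f]])
    then have "?h 0 = a \<ominus> g 0 \<otimes> a"
      unfolding mult_single_right[OF g(1) f a] using g a by (simp add: single_def[of A 0 a] m_0)
    then have "nrm A (a \<ominus> g 0 \<otimes> a) \<le> red ?h" using nrm_le_red[OF k h, of 0] by simp
    also have "\<dots> \<le> nrm C (\<iota> ?h)" by (rule dom[OF red_cstar_seminorm h])
    also have "\<iota> ?h = (e \<ominus>\<^bsub>C\<^esub> \<iota> g) \<otimes>\<^bsub>C\<^esub> \<iota> ?f"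
    proof -
      have "emb C (\<iota> ?h) = emb C ((e \<ominus>\<^bsub>C\<^esub> \<iota> g) \<otimes>\<^bsub>C\<^esub> \<iota> ?f)"
        using f g ec e by (simp add: i.hom_minus i.hom_mult C.emb_minus C.emb_mult left_diff_distrib)
          (simp add: is_one_def flip: C.emb_mult)
      then show ?thesis using h f g ec by (simp add: C.emb_eq_iff)
    qed
    also have "nrm C \<dots> \<le> nrm C (e \<ominus>\<^bsub>C\<^esub> \<iota> g) * nrm C (\<iota> ?f)" using f g ec by (intro C.nrm_mult) auto
    also have "\<dots> \<le> \<epsilon> * (K * nrm A a)"
      using star_hom_contractive[OF banach_F C hom f] sK[OF a] eg f \<epsilon>(1) by (intro mult_mono) auto
    also have "\<dots> \<le> 1 / 2 * nrm A a" unfolding mult.assoc[symmetric] using \<epsilon>(2) a by (intro mult_right_mono) auto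
    finally show ?thesis .
  qed
  obtain u where u: "u \<in> carrier A" "\<And>a. a \<in> carrier A ==> u \<otimes> a = a"
    using left_unit_of_approximate[OF F_value[OF g(1)] _ _ approx] by auto
  show ?thesis
    unfolding unital_def using is_one_F[OF unital_of_left_unit[OF u] sF[OF u(1)]] by blast
qed

theorem envelope_F:
  fixes C :: "'c normed_star_alg"
  assumes env: "enveloping F C \<iota>" shows "\<exists>p. envelope F C \<iota> p"
proof -
  have C: "cstar_algebra C" and hom: "\<iota> \<in> star_hom F C" using env by (auto simp: enveloping_def)
  interpret C: cstar_factor C by (rule cstar_factor.intro[OF C])
  show ?thesis
  proof (cases rule: weight_or_trivial)
    case (1 k)
    have "envelope F C \<iota> red"
    proof (unfold_locales, rule hom, rule env, rule symmetric_F, rule red_cstar_seminorm)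
      fix f assume f: "f \<in> carrier F" "red f = 0"
      then have "nrm A (f x) = 0" for x using nrm_le_red[OF 1 f(1), of x] by (intro antisym) auto
      then show "f = \<zero>\<^bsub>F\<^esub>" using f by (auto simp: F_ops nrm_eq_zero)
    next
      show "unital C ==> unital F" by (rule unital_of_enveloping[OF env _ 1])
    qed
    then show ?thesis by blast
  next
    case 2
    have "is_one F \<zero>\<^bsub>F\<^esub>" using 2 by (simp add: is_one_def)
    then have "envelope F C \<iota> (\<lambda>_. 0)"
      by unfold_locales (use hom env symmetric_F 2 in \<open>auto simp: cstar_seminorm_def unital_def\<close>)
    then show ?thesis by blast
  qed
qed

end

section \<open>Bounded operators and adjoints\<close>

lemma quadratic_nonneg:
  fixes a b c :: real
  assumes "\<And>s. 0 \<le> a + 2 * s * b + s\<^sup>2 * c" and c: "0 \<le> c" shows "b\<^sup>2 \<le> a * c"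
proof (cases "c = 0")
  case True
  have "b = 0"
  proof (rule ccontr)
    assume "b \<noteq> 0"
    then show False using assms(1)[of "- (a + 1) / (2 * b)"] True by (simp add: field_simps)
  qed
  then show ?thesis using True by simp
next
  case False
  then have c0: "0 < c" using c by simp
  have "a + 2 * (- b / c) * b + (- b / c)\<^sup>2 * c = (a * c - b\<^sup>2) / c" using c0 by (simp add: power2_eq_square field_simps)
  then have "0 \<le> (a * c - b\<^sup>2) / c" using assms(1)[of "- b / c"] by simp
  then show ?thesis using c0 by (simp add: zero_le_divide_iff)
qed

context hilbert_space
begin

lemma sm_ops:
  "x \<in> carrier H ==> z \<odot>\<^bsub>H\<^esub> x \<in> carrier H" "x \<in> carrier H ==> z \<odot>\<^bsub>H\<^esub> (w \<odot>\<^bsub>H\<^esub> x) = (z * w) \<odot>\<^bsub>H\<^esub> x"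
  "x \<in> carrier H ==> (z + w) \<odot>\<^bsub>H\<^esub> x = z \<odot>\<^bsub>H\<^esub> x \<oplus>\<^bsub>H\<^esub> w \<odot>\<^bsub>H\<^esub> x"
  "x \<in> carrier H ==> y \<in> carrier H ==> z \<odot>\<^bsub>H\<^esub> (x \<oplus>\<^bsub>H\<^esub> y) = z \<odot>\<^bsub>H\<^esub> x \<oplus>\<^bsub>H\<^esub> z \<odot>\<^bsub>H\<^esub> y"
  "x \<in> carrier H ==> 1 \<odot>\<^bsub>H\<^esub> x = x" "x \<in> carrier H ==> 0 \<odot>\<^bsub>H\<^esub> x = \<zero>\<^bsub>H\<^esub>" "z \<odot>\<^bsub>H\<^esub> \<zero>\<^bsub>H\<^esub> = \<zero>\<^bsub>H\<^esub>"
  using smult_assoc1[of z w x] smult_l_distr[of z w x] smult_r_distr[of z x y] smult_one[of x] smult_l_null[of x] smult_r_null[of z]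
  by simp_all

lemma diff_eq: "x \<in> carrier H ==> y \<in> carrier H ==> x \<ominus>\<^bsub>H\<^esub> y = x \<oplus>\<^bsub>H\<^esub> (- 1) \<odot>\<^bsub>H\<^esub> y"
  using smult_l_minus[of 1 y] sm_ops(5)[of y] by (simp add: a_minus_def)

lemma ip_right:
  "x \<in> carrier H ==> y \<in> carrier H ==> z \<in> carrier H ==> ip H z (x \<oplus>\<^bsub>H\<^esub> y) = ip H z x + ip H z y"
  "x \<in> carrier H ==> y \<in> carrier H ==> ip H y (c \<odot>\<^bsub>H\<^esub> x) = cnj c * ip H y x"
  using ip_commute[of "x \<oplus>\<^bsub>H\<^esub> y" z] ip_commute[of x z] ip_commute[of y z] ip_commute[of "c \<odot>\<^bsub>H\<^esub> x" y] ip_commute[of x y]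
  by (simp_all add: ip_add ip_smult sm_ops)

lemma ip_diff:
  "x \<in> carrier H ==> y \<in> carrier H ==> z \<in> carrier H ==> ip H (x \<ominus>\<^bsub>H\<^esub> y) z = ip H x z - ip H y z"
  "x \<in> carrier H ==> y \<in> carrier H ==> z \<in> carrier H ==> ip H z (x \<ominus>\<^bsub>H\<^esub> y) = ip H z x - ip H z y"
  by (simp_all add: diff_eq ip_add ip_smult ip_right sm_ops)

lemma ip_zero [simp]: "x \<in> carrier H ==> ip H \<zero>\<^bsub>H\<^esub> x = 0" "x \<in> carrier H ==> ip H x \<zero>\<^bsub>H\<^esub> = 0"
  using ip_smult[of "\<zero>\<^bsub>H\<^esub>" x 0] ip_right(2)[of "\<zero>\<^bsub>H\<^esub>" x 0] by (simp_all add: sm_ops)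

lemma ip_eqI:
  assumes xy: "x \<in> carrier H" "y \<in> carrier H" and e: "\<And>v. v \<in> carrier H ==> ip H v x = ip H v y" shows "x = y"
proof -
  have "ip H (x \<ominus>\<^bsub>H\<^esub> y) (x \<ominus>\<^bsub>H\<^esub> y) = 0" using xy by (simp add: ip_diff(2) e)
  then have "x \<ominus>\<^bsub>H\<^esub> y = \<zero>\<^bsub>H\<^esub>" using xy ip_definite by simp
  then show ?thesis using minus_zero_iff[OF M.abelian_group_axioms] xy by simp
qed

lemma ip_self: "x \<in> carrier H ==> ip H x x = complex_of_real ((hnorm H x)\<^sup>2)"
  using ip_commute[of x x] ip_nonneg[of x] by (auto simp: hnorm_def complex_eq_iff)

lemma hnorm_square: "x \<in> carrier H ==> (hnorm H x)\<^sup>2 = Re (ip H x x)" by (simp add: ip_self)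

lemma hnorm_nonneg: "x \<in> carrier H ==> 0 \<le> hnorm H x" by (simp add: hnorm_def ip_nonneg)

lemma hnorm_eq_0: "x \<in> carrier H ==> hnorm H x = 0 \<longleftrightarrow> x = \<zero>\<^bsub>H\<^esub>"
  using ip_self[of x] ip_definite[of x] by (auto simp: hnorm_def)

lemma hnorm_add_scaled:
  assumes "x \<in> carrier H" "y \<in> carrier H"
  shows "(hnorm H (x \<oplus>\<^bsub>H\<^esub> complex_of_real s \<odot>\<^bsub>H\<^esub> y))\<^sup>2 = (hnorm H x)\<^sup>2 + 2 * s * Re (ip H x y) + s\<^sup>2 * (hnorm H y)\<^sup>2"
  using assms ip_commute[of x y]
  by (simp add: hnorm_square sm_ops ip_add ip_right ip_smult) (simp add: power2_eq_square algebra_simps)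

lemma cauchy_schwarz: assumes "x \<in> carrier H" "y \<in> carrier H" shows "\<bar>Re (ip H x y)\<bar> \<le> hnorm H x * hnorm H y"
proof -
  have "(Re (ip H x y))\<^sup>2 \<le> (hnorm H x)\<^sup>2 * (hnorm H y)\<^sup>2"
    by (rule quadratic_nonneg) (use hnorm_add_scaled[OF assms] in \<open>metis zero_le_power2\<close>, simp)
  then have "\<bar>Re (ip H x y)\<bar>\<^sup>2 \<le> (hnorm H x * hnorm H y)\<^sup>2" by (simp add: power_mult_distrib)
  then show ?thesis by (rule power2_le_imp_le) (use assms hnorm_nonneg in simp)
qed

lemma hnorm_triangle: assumes xy: "x \<in> carrier H" "y \<in> carrier H" shows "hnorm H (x \<oplus>\<^bsub>H\<^esub> y) \<le> hnorm H x + hnorm H y"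
proof -
  have "(hnorm H (x \<oplus>\<^bsub>H\<^esub> y))\<^sup>2 \<le> (hnorm H x + hnorm H y)\<^sup>2"
    using hnorm_add_scaled[OF xy, of 1] cauchy_schwarz[OF xy] xy by (simp add: sm_ops power2_sum)
  then show ?thesis by (rule power2_le_imp_le) (use xy hnorm_nonneg in simp)
qed

lemma hnorm_minus: "x \<in> carrier H ==> hnorm H (\<ominus>\<^bsub>H\<^esub> x) = hnorm H x"
  using smult_l_minus[of 1 x] sm_ops(5)[of x] ip_smult[of x "(- 1) \<odot>\<^bsub>H\<^esub> x" "- 1"] ip_right(2)[of x x "- 1"]
  by (simp add: hnorm_def sm_ops)

lemma metric_H: "Metric_space (carrier H) (norm_dist H (hnorm H))"
  by (rule norm_dist_metric[OF M.abelian_group_axioms]) (auto simp: hnorm_nonneg hnorm_eq_0 hnorm_minus hnorm_triangle)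

text \<open>The Riesz representation theorem by minimising \<open>\<parallel>x\<parallel>\<^sup>2 - 2 Re f x\<close>.\<close>

lemma riesz:
  assumes add: "\<And>x y. x \<in> carrier H ==> y \<in> carrier H ==> f (x \<oplus>\<^bsub>H\<^esub> y) = f x + f y"
    and sm: "\<And>x z. x \<in> carrier H ==> f (z \<odot>\<^bsub>H\<^esub> x) = z * f x"
    and bd: "\<And>x. x \<in> carrier H ==> \<bar>Re (f x)\<bar> \<le> K * hnorm H x"
  obtains w where "w \<in> carrier H" "\<And>v. v \<in> carrier H ==> f v = ip H v w"
proof -
  define J where "J x = (hnorm H x)\<^sup>2 - 2 * Re (f x)" for x
  define d where "d = Inf (J ` carrier H)"
  have low: "- K\<^sup>2 \<le> J x" if x: "x \<in> carrier H" for x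
  proof -
    have "0 \<le> (hnorm H x - K)\<^sup>2" by simp
    then show ?thesis using bd[OF x] by (simp add: J_def power2_diff) (simp add: mult.commute)
  qed
  have bb: "bdd_below (J ` carrier H)" using low by (auto intro!: bdd_belowI[of _ "- K\<^sup>2"])
  have dJ: "d \<le> J x" if "x \<in> carrier H" for x unfolding d_def using that by (intro cInf_lower bb) auto
  have "\<exists>x\<in>carrier H. J x < d + 1 / real (Suc n)" for n
    using cInf_lessD[of "J ` carrier H" "d + 1 / real (Suc n)"] M.zero_closed by (auto simp: d_def)
  then obtain x where x: "\<And>n. x n \<in> carrier H" "\<And>n. J (x n) < d + 1 / real (Suc n)" by metis
  have par: "(hnorm H (u \<ominus>\<^bsub>H\<^esub> v))\<^sup>2 = 2 * J u + 2 * J v - 4 * J (complex_of_real (1 / 2) \<odot>\<^bsub>H\<^esub> (u \<oplus>\<^bsub>H\<^esub> v))"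
    if uv: "u \<in> carrier H" "v \<in> carrier H" for u v
  proof -
    have "(hnorm H (u \<ominus>\<^bsub>H\<^esub> v))\<^sup>2 = (hnorm H u)\<^sup>2 - 2 * Re (ip H u v) + (hnorm H v)\<^sup>2"
      using hnorm_add_scaled[OF uv, of "- 1"] uv by (simp add: diff_eq)
    moreover have "(hnorm H (complex_of_real (1 / 2) \<odot>\<^bsub>H\<^esub> (u \<oplus>\<^bsub>H\<^esub> v)))\<^sup>2 = ((hnorm H u)\<^sup>2 + 2 * Re (ip H u v) + (hnorm H v)\<^sup>2) / 4"
    proof -
      have "(hnorm H (complex_of_real (1 / 2) \<odot>\<^bsub>H\<^esub> (u \<oplus>\<^bsub>H\<^esub> v)))\<^sup>2 = (hnorm H (u \<oplus>\<^bsub>H\<^esub> v))\<^sup>2 / 4"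
        using uv by (simp add: hnorm_square sm_ops(1) ip_smult ip_right(2))
      then show ?thesis using hnorm_add_scaled[OF uv, of 1] uv by (simp add: sm_ops(5))
    qed
    ultimately show ?thesis using uv by (simp add: J_def add sm sm_ops)
  qed
  have close: "(hnorm H (x m \<ominus>\<^bsub>H\<^esub> x n))\<^sup>2 \<le> 2 / real (Suc m) + 2 / real (Suc n)" for m n
    using par[OF x(1) x(1), of m n] x(2)[of m] x(2)[of n] dJ[of "complex_of_real (1 / 2) \<odot>\<^bsub>H\<^esub> (x m \<oplus>\<^bsub>H\<^esub> x n)"] x(1) by (simp add: sm_ops)
  interpret MS: Metric_space "carrier H" "norm_dist H (hnorm H)" by (rule metric_H)
  have "MS.MCauchy x"
    unfolding MS.MCauchy_def
  proof (intro conjI allI impI)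
    show "range x \<subseteq> carrier H" using x by auto
    fix e :: real assume e: "0 < e"
    then obtain M where M: "1 / real (Suc M) < e\<^sup>2 / 4" using nat_approx_posE[of "e\<^sup>2 / 4"] by (metis divide_pos_pos zero_less_numeral zero_less_power)
    have "norm_dist H (hnorm H) (x m) (x n) < e" if mn: "M \<le> m" "M \<le> n" for m n
    proof -
      have "1 / real (Suc m) \<le> 1 / real (Suc M)" "1 / real (Suc n) \<le> 1 / real (Suc M)" using mn by (simp_all add: frac_le)
      then have "(hnorm H (x m \<ominus>\<^bsub>H\<^esub> x n))\<^sup>2 < e\<^sup>2" using close[of m n] M by linarith
      then have "hnorm H (x m \<ominus>\<^bsub>H\<^esub> x n) < e" by (rule power2_less_imp_less) (use e in simp)
      then show ?thesis using x by (simp add: norm_dist_def)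
    qed
    then show "\<exists>N. \<forall>m n. N \<le> m \<longrightarrow> N \<le> n \<longrightarrow> norm_dist H (hnorm H) (x m) (x n) < e" by blast
  qed
  then obtain w where w: "limitin MS.mtopology x w sequentially" using complete by (auto simp: MS.mcomplete_def)
  then have wH: "w \<in> carrier H" by (auto simp: MS.limitin_metric)
  have lim: "(\<lambda>n. hnorm H (x n \<ominus>\<^bsub>H\<^esub> w)) \<longlonglongrightarrow> 0"
    using w wH x by (auto simp: MS.limitin_metric norm_dist_def tendsto_iff hnorm_nonneg)
  have Re: "Re (f v) = Re (ip H v w)" if v: "v \<in> carrier H" for v
  proof -
    have "(\<lambda>n. Re (ip H (x n) v)) \<longlonglongrightarrow> Re (ip H w v)"
    proof (rule Lim_transform_bound[OF _ tendsto_mult_left_zero[OF lim, of "hnorm H v"], THEN LIM_zero_cancel])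
      show "\<forall>\<^sub>F n in sequentially. norm (Re (ip H (x n) v) - Re (ip H w v)) \<le> norm (hnorm H (x n \<ominus>\<^bsub>H\<^esub> w) * hnorm H v)"
        using cauchy_schwarz[OF _ v, of "x n \<ominus>\<^bsub>H\<^esub> w" for n] x wH v by (intro always_eventually allI) (simp add: ip_diff abs_mult hnorm_nonneg)
    qed
    note lim' = this
    have "0 \<le> 0 + 2 * s * (Re (ip H w v) - Re (f v)) + s\<^sup>2 * (hnorm H v)\<^sup>2" for s
    proof (rule LIMSEQ_le_const)
      show "(\<lambda>n. 1 / real (Suc n) + 2 * s * (Re (ip H (x n) v) - Re (f v)) + s\<^sup>2 * (hnorm H v)\<^sup>2)
          \<longlonglongrightarrow> 0 + 2 * s * (Re (ip H w v) - Re (f v)) + s\<^sup>2 * (hnorm H v)\<^sup>2"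
        by (intro tendsto_add tendsto_mult tendsto_diff tendsto_const lim' LIMSEQ_Suc[OF lim_1_over_n])
      have "0 \<le> 1 / real (Suc n) + 2 * s * (Re (ip H (x n) v) - Re (f v)) + s\<^sup>2 * (hnorm H v)\<^sup>2" for n
        using dJ[of "x n \<oplus>\<^bsub>H\<^esub> complex_of_real s \<odot>\<^bsub>H\<^esub> v"] x(2)[of n] x(1)[of n] v
        by (simp add: J_def hnorm_add_scaled sm_ops add sm algebra_simps)
      then show "\<exists>N. \<forall>n\<ge>N. 0 \<le> 1 / real (Suc n) + 2 * s * (Re (ip H (x n) v) - Re (f v)) + s\<^sup>2 * (hnorm H v)\<^sup>2" by blast
    qed
    then have "(Re (ip H w v) - Re (f v))\<^sup>2 \<le> 0 * (hnorm H v)\<^sup>2" by (rule quadratic_nonneg) simp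
    then show ?thesis using ip_commute[OF v wH] by simp
  qed
  show thesis
  proof (rule that[OF wH])
    fix v assume v: "v \<in> carrier H"
    have "Im (f v) = Im (ip H v w)" using Re[of "\<i> \<odot>\<^bsub>H\<^esub> v"] v wH by (simp add: sm_ops sm ip_smult)
    then show "f v = ip H v w" using Re[OF v] by (simp add: complex_eq_iff)
  qed
qed

abbreviation "BH \<equiv> operator_algebra H"

lemma BH_D:
  assumes "T \<in> carrier BH"
  shows "x \<in> carrier H ==> T x \<in> carrier H" "x \<in> carrier H ==> y \<in> carrier H ==> T (x \<oplus>\<^bsub>H\<^esub> y) = T x \<oplus>\<^bsub>H\<^esub> T y"
    "x \<in> carrier H ==> T (z \<odot>\<^bsub>H\<^esub> x) = z \<odot>\<^bsub>H\<^esub> T x" "T \<in> extensional (carrier H)"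
    "\<exists>K>0. \<forall>x\<in>carrier H. hnorm H (T x) \<le> K * hnorm H x"
proof -
  obtain K where K: "\<forall>x\<in>carrier H. hnorm H (T x) \<le> K * hnorm H x" using assms by (auto simp: operator_algebra_def bounded_ops_def)
  have "hnorm H (T x) \<le> max K 1 * hnorm H x" if "x \<in> carrier H" for x
    using K that mult_right_mono[of K "max K 1" "hnorm H x"] hnorm_nonneg[OF that] by fastforce
  moreover have "0 < max K 1" by linarith
  ultimately show "\<exists>K>0. \<forall>x\<in>carrier H. hnorm H (T x) \<le> K * hnorm H x" by blast
qed (use assms in \<open>auto simp: operator_algebra_def bounded_ops_def PiE_def\<close>)

lemma BH_eqI: "S \<in> carrier BH ==> T \<in> carrier BH ==> (\<And>x. x \<in> carrier H ==> S x = T x) ==> S = T"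
  using BH_D(4) by (metis extensionalityI)

lemma BH_ops:
  "x \<in> carrier H ==> (S \<otimes>\<^bsub>BH\<^esub> T) x = S (T x)" "x \<in> carrier H ==> (S \<oplus>\<^bsub>BH\<^esub> T) x = S x \<oplus>\<^bsub>H\<^esub> T x"
  "x \<in> carrier H ==> (z \<odot>\<^bsub>BH\<^esub> T) x = z \<odot>\<^bsub>H\<^esub> T x" "\<zero>\<^bsub>BH\<^esub> = (\<lambda>x\<in>carrier H. \<zero>\<^bsub>H\<^esub>)"
  by (simp_all add: operator_algebra_def compose_def)

lemma adjoint_exists:
  assumes T: "T \<in> carrier BH"
  shows "\<exists>S\<in>carrier BH. \<forall>x\<in>carrier H. \<forall>y\<in>carrier H. ip H (T x) y = ip H x (S y)"
proof -
  obtain K where K: "0 < K" "\<And>x. x \<in> carrier H ==> hnorm H (T x) \<le> K * hnorm H x" using BH_D(5)[OF T] by blast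
  have "\<exists>w\<in>carrier H. \<forall>x\<in>carrier H. ip H (T x) y = ip H x w" if y: "y \<in> carrier H" for y
  proof (rule riesz[of "\<lambda>x. ip H (T x) y" "K * hnorm H y"])
    fix x assume x: "x \<in> carrier H"
    have "\<bar>Re (ip H (T x) y)\<bar> \<le> hnorm H (T x) * hnorm H y" by (rule cauchy_schwarz[OF BH_D(1)[OF T x] y])
    also have "\<dots> \<le> (K * hnorm H x) * hnorm H y" using K(2)[OF x] hnorm_nonneg[OF y] by (rule mult_right_mono)
    finally show "\<bar>Re (ip H (T x) y)\<bar> \<le> K * hnorm H y * hnorm H x" by (simp add: ac_simps)
  qed (use T y in \<open>auto simp: BH_D ip_add ip_smult\<close>)
  then obtain S where S: "\<And>y. y \<in> carrier H ==> S y \<in> carrier H" "\<And>x y. x \<in> carrier H ==> y \<in> carrier H ==> ip H (T x) y = ip H x (S y)"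
    by metis
  define S' where "S' = restrict S (carrier H)"
  have b: "hnorm H (S y) \<le> K * hnorm H y" if y: "y \<in> carrier H" for y
  proof (cases "hnorm H (S y) = 0")
    case True then show ?thesis using K(1) hnorm_nonneg[OF y] by simp
  next
    case False
    then have p: "0 < hnorm H (S y)" using hnorm_nonneg[OF S(1)[OF y]] by simp
    have "(hnorm H (S y))\<^sup>2 = Re (ip H (T (S y)) y)" using S y by (simp add: hnorm_square)
    also have "\<dots> \<le> hnorm H (T (S y)) * hnorm H y" using cauchy_schwarz[OF BH_D(1)[OF T S(1)[OF y]] y] by linarith
    also have "\<dots> \<le> (K * hnorm H (S y)) * hnorm H y" using K(2)[OF S(1)[OF y]] hnorm_nonneg[OF y] by (rule mult_right_mono)
    finally have "hnorm H (S y) * hnorm H (S y) \<le> hnorm H (S y) * (K * hnorm H y)" by (simp add: power2_eq_square ac_simps)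
    then show ?thesis using p by simp
  qed
  have "S' \<in> carrier BH"
    unfolding operator_algebra_def bounded_ops_def
  proof (simp, intro conjI ballI allI)
    show "S' \<in> carrier H \<rightarrow>\<^sub>E carrier H" using S by (auto simp: S'_def)
    show "\<exists>K. \<forall>x\<in>carrier H. hnorm H (S' x) \<le> K * hnorm H x" using b by (auto simp: S'_def)
    fix x z assume x: "x \<in> carrier H"
    show "S' (z \<odot>\<^bsub>H\<^esub> x) = z \<odot>\<^bsub>H\<^esub> S' x"
    proof (rule ip_eqI)
      fix v assume v: "v \<in> carrier H"
      show "ip H v (S' (z \<odot>\<^bsub>H\<^esub> x)) = ip H v (z \<odot>\<^bsub>H\<^esub> S' x)"
        using S(2)[OF v, of "z \<odot>\<^bsub>H\<^esub> x"] S(2)[OF v x] BH_D(1)[OF T v] S(1) x v by (simp add: S'_def sm_ops(1) ip_right)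
    qed (use S x in \<open>simp_all add: S'_def sm_ops(1)\<close>)
    fix y assume y: "y \<in> carrier H"
    show "S' (x \<oplus>\<^bsub>H\<^esub> y) = S' x \<oplus>\<^bsub>H\<^esub> S' y"
    proof (rule ip_eqI)
      fix v assume v: "v \<in> carrier H"
      show "ip H v (S' (x \<oplus>\<^bsub>H\<^esub> y)) = ip H v (S' x \<oplus>\<^bsub>H\<^esub> S' y)"
        using S(2)[OF v, of "x \<oplus>\<^bsub>H\<^esub> y"] S(2)[OF v x] S(2)[OF v y] BH_D(1)[OF T v] S(1) x y v by (simp add: S'_def ip_right)
    qed (use S x y in \<open>simp_all add: S'_def\<close>)
  qed
  then show ?thesis using S by (intro bexI[of _ S']) (auto simp: S'_def)
qed

lemma star_BH:
  assumes T: "T \<in> carrier BH" and xy: "x \<in> carrier H" "y \<in> carrier H"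
  shows "star BH T \<in> carrier BH" "ip H (T x) y = ip H x (star BH T y)"
proof -
  let ?P = "\<lambda>S. S \<in> bounded_ops H (hnorm H) \<and> (\<forall>x\<in>carrier H. \<forall>y\<in>carrier H. ip H (T x) y = ip H x (S y))"
  have c: "carrier BH = bounded_ops H (hnorm H)" by (simp add: operator_algebra_def)
  have "\<exists>!S. ?P S"
  proof (rule ex_ex1I)
    show "\<exists>S. ?P S" using adjoint_exists[OF T] c by auto
    fix S S' assume SS: "?P S" "?P S'"
    show "S = S'"
    proof (rule BH_eqI)
      fix x assume x: "x \<in> carrier H"
      show "S x = S' x"
      proof (rule ip_eqI)
        fix v assume "v \<in> carrier H"
        then show "ip H v (S x) = ip H v (S' x)" using SS x by metis
      qed (use SS x in \<open>auto simp: c[symmetric] intro: BH_D(1)\<close>)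
    qed (use SS c in auto)
  qed
  then have "?P (THE S. ?P S)" by (rule theI')
  then show "star BH T \<in> carrier BH" "ip H (T x) y = ip H x (star BH T y)"
    using xy by (auto simp: operator_algebra_def)
qed

lemma is_one_BH: "is_one BH (\<lambda>x\<in>carrier H. x)"
proof -
  have "\<exists>K. \<forall>x\<in>carrier H. hnorm H x \<le> K * hnorm H x" by (intro exI[of _ 1]) simp
  then have 1: "(\<lambda>x\<in>carrier H. x) \<in> carrier BH" by (auto simp: operator_algebra_def bounded_ops_def sm_ops)
  have "(\<lambda>x\<in>carrier H. x) \<otimes>\<^bsub>BH\<^esub> T = T \<and> T \<otimes>\<^bsub>BH\<^esub> (\<lambda>x\<in>carrier H. x) = T" if T: "T \<in> carrier BH" for T
    using BH_D(1,4)[OF T] by (auto simp: operator_algebra_def compose_def fun_eq_iff extensional_def)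
  then show ?thesis using 1 by (simp add: is_one_def)
qed

lemma unit_of_BH: "unit_of BH = (\<lambda>x\<in>carrier H. x)"
  unfolding unit_of_def by (rule the_equality, rule is_one_BH) (metis is_one_BH is_one_def)

end

section \<open>Inverse closedness in a faithful representation\<close>

context cstar_factor
begin

text \<open>The square of \<open>r\<close> is the absolute value of \<open>w\<close>. The binomial series for \<open>(1 - y) powr (1/4)\<close> at \<open>y = 1 - w\<^sup>2\<close>
  converges although \<open>y\<close> may have spectral radius \<open>1\<close>, because self-adjoint elements of a \<open>C\<^sup>*\<close>-algebra are
  normaloid and the powers of \<open>y\<close> are bounded.\<close>

lemma abs_root:
  assumes w: "w \<in> unitized A" "adj w = w" "norm w \<le> 1"
  obtains r where "r \<in> unitized A" "adj r = r" "(r * r) * (r * r) = w * w" "r * w = w * r"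
proof -
  define y where "y = 1 - w * w"
  have y: "y \<in> unitized A" "adj y = y" using w by (auto simp: y_def adj_diff adj_mult)
  have ww: "norm (w * w) \<le> 1" using norm_mult_ineq[of w w] mult_mono[OF w(3) w(3)] by simp
  have rad_y: "rad y \<le> 1"
  proof (rule rad_le_of_positive[OF y])
    show "positive (of_real 1 - y)" using positive_square[OF w(1,2)] by (simp add: y_def)
    have "rad (w * w) \<le> 2" using rad_le_norm[of "w * w"] ww by linarith
    then have "positive (of_real 2 - w * w)" using w by (intro positive_of_rad_le) (simp_all add: adj_mult)
    moreover have "of_real 1 + y = of_real 2 - w * w" by (simp add: y_def)
    ultimately show "positive (of_real 1 + y)" by simp
  qed simp
  have yn: "y ^ n \<in> unitized A" "adj (y ^ n) = y ^ n" for n using y by (auto simp: adj_power)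
  have rad_yn: "rad (y ^ n) \<le> 1" for n
  proof -
    have y1: "ptak_norm y \<le> 1" using rad_y rad_nonneg[of y] y by (simp add: ptak_norm_def rad_square power_le_one)
    have "ptak_norm (y ^ n) \<le> 1"
    proof (induction n)
      case 0 show ?case using rad_le_norm[of 1] by (simp add: ptak_norm_def)
    next
      case (Suc n)
      have "ptak_norm (y * y ^ n) \<le> ptak_norm y * ptak_norm (y ^ n)" by (rule ptak_norm_mult[OF y(1) yn(1)])
      also have "\<dots> \<le> 1" using mult_mono[OF y1 Suc] by simp
      finally show ?case by simp
    qed
    then show ?thesis using rad_le_ptak_norm[OF yn(1), of n] by linarith
  qed
  have bound: "norm (y ^ n) \<le> 3" for n
  proof -
    define c where "c = chr A (y ^ n)"
    have c_real: "cnj c = c" using arg_cong[OF yn(2), of "chr A" n] by (simp add: c_def chr_simps)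
    have c1: "cmod c \<le> 1"
    proof -
      have "cnj (chr A w) = chr A w" using arg_cong[OF w(2), of "chr A"] by (simp add: chr_simps)
      then obtain s where s: "chr A w = complex_of_real s" by (metis Reals_cnj_iff Reals_cases)
      have "\<bar>s\<bar> \<le> 1" using norm_chr[of w] w(3) s by simp
      then have "s\<^sup>2 \<le> 1" by (simp add: abs_square_le_1)
      moreover have "chr A y = complex_of_real (1 - s\<^sup>2)" by (simp add: y_def chr_simps s power2_eq_square)
      ultimately have cy: "cmod (chr A y) \<le> 1" by (simp only: norm_of_real) (simp add: abs_le_iff)
      have "chr A (y ^ n) = chr A y ^ n" by (induction n) (simp_all add: chr_simps)
      then show ?thesis using cy by (simp add: c_def norm_power power_le_one)
    qed
    let ?a = "prj A (y ^ n)"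
    have e: "y ^ n = cx c + emb A ?a" using unitized_eq[OF yn(1)] by (simp add: c_def)
    have sa: "star A ?a = ?a" using arg_cong[OF yn(2), of "prj A" n] by (simp add: prj_simps)
    have k: "cx (- c) \<in> unitized A" "adj (cx (- c) :: 'a uni) = cx (- c)" using c_real cx_mem by auto
    have "rad (y ^ n + cx (- c)) \<le> rad (y ^ n) + rad (cx (- c) :: 'a uni)" by (rule rad_add_le[OF yn k])
    moreover have "rad (cx (- c) :: 'a uni) \<le> 1" using rad_le_norm[of "cx (- c) :: 'a uni"] c1 by simp
    moreover have "y ^ n + cx (- c) = emb A ?a" using e by (simp add: algebra_simps)
    ultimately have "nrm A ?a \<le> 2" using rad_self_adjoint[OF _ sa] rad_yn[of n] by simp
    then have "norm (cx c + emb A ?a) \<le> 3" using c1 by (subst norm_unitized) auto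
    then show ?thesis using e by simp
  qed
  define r where "r = bser (1 / 4) y"
  have "r * r = bser (1 / 2) y" unfolding r_def by (subst bser_mult[OF _ _ _ bound]) auto
  then have "(r * r) * (r * r) = bser 1 y" by (simp only:) (subst bser_mult[OF _ _ _ bound], auto)
  then have rr: "(r * r) * (r * r) = w * w" by (simp add: bser_1 y_def)
  have "y * w = w * y" by (simp add: y_def algebra_simps)
  then have rw: "r * w = w * r" unfolding r_def by (intro bser_commute[OF _ _ bound]) auto
  show thesis
    by (rule that[OF _ _ rr rw]) (use bser_mem[OF _ _ bound y(1)] bser_adj[OF _ _ bound y(2)] in \<open>auto simp: r_def\<close>)
qed

end

locale faithful_rep = C: cstar_factor C + hilbert_space H
  for C :: "'c normed_star_alg" and H :: "'h hilbert" +
  fixes \<Phi> assumes rep: "\<Phi> \<in> star_hom C (operator_algebra H)" and inj: "inj_on \<Phi> (carrier C)"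
begin

lemma rep_closed [simp, intro]: "a \<in> carrier C ==> \<Phi> a \<in> carrier BH"
  using rep by (auto simp: star_hom_def)

lemma rep_ops:
  assumes a: "a \<in> carrier C" and x: "x \<in> carrier H"
  shows "b \<in> carrier C ==> \<Phi> (a \<oplus>\<^bsub>C\<^esub> b) x = \<Phi> a x \<oplus>\<^bsub>H\<^esub> \<Phi> b x" "b \<in> carrier C ==> \<Phi> (a \<otimes>\<^bsub>C\<^esub> b) x = \<Phi> a (\<Phi> b x)"
    "\<Phi> (z \<odot>\<^bsub>C\<^esub> a) x = z \<odot>\<^bsub>H\<^esub> \<Phi> a x" "y \<in> carrier H ==> ip H (\<Phi> a x) y = ip H x (\<Phi> (star C a) y)"
  using rep a x star_BH(2)[OF rep_closed[OF a] x] by (simp_all add: star_hom_def BH_ops)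

lemma rep_value [simp]: "a \<in> carrier C ==> x \<in> carrier H ==> \<Phi> a x \<in> carrier H" by (rule BH_D(1)) auto
lemma rep_linear:
  assumes "a \<in> carrier C" "x \<in> carrier H"
  shows "y \<in> carrier H ==> \<Phi> a (x \<oplus>\<^bsub>H\<^esub> y) = \<Phi> a x \<oplus>\<^bsub>H\<^esub> \<Phi> a y" "\<Phi> a (z \<odot>\<^bsub>H\<^esub> x) = z \<odot>\<^bsub>H\<^esub> \<Phi> a x"
  using BH_D(2,3)[OF rep_closed] assms by auto

definition \<rho> :: "'c uni => 'h => 'h" where
  "\<rho> F x = chr C F \<odot>\<^bsub>H\<^esub> x \<oplus>\<^bsub>H\<^esub> \<Phi> (prj C F) x"

lemma rep_zero: assumes x: "x \<in> carrier H" shows "\<Phi> \<zero>\<^bsub>C\<^esub> x = \<zero>\<^bsub>H\<^esub>"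
  using rep_ops(3)[OF C.M.zero_closed x, of 0] x by (simp add: sm_ops)

lemma \<rho>_closed [simp]: "x \<in> carrier H ==> \<rho> F x \<in> carrier H" by (simp add: \<rho>_def sm_ops)

lemma \<rho>_emb: "a \<in> carrier C ==> x \<in> carrier H ==> \<rho> (emb C a) x = \<Phi> a x" by (simp add: \<rho>_def C.chr_emb sm_ops)

lemma \<rho>_mult: assumes x: "x \<in> carrier H" shows "\<rho> (F * G) x = \<rho> F (\<rho> G x)"
  using x by (simp add: \<rho>_def C.chr_simps C.prj_simps(5) rep_ops rep_linear sm_ops M.a_ac mult.commute)

lemma ip_\<rho>: assumes x: "x \<in> carrier H" "y \<in> carrier H" shows "ip H (\<rho> F x) y = ip H x (\<rho> (adj F) y)"
  using x by (simp add: \<rho>_def C.chr_simps C.prj_simps(6) ip_add ip_right ip_smult sm_ops(1) rep_ops(4))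

lemma ip_\<rho>_add: "x \<in> carrier H ==> y \<in> carrier H ==> ip H (\<rho> (F + G) x) y = ip H (\<rho> F x) y + ip H (\<rho> G x) y"
  by (simp add: \<rho>_def C.chr_simps C.prj_simps(4) ip_add ip_smult sm_ops rep_ops distrib_right)

lemma ip_\<rho>_cx: "x \<in> carrier H ==> y \<in> carrier H ==> ip H (\<rho> (cx z * F) x) y = z * ip H (\<rho> F x) y"
  by (simp add: \<rho>_def C.chr_simps C.prj_cx_mult ip_add ip_smult sm_ops rep_ops distrib_left)

lemma ip_\<rho>_cx': "x \<in> carrier H ==> y \<in> carrier H ==> ip H (\<rho> (cx z) x) y = z * ip H x y"
  by (simp add: \<rho>_def C.chr_simps C.prj_simps ip_smult sm_ops rep_zero)

text \<open>If \<open>\<Phi> (c\<^sup>* c) \<ge> 2 t > 0\<close> on \<open>H\<close>, then the negative part of \<open>c\<^sup>* c - t\<close> is annihilated by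
  the extension of \<open>\<Phi>\<close> to the unitization. Its scalar part does not vanish, so the identity operator lies in the range
  of \<open>\<Phi>\<close>. This gives a unit of \<open>C\<close>, and on it \<open>c\<^sup>* c = \<bar>c\<^sup>* c - t\<bar> + t\<close>, which is invertible.\<close>

lemma left_inverse_of_bounded_below:
  assumes c: "c \<in> carrier C" and \<epsilon>: "0 < \<epsilon>" and below: "\<And>x. x \<in> carrier H ==> \<epsilon> * (hnorm H x)\<^sup>2 \<le> (hnorm H (\<Phi> c x))\<^sup>2"
  obtains e b where "is_one C e" "\<And>x. x \<in> carrier H ==> \<Phi> e x = x" "b \<in> carrier C" "b \<otimes>\<^bsub>C\<^esub> c = e"
proof -
  define t where "t = \<epsilon> / 2"
  let ?h = "adj (emb C c) * emb C c"
  define R where "R = norm ?h + t"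
  have t: "0 < t" "0 < R" using \<epsilon> by (auto simp: t_def R_def add_nonneg_pos)
  define \<tau> where "\<tau> = t / R"
  have \<tau>: "0 < \<tau>" using t by (simp add: \<tau>_def)
  define w where "w = (1 / R) *\<^sub>R ?h - of_real \<tau>"
  have hU: "?h \<in> unitized C" using c by auto
  have wU: "w \<in> unitized C" "adj w = w" using hU by (auto simp: w_def adj_diff adj_mult)
  have "norm w \<le> norm ((1 / R) *\<^sub>R ?h) + norm (of_real \<tau> :: 'c uni)" unfolding w_def by (rule norm_triangle_ineq4)
  also have "\<dots> = norm ?h / R + \<tau>" using t \<tau> by simp
  also have "\<dots> = 1" using t by (simp add: \<tau>_def R_def add_divide_distrib[symmetric])
  finally obtain r where r: "r \<in> unitized C" "adj r = r" "(r * r) * (r * r) = w * w" "r * w = w * r"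
    using C.abs_root[OF wU] by blast
  define m where "m = r * r"
  have mU: "m \<in> unitized C" using r by (simp add: m_def)
  have mw: "m * w = w * m" using r(4) by (metis m_def mult.assoc)
  have mm: "(m + w) * (m - w) = 0" using r(3) mw by (simp add: m_def[symmetric] distrib_right right_diff_distrib)
  have pos: "\<tau> * (hnorm H x)\<^sup>2 \<le> Re (ip H (\<rho> (m + w) x) x)" if x: "x \<in> carrier H" for x
  proof -
    have "ip H (\<rho> m x) x = ip H (\<rho> r x) (\<rho> r x)" using x r(2) by (simp add: m_def \<rho>_mult ip_\<rho>)
    then have 1: "0 \<le> Re (ip H (\<rho> m x) x)" using ip_nonneg[of "\<rho> r x"] x by simp
    have wx: "w = cx (complex_of_real (1 / R)) * ?h + cx (complex_of_real (- \<tau>))" by (simp add: w_def scaleR_cx cx_complex_of_real)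
    have "ip H (\<rho> ?h x) x = ip H (\<Phi> c x) (\<Phi> c x)"
      using x c ip_\<rho>[of "\<rho> (emb C c) x" x "adj (emb C c)"] by (simp add: \<rho>_mult) (simp add: \<rho>_emb)
    then have "Re (ip H (\<rho> w x) x) = (1 / R) * (hnorm H (\<Phi> c x))\<^sup>2 - \<tau> * (hnorm H x)\<^sup>2"
      unfolding wx ip_\<rho>_add[OF x x] ip_\<rho>_cx[OF x x] ip_\<rho>_cx'[OF x x] using x c by (simp add: ip_self)
    moreover have "(1 / R) * (\<epsilon> * (hnorm H x)\<^sup>2) \<le> (1 / R) * (hnorm H (\<Phi> c x))\<^sup>2" using below[OF x] t by (intro mult_left_mono) auto
    moreover have "(1 / R) * (\<epsilon> * (hnorm H x)\<^sup>2) = 2 * (\<tau> * (hnorm H x)\<^sup>2)" by (simp add: \<tau>_def t_def)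
    ultimately have "\<tau> * (hnorm H x)\<^sup>2 \<le> Re (ip H (\<rho> w x) x)" by linarith
    then show ?thesis using 1 by (simp add: ip_\<rho>_add[OF x x])
  qed
  have kill: "\<rho> (m - w) v = \<zero>\<^bsub>H\<^esub>" if v: "v \<in> carrier H" for v
  proof -
    let ?x = "\<rho> (m - w) v"
    have x: "?x \<in> carrier H" using v by simp
    have "\<rho> (m + w) ?x = \<rho> 0 v" using v mm by (simp flip: \<rho>_mult)
    also have "\<dots> = \<zero>\<^bsub>H\<^esub>" using v by (simp add: \<rho>_def C.chr_simps C.prj_simps rep_zero sm_ops)
    finally have "\<tau> * (hnorm H ?x)\<^sup>2 \<le> 0" using pos[OF x] x by simp
    then have "hnorm H ?x = 0" using \<tau> by (simp add: mult_le_0_iff)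
    then show ?thesis using hnorm_eq_0[OF x] by simp
  qed
  have chr_w: "chr C w = - complex_of_real \<tau>" using c
    by (simp add: w_def scaleR_cx C.chr_simps C.chr_emb flip: cx_complex_of_real)
  have chr_m: "chr C m = complex_of_real \<tau>"
  proof -
    have "cnj (chr C r) = chr C r" using arg_cong[OF r(2), of "chr C"] by (simp add: C.chr_simps)
    then obtain s where s: "chr C r = complex_of_real s" by (metis Reals_cnj_iff Reals_cases)
    have "complex_of_real (s * s * (s * s)) = complex_of_real (\<tau> * \<tau>)"
      using arg_cong[OF r(3), of "chr C"] by (simp add: C.chr_simps s chr_w)
    then have "(s * s)\<^sup>2 = \<tau>\<^sup>2" unfolding of_real_eq_iff power2_eq_square .
    then have "s * s = \<tau>" using \<tau> power2_eq_imp_eq[of "s * s" \<tau>] by simp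
    then show ?thesis by (simp add: m_def C.chr_simps s flip: of_real_mult)
  qed
  define e where "e = (- 1 / (2 * complex_of_real \<tau>)) \<odot>\<^bsub>C\<^esub> prj C (m - w)"
  have eC: "e \<in> carrier C" by (simp add: e_def)
  have chr_mw: "chr C (m - w) = 2 * complex_of_real \<tau>" by (simp add: C.chr_simps chr_w chr_m)
  have \<Phi>e: "\<Phi> e x = x" if x: "x \<in> carrier H" for x
  proof (rule ip_eqI)
    fix v assume v: "v \<in> carrier H"
    let ?z = "2 * complex_of_real \<tau>"
    have z: "?z \<noteq> 0" using \<tau> by simp
    have "ip H v (?z \<odot>\<^bsub>H\<^esub> x \<oplus>\<^bsub>H\<^esub> \<Phi> (prj C (m - w)) x) = 0" using kill[OF x] v by (simp add: \<rho>_def chr_mw)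
    then have "ip H v (\<Phi> (prj C (m - w)) x) = - (cnj ?z * ip H v x)" using x v by (simp add: ip_right sm_ops eq_neg_iff_add_eq_0 add.commute)
    then show "ip H v (\<Phi> e x) = ip H v x" using x v \<tau> by (simp add: e_def rep_ops(3) ip_right)
  qed (use x eC in auto)
  have one: "is_one C e"
    unfolding is_one_def
  proof (intro conjI ballI eC)
    fix a assume a: "a \<in> carrier C"
    have "\<Phi> (e \<otimes>\<^bsub>C\<^esub> a) = \<Phi> a" "\<Phi> (a \<otimes>\<^bsub>C\<^esub> e) = \<Phi> a"
      by (rule BH_eqI; use a eC in \<open>auto simp: rep_ops(2) \<Phi>e\<close>)+
    then show "e \<otimes>\<^bsub>C\<^esub> a = a" "a \<otimes>\<^bsub>C\<^esub> e = a" using inj a eC by (auto simp: inj_on_def)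
  qed
  let ?E = "emb C e"
  have E: "?E * emb C a = emb C a" "emb C a * ?E = emb C a" if "a \<in> carrier C" for a
    using one that by (simp_all add: is_one_def flip: C.emb_mult)
  have hE: "?h * ?E = ?h" using c by (simp add: mult.assoc E)
  have "emb C (prj C (m - w)) = - (of_real (2 * \<tau>) * ?E)"
  proof -
    have "(- 2 * complex_of_real \<tau>) \<odot>\<^bsub>C\<^esub> e = prj C (m - w)" using \<tau> by (simp add: e_def C.sm_sm)
    then have "emb C (prj C (m - w)) = cx (- 2 * complex_of_real \<tau>) * ?E" using eC by (metis C.emb_smult)
    also have "\<dots> = - (of_real (2 * \<tau>) * ?E)" by (simp flip: cx_complex_of_real)
    finally show ?thesis .
  qed
  then have mw': "m - w = of_real (2 * \<tau>) - of_real (2 * \<tau>) * ?E"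
    using C.unitized_eq[of "m - w"] mU wU chr_mw by (simp flip: cx_complex_of_real)
  have "(m - w) * ?E = 0" unfolding mw' using E[OF eC] by (simp add: left_diff_distrib mult.assoc)
  then have mE: "m * ?E = w * ?E" by (simp add: left_diff_distrib)
  have i: "has_inverse (of_real \<tau> + m)"
    using C.shirali_ford[OF r(1)] r(2) \<tau> positiveD[of m \<tau>] by (simp add: m_def)
  have "(of_real \<tau> + m) * ?E = (1 / R) *\<^sub>R ?h"
    using hE by (simp add: distrib_right mE w_def left_diff_distrib)
  then have inv: "minv (of_real \<tau> + m) * ((1 / R) *\<^sub>R ?h) = ?E" using minv_mult_cancel(2)[OF i] by metis
  define B where "B = (1 / R) *\<^sub>R (minv (of_real \<tau> + m) * adj (emb C c))"
  have BU: "B \<in> unitized C" unfolding B_def using i mU c by (intro C.scaleR_mem C.mult_mem C.minv_mem) (auto intro: C.add_mem)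
  have "chr C B = 0" using c by (simp add: B_def scaleR_cx C.chr_simps C.chr_emb)
  then have Bb: "B = emb C (prj C B)" using C.unitized_eq[OF BU] by simp
  have "emb C (prj C B) * emb C c = ?E" unfolding Bb[symmetric] using inv by (simp add: B_def mult.assoc)
  then have "prj C B \<otimes>\<^bsub>C\<^esub> c = e" using c eC by (simp flip: C.emb_mult add: C.emb_eq_iff)
  then show thesis using that[OF one \<Phi>e] by blast
qed

text \<open>An operator with a bounded inverse is bounded below.\<close>

lemma preimage_of_inverse:
  assumes c: "c \<in> carrier C" and i: "inverses BH (\<Phi> c) S"
  obtains b where "unital C" "inverses C c b" "S = \<Phi> b"
proof -
  have S: "S \<in> carrier BH" and cS: "\<Phi> c \<otimes>\<^bsub>BH\<^esub> S = (\<lambda>x\<in>carrier H. x)" and Sc: "S \<otimes>\<^bsub>BH\<^esub> \<Phi> c = (\<lambda>x\<in>carrier H. x)"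
    using i by (simp_all add: inverses_def unit_of_BH)
  have cSx: "\<Phi> c (S x) = x" and Scx: "S (\<Phi> c x) = x" if "x \<in> carrier H" for x
    using fun_cong[OF cS, of x] fun_cong[OF Sc, of x] that by (simp_all add: BH_ops)
  obtain K where K: "0 < K" "\<And>x. x \<in> carrier H ==> hnorm H (S x) \<le> K * hnorm H x" using BH_D(5)[OF S] by blast
  have "(1 / K\<^sup>2) * (hnorm H x)\<^sup>2 \<le> (hnorm H (\<Phi> c x))\<^sup>2" if x: "x \<in> carrier H" for x
  proof -
    have "hnorm H x \<le> K * hnorm H (\<Phi> c x)" using K(2)[of "\<Phi> c x"] x c by (simp add: Scx)
    then have "(hnorm H x)\<^sup>2 \<le> (K * hnorm H (\<Phi> c x))\<^sup>2" using hnorm_nonneg[OF x] by (intro power_mono)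
    then show ?thesis using K(1) by (simp add: power_mult_distrib field_simps)
  qed
  then obtain e b where e: "is_one C e" and \<Phi>e: "\<And>x. x \<in> carrier H ==> \<Phi> e x = x" and b: "b \<in> carrier C" "b \<otimes>\<^bsub>C\<^esub> c = e"
    using left_inverse_of_bounded_below[OF c, of "1 / K\<^sup>2"] K(1) by auto
  have ec: "e \<in> carrier C" using e by (simp add: is_one_def)
  have "\<Phi> b x = S x" if x: "x \<in> carrier H" for x
  proof -
    have Sx: "S x \<in> carrier H" by (rule BH_D(1)[OF S x])
    have "\<Phi> b (\<Phi> c (S x)) = S x" using rep_ops(2)[OF b(1) Sx c] b(2) \<Phi>e[OF Sx] by simp
    then show ?thesis by (simp add: cSx[OF x])
  qed
  then have Sb: "S = \<Phi> b" using S b by (intro BH_eqI) auto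
  have "\<Phi> (c \<otimes>\<^bsub>C\<^esub> b) = \<Phi> e" by (rule BH_eqI) (use b c ec in \<open>auto simp: rep_ops(2) \<Phi>e cSx simp flip: Sb\<close>)
  then have "c \<otimes>\<^bsub>C\<^esub> b = e" using inj b c ec by (auto simp: inj_on_def)
  then have "inverses C c b" using b c C.unit_of_eq[OF e] by (simp add: inverses_def)
  then show thesis using that e Sb by (auto simp: unital_def)
qed

end

theorem (in envelope) inverse_closed_in_operators:
  assumes H: "hilbert_space (H :: 'h hilbert)" and \<Phi>: "\<Phi> \<in> star_hom B (operator_algebra H)" and inj: "inj_on \<Phi> (carrier B)"
  shows "inverse_closed (\<Phi> ` \<phi> ` carrier A) (operator_algebra H)"
proof -
  interpret hilbert_space H by (rule H)
  interpret R: faithful_rep B H \<Phi> by unfold_locales (rule \<Phi>, rule inj)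
  show ?thesis
    unfolding inverse_closed_def
  proof (intro conjI ballI allI impI)
    show "unital (operator_algebra H)" using is_one_BH by (auto simp: unital_def)
    have hom: "\<Phi> (a \<oplus>\<^bsub>B\<^esub> b) = \<Phi> a \<oplus>\<^bsub>BH\<^esub> \<Phi> b" "\<Phi> (a \<otimes>\<^bsub>B\<^esub> b) = \<Phi> a \<otimes>\<^bsub>BH\<^esub> \<Phi> b" "\<Phi> (z \<odot>\<^bsub>B\<^esub> a) = z \<odot>\<^bsub>BH\<^esub> \<Phi> a" "\<Phi> (star B a) = star BH (\<Phi> a)"
      if "a \<in> carrier B" "b \<in> carrier B" for a b z using \<Phi> that by (auto simp: star_hom_def)
    have "\<Phi> (\<phi> \<zero>\<^bsub>A\<^esub>) = \<zero>\<^bsub>BH\<^esub>"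
      unfolding hom_zero by (rule extensionalityI[of _ "carrier H"]) (use BH_D(4)[OF R.rep_closed[OF B.M.zero_closed]] in \<open>auto simp: BH_ops R.rep_zero\<close>)
    then have "\<zero>\<^bsub>BH\<^esub> \<in> \<Phi> ` \<phi> ` carrier A" by (metis A.M.zero_closed image_eqI)
    moreover have sub: "\<phi> ` carrier A \<subseteq> carrier B" by auto
    ultimately show "star_subalgebra (\<Phi> ` \<phi> ` carrier A) (operator_algebra H)"
      using star_subalgebra_range R.rep_closed unfolding star_subalgebra_def
      by (auto simp: subset_iff hom(1)[symmetric] hom(2)[symmetric] hom(3)[OF _ B.M.zero_closed, symmetric] hom(4)[OF _ B.M.zero_closed, symmetric]
        simp flip: hom_add hom_mult hom_sm hom_star hom_zero)
    fix a S assume "a \<in> \<Phi> ` \<phi> ` carrier A" and i: "inverses BH a S"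
    then obtain f where f: "f \<in> carrier A" "a = \<Phi> (\<phi> f)" by blast
    obtain b where b: "unital B" "inverses B (\<phi> f) b" "S = \<Phi> b" using R.preimage_of_inverse[of "\<phi> f" S] f i by auto
    then show "S \<in> \<Phi> ` \<phi> ` carrier A" using inverse_closed_unital[OF b(1)] f unfolding inverse_closed_def by blast
  qed
qed

theorem theorem2p9:
  fixes L :: "('g::group_add \<Rightarrow> complex) set"
    and N :: "('g \<Rightarrow> complex) \<Rightarrow> real"
    and A :: "'a normed_star_alg"
    and \<alpha> :: "'g \<Rightarrow> 'a \<Rightarrow> 'a"
    and \<omega> :: "'g \<Rightarrow> 'g \<Rightarrow> ('a \<Rightarrow> 'a) \<times> ('a \<Rightarrow> 'a)"
  assumes "admissible L N"
    and "rigidly_symmetric TYPE(('g \<Rightarrow> 'a) \<Rightarrow> ('g \<Rightarrow> 'a)) L N"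
    and "twisted_system A \<alpha> \<omega>"
  shows "banach_star_algebra (twisted_algebra L N A \<alpha> \<omega>) \<and>
         symmetric_algebra (twisted_algebra L N A \<alpha> \<omega>)
       \<and> (\<forall>(C :: 'c normed_star_alg) \<iota>.
            enveloping (twisted_algebra L N A \<alpha> \<omega>) C \<iota>
            \<longrightarrow> spectral_in_enveloping (twisted_algebra L N A \<alpha> \<omega>) C \<iota>)
       \<and> (rigidly_symmetric TYPE(('g \<Rightarrow> 'a) \<Rightarrow> ('g \<Rightarrow> 'a)) (ell1 :: ('g \<Rightarrow> complex) set) ell1_norm
          \<longrightarrow> (\<forall>(C :: 'c normed_star_alg) \<iota>.
                enveloping (twisted_algebra ell1 ell1_norm A \<alpha> \<omega>) C \<iota>
                \<longrightarrow> spectral_in_enveloping (twisted_algebra ell1 ell1_norm A \<alpha> \<omega>) C \<iota>))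
       \<and> (rigidly_symmetric TYPE(('g \<Rightarrow> 'a) \<Rightarrow> ('g \<Rightarrow> 'a)) (ell1 :: ('g \<Rightarrow> complex) set) ell1_norm
          \<longrightarrow> (\<forall>(C :: 'c normed_star_alg) \<iota> (H :: 'h hilbert) \<Phi>.
                enveloping (twisted_algebra ell1 ell1_norm A \<alpha> \<omega>) C \<iota> \<and>
                hilbert_space H \<and> \<Phi> \<in> star_hom C (operator_algebra H) \<and> inj_on \<Phi> (carrier C)
                \<longrightarrow> inverse_closed (\<Phi> ` \<iota> ` carrier (twisted_algebra ell1 ell1_norm A \<alpha> \<omega>))
                      (operator_algebra H)))"
proof -
  interpret S: solid_space L N by (rule admissible_solid) (rule assms(1))
  interpret solid_ell: solid_space "ell1 :: ('g \<Rightarrow> complex) set" ell1_norm by (rule solid_ell1)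
  have "cstar_algebra A" using assms(3) by (simp add: twisted_system_def Let_def)
  then interpret twisted A \<alpha> \<omega> by (intro twisted.intro twisted_axioms.intro cstar_factor.intro assms(3))
  interpret F: rigid_fell_algebra A "tw_m A \<alpha> \<omega>" "tw_s A \<alpha> \<omega>" L N by unfold_locales (rule assms(2))
  have envelope_ell1: "\<exists>p. envelope (twisted_algebra ell1 ell1_norm A \<alpha> \<omega>) C \<iota> p"
    if "rigidly_symmetric TYPE(('g \<Rightarrow> 'a) \<Rightarrow> ('g \<Rightarrow> 'a)) (ell1 :: ('g \<Rightarrow> complex) set) ell1_norm"
      "enveloping (twisted_algebra ell1 ell1_norm A \<alpha> \<omega>) C \<iota>" for C :: "'c normed_star_alg" and \<iota>
  proof -
    interpret R: rigid_fell_algebra A "tw_m A \<alpha> \<omega>" "tw_s A \<alpha> \<omega>" ell1 ell1_norm by unfold_locales (rule that(1))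
    show ?thesis using R.envelope_F that(2) unfolding twisted_algebra_fell by blast
  qed
  show ?thesis
  proof (intro conjI allI impI)
    show "banach_star_algebra (twisted_algebra L N A \<alpha> \<omega>)" "symmetric_algebra (twisted_algebra L N A \<alpha> \<omega>)"
      unfolding twisted_algebra_fell by (rule F.banach_F) (rule F.symmetric_F)
  next
    fix C :: "'c normed_star_alg" and \<iota>
    assume "enveloping (twisted_algebra L N A \<alpha> \<omega>) C \<iota>"
    then show "spectral_in_enveloping (twisted_algebra L N A \<alpha> \<omega>) C \<iota>"
      unfolding twisted_algebra_fell using F.envelope_F envelope.spectral by blast
  next
    fix C :: "'c normed_star_alg" and \<iota>
    assume "rigidly_symmetric TYPE(('g \<Rightarrow> 'a) \<Rightarrow> ('g \<Rightarrow> 'a)) (ell1 :: ('g \<Rightarrow> complex) set) ell1_norm"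
      "enveloping (twisted_algebra ell1 ell1_norm A \<alpha> \<omega>) C \<iota>"
    then show "spectral_in_enveloping (twisted_algebra ell1 ell1_norm A \<alpha> \<omega>) C \<iota>"
      using envelope_ell1 envelope.spectral by blast
  next
    fix C :: "'c normed_star_alg" and \<iota> and H :: "'h hilbert" and \<Phi>
    assume "rigidly_symmetric TYPE(('g \<Rightarrow> 'a) \<Rightarrow> ('g \<Rightarrow> 'a)) (ell1 :: ('g \<Rightarrow> complex) set) ell1_norm"
      and "enveloping (twisted_algebra ell1 ell1_norm A \<alpha> \<omega>) C \<iota> \<and> hilbert_space H
        \<and> \<Phi> \<in> star_hom C (operator_algebra H) \<and> inj_on \<Phi> (carrier C)"
    then show "inverse_closed (\<Phi> ` \<iota> ` carrier (twisted_algebra ell1 ell1_norm A \<alpha> \<omega>)) (operator_algebra H)"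
      using envelope_ell1 envelope.inverse_closed_in_operators by blast
  qed
qed

end
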